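(* Let $k\ge1$ be an integer. The finite element $(\Omega,\mathcal U^{(1),k}(\Omega),\Sigma^{(1),k})$ is curl-conforming and unisolvent. That is: (i) (conforming) $\mathcal U^{(1),k}(\Omega)\subset H(\mathrm{curl},\Omega)$ and, for every face $F$ of $\Omega$ and every $u\in\mathcal U^{(1),k}(\Omega)$, all edge and face degrees of freedom in $\Sigma^{(1),k}$ associated with $F$ and with the edges of $F$ vanish on $u$ if and only if the tangential component of $u$ vanishes on $F$; (ii) (unisolvent) for every family of real numbers $(u_m)_{m\in\Sigma^{(1),k}}$ there is exactly one $u\in\mathcal U^{(1),k}(\Omega)$ with $m(u)=u_m$ for all $m\in\Sigma^{(1),k}$.
   Context: Finite pyramid: $\Omega=\{(\xi,\eta,\zeta)\in\mathbb R^3:\xi,\eta,\zeta\ge0,\ \xi\le1-\zeta,\ \eta\le1-\zeta\}$, with four triangular faces $S_{i,\Omega}$ ($i=1,\dots,4$), square base $B$ and eight edges. Infinite pyramid: $\Omega_\infty=\{(x,y,z): 0\le x,y\le1,\ z\ge0\}$ (together with a point $\infty$). Map: $\phi:\Omega_\infty\to\Omega$, $\phi(x,y,z)=\left(\frac{x}{1+z},\frac{y}{1+z},\frac{z}{1+z}\right)$, a diffeomorphism onto $\Omega$ minus its apex $(0,0,1)$. Pullbacks: for 0-forms $\phi^*u=u\circ\phi$; for 1-forms (vector fields $E$) $\phi^*E=D\phi^T\,(E\circ\phi)$; $(\phi^{-1})^*=(\phi^* )^{-1}$. $Q^{l,m,n}$: polynomials of degree at most $l,m,n$ in $x,y,z$;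 $Q^{l,m,n}_k=\{u/(1+z)^k:u\in Q^{l,m,n}\}$; $P^n_k[w,z]=\{u(w,z)/(1+z)^k:u$ polynomial of total degree $\le n\}$; $\tilde P^{k-1}_{k+1}[w,1+z]=\frac{1}{(1+z)^{k+1}}\mathrm{span}\{w^a(1+z)^{k-1-a}:0\le a\le k-1\}$. Polynomial spaces with a negative degree are $\{0\}$. 0-forms: $\mathcal U^{(0),k}(\Omega_\infty)$ is the set of $u\in Q_k^{k,k,k-1}\oplus\mathrm{span}\{z^k/(1+z)^k\}$ whose restrictions to $y=0,1$ lie in $P_k^k[x,z]$ and to $x=0,1$ lie in $P_k^k[y,z]$; $\mathcal U^{(0),k}(\Omega)=(\phi^{-1})^*\mathcal U^{(0),k}(\Omega_\infty)$; $\mathcal U_0^{(0),k}(\Omega)$ is the subspace of functions vanishing on $\partial\Omega$. 1-forms: $$\overline{\mathcal U^{(1),k}}(\Omega_\infty)=Q_{k+1}^{k-1,k,k-1}\times Q_{k+1}^{k,k-1,k-1}\times Q_{k+1}^{k,k,k-2}\ \oplus\ \Big\{\tfrac{z^{k-1}}{(1+z)^{k+1}}(r_xz,\ r_yz,\ -r)^T: r\in Q^{k,k}[x,y]\Big\}.$$ $\mathcal U^{(1),k}(\Omega_\infty)$ is the set of $u=(u_1,u_2,u_3)\in\overline{\mathcal U^{(1),k}}(\Omega_\infty)$ whose tangential components on the vertical faces satisfy: on $y=0$ and $y=1$ (with $w=x$), $(u_1,u_3)\in (P^{k-1}_{k+1}[w,z])^2\oplus\tilde P^{k-1}_{k+1}[w,1+z]\,(1+z,-w)^T$;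 on $x=0$ and $x=1$ (with $w=y$), $(u_2,u_3)$ lies in the same space. $\mathcal U^{(1),k}(\Omega)=(\phi^{-1})^*\mathcal U^{(1),k}(\Omega_\infty)$. $\mathcal U^{(1),k}_{0,\mathrm{curl}}(\Omega)=(\phi^{-1})^*\mathcal U^{(1),k}_{0,\mathrm{curl}}(\Omega_\infty)$, where $\mathcal U^{(1),k}_{0,\mathrm{curl}}(\Omega_\infty)$ consists of the fields $\big(y(1-y)zq_1,\ x(1-x)zq_2,\ x(1-x)y(1-y)\rho\big)^T$ with $q_1\in Q_{k+1}^{k-1,k-2,k-2}$, $q_2\in Q_{k+1}^{k-2,k-1,k-2}$, $\rho\in Q_{k+1}^{k-2,k-2,0}$. $\mathcal B[P]$ denotes an arbitrary (fixed) basis of a finite-dimensional space $P$. $t$ is a unit tangent to an edge, $\nu$ a unit normal to a face. $P^n(\cdot)$: polynomials of total degree $\le n$ on an edge or face; $Q^{m,n}(B)$: polynomials on $B$ of degree $\le m$ in $\xi$, $\le n$ in $\eta$. Degrees of freedom $\Sigma^{(1),k}$ (linear functionals of $u$): edges: $u\mapsto\int_e (u\cdot t)\,q\,ds$, $q\in\mathcal B[P^{k-1}(e)]$, for each of the eight edges $e$; triangular faces: $u\mapsto\int_{S_{i,\Omega}}u\cdot q\,dA$, $q\in\mathcal B[\{q\in(P^{k-2}(S_{i,\Omega}))^3: q\cdot\nu=0\}]$, $i=1,\dots,4$; base: $u\mapsto\int_B (u\times\nu)\cdot q\,dA$, $q\in\mathcal B[Q^{k-2,k-1}(B)\times Q^{k-1,k-2}(B)]$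 ($q$ being regarded as a tangential field with components in the $\xi$ and $\eta$ directions); volume: $u\mapsto\int_\Omega u\cdot\nabla q\,dV$, $q\in\mathcal B[\mathcal U_0^{(0),k}(\Omega)]$, and $u\mapsto\int_\Omega(\nabla\times u)\cdot(\nabla\times v)\,dV$, $v\in\mathcal B[\mathcal U^{(1),k}_{0,\mathrm{curl}}(\Omega)]$. *)

theory Defs
  imports "HOL-Analysis.Analysis" "HOL-Library.Function_Algebras"
begin

section \<open>Function spaces\<close>

text \<open>Functions into a real vector space form a real vector space under the pointwise operations,
  so that the library notions \<^const>\<open>span\<close> and \<^const>\<open>independent\<close> apply to sets of functions.\<close>

instantiation "fun" :: (type, real_vector) real_vector
begin

definition scaleR_fun :: "real \<Rightarrow> ('a \<Rightarrow> 'b) \<Rightarrow> 'a \<Rightarrow> 'b"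
  where "scaleR_fun c f = (\<lambda>x. c *\<^sub>R f x)"

instance
  by standard (auto simp: scaleR_fun_def plus_fun_def algebra_simps)

end

definition is_basis :: "'a::real_vector set \<Rightarrow> 'a set \<Rightarrow> bool"
  where "is_basis B P \<longleftrightarrow> independent B \<and> span B = P"

text \<open>A function on a set \<open>S\<close> is represented by the total function that vanishes off \<open>S\<close>;
  independence of such functions is then independence as functions on \<open>S\<close>.\<close>

definition restr :: "'a set \<Rightarrow> ('a \<Rightarrow> 'b::zero) \<Rightarrow> 'a \<Rightarrow> 'b"
  where "restr S f = (\<lambda>p. if p \<in> S then f p else 0)"

type_synonym pt = "real^3"

section \<open>The pyramids\<close>

definition apex :: pt where "apex = vector [0, 0, 1]"

definition pyramid :: "pt set"
  where "pyramid = {p. p$1 \<ge> 0 \<and> p$2 \<ge> 0 \<and> p$3 \<ge> 0 \<and> p$1 \<le> 1 - p$3 \<and> p$2 \<le> 1 - p$3}"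

text \<open>The point at infinity is not represented: 0-forms on the pyramid get their value at the apex
  by continuity, and 1-forms are not evaluated there.\<close>

definition inf_pyramid :: "pt set"
  where "inf_pyramid = {p. 0 \<le> p$1 \<and> p$1 \<le> 1 \<and> 0 \<le> p$2 \<and> p$2 \<le> 1 \<and> 0 \<le> p$3}"

definition phi :: "pt \<Rightarrow> pt"
  where "phi p = vector [p$1 / (1 + p$3), p$2 / (1 + p$3), p$3 / (1 + p$3)]"

definition base :: "pt set"
  where "base = {p \<in> pyramid. p$3 = 0}"

text \<open>Edges and triangular faces are given by their vertices.\<close>

definition edges :: "(pt \<times> pt) set"
  where "edges =
    {(vector [0,0,0], vector [1,0,0]), (vector [1,0,0], vector [1,1,0]),
     (vector [0,1,0], vector [1,1,0]), (vector [0,0,0], vector [0,1,0]),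
     (vector [0,0,0], apex), (vector [1,0,0], apex),
     (vector [1,1,0], apex), (vector [0,1,0], apex)}"

definition tri_faces :: "(pt \<times> pt \<times> pt) set"
  where "tri_faces =
    {(vector [0,0,0], vector [1,0,0], apex), (vector [1,0,0], vector [1,1,0], apex),
     (vector [0,1,0], vector [1,1,0], apex), (vector [0,0,0], vector [0,1,0], apex)}"

fun edge_set :: "pt \<times> pt \<Rightarrow> pt set"
  where "edge_set (a, b) = closed_segment a b"

fun tri_set :: "pt \<times> pt \<times> pt \<Rightarrow> pt set"
  where "tri_set (a, b, c) = convex hull {a, b, c}"

definition faces :: "pt set set"
  where "faces = insert base (tri_set ` tri_faces)"

definition unit_tangent :: "pt \<times> pt \<Rightarrow> pt \<Rightarrow> bool"
  where "unit_tangent e t \<longleftrightarrow> norm t = 1 \<and> (\<exists>c. t = c *\<^sub>R (snd e - fst e))"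

definition unit_normal :: "pt set \<Rightarrow> pt \<Rightarrow> bool"
  where "unit_normal F n \<longleftrightarrow> norm n = 1 \<and> (\<forall>p\<in>F. \<forall>q\<in>F. n \<bullet> (p - q) = 0)"

section \<open>Polynomial and rational spaces\<close>

text \<open>Degrees are integers, so that a negative degree gives the zero space.\<close>

definition Qpoly :: "int \<Rightarrow> int \<Rightarrow> int \<Rightarrow> (pt \<Rightarrow> real) set"
  where "Qpoly l m n =
    span {\<lambda>p. p$1 ^ a * p$2 ^ b * p$3 ^ c | a b c. int a \<le> l \<and> int b \<le> m \<and> int c \<le> n}"

definition Qrat :: "nat \<Rightarrow> int \<Rightarrow> int \<Rightarrow> int \<Rightarrow> (pt \<Rightarrow> real) set"
  where "Qrat k l m n = {\<lambda>p. u p / (1 + p$3) ^ k | u. u \<in> Qpoly l m n}"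

definition Qpoly2 :: "int \<Rightarrow> int \<Rightarrow> (real \<Rightarrow> real \<Rightarrow> real) set"
  where "Qpoly2 l m = span {\<lambda>x y. x ^ a * y ^ b | a b. int a \<le> l \<and> int b \<le> m}"

definition Ppoly2 :: "int \<Rightarrow> (real \<Rightarrow> real \<Rightarrow> real) set"
  where "Ppoly2 n = span {\<lambda>x y. x ^ a * y ^ b | a b. int (a + b) \<le> n}"

definition Prat2 :: "nat \<Rightarrow> int \<Rightarrow> (real \<Rightarrow> real \<Rightarrow> real) set"
  where "Prat2 k n = {\<lambda>w z. u w z / (1 + z) ^ k | u. u \<in> Ppoly2 n}"

text \<open>The space of \<open>w\<close>, \<open>1 + z\<close> homogeneous polynomials of degree \<open>k - 1\<close> over \<open>(1 + z)^(k + 1)\<close>,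
  for \<open>k \<ge> 1\<close>.\<close>

definition Ptilde :: "nat \<Rightarrow> (real \<Rightarrow> real \<Rightarrow> real) set"
  where "Ptilde k = {\<lambda>w z. u w z / (1 + z) ^ (k + 1) | u.
    u \<in> span {\<lambda>w z. w ^ a * (1 + z) ^ (k - 1 - a) | a. a \<le> k - 1}}"

text \<open>Polynomials of total degree at most \<open>n\<close> on an edge or face \<open>S\<close>: restrictions of
  polynomials in the ambient coordinates.\<close>

definition Ppoly_on :: "pt set \<Rightarrow> int \<Rightarrow> (pt \<Rightarrow> real) set"
  where "Ppoly_on S n =
    restr S ` span {\<lambda>p. p$1 ^ a * p$2 ^ b * p$3 ^ c | a b c. int (a + b + c) \<le> n}"

section \<open>Differential operators and pullbacks\<close>

definition grad :: "(pt \<Rightarrow> real) \<Rightarrow> pt \<Rightarrow> pt"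
  where "grad q p = (\<chi> i. frechet_derivative q (at p) (axis i 1))"

definition curl :: "(pt \<Rightarrow> pt) \<Rightarrow> pt \<Rightarrow> pt"
  where "curl u p =
    (let D = (\<lambda>j i. frechet_derivative u (at p) (axis j 1) $ i)
     in vector [D 2 3 - D 3 2, D 3 1 - D 1 3, D 1 2 - D 2 1])"

definition pullback1 :: "(pt \<Rightarrow> pt) \<Rightarrow> pt \<Rightarrow> pt"
  where "pullback1 E x = transpose (matrix (frechet_derivative phi (at x))) *v E (phi x)"

text \<open>The images of a set of forms on the infinite pyramid under the inverse of the pullback.
  A 1-form on the pyramid is undefined at the apex; its representative is \<open>0\<close> there.\<close>

definition push0 :: "(pt \<Rightarrow> real) set \<Rightarrow> (pt \<Rightarrow> real) set"
  where "push0 U = {q. (\<forall>p. p \<notin> pyramid \<longrightarrow> q p = 0) \<and>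
    (\<exists>u\<in>U. \<forall>x\<in>inf_pyramid. q (phi x) = u x) \<and> continuous (at apex within pyramid) q}"

definition push1 :: "(pt \<Rightarrow> pt) set \<Rightarrow> (pt \<Rightarrow> pt) set"
  where "push1 U = {E. (\<forall>p. p \<notin> pyramid - {apex} \<longrightarrow> E p = 0) \<and>
    (\<exists>u\<in>U. \<forall>x\<in>inf_pyramid. pullback1 E x = u x)}"

section \<open>Approximation spaces\<close>

definition U0_inf :: "nat \<Rightarrow> (pt \<Rightarrow> real) set"
  where "U0_inf k = {u.
    (\<exists>q \<in> Qrat k (int k) (int k) (int k - 1). \<exists>c.
      u = (\<lambda>p. q p + c * (p$3 ^ k / (1 + p$3) ^ k))) \<and>
    (\<forall>s\<in>{0, 1}.
      (\<exists>f \<in> Prat2 k (int k). \<forall>x\<in>{0..1}. \<forall>z\<ge>0. u (vector [x, s, z]) = f x z) \<and>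
      (\<exists>f \<in> Prat2 k (int k). \<forall>y\<in>{0..1}. \<forall>z\<ge>0. u (vector [s, y, z]) = f y z))}"

definition U0 :: "nat \<Rightarrow> (pt \<Rightarrow> real) set"
  where "U0 k = push0 (U0_inf k)"

definition U0_zero :: "nat \<Rightarrow> (pt \<Rightarrow> real) set"
  where "U0_zero k = {q \<in> U0 k. \<forall>p \<in> frontier pyramid. q p = 0}"

definition U1_bar_inf :: "nat \<Rightarrow> (pt \<Rightarrow> pt) set"
  where "U1_bar_inf k =
    {\<lambda>p. vector [q1 p, q2 p, q3 p] +
        (p$3 ^ (k - 1) / (1 + p$3) ^ (k + 1)) *\<^sub>R
          vector [deriv (\<lambda>x. r x (p$2)) (p$1) * p$3, deriv (\<lambda>y. r (p$1) y) (p$2) * p$3,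
                  - r (p$1) (p$2)]
     | q1 q2 q3 r.
       q1 \<in> Qrat (k + 1) (int k - 1) (int k) (int k - 1) \<and>
       q2 \<in> Qrat (k + 1) (int k) (int k - 1) (int k - 1) \<and>
       q3 \<in> Qrat (k + 1) (int k) (int k) (int k - 2) \<and>
       r \<in> Qpoly2 (int k) (int k)}"

text \<open>Admissible tangential traces \<open>(f, g)\<close> on a vertical face, as functions of \<open>(w, z)\<close>.\<close>

definition tangential_traces :: "nat \<Rightarrow> ((real \<Rightarrow> real \<Rightarrow> real) \<times> (real \<Rightarrow> real \<Rightarrow> real)) set"
  where "tangential_traces k =
    {(\<lambda>w z. a w z + s w z * (1 + z), \<lambda>w z. b w z - s w z * w) | a b s.
      a \<in> Prat2 (k + 1) (int k - 1) \<and> b \<in> Prat2 (k + 1) (int k - 1) \<and> s \<in> Ptilde k}"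

definition U1_inf :: "nat \<Rightarrow> (pt \<Rightarrow> pt) set"
  where "U1_inf k = {u \<in> U1_bar_inf k. \<forall>s\<in>{0, 1}.
    (\<exists>(f, g) \<in> tangential_traces k. \<forall>x\<in>{0..1}. \<forall>z\<ge>0.
      u (vector [x, s, z]) $ 1 = f x z \<and> u (vector [x, s, z]) $ 3 = g x z) \<and>
    (\<exists>(f, g) \<in> tangential_traces k. \<forall>y\<in>{0..1}. \<forall>z\<ge>0.
      u (vector [s, y, z]) $ 2 = f y z \<and> u (vector [s, y, z]) $ 3 = g y z)}"

definition U1 :: "nat \<Rightarrow> (pt \<Rightarrow> pt) set"
  where "U1 k = push1 (U1_inf k)"

definition U1_zero_curl_inf :: "nat \<Rightarrow> (pt \<Rightarrow> pt) set"
  where "U1_zero_curl_inf k =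
    {\<lambda>p. vector [p$2 * (1 - p$2) * p$3 * q1 p, p$1 * (1 - p$1) * p$3 * q2 p,
                 p$1 * (1 - p$1) * p$2 * (1 - p$2) * \<rho> p]
     | q1 q2 \<rho>.
       q1 \<in> Qrat (k + 1) (int k - 1) (int k - 2) (int k - 2) \<and>
       q2 \<in> Qrat (k + 1) (int k - 2) (int k - 1) (int k - 2) \<and>
       \<rho> \<in> Qrat (k + 1) (int k - 2) (int k - 2) 0}"

definition U1_zero_curl :: "nat \<Rightarrow> (pt \<Rightarrow> pt) set"
  where "U1_zero_curl k = push1 (U1_zero_curl_inf k)"

section \<open>The space H(curl)\<close>

definition square_integrable :: "pt set \<Rightarrow> (pt \<Rightarrow> pt) \<Rightarrow> bool"
  where "square_integrable S u \<longleftrightarrow>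
    set_borel_measurable lebesgue S u \<and> set_integrable lebesgue S (\<lambda>p. (norm (u p))\<^sup>2)"

primrec C_n :: "nat \<Rightarrow> ('a::euclidean_space \<Rightarrow> 'b::real_normed_vector) \<Rightarrow> bool"
  where
    "C_n 0 f \<longleftrightarrow> continuous_on UNIV f"
  | "C_n (Suc n) f \<longleftrightarrow> (\<forall>x. f differentiable (at x)) \<and>
      (\<forall>b\<in>Basis. C_n n (\<lambda>x. frechet_derivative f (at x) b))"

text \<open>Smooth fields with compact support in the interior of \<open>S\<close>.\<close>

definition test_field :: "pt set \<Rightarrow> (pt \<Rightarrow> pt) \<Rightarrow> bool"
  where "test_field S v \<longleftrightarrow> (\<forall>n. C_n n v) \<and>
    compact (closure {p. v p \<noteq> 0}) \<and> closure {p. v p \<noteq> 0} \<subseteq> interior S"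

text \<open>Square integrable fields with a square integrable distributional curl \<open>w\<close>.\<close>

definition H_curl :: "pt set \<Rightarrow> (pt \<Rightarrow> pt) set"
  where "H_curl S = {u. square_integrable S u \<and>
    (\<exists>w. square_integrable S w \<and> (\<forall>v. test_field S v \<longrightarrow>
      (LINT p:S|lebesgue. u p \<bullet> curl v p) = (LINT p:S|lebesgue. w p \<bullet> v p)))}"

section \<open>Degrees of freedom\<close>

text \<open>Line and surface integrals, by affine parametrisations of the edges and faces.\<close>

fun edge_integral :: "pt \<times> pt \<Rightarrow> (pt \<Rightarrow> real) \<Rightarrow> real"
  where "edge_integral (a, b) f =
    norm (b - a) * (LINT s:{0..1}|lebesgue. f (a + s *\<^sub>R (b - a)))"

fun tri_integral :: "pt \<times> pt \<times> pt \<Rightarrow> (pt \<Rightarrow> real) \<Rightarrow> real"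
  where "tri_integral (a, b, c) f =
    norm (cross3 (b - a) (c - a)) *
    (LINT \<sigma>:{\<sigma>. 0 \<le> fst \<sigma> \<and> 0 \<le> snd \<sigma> \<and> fst \<sigma> + snd \<sigma> \<le> 1}|lebesgue.
      f (a + fst \<sigma> *\<^sub>R (b - a) + snd \<sigma> *\<^sub>R (c - a)))"

definition base_integral :: "(pt \<Rightarrow> real) \<Rightarrow> real"
  where "base_integral f = (LINT \<sigma>:{0..1} \<times> {0..1}|lebesgue. f (vector [fst \<sigma>, snd \<sigma>, 0]))"

definition edge_space :: "nat \<Rightarrow> pt \<times> pt \<Rightarrow> (pt \<Rightarrow> real) set"
  where "edge_space k e = Ppoly_on (edge_set e) (int k - 1)"

definition tri_space :: "nat \<Rightarrow> (pt set \<Rightarrow> pt) \<Rightarrow> pt \<times> pt \<times> pt \<Rightarrow> (pt \<Rightarrow> pt) set"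
  where "tri_space k \<nu> T =
    {q. (\<forall>i. (\<lambda>p. q p $ i) \<in> Ppoly_on (tri_set T) (int k - 2)) \<and>
        (\<forall>p. q p \<bullet> \<nu> (tri_set T) = 0)}"

definition base_space :: "nat \<Rightarrow> (pt \<Rightarrow> pt) set"
  where "base_space k =
    {restr base (\<lambda>p. vector [q1 (p$1) (p$2), q2 (p$1) (p$2), 0]) | q1 q2.
      q1 \<in> Qpoly2 (int k - 2) (int k - 1) \<and> q2 \<in> Qpoly2 (int k - 1) (int k - 2)}"

type_synonym functional = "(pt \<Rightarrow> pt) \<Rightarrow> real"

definition edge_dof :: "pt \<times> pt \<Rightarrow> pt \<Rightarrow> (pt \<Rightarrow> real) \<Rightarrow> functional"
  where "edge_dof e t q = (\<lambda>u. edge_integral e (\<lambda>p. (u p \<bullet> t) * q p))"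

definition tri_dof :: "pt \<times> pt \<times> pt \<Rightarrow> (pt \<Rightarrow> pt) \<Rightarrow> functional"
  where "tri_dof T q = (\<lambda>u. tri_integral T (\<lambda>p. u p \<bullet> q p))"

definition base_dof :: "pt \<Rightarrow> (pt \<Rightarrow> pt) \<Rightarrow> functional"
  where "base_dof n q = (\<lambda>u. base_integral (\<lambda>p. cross3 (u p) n \<bullet> q p))"

text \<open>The integrands below are meaningful in the interior of the pyramid; its boundary is a null
  set.\<close>

definition grad_dof :: "(pt \<Rightarrow> real) \<Rightarrow> functional"
  where "grad_dof q = (\<lambda>u. LINT p:pyramid|lebesgue. u p \<bullet> grad q p)"

definition curl_dof :: "(pt \<Rightarrow> pt) \<Rightarrow> functional"
  where "curl_dof v = (\<lambda>u. LINT p:pyramid|lebesgue. curl u p \<bullet> curl v p)"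

text \<open>The choices left open by the degrees of freedom: unit tangents of the edges, unit normals of
  the faces, and bases of the test spaces.\<close>

record dof_choice =
  tangent :: "pt \<times> pt \<Rightarrow> pt"
  normal :: "pt set \<Rightarrow> pt"
  edge_basis :: "pt \<times> pt \<Rightarrow> (pt \<Rightarrow> real) set"
  tri_basis :: "pt \<times> pt \<times> pt \<Rightarrow> (pt \<Rightarrow> pt) set"
  base_basis :: "(pt \<Rightarrow> pt) set"
  grad_basis :: "(pt \<Rightarrow> real) set"
  curl_basis :: "(pt \<Rightarrow> pt) set"

definition valid_choice :: "nat \<Rightarrow> dof_choice \<Rightarrow> bool"
  where "valid_choice k C \<longleftrightarrow>
    (\<forall>e\<in>edges. unit_tangent e (tangent C e)) \<and>
    (\<forall>F\<in>faces. unit_normal F (normal C F)) \<and>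
    (\<forall>e\<in>edges. is_basis (edge_basis C e) (edge_space k e)) \<and>
    (\<forall>T\<in>tri_faces. is_basis (tri_basis C T) (tri_space k (normal C) T)) \<and>
    is_basis (base_basis C) (base_space k) \<and>
    is_basis (grad_basis C) (U0_zero k) \<and>
    is_basis (curl_basis C) (U1_zero_curl k)"

text \<open>The edge and face degrees of freedom associated with \<open>F\<close> and with the edges of \<open>F\<close>.\<close>

definition dofs_on :: "dof_choice \<Rightarrow> pt set \<Rightarrow> functional set"
  where "dofs_on C F =
    {edge_dof e (tangent C e) q | e q. e \<in> edges \<and> edge_set e \<subseteq> F \<and> q \<in> edge_basis C e} \<union>
    {tri_dof T q | T q. T \<in> tri_faces \<and> tri_set T = F \<and> q \<in> tri_basis C T} \<union>
    {base_dof (normal C base) q | q. F = base \<and> q \<in> base_basis C}"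

definition dofs :: "dof_choice \<Rightarrow> functional set"
  where "dofs C =
    {edge_dof e (tangent C e) q | e q. e \<in> edges \<and> q \<in> edge_basis C e} \<union>
    {tri_dof T q | T q. T \<in> tri_faces \<and> q \<in> tri_basis C T} \<union>
    base_dof (normal C base) ` base_basis C \<union>
    grad_dof ` grad_basis C \<union>
    curl_dof ` curl_basis C"

definition tangential_component :: "pt \<Rightarrow> pt \<Rightarrow> pt"
  where "tangential_component n a = a - (a \<bullet> n) *\<^sub>R n"

end

theory Submission
  imports Defs
begin

text \<open>Pulled back to the infinite pyramid, the fields are polynomial numerators over powers of \<open>1 + z\<close>.
  The degrees of freedom are treated in the order edges, triangular faces, base, interior.  At each
  stage, a field whose earlier degrees of freedom vanish has a trace with explicit bubble factors, and
  testing it against the cofactors gives the integral of a nonnegative form, so the trace is \<open>0\<close>.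
  Conversely every choice of cofactors is attained by a field whose other traces on edges and faces
  vanish, so the pairing with the test space is nondegenerate and all values are attained; no dimension
  is counted.  In the interior, a field with vanishing tangential trace is \<open>\<nabla>q + v\<close> with \<open>q\<close> in
  \<open>U0_zero\<close> and \<open>v\<close> in \<open>U1_zero_curl\<close>, and \<open>curl v = 0\<close> forces \<open>v = 0\<close>: along \<open>z\<close>, the first
  two components of its pull-back then have a derivative of the form \<open>c / (1 + z)^(k + 1)\<close>, while they
  vanish for \<open>z = 0\<close> and decay like \<open>1 / (1 + z)\<close>.\<close>

section \<open>Polynomials\<close>

text \<open>Two obstacles shape the proof. The space is cut out by conditions on the four vertical
  faces, so a field built to have a prescribed trace must be shown to satisfy them on every face. A
  trace with monomials of total degree \<open>k\<close> is one degree too high; replacing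
  \<open>z^j\<close> by \<open>(1 + z)^j\<close> costs only lower order terms and moves the excess
  into the homogeneous part of the trace space. This exchange makes the lifts from vertical edges
  and triangular faces possible. The other obstacle is the apex, where fields are not evaluated and
  near which they are only known to be bounded. Every integral is therefore reduced to functions
  that are continuous and bounded on the interior of a convex set, whose boundary is negligible. The
  terms \<open>z^(k-1) (r_x z, r_y z, -r)\<close> of the space are what gradients of 0-forms of top
  degree in \<open>z\<close> produce. In the interior, the gradient part of a field absorbs its
  third component up to a factor \<open>\<rho>\<close> of degree \<open>0\<close> in
  \<open>z\<close>. The curl functionals are treated before the gradient functionals, because
  gradients are invisible to them.\<close>

lemma pt_eq_iff: "(p::pt) = q \<longleftrightarrow> p$1 = q$1 \<and> p$2 = q$2 \<and> p$3 = q$3"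
  by (simp add: vec_eq_iff forall_3)

text \<open>Linear claims are proved one monomial at a time. The remainder \<open>g\<close> keeps
  its membership in the space, so that lemmas about sums apply to it in the step.\<close>

lemma Qpoly_induct [consumes 1, case_names zero step]:
  assumes "f \<in> Qpoly l m n" and "P (\<lambda>_. 0)"
    and "\<And>c a b e g. int a \<le> l \<Longrightarrow> int b \<le> m \<Longrightarrow> int e \<le> n \<Longrightarrow> g \<in> Qpoly l m n \<Longrightarrow> P g \<Longrightarrow>
      P (\<lambda>p. c * (p$1 ^ a * p$2 ^ b * p$3 ^ e) + g p)"
  shows "P f"
proof -
  have "f \<in> Qpoly l m n \<and> P f"
    using assms(1)[unfolded Qpoly_def]
  proof (induction rule: span_induct_alt)
    case base
    have "0 \<in> Qpoly l m n" unfolding Qpoly_def by (rule span_zero)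
    then show ?case using assms(2) by (simp add: zero_fun_def)
  next
    case (step c x y)
    then obtain a b e where x: "x = (\<lambda>p. p$1 ^ a * p$2 ^ b * p$3 ^ e)"
      and le: "int a \<le> l" "int b \<le> m" "int e \<le> n" by blast
    have "c *\<^sub>R x + y = (\<lambda>p. c * (p$1 ^ a * p$2 ^ b * p$3 ^ e) + y p)"
      by (simp add: x scaleR_fun_def plus_fun_def)
    moreover have "c *\<^sub>R x + y \<in> Qpoly l m n"
      using step unfolding Qpoly_def by (intro span_add[OF span_scale[OF span_base]]) auto
    ultimately show ?case using assms(3)[OF le, of y c] step by auto
  qed
  then show ?thesis ..
qed

lemma Qpoly_monom: "int a \<le> l \<Longrightarrow> int b \<le> m \<Longrightarrow> int e \<le> n \<Longrightarrow>
    (\<lambda>p. p$1 ^ a * p$2 ^ b * p$3 ^ e) \<in> Qpoly l m n"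
  unfolding Qpoly_def by (rule span_base) blast

lemma Qpoly_zero: "(\<lambda>_. 0) \<in> Qpoly l m n"
proof -
  have "0 \<in> Qpoly l m n" unfolding Qpoly_def by (rule span_zero)
  then show ?thesis by (simp add: zero_fun_def)
qed

lemma Qpoly_add: "f \<in> Qpoly l m n \<Longrightarrow> g \<in> Qpoly l m n \<Longrightarrow> (\<lambda>p. f p + g p) \<in> Qpoly l m n"
  unfolding Qpoly_def using span_add[of f _ g] by (simp add: plus_fun_def)

lemma Qpoly_cmult: "f \<in> Qpoly l m n \<Longrightarrow> (\<lambda>p. c * f p) \<in> Qpoly l m n"
  unfolding Qpoly_def using span_scale[of f _ c] by (simp add: scaleR_fun_def)

lemma Qpoly_diff: "f \<in> Qpoly l m n \<Longrightarrow> g \<in> Qpoly l m n \<Longrightarrow> (\<lambda>p. f p - g p) \<in> Qpoly l m n"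
  using Qpoly_add[of f l m n "\<lambda>p. (-1) * g p"] Qpoly_cmult[of g l m n "-1"] by simp

lemma Qpoly_mono:
  assumes "f \<in> Qpoly l m n" "l \<le> l'" "m \<le> m'" "n \<le> n'"
  shows "f \<in> Qpoly l' m' n'"
proof -
  have "Qpoly l m n \<subseteq> Qpoly l' m' n'"
    unfolding Qpoly_def by (rule span_mono) (use assms(2-4) in fastforce)
  then show ?thesis using assms(1) by blast
qed

lemma Qpoly_sum: "(\<And>i. i \<in> I \<Longrightarrow> f i \<in> Qpoly l m n) \<Longrightarrow> (\<lambda>p. \<Sum>i\<in>I. f i p) \<in> Qpoly l m n"
  by (induction I rule: infinite_finite_induct) (auto intro: Qpoly_add simp: Qpoly_zero)

lemma Qpoly_mult:
  assumes "f \<in> Qpoly l m n" "g \<in> Qpoly l' m' n'"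
    and "l + l' \<le> L" "m + m' \<le> M" "n + n' \<le> N"
  shows "(\<lambda>p. f p * g p) \<in> Qpoly L M N"
  using assms(1)
proof (induction rule: Qpoly_induct)
  case zero
  then show ?case by (simp add: Qpoly_zero)
next
  case (step c a b e h)
  have "(\<lambda>p. (p$1 ^ a * p$2 ^ b * p$3 ^ e) * g p) \<in> Qpoly L M N"
    using assms(2)
  proof (induction rule: Qpoly_induct)
    case zero
    then show ?case by (simp add: Qpoly_zero)
  next
    case (step c' a' b' e' h')
    have "(\<lambda>p. p$1 ^ (a + a') * p$2 ^ (b + b') * p$3 ^ (e + e')) \<in> Qpoly L M N"
      using assms step \<open>int a \<le> l\<close> \<open>int b \<le> m\<close> \<open>int e \<le> n\<close> by (intro Qpoly_monom) auto
    from Qpoly_add[OF Qpoly_cmult[OF this, of c'] step.IH]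
    show ?case by (simp add: power_add algebra_simps)
  qed
  from Qpoly_add[OF Qpoly_cmult[OF this, of c] step.IH]
  show ?case by (simp add: algebra_simps)
qed

lemma Qpoly_coord: "(\<lambda>p. p$1) \<in> Qpoly 1 0 0" "(\<lambda>p. p$2) \<in> Qpoly 0 1 0" "(\<lambda>p. p$3) \<in> Qpoly 0 0 1"
  using Qpoly_monom[of 1 1 0 0 0 0] Qpoly_monom[of 0 0 1 1 0 0] Qpoly_monom[of 0 0 0 0 1 1] by auto

lemma Qpoly_const: "(\<lambda>p. c) \<in> Qpoly 0 0 0"
  using Qpoly_cmult[OF Qpoly_monom[of 0 0 0 0 0 0], of c] by simp

lemma Qpoly_zpow: "(\<lambda>p. p$3 ^ e) \<in> Qpoly 0 0 (int e)"
  using Qpoly_monom[of 0 0 0 0 e "int e"] by simp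

lemma Qpoly_1z: "(\<lambda>p. 1 + p$3) \<in> Qpoly 0 0 1"
  by (rule Qpoly_add) (auto intro: Qpoly_mono[OF Qpoly_const] Qpoly_coord)

lemma Qpoly_neg: "f \<in> Qpoly l m n \<Longrightarrow> l < 0 \<or> m < 0 \<or> n < 0 \<Longrightarrow> f = (\<lambda>_. 0)"
  by (induction rule: Qpoly_induct) auto

text \<open>The factor theorem in the first variable. When \<open>f\<close> vanishes on
  \<open>x = s\<close> it removes a linear factor and one degree; the bubble factors below arise in
  this way.\<close>

lemma Qpoly_div1:
  assumes "f \<in> Qpoly l m n"
  shows "\<exists>g \<in> Qpoly (l - 1) m n. \<forall>p. f p = f (vector [s, p$2, p$3]) + (p$1 - s) * g p"
  using assms
proof (induction rule: Qpoly_induct)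
  case zero
  then show ?case by (intro bexI[of _ "\<lambda>_. 0"]) (auto simp: Qpoly_zero)
next
  case (step c a b e h)
  then obtain g where g: "g \<in> Qpoly (l - 1) m n"
    "\<forall>p. h p = h (vector [s, p$2, p$3]) + (p$1 - s) * g p" by blast
  \<comment> \<open>The cofactor in \<open>x^a - s^a = (x - s) (x^(a-1) + ... + s^(a-1))\<close>;
    the empty sum covers \<open>a = 0\<close>.\<close>
  define d :: "pt \<Rightarrow> real" where
    "d = (\<lambda>p. \<Sum>i<a. s ^ (a - Suc i) * (p$1 ^ i * p$2 ^ b * p$3 ^ e))"
  have d: "d \<in> Qpoly (l - 1) m n"
    unfolding d_def by (intro Qpoly_sum Qpoly_cmult Qpoly_monom) (use step in auto)
  have m: "p$1 ^ a * p$2 ^ b * p$3 ^ e = s ^ a * p$2 ^ b * p$3 ^ e + (p$1 - s) * d p" for p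
  proof -
    have "(p$1 - s) * d p = ((p$1 - s) * (\<Sum>i<a. s ^ (a - Suc i) * p$1 ^ i)) * (p$2 ^ b * p$3 ^ e)"
      unfolding d_def by (simp add: sum_distrib_right sum_distrib_left mult_ac)
    also have "\<dots> = (p$1 ^ a - s ^ a) * (p$2 ^ b * p$3 ^ e)"
      by (simp only: power_diff_sumr2)
    finally show ?thesis by (simp add: algebra_simps)
  qed
  have "c * (p$1 ^ a * p$2 ^ b * p$3 ^ e) + h p = c * (s ^ a * p$2 ^ b * p$3 ^ e) + h (vector [s, p$2, p$3]) + (p$1 - s) * (c * d p + g p)" for p
    by (subst m, subst g(2)[rule_format]) (simp add: algebra_simps)
  then show ?case
    by (intro bexI[OF _ Qpoly_add[OF Qpoly_cmult[OF d, of c] g(1)]]) simp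
qed

text \<open>The reflection in \<open>x = y\<close>. It exchanges the two pairs of vertical faces, so
  lifts from base edges and triangular faces are built for \<open>y = s\<close> and carried over to
  \<open>x = s\<close>.\<close>

definition swap12 :: "pt \<Rightarrow> pt" where "swap12 p = vector [p$2, p$1, p$3]"

lemma swap12_nth [simp]: "swap12 p $ 1 = p$2" "swap12 p $ 2 = p$1" "swap12 p $ 3 = p$3"
  by (auto simp: swap12_def)

lemma swap12_swap12 [simp]: "swap12 (swap12 p) = p"
  by (simp add: pt_eq_iff)

lemma swap12_vector [simp]: "swap12 (vector [a, b, c]) = vector [b, a, c]"
  by (simp add: pt_eq_iff)

lemma Qpoly_swap12: "f \<in> Qpoly l m n \<Longrightarrow> (\<lambda>p. f (swap12 p)) \<in> Qpoly m l n"
proof (induction rule: Qpoly_induct)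
  case (step c a b e h)
  from step Qpoly_add[OF Qpoly_cmult[OF Qpoly_monom[of b m a l e n], of c] step.IH]
  show ?case by (simp add: mult_ac)
qed (simp add: Qpoly_zero)

lemma Qpoly_div3:
  assumes "f \<in> Qpoly l m n"
  shows "\<exists>g \<in> Qpoly l m (n - 1). \<forall>p. f p = f (vector [p$1, p$2, 0]) + p$3 * g p"
  using assms
proof (induction rule: Qpoly_induct)
  case zero
  then show ?case by (intro bexI[of _ "\<lambda>_. 0"]) (auto simp: Qpoly_zero)
next
  case (step c a b e h)
  then obtain g where g: "g \<in> Qpoly l m (n - 1)"
    "\<forall>p. h p = h (vector [p$1, p$2, 0]) + p$3 * g p" by blast
  define d :: "pt \<Rightarrow> real" where
    "d = (\<lambda>p. if e = 0 then 0 else p$1 ^ a * p$2 ^ b * p$3 ^ (e - 1))"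
  have d: "d \<in> Qpoly l m (n - 1)"
    using step Qpoly_monom[of a l b m "e - 1" "n - 1"] by (cases e) (auto simp: d_def Qpoly_zero)
  have m: "p$1 ^ a * p$2 ^ b * p$3 ^ e = p$1 ^ a * p$2 ^ b * 0 ^ e + p$3 * d p" for p
    by (cases e) (auto simp: d_def)
  have "c * (p$1 ^ a * p$2 ^ b * p$3 ^ e) + h p = c * (p$1 ^ a * p$2 ^ b * 0 ^ e) + h (vector [p$1, p$2, 0]) + p$3 * (c * d p + g p)" for p
    by (subst m, subst g(2)[rule_format]) (simp add: algebra_simps)
  then show ?case
    by (intro bexI[OF _ Qpoly_add[OF Qpoly_cmult[OF d, of c] g(1)]]) simp
qed

text \<open>Isolates the coefficient of the top power of \<open>z\<close>, which becomes the
  function \<open>r\<close> when the gradient of a 0-form is put into the shape of the 1-form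
  space.\<close>

lemma Qpoly_top:
  assumes "f \<in> Qpoly l m (int j)"
  shows "\<exists>g \<in> Qpoly l m (int j - 1). \<exists>h \<in> Qpoly l m 0. \<forall>p. f p = g p + p$3 ^ j * h p"
  using assms
proof (induction rule: Qpoly_induct)
  case zero
  then show ?case by (intro bexI[of _ "\<lambda>_. 0"]) (auto simp: Qpoly_zero)
next
  case (step c a b e F)
  then obtain g h where gh: "g \<in> Qpoly l m (int j - 1)" "h \<in> Qpoly l m 0"
    "\<forall>p. F p = g p + p$3 ^ j * h p" by blast
  show ?case
  proof (cases "e = j")
    case True
    have "(\<lambda>p. c * (p$1 ^ a * p$2 ^ b * p$3 ^ 0) + h p) \<in> Qpoly l m 0"
      by (rule Qpoly_add[OF Qpoly_cmult[OF Qpoly_monom] gh(2)]) (use step in auto)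
    then show ?thesis
      using gh(3) True by (intro bexI[OF _ gh(1)] bexI[rotated]) (auto simp: algebra_simps)
  next
    case False
    have "(\<lambda>p. c * (p$1 ^ a * p$2 ^ b * p$3 ^ e) + g p) \<in> Qpoly l m (int j - 1)"
      by (rule Qpoly_add[OF Qpoly_cmult[OF Qpoly_monom] gh(1)]) (use step False in auto)
    then show ?thesis
      using gh by (intro bexI[of _ "\<lambda>p. c * (p$1 ^ a * p$2 ^ b * p$3 ^ e) + g p"] bexI[OF _ gh(2)])
        (auto simp: algebra_simps)
  qed
qed

lemma Qpoly_continuous: "f \<in> Qpoly l m n \<Longrightarrow> continuous_on S f"
  by (induction rule: Qpoly_induct) (auto intro!: continuous_intros)

text \<open>On the infinite pyramid \<open>x\<close> and \<open>y\<close> stay in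
  \<open>[0,1]\<close>, so the degree in \<open>z\<close> alone controls growth. The natural
  exponents on the two sides avoid a power with the possibly negative exponent
  \<open>n\<close>.\<close>

lemma Qpoly_bound:
  assumes "f \<in> Qpoly l m n" "n + int i \<le> int j"
  shows "\<exists>C\<ge>0. \<forall>p\<in>inf_pyramid. \<bar>f p\<bar> * (1 + p$3) ^ i \<le> C * (1 + p$3) ^ j"
  using assms(1)
proof (induction rule: Qpoly_induct)
  case zero
  then show ?case by (intro exI[of _ 0]) auto
next
  case (step c a b e g)
  then obtain C where C: "C \<ge> 0" "\<forall>p\<in>inf_pyramid. \<bar>g p\<bar> * (1 + p$3) ^ i \<le> C * (1 + p$3) ^ j"
    by blast
  have "\<bar>c * (p$1 ^ a * p$2 ^ b * p$3 ^ e) + g p\<bar> * (1 + p$3) ^ i \<le> (\<bar>c\<bar> + C) * (1 + p$3) ^ j"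
    if p: "p \<in> inf_pyramid" for p
  proof -
    have p': "0 \<le> p$1" "p$1 \<le> 1" "0 \<le> p$2" "p$2 \<le> 1" "0 \<le> p$3"
      using p by (auto simp: inf_pyramid_def)
    have "p$1 ^ a * p$2 ^ b \<le> 1"
      using p' by (intro mult_le_one power_le_one) auto
    moreover have "p$3 ^ e \<le> (1 + p$3) ^ e" using p' by (intro power_mono) auto
    ultimately have "p$1 ^ a * p$2 ^ b * p$3 ^ e \<le> 1 * (1 + p$3) ^ e"
      using p' by (intro mult_mono) auto
    then have "(p$1 ^ a * p$2 ^ b * p$3 ^ e) * (1 + p$3) ^ i \<le> (1 + p$3) ^ e * (1 + p$3) ^ i"
      using p' by (intro mult_right_mono) auto
    also have "\<dots> = (1 + p$3) ^ (e + i)" by (simp add: power_add)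
    also have "\<dots> \<le> (1 + p$3) ^ j" using p' step assms(2) by (intro power_increasing) auto
    finally have *: "\<bar>c\<bar> * ((p$1 ^ a * p$2 ^ b * p$3 ^ e) * (1 + p$3) ^ i) \<le> \<bar>c\<bar> * (1 + p$3) ^ j"
      by (intro mult_left_mono) auto
    have "\<bar>c * (p$1 ^ a * p$2 ^ b * p$3 ^ e) + g p\<bar> \<le> \<bar>c\<bar> * (p$1 ^ a * p$2 ^ b * p$3 ^ e) + \<bar>g p\<bar>"
      using p' abs_triangle_ineq[of "c * (p$1 ^ a * p$2 ^ b * p$3 ^ e)" "g p"] by (simp add: abs_mult)
    then have "\<bar>c * (p$1 ^ a * p$2 ^ b * p$3 ^ e) + g p\<bar> * (1 + p$3) ^ i \<le>
        (\<bar>c\<bar> * (p$1 ^ a * p$2 ^ b * p$3 ^ e) + \<bar>g p\<bar>) * (1 + p$3) ^ i"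
      using p' by (intro mult_right_mono) auto
    also have "\<dots> \<le> (\<bar>c\<bar> + C) * (1 + p$3) ^ j"
      using * C(2)[rule_format, OF p] by (simp add: algebra_simps)
    finally show ?thesis .
  qed
  then show ?case using C(1) by (intro exI[of _ "\<bar>c\<bar> + C"]) auto
qed

lemma Qpoly_real_polynomial: "f \<in> Qpoly l m n \<Longrightarrow> real_polynomial_function f"
proof (induction rule: Qpoly_induct)
  case (step c a b e g)
  have "real_polynomial_function (\<lambda>p::pt. p$i)" for i
    by (rule real_polynomial_function.intros(1)) (rule bounded_linear_vec_nth)
  then show ?case using step
    by (intro real_polynomial_function.intros(2-4) real_polynomial_function_power) auto
qed (rule real_polynomial_function.intros)

text \<open>Restricted to the line from \<open>x\<close> to \<open>q\<close>, \<open>f\<close>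
  becomes a polynomial in one variable with infinitely many zeros near \<open>0\<close>.\<close>

lemma Qpoly_eq_zero:
  assumes f: "f \<in> Qpoly l m n" and S: "open S" "x \<in> S" "\<And>p. p \<in> S \<Longrightarrow> f p = 0"
  shows "f q = 0"
proof -
  define h where "h = (\<lambda>s::real. f (x + s *\<^sub>R (q - x)))"
  have "polynomial_function (\<lambda>s::real. x + s *\<^sub>R (q - x))"
    by (intro polynomial_function_add polynomial_function_mult polynomial_function_const polynomial_function_id)
  then have "real_polynomial_function (f \<circ> (\<lambda>s. x + s *\<^sub>R (q - x)))"
    by (rule real_polynomial_function_compose[OF _ Qpoly_real_polynomial[OF f]])
  then obtain a N where h: "h = (\<lambda>s. \<Sum>i\<le>N. a i * s ^ i)"
    unfolding h_def comp_def using real_polynomial_function_iff_sum by blast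
  obtain e where e: "e > 0" "ball x e \<subseteq> S" using S(1,2) open_contains_ball by blast
  have "infinite {s. h s = 0}"
  proof -
    \<comment> \<open>Short enough to stay in the ball; the added \<open>1\<close> covers
      \<open>q = x\<close>.\<close>
    define d where "d = e / (norm (q - x) + 1)"
    have d: "d > 0" using e by (simp add: d_def add_nonneg_pos)
    have "{0<..<d} \<subseteq> {s. h s = 0}"
    proof
      fix s assume "s \<in> {0<..<d}"
      then have s: "0 < s" "s < d" by auto
      have "norm (s *\<^sub>R (q - x)) \<le> s * (norm (q - x) + 1)" using s by simp
      also have "\<dots> < d * (norm (q - x) + 1)" using s by (intro mult_strict_right_mono) (auto simp: add_nonneg_pos)
      also have "\<dots> = e" by (simp add: d_def add_nonneg_eq_0_iff)
      finally have "x + s *\<^sub>R (q - x) \<in> ball x e"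
        by (simp add: dist_norm)
      then show "s \<in> {s. h s = 0}" using S(3) e(2) by (auto simp: h_def)
    qed
    then show ?thesis using d infinite_Ioo infinite_super by blast
  qed
  then have "\<forall>i\<le>N. a i = 0" using polyfun_finite_roots[of a N] unfolding h by auto
  then have "h 1 = 0" by (simp add: h)
  then show ?thesis by (simp add: h_def)
qed

section \<open>Partial derivatives\<close>

definition D1 :: "(pt \<Rightarrow> real) \<Rightarrow> pt \<Rightarrow> real"
  where "D1 f p = deriv (\<lambda>s. f (vector [s, p$2, p$3])) (p$1)"

definition D2 :: "(pt \<Rightarrow> real) \<Rightarrow> pt \<Rightarrow> real"
  where "D2 f p = deriv (\<lambda>s. f (vector [p$1, s, p$3])) (p$2)"

definition D3 :: "(pt \<Rightarrow> real) \<Rightarrow> pt \<Rightarrow> real"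
  where "D3 f p = deriv (\<lambda>s. f (vector [p$1, p$2, s])) (p$3)"

lemma inner_pt: "(a::pt) \<bullet> b = a$1 * b$1 + a$2 * b$2 + a$3 * b$3"
  by (simp add: inner_vec_def sum_3)

lemma has_derivative_vec_nth_iff:
  fixes f :: "'a::real_normed_vector \<Rightarrow> pt"
  shows "(f has_derivative f') (at x within S) \<longleftrightarrow>
    (\<forall>i. ((\<lambda>x. f x $ i) has_derivative (\<lambda>h. f' h $ i)) (at x within S))"
proof -
  have *: "(\<forall>b\<in>(Basis::pt set). P b) \<longleftrightarrow> (\<forall>i. P (axis i 1))" for P
    by (auto simp: Basis_vec_def)
  show ?thesis
    unfolding has_derivative_componentwise_within[of f] * by (simp add: inner_axis)
qed

lemma has_derivative_vector3:
  assumes "(f1 has_derivative f1') F" "(f2 has_derivative f2') F" "(f3 has_derivative f3') F"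
    and "F = at x within S"
  shows "((\<lambda>x. vector [f1 x, f2 x, f3 x] :: pt) has_derivative (\<lambda>h. vector [f1' h, f2' h, f3' h])) F"
  using assms by (simp add: has_derivative_vec_nth_iff forall_3)

lemma GDERIV_line:
  fixes f :: "pt \<Rightarrow> real"
  assumes "GDERIV f (\<gamma> s) :> g" "(\<gamma> has_vector_derivative v) (at s)"
  shows "((\<lambda>s. f (\<gamma> s)) has_real_derivative (v \<bullet> g)) (at s)"
proof -
  have "((\<lambda>s. f (\<gamma> s)) has_derivative (\<lambda>h. (h *\<^sub>R v) \<bullet> g)) (at s)"
    using assms unfolding gderiv_def has_vector_derivative_def
    by (rule has_derivative_compose[rotated])
  then show ?thesis by (simp add: has_field_derivative_def mult.commute[of _ "v \<bullet> g"])
qed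

lemma has_vector_derivative_vector3:
  assumes "(f1 has_real_derivative f1') (at s)" "(f2 has_real_derivative f2') (at s)"
    "(f3 has_real_derivative f3') (at s)"
  shows "((\<lambda>s. vector [f1 s, f2 s, f3 s] :: pt) has_vector_derivative vector [f1', f2', f3']) (at s)"
proof -
  have "((\<lambda>s. vector [f1 s, f2 s, f3 s] :: pt) has_derivative (\<lambda>h. vector [f1' * h, f2' * h, f3' * h])) (at s)"
    using assms unfolding has_field_derivative_def by (intro has_derivative_vector3) auto
  moreover have "(\<lambda>h. vector [f1' * h, f2' * h, f3' * h] :: pt) = (\<lambda>h. h *\<^sub>R vector [f1', f2', f3'])"
    by (auto simp: fun_eq_iff pt_eq_iff)
  ultimately show ?thesis by (simp add: has_vector_derivative_def)
qed

lemma GDERIV_partial: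
  fixes f :: "pt \<Rightarrow> real"
  assumes "GDERIV f p :> g"
  shows "((\<lambda>s. f (vector [s, p$2, p$3])) has_real_derivative g$1) (at (p$1))"
    and "((\<lambda>s. f (vector [p$1, s, p$3])) has_real_derivative g$2) (at (p$2))"
    and "((\<lambda>s. f (vector [p$1, p$2, s])) has_real_derivative g$3) (at (p$3))"
proof -
  have p: "vector [p$1, p$2, p$3] = p" by (simp add: pt_eq_iff)
  have "((\<lambda>s. vector [s, p$2, p$3] :: pt) has_vector_derivative vector [1, 0, 0]) (at (p$1))"
    "((\<lambda>s. vector [p$1, s, p$3] :: pt) has_vector_derivative vector [0, 1, 0]) (at (p$2))"
    "((\<lambda>s. vector [p$1, p$2, s] :: pt) has_vector_derivative vector [0, 0, 1]) (at (p$3))"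
    by (rule has_vector_derivative_vector3; auto intro!: derivative_eq_intros)+
  note this[THEN GDERIV_line[rotated]]
  then show "((\<lambda>s. f (vector [s, p$2, p$3])) has_real_derivative g$1) (at (p$1))"
    and "((\<lambda>s. f (vector [p$1, s, p$3])) has_real_derivative g$2) (at (p$2))"
    and "((\<lambda>s. f (vector [p$1, p$2, s])) has_real_derivative g$3) (at (p$3))"
    using assms by (force simp: p inner_pt)+
qed

lemma GDERIV_D:
  fixes f :: "pt \<Rightarrow> real"
  assumes "GDERIV f p :> g"
  shows "D1 f p = g$1" "D2 f p = g$2" "D3 f p = g$3"
  unfolding D1_def D2_def D3_def using GDERIV_partial[OF assms] by (auto intro!: DERIV_imp_deriv)

lemma GDERIV_nth: "GDERIV (\<lambda>p::pt. p$i) p :> axis i 1"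
  unfolding gderiv_def by (simp add: inner_axis bounded_linear.has_derivative[OF bounded_linear_vec_nth] bounded_linear_imp_has_derivative bounded_linear_vec_nth)

lemma GDERIV_power: "GDERIV f p :> g \<Longrightarrow> GDERIV (\<lambda>p. f p ^ n) p :> (real n * f p ^ (n - 1)) *\<^sub>R g"
  by (rule GDERIV_DERIV_compose[where g = "\<lambda>x. x ^ n"]) (auto intro!: derivative_eq_intros)

lemma GDERIV_monom:
  "GDERIV (\<lambda>p::pt. p$1 ^ a * p$2 ^ b * p$3 ^ e) p :>
    vector [real a * p$1 ^ (a - 1) * p$2 ^ b * p$3 ^ e, real b * p$1 ^ a * p$2 ^ (b - 1) * p$3 ^ e,
      real e * p$1 ^ a * p$2 ^ b * p$3 ^ (e - 1)]"
  by (rule GDERIV_subst, (rule GDERIV_mult GDERIV_power GDERIV_nth)+)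
    (simp add: pt_eq_iff axis_def)

text \<open>The factor \<open>real a\<close> is \<open>0\<close> when \<open>a = 0\<close>, which
  repairs the truncated exponent \<open>a - 1\<close> and the bound \<open>l - 1\<close>; likewise
  for \<open>b\<close> and \<open>e\<close>.\<close>

lemma Qpoly_monom_D:
  assumes "int a \<le> l" "int b \<le> m" "int e \<le> n"
  shows "(\<lambda>p. real a * p$1 ^ (a - 1) * p$2 ^ b * p$3 ^ e) \<in> Qpoly (l - 1) m n"
    "(\<lambda>p. real b * p$1 ^ a * p$2 ^ (b - 1) * p$3 ^ e) \<in> Qpoly l (m - 1) n"
    "(\<lambda>p. real e * p$1 ^ a * p$2 ^ b * p$3 ^ (e - 1)) \<in> Qpoly l m (n - 1)"
proof -
  show "(\<lambda>p. real a * p$1 ^ (a - 1) * p$2 ^ b * p$3 ^ e) \<in> Qpoly (l - 1) m n"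
    using Qpoly_cmult[OF Qpoly_monom[of "a - 1" "l - 1" b m e n], of "real a"] assms
    by (cases a) (auto simp: Qpoly_zero mult_ac)
  show "(\<lambda>p. real b * p$1 ^ a * p$2 ^ (b - 1) * p$3 ^ e) \<in> Qpoly l (m - 1) n"
    using Qpoly_cmult[OF Qpoly_monom[of a l "b - 1" "m - 1" e n], of "real b"] assms
    by (cases b) (auto simp: Qpoly_zero mult_ac)
  show "(\<lambda>p. real e * p$1 ^ a * p$2 ^ b * p$3 ^ (e - 1)) \<in> Qpoly l m (n - 1)"
    using Qpoly_cmult[OF Qpoly_monom[of a l b m "e - 1" "n - 1"], of "real e"] assms
    by (cases e) (auto simp: Qpoly_zero mult_ac)
qed

lemma Qpoly_D:
  assumes "f \<in> Qpoly l m n"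
  shows "D1 f \<in> Qpoly (l - 1) m n \<and> D2 f \<in> Qpoly l (m - 1) n \<and> D3 f \<in> Qpoly l m (n - 1) \<and>
    (\<forall>p. GDERIV f p :> vector [D1 f p, D2 f p, D3 f p])"
  using assms
proof (induction rule: Qpoly_induct)
  case zero
  have *: "D1 (\<lambda>_. 0) = (\<lambda>_. 0)" "D2 (\<lambda>_. 0) = (\<lambda>_. 0)" "D3 (\<lambda>_. 0) = (\<lambda>_. 0)"
    by (auto simp: fun_eq_iff GDERIV_D[OF GDERIV_const])
  have "(vector [0, 0, 0] :: pt) = 0" by (simp add: pt_eq_iff)
  with * show ?case by (simp add: Qpoly_zero GDERIV_const)
next
  case (step c a b e g)
  have G: "GDERIV (\<lambda>p. c * (p$1 ^ a * p$2 ^ b * p$3 ^ e) + g p) p :>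
     vector [c * (real a * p$1 ^ (a - 1) * p$2 ^ b * p$3 ^ e) + D1 g p,
       c * (real b * p$1 ^ a * p$2 ^ (b - 1) * p$3 ^ e) + D2 g p,
       c * (real e * p$1 ^ a * p$2 ^ b * p$3 ^ (e - 1)) + D3 g p]" for p
    by (rule GDERIV_subst, rule GDERIV_add[OF GDERIV_mult[OF GDERIV_const GDERIV_monom]])
      (use step in \<open>auto simp: pt_eq_iff\<close>)
  note D = GDERIV_D[OF G]
  have *: "D1 (\<lambda>p. c * (p$1 ^ a * p$2 ^ b * p$3 ^ e) + g p) =
      (\<lambda>p. c * (real a * p$1 ^ (a - 1) * p$2 ^ b * p$3 ^ e) + D1 g p)"
    "D2 (\<lambda>p. c * (p$1 ^ a * p$2 ^ b * p$3 ^ e) + g p) =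
      (\<lambda>p. c * (real b * p$1 ^ a * p$2 ^ (b - 1) * p$3 ^ e) + D2 g p)"
    "D3 (\<lambda>p. c * (p$1 ^ a * p$2 ^ b * p$3 ^ e) + g p) =
      (\<lambda>p. c * (real e * p$1 ^ a * p$2 ^ b * p$3 ^ (e - 1)) + D3 g p)"
    using D by (auto simp: fun_eq_iff)
  show ?case
    unfolding * using G step
    by (intro conjI Qpoly_add[OF Qpoly_cmult] Qpoly_monom_D allI) auto
qed

lemmas Qpoly_D1 = Qpoly_D[THEN conjunct1]
  and Qpoly_D2 = Qpoly_D[THEN conjunct2, THEN conjunct1]
  and Qpoly_D3 = Qpoly_D[THEN conjunct2, THEN conjunct2, THEN conjunct1]
  and Qpoly_GDERIV = Qpoly_D[THEN conjunct2, THEN conjunct2, THEN conjunct2, rule_format]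

lemma D_linear:
  assumes "\<And>p. GDERIV f p :> F p" "\<And>p. GDERIV g p :> G p"
  shows "D1 (\<lambda>p. c * f p + g p) = (\<lambda>p. c * D1 f p + D1 g p)"
    "D2 (\<lambda>p. c * f p + g p) = (\<lambda>p. c * D2 f p + D2 g p)"
    "D3 (\<lambda>p. c * f p + g p) = (\<lambda>p. c * D3 f p + D3 g p)"
proof -
  have "GDERIV (\<lambda>p. c * f p + g p) p :> c *\<^sub>R F p + f p *\<^sub>R 0 + G p" for p
    by (intro GDERIV_add GDERIV_mult GDERIV_const assms)
  note GDERIV_D[OF this] GDERIV_D[OF assms(1)] GDERIV_D[OF assms(2)]
  then show "D1 (\<lambda>p. c * f p + g p) = (\<lambda>p. c * D1 f p + D1 g p)"
    "D2 (\<lambda>p. c * f p + g p) = (\<lambda>p. c * D2 f p + D2 g p)"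
    "D3 (\<lambda>p. c * f p + g p) = (\<lambda>p. c * D3 f p + D3 g p)"
    by (auto simp: fun_eq_iff)
qed

text \<open>For monomials this is read off from the explicit derivatives; linearity carries it to
  sums.\<close>

lemma Qpoly_D_commute:
  assumes "f \<in> Qpoly l m n"
  shows "D1 (D2 f) = D2 (D1 f) \<and> D1 (D3 f) = D3 (D1 f) \<and> D2 (D3 f) = D3 (D2 f)"
  using assms
proof (induction rule: Qpoly_induct)
  case zero
  have *: "D1 (\<lambda>_. 0) = (\<lambda>_. 0)" "D2 (\<lambda>_. 0) = (\<lambda>_. 0)" "D3 (\<lambda>_. 0) = (\<lambda>_. 0)"
    by (auto simp: fun_eq_iff GDERIV_D[OF GDERIV_const])
  then show ?case by simp
next
  case (step c a b e g)
  define f where "f = (\<lambda>p::pt. p$1 ^ a * p$2 ^ b * p$3 ^ e)"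
  have f: "f \<in> Qpoly l m n" unfolding f_def using step by (intro Qpoly_monom)
  have Df: "D1 f = (\<lambda>p. real a * (p$1 ^ (a - 1) * p$2 ^ b * p$3 ^ e) + 0)"
    "D2 f = (\<lambda>p. real b * (p$1 ^ a * p$2 ^ (b - 1) * p$3 ^ e) + 0)"
    "D3 f = (\<lambda>p. real e * (p$1 ^ a * p$2 ^ b * p$3 ^ (e - 1)) + 0)"
    unfolding f_def by (auto simp: fun_eq_iff GDERIV_D[OF GDERIV_monom])
  have c: "D1 (D2 f) = D2 (D1 f)" "D1 (D3 f) = D3 (D1 f)" "D2 (D3 f) = D3 (D2 f)"
    unfolding Df D_linear[OF GDERIV_monom GDERIV_const]
    by (simp_all add: fun_eq_iff GDERIV_D[OF GDERIV_monom] GDERIV_D[OF GDERIV_const])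
  note g = \<open>g \<in> Qpoly l m n\<close>
  have lin: "D1 (\<lambda>p. c * u p + v p) = (\<lambda>p. c * D1 u p + D1 v p)"
    "D2 (\<lambda>p. c * u p + v p) = (\<lambda>p. c * D2 u p + D2 v p)"
    "D3 (\<lambda>p. c * u p + v p) = (\<lambda>p. c * D3 u p + D3 v p)"
    if "u \<in> Qpoly i j q" "v \<in> Qpoly i j q" for u v i j q
    by (rule D_linear; rule Qpoly_GDERIV, fact)+
  have "D1 (D2 (\<lambda>p. c * f p + g p)) = D2 (D1 (\<lambda>p. c * f p + g p)) \<and>
    D1 (D3 (\<lambda>p. c * f p + g p)) = D3 (D1 (\<lambda>p. c * f p + g p)) \<and>
    D2 (D3 (\<lambda>p. c * f p + g p)) = D3 (D2 (\<lambda>p. c * f p + g p))"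
    using f g c step.IH
    by (simp add: lin[OF f g] lin[OF Qpoly_D1[OF f] Qpoly_D1[OF g]]
        lin[OF Qpoly_D2[OF f] Qpoly_D2[OF g]] lin[OF Qpoly_D3[OF f] Qpoly_D3[OF g]])
  then show ?case by (simp add: f_def)
qed

section \<open>Polynomials in two variables\<close>

lemma Qpoly2_induct [consumes 1, case_names zero step]:
  assumes "f \<in> Qpoly2 l m" and "P (\<lambda>_ _. 0)"
    and "\<And>c a b g. int a \<le> l \<Longrightarrow> int b \<le> m \<Longrightarrow> g \<in> Qpoly2 l m \<Longrightarrow> P g \<Longrightarrow>
      P (\<lambda>x y. c * (x ^ a * y ^ b) + g x y)"
  shows "P f"
proof -
  have "f \<in> Qpoly2 l m \<and> P f"
    using assms(1)[unfolded Qpoly2_def]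
  proof (induction rule: span_induct_alt)
    case base
    have "0 \<in> Qpoly2 l m" unfolding Qpoly2_def by (rule span_zero)
    then show ?case using assms(2) by (simp add: zero_fun_def)
  next
    case (step c x y)
    then obtain a b where x: "x = (\<lambda>x y. x ^ a * y ^ b)"
      and le: "int a \<le> l" "int b \<le> m" by blast
    have "c *\<^sub>R x + y = (\<lambda>w z. c * (w ^ a * z ^ b) + y w z)"
      by (simp add: x scaleR_fun_def plus_fun_def)
    moreover have "c *\<^sub>R x + y \<in> Qpoly2 l m"
      using step unfolding Qpoly2_def by (intro span_add[OF span_scale[OF span_base]]) auto
    ultimately show ?case using assms(3)[OF le, of y c] step by auto
  qed
  then show ?thesis ..
qed

lemma Qpoly2_monom: "int a \<le> l \<Longrightarrow> int b \<le> m \<Longrightarrow> (\<lambda>x y. x ^ a * y ^ b) \<in> Qpoly2 l m"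
  unfolding Qpoly2_def by (rule span_base) blast

lemma Qpoly2_add: "f \<in> Qpoly2 l m \<Longrightarrow> g \<in> Qpoly2 l m \<Longrightarrow> (\<lambda>x y. f x y + g x y) \<in> Qpoly2 l m"
  unfolding Qpoly2_def using span_add[of f _ g] by (simp add: plus_fun_def)

lemma Qpoly2_zero: "(\<lambda>_ _. 0) \<in> Qpoly2 l m"
proof -
  have "0 \<in> Qpoly2 l m" unfolding Qpoly2_def by (rule span_zero)
  then show ?thesis by (simp add: zero_fun_def)
qed

lemma Qpoly2_cmult: "f \<in> Qpoly2 l m \<Longrightarrow> (\<lambda>x y. c * f x y) \<in> Qpoly2 l m"
  unfolding Qpoly2_def using span_scale[of f _ c] by (simp add: scaleR_fun_def)

text \<open>\<open>Qpoly2 l m\<close> and \<open>Qpoly l m 0\<close> present one space; the form in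
  three variables gives access to the derivatives and to the identity theorem above.\<close>

lemma Qpoly2_Qpoly: "r \<in> Qpoly2 l m \<Longrightarrow> (\<lambda>p. r (p$1) (p$2)) \<in> Qpoly l m 0"
proof (induction rule: Qpoly2_induct)
  case (step c a b g)
  have "(\<lambda>p. c * (p$1 ^ a * p$2 ^ b * p$3 ^ 0) + g (p$1) (p$2)) \<in> Qpoly l m 0"
    using step by (intro Qpoly_add[OF Qpoly_cmult[OF Qpoly_monom]]) auto
  then show ?case by simp
qed (simp add: Qpoly_zero)

lemma Qpoly_Qpoly2: "R \<in> Qpoly l m n \<Longrightarrow> (\<lambda>x y. R (vector [x, y, 0])) \<in> Qpoly2 l m"
proof (induction rule: Qpoly_induct)
  case (step c a b e g)
  have "(\<lambda>x y. (c * 0 ^ e) * (x ^ a * y ^ b) + g (vector [x, y, 0])) \<in> Qpoly2 l m"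
    using step by (intro Qpoly2_add[OF Qpoly2_cmult[OF Qpoly2_monom]]) auto
  then show ?case by (simp add: mult_ac)
qed (simp add: Qpoly2_zero)

lemma Qpoly_no_z: "R \<in> Qpoly l m 0 \<Longrightarrow> R p = R (vector [p$1, p$2, 0])"
  by (induction rule: Qpoly_induct) auto

lemma Ppoly2_induct [consumes 1, case_names zero step]:
  assumes "f \<in> Ppoly2 n" and "P (\<lambda>_ _. 0)"
    and "\<And>c a b g. int (a + b) \<le> n \<Longrightarrow> g \<in> Ppoly2 n \<Longrightarrow> P g \<Longrightarrow>
      P (\<lambda>x y. c * (x ^ a * y ^ b) + g x y)"
  shows "P f"
proof -
  have "f \<in> Ppoly2 n \<and> P f"
    using assms(1)[unfolded Ppoly2_def]
  proof (induction rule: span_induct_alt)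
    case base
    have "0 \<in> Ppoly2 n" unfolding Ppoly2_def by (rule span_zero)
    then show ?case using assms(2) by (simp add: zero_fun_def)
  next
    case (step c x y)
    then obtain a b where x: "x = (\<lambda>x y. x ^ a * y ^ b)" and le: "int (a + b) \<le> n" by blast
    have "c *\<^sub>R x + y = (\<lambda>w z. c * (w ^ a * z ^ b) + y w z)"
      by (simp add: x scaleR_fun_def plus_fun_def)
    moreover have "c *\<^sub>R x + y \<in> Ppoly2 n"
      using step unfolding Ppoly2_def by (intro span_add[OF span_scale[OF span_base]]) auto
    ultimately show ?case using assms(3)[OF le, of y c] step by auto
  qed
  then show ?thesis ..
qed

lemma Ppoly2_monom: "int (a + b) \<le> n \<Longrightarrow> (\<lambda>x y. x ^ a * y ^ b) \<in> Ppoly2 n"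
  unfolding Ppoly2_def by (rule span_base) blast

lemma Ppoly2_add: "f \<in> Ppoly2 n \<Longrightarrow> g \<in> Ppoly2 n \<Longrightarrow> (\<lambda>x y. f x y + g x y) \<in> Ppoly2 n"
  unfolding Ppoly2_def using span_add[of f _ g] by (simp add: plus_fun_def)

lemma Ppoly2_zero: "(\<lambda>_ _. 0) \<in> Ppoly2 n"
proof -
  have "0 \<in> Ppoly2 n" unfolding Ppoly2_def by (rule span_zero)
  then show ?thesis by (simp add: zero_fun_def)
qed

lemma Ppoly2_cmult: "f \<in> Ppoly2 n \<Longrightarrow> (\<lambda>x y. c * f x y) \<in> Ppoly2 n"
  unfolding Ppoly2_def using span_scale[of f _ c] by (simp add: scaleR_fun_def)

lemma Ppoly2_diff: "f \<in> Ppoly2 n \<Longrightarrow> g \<in> Ppoly2 n \<Longrightarrow> (\<lambda>x y. f x y - g x y) \<in> Ppoly2 n"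
  using Ppoly2_add[of f n "\<lambda>x y. (-1) * g x y"] Ppoly2_cmult[of g n "-1"] by simp

lemma Ppoly2_mono:
  assumes "f \<in> Ppoly2 n" "n \<le> n'"
  shows "f \<in> Ppoly2 n'"
proof -
  have "Ppoly2 n \<subseteq> Ppoly2 n'"
    unfolding Ppoly2_def by (rule span_mono) (use assms(2) in fastforce)
  then show ?thesis using assms(1) by blast
qed

lemma Ppoly2_sum: "(\<And>i. i \<in> I \<Longrightarrow> f i \<in> Ppoly2 n) \<Longrightarrow> (\<lambda>x y. \<Sum>i\<in>I. f i x y) \<in> Ppoly2 n"
  by (induction I rule: infinite_finite_induct) (auto intro: Ppoly2_add simp: Ppoly2_zero)

lemma Ppoly2_mult:
  assumes "f \<in> Ppoly2 n" "g \<in> Ppoly2 n'" "n + n' \<le> N"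
  shows "(\<lambda>x y. f x y * g x y) \<in> Ppoly2 N"
  using assms(1)
proof (induction rule: Ppoly2_induct)
  case zero
  then show ?case by (simp add: Ppoly2_zero)
next
  case (step c a b h)
  have "(\<lambda>x y. (x ^ a * y ^ b) * g x y) \<in> Ppoly2 N"
    using assms(2)
  proof (induction rule: Ppoly2_induct)
    case zero
    then show ?case by (simp add: Ppoly2_zero)
  next
    case (step c' a' b' h')
    have "(\<lambda>x y. x ^ (a + a') * y ^ (b + b')) \<in> Ppoly2 N"
      using assms step \<open>int (a + b) \<le> n\<close> by (intro Ppoly2_monom) auto
    from Ppoly2_add[OF Ppoly2_cmult[OF this, of c'] step.IH]
    show ?case by (simp add: power_add algebra_simps)
  qed
  from Ppoly2_add[OF Ppoly2_cmult[OF this, of c] step.IH]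
  show ?case by (simp add: algebra_simps)
qed

lemma Ppoly2_coord: "(\<lambda>x y. x) \<in> Ppoly2 1" "(\<lambda>x y. y) \<in> Ppoly2 1"
  using Ppoly2_monom[of 1 0 1] Ppoly2_monom[of 0 1 1] by auto

lemma Ppoly2_const: "(\<lambda>x y. c) \<in> Ppoly2 0"
  using Ppoly2_cmult[OF Ppoly2_monom[of 0 0 0], of c] by simp

lemma Ppoly2_affine: "(\<lambda>x y. a + b * x + c * y) \<in> Ppoly2 1"
  by (intro Ppoly2_add Ppoly2_cmult Ppoly2_coord Ppoly2_mono[OF Ppoly2_const]) simp

lemma Ppoly2_power: "f \<in> Ppoly2 1 \<Longrightarrow> (\<lambda>x y. f x y ^ j) \<in> Ppoly2 (int j)"
  by (induction j) (auto simp: Ppoly2_const intro: Ppoly2_mult)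

lemma Ppoly2_neg: "f \<in> Ppoly2 n \<Longrightarrow> n < 0 \<Longrightarrow> f = (\<lambda>_ _. 0)"
  by (induction rule: Ppoly2_induct) auto

lemma Ppoly2_div1:
  assumes "f \<in> Ppoly2 n"
  shows "\<exists>g \<in> Ppoly2 (n - 1). \<forall>x y. f x y = f s y + (x - s) * g x y"
  using assms
proof (induction rule: Ppoly2_induct)
  case zero
  then show ?case by (intro bexI[of _ "\<lambda>_ _. 0"]) (auto simp: Ppoly2_zero)
next
  case (step c a b h)
  then obtain g where g: "g \<in> Ppoly2 (n - 1)" "\<forall>x y. h x y = h s y + (x - s) * g x y" by blast
  define d :: "real \<Rightarrow> real \<Rightarrow> real" where
    "d = (\<lambda>x y. \<Sum>i<a. s ^ (a - Suc i) * (x ^ i * y ^ b))"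
  have d: "d \<in> Ppoly2 (n - 1)"
    unfolding d_def by (intro Ppoly2_sum Ppoly2_cmult Ppoly2_monom) (use step in auto)
  have m: "x ^ a * y ^ b = s ^ a * y ^ b + (x - s) * d x y" for x y
  proof -
    have "(x - s) * d x y = ((x - s) * (\<Sum>i<a. s ^ (a - Suc i) * x ^ i)) * y ^ b"
      unfolding d_def by (simp add: sum_distrib_right sum_distrib_left mult_ac)
    also have "\<dots> = (x ^ a - s ^ a) * y ^ b"
      by (simp only: power_diff_sumr2)
    finally show ?thesis by (simp add: algebra_simps)
  qed
  have *: "c * (x ^ a * y ^ b) + h x y = c * (s ^ a * y ^ b) + h s y + (x - s) * (c * d x y + g x y)" for x y
    by (subst m, subst g(2)[rule_format]) (simp add: algebra_simps)
  show ?case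
    by (intro bexI[OF _ Ppoly2_add[OF Ppoly2_cmult[OF d, of c] g(1)]] allI) (rule *)
qed

lemma Ppoly2_swap: "f \<in> Ppoly2 n \<Longrightarrow> (\<lambda>x y. f y x) \<in> Ppoly2 n"
proof (induction rule: Ppoly2_induct)
  case (step c a b g)
  from step Ppoly2_add[OF Ppoly2_cmult[OF Ppoly2_monom[of b a n], of c] step.IH]
  show ?case by (simp add: mult_ac add.commute)
qed (simp add: Ppoly2_zero)

lemma Ppoly2_div2:
  assumes "f \<in> Ppoly2 n"
  shows "\<exists>g \<in> Ppoly2 (n - 1). \<forall>x y. f x y = f x s + (y - s) * g x y"
proof -
  obtain g where g: "g \<in> Ppoly2 (n - 1)" "\<forall>x y. f y x = f y s + (x - s) * g x y"
    by (rule bexE[OF Ppoly2_div1[OF Ppoly2_swap[OF assms], of s]])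
  show ?thesis
    by (intro bexI[OF _ Ppoly2_swap[OF g(1)]] allI) (rule g(2)[rule_format])
qed

lemma Ppoly2_Qpoly: "f \<in> Ppoly2 n \<Longrightarrow> (\<lambda>p. f (p$1) (p$3)) \<in> Qpoly n 0 n"
proof (induction rule: Ppoly2_induct)
  case (step c a b g)
  have "(\<lambda>p. c * (p$1 ^ a * p$2 ^ 0 * p$3 ^ b) + g (p$1) (p$3)) \<in> Qpoly n 0 n"
    using step by (intro Qpoly_add[OF Qpoly_cmult[OF Qpoly_monom]]) auto
  then show ?case by simp
qed (simp add: Qpoly_zero)

lemma Ppoly2_eq_zero:
  assumes f: "f \<in> Ppoly2 n" and S: "open S" "(a, b) \<in> S" "\<And>x y. (x, y) \<in> S \<Longrightarrow> f x y = 0"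
  shows "f x y = 0"
proof -
  have "open ((\<lambda>p::pt. (p$1, p$3)) -` S)"
    by (rule open_vimage[OF S(1)]) (intro continuous_intros)
  moreover have "vector [a, 0, b] \<in> (\<lambda>p::pt. (p$1, p$3)) -` S" using S(2) by simp
  ultimately have "(\<lambda>p::pt. f (p$1) (p$3)) (vector [x, 0, y]) = 0"
    by (rule Qpoly_eq_zero[OF Ppoly2_Qpoly[OF f]]) (use S(3) in auto)
  then show ?thesis by simp
qed

text \<open>Homogenisation: the change of variables \<open>\<sigma> = (w, z) / (1 + z)\<close> preserves the total degree.\<close>

lemma Ppoly2_hom:
  assumes "D \<in> Ppoly2 (int k - 2)"
  shows "\<exists>d \<in> Ppoly2 (int k - 2). \<forall>w z. z \<noteq> -1 \<longrightarrow> D w z = (1 + z) ^ (k - 2) * d (w / (1 + z)) (z / (1 + z))"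
  using assms
proof (induction rule: Ppoly2_induct)
  case zero
  then show ?case by (intro bexI[of _ "\<lambda>_ _. 0"]) (auto simp: Ppoly2_zero)
next
  case (step c a b g)
  then obtain d where d: "d \<in> Ppoly2 (int k - 2)"
    "\<forall>w z. z \<noteq> -1 \<longrightarrow> g w z = (1 + z) ^ (k - 2) * d (w / (1 + z)) (z / (1 + z))" by blast
  \<comment> \<open>With \<open>s = w / (1 + z)\<close> and \<open>t = z / (1 + z)\<close> one has
    \<open>1 - t = 1 / (1 + z)\<close>; the extra factor raises the denominator of
    \<open>s^a t^b\<close> to exactly \<open>(1 + z)^(k - 2)\<close>. The truncated subtraction is
    exact, since the step only arises for \<open>a + b \<le> k - 2\<close>.\<close>
  define h where "h = (\<lambda>s t::real. (s ^ a * t ^ b) * (1 + 0 * s + (-1) * t) ^ (k - 2 - a - b))"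
  have h: "h \<in> Ppoly2 (int k - 2)"
    unfolding h_def by (rule Ppoly2_mult[OF Ppoly2_monom[OF order_refl] Ppoly2_power[OF Ppoly2_affine]]) (use step in auto)
  have m: "w ^ a * z ^ b = (1 + z) ^ (k - 2) * h (w / (1 + z)) (z / (1 + z))" if "z \<noteq> -1" for w z
  proof -
    have nz: "1 + z \<noteq> 0" using that by linarith
    have "k - 2 = a + b + (k - 2 - a - b)" using step by linarith
    then have "(1 + z) ^ (k - 2) = (1 + z) ^ a * (1 + z) ^ b * (1 + z) ^ (k - 2 - a - b)"
      by (metis power_add)
    moreover have "1 - z / (1 + z) = 1 / (1 + z)" using nz by (simp add: field_simps)
    ultimately show ?thesis using nz by (simp add: h_def power_divide)
  qed
  have "c * (w ^ a * z ^ b) + g w z =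
      (1 + z) ^ (k - 2) * (c * h (w / (1 + z)) (z / (1 + z)) + d (w / (1 + z)) (z / (1 + z)))"
    if "z \<noteq> -1" for w z
    unfolding m[OF that] d(2)[rule_format, OF that] by (simp only: distrib_left mult.left_commute)
  then show ?case
    by (intro bexI[OF _ Ppoly2_add[OF Ppoly2_cmult[OF h, of c] d(1)]]) blast
qed

lemma Ppoly2_dehom:
  assumes "d \<in> Ppoly2 (int k - 2)"
  shows "\<exists>D \<in> Ppoly2 (int k - 2). \<forall>w z. z \<noteq> -1 \<longrightarrow> D w z = (1 + z) ^ (k - 2) * d (w / (1 + z)) (z / (1 + z))"
  using assms
proof (induction rule: Ppoly2_induct)
  case zero
  then show ?case by (intro bexI[of _ "\<lambda>_ _. 0"]) (auto simp: Ppoly2_zero)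
next
  case (step c a b g)
  then obtain D where D: "D \<in> Ppoly2 (int k - 2)"
    "\<forall>w z. z \<noteq> -1 \<longrightarrow> D w z = (1 + z) ^ (k - 2) * g (w / (1 + z)) (z / (1 + z))" by blast
  \<comment> \<open>The inverse substitution: powers of \<open>1 + z\<close> lift each monomial to
    the common degree \<open>k - 2\<close>.\<close>
  define h where "h = (\<lambda>s t::real. (s ^ a * t ^ b) * (1 + 0 * s + 1 * t) ^ (k - 2 - a - b))"
  have h: "h \<in> Ppoly2 (int k - 2)"
    unfolding h_def by (rule Ppoly2_mult[OF Ppoly2_monom[OF order_refl] Ppoly2_power[OF Ppoly2_affine]]) (use step in auto)
  have m: "h w z = (1 + z) ^ (k - 2) * ((w / (1 + z)) ^ a * (z / (1 + z)) ^ b)" if "z \<noteq> -1" for w z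
  proof -
    have nz: "1 + z \<noteq> 0" using that by linarith
    have "k - 2 = a + b + (k - 2 - a - b)" using step by linarith
    then have "(1 + z) ^ (k - 2) = (1 + z) ^ a * (1 + z) ^ b * (1 + z) ^ (k - 2 - a - b)"
      by (metis power_add)
    then show ?thesis using nz by (simp add: h_def power_divide)
  qed
  have "c * h w z + D w z = (1 + z) ^ (k - 2) *
      (c * ((w / (1 + z)) ^ a * (z / (1 + z)) ^ b) + g (w / (1 + z)) (z / (1 + z)))"
    if "z \<noteq> -1" for w z
    unfolding m[OF that] D(2)[rule_format, OF that] by (simp only: distrib_left mult.left_commute)
  then show ?case
    by (intro bexI[OF _ Ppoly2_add[OF Ppoly2_cmult[OF h, of c] D(1)]]) blast
qed

lemma Ptilde_num:
  assumes "u \<in> span {\<lambda>w z. w ^ a * (1 + z) ^ (k - 1 - a) | a. a \<le> k - 1}" "k \<ge> 1"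
  shows "u \<in> Ppoly2 (int k - 1)"
proof -
  have "{\<lambda>w z. w ^ a * (1 + z) ^ (k - 1 - a) | a. a \<le> k - 1} \<subseteq> Ppoly2 (int k - 1)"
  proof clarify
    fix a assume "a \<le> k - 1"
    then have "(\<lambda>w z::real. (w ^ a * z ^ 0) * (1 + 0 * w + 1 * z) ^ (k - 1 - a)) \<in> Ppoly2 (int k - 1)"
      using assms(2) by (intro Ppoly2_mult[OF Ppoly2_monom[OF order_refl] Ppoly2_power[OF Ppoly2_affine]]) auto
    then show "(\<lambda>w z. w ^ a * (1 + z) ^ (k - 1 - a)) \<in> Ppoly2 (int k - 1)" by simp
  qed
  then have "span {\<lambda>w z. w ^ a * (1 + z) ^ (k - 1 - a) | a. a \<le> k - 1} \<subseteq> Ppoly2 (int k - 1)"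
    unfolding Ppoly2_def by (rule span_minimal) (rule subspace_span)
  then show ?thesis using assms(1) by blast
qed

text \<open>Vanishing on the two vertical edges makes the second component divisible by
  \<open>w (1 - w)\<close>, with cofactor \<open>D3\<close>. This also determines
  \<open>S = B' - (1 - w) D3\<close>: its degree \<open>k - 1\<close> exceeds that of the cofactors,
  but the excess is just \<open>w D3\<close>. Substituted into the first component, after the base
  edge has given \<open>A + S = z C\<close>, it leaves \<open>z (D2 + w D3)\<close>.\<close>

lemma bubble_trace:
  assumes A: "A \<in> Ppoly2 (int k - 1)" and B: "B \<in> Ppoly2 (int k - 1)" and S: "S \<in> Ppoly2 (int k - 1)"
    and z0: "\<And>w. w \<in> {0..1} \<Longrightarrow> A w 0 + S w 0 = 0"
    and w0: "\<And>z. z \<ge> 0 \<Longrightarrow> B 0 z = 0"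
    and w1: "\<And>z. z \<ge> 0 \<Longrightarrow> B 1 z - S 1 z = 0"
  shows "\<exists>D2 \<in> Ppoly2 (int k - 2). \<exists>D3 \<in> Ppoly2 (int k - 2). \<forall>w\<in>{0..1}. \<forall>z\<ge>0.
    A w z + S w z * (1 + z) = z * (D2 w z + w * D3 w z) \<and> B w z - S w z * w = w * (1 - w) * D3 w z"
proof -
  have k: "int k - 1 - 1 = int k - 2" by simp
  obtain B' where B': "B' \<in> Ppoly2 (int k - 2)" "\<forall>w z. B w z = B 0 z + (w - 0) * B' w z"
    by (rule bexE[OF Ppoly2_div1[OF B, of 0, unfolded k]])
  have BS: "(\<lambda>w z. B' w z - S w z) \<in> Ppoly2 (int k - 1)"
    by (intro Ppoly2_diff S Ppoly2_mono[OF B'(1)]) simp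
  obtain G where G: "G \<in> Ppoly2 (int k - 2)"
    "\<forall>w z. B' w z - S w z = B' 1 z - S 1 z + (w - 1) * G w z"
    by (rule bexE[OF Ppoly2_div1[OF BS, of 1, unfolded k]])
  obtain C where C: "C \<in> Ppoly2 (int k - 2)"
    "\<forall>w z. A w z + S w z = A w 0 + S w 0 + (z - 0) * C w z"
    by (rule bexE[OF Ppoly2_div2[OF Ppoly2_add[OF A S], of 0, unfolded k]])
  define D3 where "D3 = (\<lambda>w z. (-1) * G w z)"
  define D2 where "D2 = (\<lambda>w z. C w z + B' w z - D3 w z)"
  have D3: "D3 \<in> Ppoly2 (int k - 2)" unfolding D3_def by (intro Ppoly2_cmult G)
  have D2: "D2 \<in> Ppoly2 (int k - 2)" unfolding D2_def by (intro Ppoly2_diff Ppoly2_add C B' D3)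
  have "A w z + S w z * (1 + z) = z * (D2 w z + w * D3 w z) \<and> B w z - S w z * w = w * (1 - w) * D3 w z"
    if w: "w \<in> {0..1}" and z: "z \<ge> 0" for w z
  proof -
    have 1: "B w z = w * B' w z" using B'(2)[rule_format, of w z] w0[OF z] by simp
    have "B' 1 z - S 1 z = 0" using B'(2)[rule_format, of 1 z] w0[OF z] w1[OF z] by simp
    then have 2: "S w z = B' w z - (1 - w) * D3 w z"
      using G(2)[rule_format, of w z] by (simp add: D3_def algebra_simps)
    have 3: "A w z = z * C w z - S w z" using C(2)[rule_format, of w z] z0[OF w] by simp
    show ?thesis unfolding 3 1 unfolding 2 D2_def by (simp add: algebra_simps)
  qed
  then show ?thesis using D2 D3 by blast
qed

section \<open>Polynomials in one variable and their use on vertical edges\<close>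

definition Poly1 :: "int \<Rightarrow> (real \<Rightarrow> real) set"
  where "Poly1 n = span {\<lambda>s. s ^ a | a. int a \<le> n}"

lemma Poly1_induct [consumes 1, case_names zero step]:
  assumes "f \<in> Poly1 n" and "P (\<lambda>_. 0)"
    and "\<And>c a g. int a \<le> n \<Longrightarrow> g \<in> Poly1 n \<Longrightarrow> P g \<Longrightarrow> P (\<lambda>s. c * s ^ a + g s)"
  shows "P f"
proof -
  have "f \<in> Poly1 n \<and> P f"
    using assms(1)[unfolded Poly1_def]
  proof (induction rule: span_induct_alt)
    case base
    have "0 \<in> Poly1 n" unfolding Poly1_def by (rule span_zero)
    then show ?case using assms(2) by (simp add: zero_fun_def)
  next
    case (step c x y)
    then obtain a where x: "x = (\<lambda>s. s ^ a)" and le: "int a \<le> n" by blast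
    have "c *\<^sub>R x + y = (\<lambda>s. c * s ^ a + y s)"
      by (simp add: x scaleR_fun_def plus_fun_def)
    moreover have "c *\<^sub>R x + y \<in> Poly1 n"
      using step unfolding Poly1_def by (intro span_add[OF span_scale[OF span_base]]) auto
    ultimately show ?case using assms(3)[OF le, of y c] step by auto
  qed
  then show ?thesis ..
qed

lemma Poly1_monom: "int a \<le> n \<Longrightarrow> (\<lambda>s. s ^ a) \<in> Poly1 n"
  unfolding Poly1_def by (rule span_base) blast

lemma Poly1_add: "f \<in> Poly1 n \<Longrightarrow> g \<in> Poly1 n \<Longrightarrow> (\<lambda>s. f s + g s) \<in> Poly1 n"
  unfolding Poly1_def using span_add[of f _ g] by (simp add: plus_fun_def)

lemma Poly1_zero: "(\<lambda>_. 0) \<in> Poly1 n"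
proof -
  have "0 \<in> Poly1 n" unfolding Poly1_def by (rule span_zero)
  then show ?thesis by (simp add: zero_fun_def)
qed

lemma Poly1_cmult: "f \<in> Poly1 n \<Longrightarrow> (\<lambda>s. c * f s) \<in> Poly1 n"
  unfolding Poly1_def using span_scale[of f _ c] by (simp add: scaleR_fun_def)

lemma Poly1_Qpoly1: "f \<in> Poly1 n \<Longrightarrow> (\<lambda>p. f (p$1)) \<in> Qpoly n 0 0"
proof (induction rule: Poly1_induct)
  case (step c a g)
  have "(\<lambda>p. c * (p$1 ^ a * p$2 ^ 0 * p$3 ^ 0) + g (p$1)) \<in> Qpoly n 0 0"
    using step by (intro Qpoly_add[OF Qpoly_cmult[OF Qpoly_monom]]) auto
  then show ?case by simp
qed (simp add: Qpoly_zero)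

lemma Poly1_Qpoly3: "f \<in> Poly1 n \<Longrightarrow> (\<lambda>p. f (p$3)) \<in> Qpoly 0 0 n"
proof (induction rule: Poly1_induct)
  case (step c a g)
  have "(\<lambda>p. c * (p$1 ^ 0 * p$2 ^ 0 * p$3 ^ a) + g (p$3)) \<in> Qpoly 0 0 n"
    using step by (intro Qpoly_add[OF Qpoly_cmult[OF Qpoly_monom]]) auto
  then show ?case by simp
qed (simp add: Qpoly_zero)

lemma Poly1_Ppoly2: "f \<in> Poly1 n \<Longrightarrow> (\<lambda>w z. f z) \<in> Ppoly2 n" "f \<in> Poly1 n \<Longrightarrow> (\<lambda>w z. f w) \<in> Ppoly2 n"
proof -
  show *: "(\<lambda>w z. f z) \<in> Ppoly2 n" if "f \<in> Poly1 n"
    using that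
  proof (induction rule: Poly1_induct)
    case (step c a g)
    have "(\<lambda>w z::real. c * (w ^ 0 * z ^ a) + g z) \<in> Ppoly2 n"
      using step by (intro Ppoly2_add[OF Ppoly2_cmult[OF Ppoly2_monom]]) auto
    then show ?case by simp
  qed (simp add: Ppoly2_zero)
  show "(\<lambda>w z. f w) \<in> Ppoly2 n" if "f \<in> Poly1 n"
    using Ppoly2_swap[OF *[OF that]] .
qed

lemma Ppoly2_Poly1: "f \<in> Ppoly2 n \<Longrightarrow> (\<lambda>s. f s c) \<in> Poly1 n"
proof (induction rule: Ppoly2_induct)
  case (step d a b g)
  have "(\<lambda>s. (d * c ^ b) * s ^ a + g s c) \<in> Poly1 n"
    using step by (intro Poly1_add[OF Poly1_cmult[OF Poly1_monom]]) auto
  then show ?case by (simp add: mult_ac)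
qed (simp add: Poly1_zero)

lemma Poly1_top:
  assumes "f \<in> Poly1 (int j)"
  shows "\<exists>g \<in> Poly1 (int j - 1). \<exists>c. \<forall>s. f s = g s + c * s ^ j"
  using assms
proof (induction rule: Poly1_induct)
  case zero
  then show ?case by (intro bexI[of _ "\<lambda>_. 0"] exI[of _ 0]) (auto simp: Poly1_zero)
next
  case (step c a F)
  then obtain g d where g: "g \<in> Poly1 (int j - 1)" "\<forall>s. F s = g s + d * s ^ j" by blast
  show ?case
  proof (cases "a = j")
    case True
    then show ?thesis using g by (intro bexI[OF _ g(1)] exI[of _ "c + d"]) (auto simp: algebra_simps)
  next
    case False
    have "(\<lambda>s. c * s ^ a + g s) \<in> Poly1 (int j - 1)"
      by (rule Poly1_add[OF Poly1_cmult[OF Poly1_monom] g(1)]) (use step False in auto)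
    then show ?thesis using g(2) by (intro bexI[of _ "\<lambda>s. c * s ^ a + g s"] exI[of _ d]) auto
  qed
qed

text \<open>In terms of the height \<open>s\<close> in the finite pyramid
  \<open>z = s / (1 - s)\<close>, and the factor \<open>(1 - s)^(k - 1)\<close> clears the
  denominators. The next lemma inverts this, so that every polynomial of degree \<open>k - 1\<close>
  occurs on a vertical edge.\<close>

lemma Qpoly_vertical:
  assumes "N \<in> Qpoly l m (int k - 1)"
  shows "\<exists>p \<in> Poly1 (int k - 1). \<forall>s. s \<noteq> 1 \<longrightarrow> (1 - s) ^ (k - 1) * N (vector [x, y, s / (1 - s)]) = p s"
  using assms
proof (induction rule: Qpoly_induct)
  case zero
  then show ?case by (intro bexI[of _ "\<lambda>_. 0"]) (auto simp: Poly1_zero)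
next
  case (step c a b e g)
  then obtain p where p: "p \<in> Poly1 (int k - 1)"
    "\<forall>s. s \<noteq> 1 \<longrightarrow> (1 - s) ^ (k - 1) * g (vector [x, y, s / (1 - s)]) = p s" by blast
  \<comment> \<open>The degree of the product is taken from the two-variable lemmas and then
    restricted to \<open>t = 0\<close>.\<close>
  have "(\<lambda>s t::real. (s ^ e * t ^ 0) * (1 + (-1) * s + 0 * t) ^ (k - 1 - e)) \<in> Ppoly2 (int k - 1)"
    by (rule Ppoly2_mult[OF Ppoly2_monom[OF order_refl] Ppoly2_power[OF Ppoly2_affine]]) (use step in auto)
  then have h: "(\<lambda>s. (s ^ e * 0 ^ 0) * (1 + (-1) * s + 0 * 0) ^ (k - 1 - e)) \<in> Poly1 (int k - 1)"
    by (rule Ppoly2_Poly1)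
  have "(1 - s) ^ (k - 1) * (s / (1 - s)) ^ e = s ^ e * (1 - s) ^ (k - 1 - e)" if "s \<noteq> 1" for s :: real
  proof -
    have "k - 1 = e + (k - 1 - e)" using step by linarith
    then have "(1 - s) ^ (k - 1) = (1 - s) ^ e * (1 - s) ^ (k - 1 - e)" by (metis power_add)
    then show ?thesis using that by (simp add: power_divide)
  qed
  then have "(1 - s) ^ (k - 1) * (c * (x ^ a * y ^ b * (s / (1 - s)) ^ e) + g (vector [x, y, s / (1 - s)])) =
     (c * x ^ a * y ^ b) * (s ^ e * (1 - s) ^ (k - 1 - e)) + p s" if "s \<noteq> 1" for s
    using that p(2) by (simp add: algebra_simps)
  then show ?case
    by (intro bexI[OF _ Poly1_add[OF Poly1_cmult[OF h, of "c * x ^ a * y ^ b"] p(1)]]) auto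
qed

lemma Poly1_vertical:
  assumes "p \<in> Poly1 (int k - 1)"
  shows "\<exists>P \<in> Poly1 (int k - 1). \<forall>s. s \<noteq> 1 \<longrightarrow> (1 - s) ^ (k - 1) * P (s / (1 - s)) = p s"
  using assms
proof (induction rule: Poly1_induct)
  case zero
  then show ?case by (intro bexI[of _ "\<lambda>_. 0"]) (auto simp: Poly1_zero)
next
  case (step c e g)
  then obtain P where P: "P \<in> Poly1 (int k - 1)"
    "\<forall>s. s \<noteq> 1 \<longrightarrow> (1 - s) ^ (k - 1) * P (s / (1 - s)) = g s" by blast
  have "(\<lambda>s t::real. (s ^ e * t ^ 0) * (1 + 1 * s + 0 * t) ^ (k - 1 - e)) \<in> Ppoly2 (int k - 1)"
    by (rule Ppoly2_mult[OF Ppoly2_monom[OF order_refl] Ppoly2_power[OF Ppoly2_affine]]) (use step in auto)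
  then have h: "(\<lambda>s. (s ^ e * 0 ^ 0) * (1 + 1 * s + 0 * 0) ^ (k - 1 - e)) \<in> Poly1 (int k - 1)"
    by (rule Ppoly2_Poly1)
  have "(1 - s) ^ (k - 1) * ((s / (1 - s)) ^ e * (1 + s / (1 - s)) ^ (k - 1 - e)) = s ^ e"
    if "s \<noteq> 1" for s :: real
  proof -
    have "k - 1 = e + (k - 1 - e)" using step by linarith
    then have "(1 - s) ^ (k - 1) = (1 - s) ^ e * (1 - s) ^ (k - 1 - e)" by (metis power_add)
    moreover have "1 + s / (1 - s) = 1 / (1 - s)" using that by (simp add: field_simps)
    ultimately show ?thesis using that by (simp add: power_divide)
  qed
  then have "(1 - s) ^ (k - 1) * (c * ((s / (1 - s)) ^ e * (1 + s / (1 - s)) ^ (k - 1 - e)) + P (s / (1 - s))) =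
     c * s ^ e + g s" if "s \<noteq> 1" for s
    using that P(2) by (simp add: algebra_simps)
  then show ?case
    by (intro bexI[OF _ Poly1_add[OF Poly1_cmult[OF h, of c] P(1)]]) auto
qed

section \<open>Polynomials of bounded total degree in space\<close>

definition Apoly :: "int \<Rightarrow> (pt \<Rightarrow> real) set"
  where "Apoly n = span {\<lambda>p. p$1 ^ a * p$2 ^ b * p$3 ^ c | a b c. int (a + b + c) \<le> n}"

lemma Apoly_induct [consumes 1, case_names zero step]:
  assumes "f \<in> Apoly n" and "P (\<lambda>_. 0)"
    and "\<And>c a b e g. int (a + b + e) \<le> n \<Longrightarrow> g \<in> Apoly n \<Longrightarrow> P g \<Longrightarrow>
      P (\<lambda>p. c * (p$1 ^ a * p$2 ^ b * p$3 ^ e) + g p)"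
  shows "P f"
proof -
  have "f \<in> Apoly n \<and> P f"
    using assms(1)[unfolded Apoly_def]
  proof (induction rule: span_induct_alt)
    case base
    have "0 \<in> Apoly n" unfolding Apoly_def by (rule span_zero)
    then show ?case using assms(2) by (simp add: zero_fun_def)
  next
    case (step c x y)
    then obtain a b e where x: "x = (\<lambda>p. p$1 ^ a * p$2 ^ b * p$3 ^ e)"
      and le: "int (a + b + e) \<le> n" by blast
    have "c *\<^sub>R x + y = (\<lambda>p. c * (p$1 ^ a * p$2 ^ b * p$3 ^ e) + y p)"
      by (simp add: x scaleR_fun_def plus_fun_def)
    moreover have "c *\<^sub>R x + y \<in> Apoly n"
      using step unfolding Apoly_def by (intro span_add[OF span_scale[OF span_base]]) auto
    ultimately show ?case using assms(3)[OF le, of y c] step by auto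
  qed
  then show ?thesis ..
qed

lemma Apoly_monom: "int (a + b + e) \<le> n \<Longrightarrow> (\<lambda>p. p$1 ^ a * p$2 ^ b * p$3 ^ e) \<in> Apoly n"
  unfolding Apoly_def by (rule span_base) blast

lemma Apoly_add: "f \<in> Apoly n \<Longrightarrow> g \<in> Apoly n \<Longrightarrow> (\<lambda>p. f p + g p) \<in> Apoly n"
  unfolding Apoly_def using span_add[of f _ g] by (simp add: plus_fun_def)

lemma Apoly_zero: "(\<lambda>_. 0) \<in> Apoly n"
proof -
  have "0 \<in> Apoly n" unfolding Apoly_def by (rule span_zero)
  then show ?thesis by (simp add: zero_fun_def)
qed

lemma Apoly_cmult: "f \<in> Apoly n \<Longrightarrow> (\<lambda>p. c * f p) \<in> Apoly n"
  unfolding Apoly_def using span_scale[of f _ c] by (simp add: scaleR_fun_def)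

lemma Apoly_continuous: "f \<in> Apoly n \<Longrightarrow> continuous_on S f"
  by (induction rule: Apoly_induct) (auto intro!: continuous_intros)

lemma Ppoly2_Apoly:
  assumes "f \<in> Ppoly2 n" "i = 1 \<or> i = 2"
  shows "(\<lambda>p. f (p$i) (p$3)) \<in> Apoly n"
  using assms(1)
proof (induction rule: Ppoly2_induct)
  case (step c a b g)
  have "(\<lambda>p::pt. c * (p$i ^ a * p$3 ^ b) + g (p$i) (p$3)) \<in> Apoly n"
    using Apoly_add[OF Apoly_cmult[OF Apoly_monom[of a 0 b n], of c] step.IH]
      Apoly_add[OF Apoly_cmult[OF Apoly_monom[of 0 a b n], of c] step.IH] step assms(2)
    by (elim disjE) auto
  then show ?case by simp
qed (simp add: Apoly_zero)

lemma Poly1_Apoly: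
  assumes "f \<in> Poly1 n"
  shows "(\<lambda>p. f (p$i)) \<in> Apoly n"
proof -
  have "i = 1 \<or> i = 2 \<or> i = 3" by (metis exhaust_3)
  then show ?thesis
    using Ppoly2_Apoly[OF Poly1_Ppoly2(2)[OF assms], of i] Ppoly2_Apoly[OF Poly1_Ppoly2(1)[OF assms], of 1]
    by auto
qed

text \<open>Total degree is stable under affine parametrisation. This links polynomials on an edge
  or face, which are defined as restrictions, to polynomials in its parameters.\<close>

lemma Apoly_Ppoly2:
  fixes a u v :: pt
  assumes "f \<in> Apoly n"
  shows "(\<lambda>s t. f (a + s *\<^sub>R u + t *\<^sub>R v)) \<in> Ppoly2 n"
  using assms
proof (induction rule: Apoly_induct)
  case (step c i j l g)
  have aff: "(\<lambda>s t. (a + s *\<^sub>R u + t *\<^sub>R v)$i) \<in> Ppoly2 1" for i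
    using Ppoly2_affine[of "a$i" "u$i" "v$i"] by (simp add: mult.commute)
  have "(\<lambda>s t. (a + s *\<^sub>R u + t *\<^sub>R v)$1 ^ i * (a + s *\<^sub>R u + t *\<^sub>R v)$2 ^ j * (a + s *\<^sub>R u + t *\<^sub>R v)$3 ^ l) \<in> Ppoly2 n"
    by (rule Ppoly2_mult[OF Ppoly2_mult[OF Ppoly2_power[OF aff] Ppoly2_power[OF aff] order_refl] Ppoly2_power[OF aff]])
      (use step in auto)
  then show ?case using step by (intro Ppoly2_add Ppoly2_cmult)
qed (simp add: Ppoly2_zero)

lemma Apoly_Poly1:
  fixes a u :: pt
  assumes "f \<in> Apoly n"
  shows "(\<lambda>s. f (a + s *\<^sub>R u)) \<in> Poly1 n"
  using Ppoly2_Poly1[OF Apoly_Ppoly2[OF assms, of a u 0], of 0] by simp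

lemma Ppoly_on_Apoly: "Ppoly_on S n = restr S ` Apoly n"
  by (simp add: Ppoly_on_def Apoly_def)

section \<open>The change of variables\<close>

definition psi :: "pt \<Rightarrow> pt"
  where "psi p = vector [p$1 / (1 - p$3), p$2 / (1 - p$3), p$3 / (1 - p$3)]"

lemma psi_nth [simp]: "psi p $ 1 = p$1 / (1 - p$3)" "psi p $ 2 = p$2 / (1 - p$3)" "psi p $ 3 = p$3 / (1 - p$3)"
  by (simp_all add: psi_def)

lemma phi_nth [simp]: "phi p $ 1 = p$1 / (1 + p$3)" "phi p $ 2 = p$2 / (1 + p$3)" "phi p $ 3 = p$3 / (1 + p$3)"
  by (simp_all add: phi_def)

lemma one_plus_psi3: "p$3 \<noteq> 1 \<Longrightarrow> 1 + psi p $ 3 = 1 / (1 - p$3)"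
  by (simp add: field_simps)

lemma phi_psi: "p$3 \<noteq> 1 \<Longrightarrow> phi (psi p) = p"
  by (simp add: pt_eq_iff one_plus_psi3[simplified])

lemma psi_phi:
  assumes "p$3 \<noteq> -1"
  shows "psi (phi p) = p"
proof -
  have "1 + p$3 \<noteq> 0" using assms by linarith
  then have "1 - p$3 / (1 + p$3) = 1 / (1 + p$3)" by (simp add: field_simps)
  then show ?thesis using \<open>1 + p$3 \<noteq> 0\<close> by (simp add: pt_eq_iff)
qed

lemma apex_nth [simp]: "apex $ 1 = 0" "apex $ 2 = 0" "apex $ 3 = 1"
  by (simp_all add: apex_def)

lemma pyramid_no_apex:
  assumes "p \<in> pyramid"
  shows "p \<noteq> apex \<longleftrightarrow> p$3 < 1"
  using assms by (auto simp: pyramid_def pt_eq_iff)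

lemma mem_pyramid_no_apex: "p \<in> pyramid - {apex} \<longleftrightarrow> p \<in> pyramid \<and> p$3 < 1"
  using pyramid_no_apex by auto

lemma psi_mem: "p \<in> pyramid - {apex} \<Longrightarrow> psi p \<in> inf_pyramid"
  unfolding mem_pyramid_no_apex by (auto simp: pyramid_def inf_pyramid_def)

lemma phi_mem: "x \<in> inf_pyramid \<Longrightarrow> phi x \<in> pyramid - {apex}"
proof -
  assume "x \<in> inf_pyramid"
  then have x: "0 \<le> x$1" "x$1 \<le> 1" "0 \<le> x$2" "x$2 \<le> 1" "0 \<le> x$3"
    by (auto simp: inf_pyramid_def)
  have "1 - x$3 / (1 + x$3) = 1 / (1 + x$3)" using x by (simp add: field_simps)
  then show ?thesis
    unfolding mem_pyramid_no_apex using x by (auto simp: pyramid_def divide_right_mono)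
qed

section \<open>Geometry of the pyramid\<close>

lemma pyramid_halfspaces:
  "pyramid = {p. axis 1 1 \<bullet> p \<ge> (0::real)} \<inter> {p. axis 2 1 \<bullet> p \<ge> (0::real)} \<inter> {p. axis 3 1 \<bullet> p \<ge> (0::real)} \<inter>
     {p. (vector [1,0,1] :: pt) \<bullet> p \<le> 1} \<inter> {p. (vector [0,1,1] :: pt) \<bullet> p \<le> 1}"
  by (auto simp: pyramid_def inner_pt axis_def)

lemma interior_pyramid:
  "interior pyramid = {p. p$1 > 0 \<and> p$2 > 0 \<and> p$3 > 0 \<and> p$1 < 1 - p$3 \<and> p$2 < 1 - p$3}"
proof -
  have nz: "(vector [1,0,1] :: pt) \<noteq> 0" "(vector [0,1,1] :: pt) \<noteq> 0"
    "axis 1 1 \<noteq> (0::pt)" "axis 2 1 \<noteq> (0::pt)" "axis 3 1 \<noteq> (0::pt)"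
    by (auto simp: pt_eq_iff axis_def)
  show ?thesis
    unfolding pyramid_halfspaces interior_Int interior_halfspace_ge[OF nz(3)] interior_halfspace_ge[OF nz(4)]
      interior_halfspace_ge[OF nz(5)] interior_halfspace_le[OF nz(1)] interior_halfspace_le[OF nz(2)]
    by (auto simp: inner_pt axis_def)
qed

lemma closed_pyramid: "closed pyramid"
  unfolding pyramid_halfspaces by (intro closed_Int closed_halfspace_ge closed_halfspace_le)

lemma convex_pyramid: "convex pyramid"
  unfolding pyramid_halfspaces by (intro convex_Int convex_halfspace_ge convex_halfspace_le)

lemma pyramid_subset_cbox: "pyramid \<subseteq> cbox 0 1"
  by (auto simp: pyramid_def mem_box_cart forall_3)

lemma bounded_pyramid: "bounded pyramid"
  using bounded_subset[OF bounded_cbox pyramid_subset_cbox] .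

lemma frontier_pyramid: "p \<in> frontier pyramid \<longleftrightarrow> p \<in> pyramid \<and> p \<notin> interior pyramid"
  by (simp add: frontier_def closure_closed[OF closed_pyramid])

lemma interior_pyramidD: "p \<in> interior pyramid \<Longrightarrow> p \<in> pyramid - {apex}"
  using interior_subset[of pyramid] by (auto simp: interior_pyramid)

text \<open>The transposed Jacobian of \<open>psi\<close> at \<open>p\<close> applied to a covector,
  which inverts the transposed Jacobian of \<open>phi\<close>. The derivatives
  \<open>p_i / (1 - p_3)^2\<close> of \<open>psi\<close> are written through
  \<open>psi p\<close>.\<close>

definition push_lin :: "pt \<Rightarrow> pt \<Rightarrow> pt"
  where "push_lin p g = vector [g$1 / (1 - p$3), g$2 / (1 - p$3),
    (psi p $ 1 * g$1 + psi p $ 2 * g$2) / (1 - p$3) + g$3 / (1 - p$3)\<^sup>2]"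

lemma push_lin_nth [simp]: "push_lin p g $ 1 = g$1 / (1 - p$3)" "push_lin p g $ 2 = g$2 / (1 - p$3)"
  "push_lin p g $ 3 = (psi p $ 1 * g$1 + psi p $ 2 * g$2) / (1 - p$3) + g$3 / (1 - p$3)\<^sup>2"
  by (simp_all add: push_lin_def)

definition pushf :: "(pt \<Rightarrow> pt) \<Rightarrow> pt \<Rightarrow> pt"
  where "pushf u p = (if p \<in> pyramid - {apex} then push_lin p (u (psi p)) else 0)"

lemma quotient_derivative_aux: "d \<noteq> 0 \<Longrightarrow> a / d - (d - 1) * a / d\<^sup>2 = a / (d::real)\<^sup>2"
  by (simp add: field_simps power2_eq_square)

lemma phi_has_derivative:
  assumes "x$3 > -1"
  shows "(phi has_derivative (\<lambda>h. vector [h$1 / (1 + x$3) - x$1 * h$3 / (1 + x$3)\<^sup>2,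
    h$2 / (1 + x$3) - x$2 * h$3 / (1 + x$3)\<^sup>2, h$3 / (1 + x$3)\<^sup>2])) (at x)"
proof -
  have nth: "((\<lambda>p::pt. p$i) has_derivative (\<lambda>h. h$i)) (at x)" for i
    by (rule bounded_linear_imp_has_derivative[OF bounded_linear_vec_nth])
  have nz: "1 + x$3 \<noteq> 0" using assms by linarith
  have q: "((\<lambda>p::pt. p$i / (1 + p$3)) has_derivative (\<lambda>h. h$i / (1 + x$3) - x$i * h$3 / (1 + x$3)\<^sup>2)) (at x)" for i
    by (rule has_derivative_eq_rhs, rule has_derivative_divide'[OF nth has_derivative_add[OF has_derivative_const nth] nz])
      (use nz in \<open>simp add: fun_eq_iff diff_divide_distrib power2_eq_square\<close>)
  have 3: "(\<lambda>h::pt. h$3 / (1 + x$3) - x$3 * h$3 / (1 + x$3)\<^sup>2) = (\<lambda>h. h$3 / (1 + x$3)\<^sup>2)"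
    using quotient_derivative_aux[OF nz] by (simp add: fun_eq_iff)
  show ?thesis
    unfolding phi_def by (rule has_derivative_vector3[OF q q q[of 3, unfolded 3] refl])
qed

lemma pullback1_eq:
  assumes "x$3 > -1"
  shows "pullback1 E x = vector [E (phi x) $ 1 / (1 + x$3), E (phi x) $ 2 / (1 + x$3),
    (E (phi x) $ 3 - x$1 * E (phi x) $ 1 - x$2 * E (phi x) $ 2) / (1 + x$3)\<^sup>2]"
proof -
  have "pullback1 E x $ j = (\<Sum>i\<in>UNIV. frechet_derivative phi (at x) (axis j 1) $ i * E (phi x) $ i)" for j
    unfolding pullback1_def matrix_vector_mult_def transpose_def matrix_def by simp
  moreover have "frechet_derivative phi (at x) = (\<lambda>h. vector [h$1 / (1 + x$3) - x$1 * h$3 / (1 + x$3)\<^sup>2,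
    h$2 / (1 + x$3) - x$2 * h$3 / (1 + x$3)\<^sup>2, h$3 / (1 + x$3)\<^sup>2])"
    using frechet_derivative_at[OF phi_has_derivative[OF assms]] by simp
  ultimately show ?thesis
    by (simp add: pt_eq_iff sum_3 axis_def diff_divide_distrib)
qed

text \<open>The system \<open>pullback1 E x = u x\<close> is triangular in \<open>E (phi x)\<close>:
  the first two components are rescaled, and the third then follows. Solving it replaces the
  implicit description of \<open>push1\<close> by an explicit field.\<close>

lemma push1_iff: "E \<in> push1 U \<longleftrightarrow> (\<exists>u\<in>U. E = pushf u)"
proof
  assume "E \<in> push1 U"
  then obtain u where u: "u \<in> U" "\<forall>x\<in>inf_pyramid. pullback1 E x = u x"
    and off: "\<forall>p. p \<notin> pyramid - {apex} \<longrightarrow> E p = 0"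
    by (auto simp: push1_def)
  have "E p = pushf u p" for p
  proof (cases "p \<in> pyramid - {apex}")
    case True
    then have p3: "p$3 < 1" "0 \<le> p$3" unfolding mem_pyramid_no_apex by (auto simp: pyramid_def)
    have "pullback1 E (psi p) = u (psi p)" using u psi_mem[OF True] by blast
    moreover have "psi p $ 3 > -1" using p3 by (simp add: field_simps)
    moreover have "phi (psi p) = p" using p3 by (intro phi_psi) auto
    ultimately have *: "u (psi p) = vector [E p $ 1 * (1 - p$3), E p $ 2 * (1 - p$3),
      (E p $ 3 - psi p $ 1 * E p $ 1 - psi p $ 2 * E p $ 2) * (1 - p$3)\<^sup>2]"
      using p3 one_plus_psi3[of p]
      by (simp add: pullback1_eq power_divide del: psi_nth)
    show ?thesis
      using True p3 by (simp add: pushf_def pt_eq_iff * add_divide_distrib)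
  qed (use off in \<open>auto simp: pushf_def\<close>)
  then show "\<exists>u\<in>U. E = pushf u" using u by blast
next
  assume "\<exists>u\<in>U. E = pushf u"
  then obtain u where u: "u \<in> U" "E = pushf u" by blast
  have "pullback1 E x = u x" if x: "x \<in> inf_pyramid" for x
  proof -
    have x3: "x$3 \<ge> 0" using x by (auto simp: inf_pyramid_def)
    then have nz: "1 + x$3 \<noteq> 0" by linarith
    have ps: "psi (phi x) = x" using x3 by (intro psi_phi) auto
    have t: "1 - phi x $ 3 = 1 / (1 + x$3)" using nz by (simp add: field_simps)
    have E: "E (phi x) = push_lin (phi x) (u x)"
      using phi_mem[OF x] by (simp add: u pushf_def ps)
    have E': "E (phi x) $ 1 = u x $ 1 * (1 + x$3)" "E (phi x) $ 2 = u x $ 2 * (1 + x$3)"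
      "E (phi x) $ 3 = (x$1 * u x $ 1 + x$2 * u x $ 2) * (1 + x$3) + u x $ 3 * (1 + x$3)\<^sup>2"
      unfolding E push_lin_nth ps t by (simp_all add: power_divide)
    have "E (phi x) $ 3 - x$1 * E (phi x) $ 1 - x$2 * E (phi x) $ 2 = u x $ 3 * (1 + x$3)\<^sup>2"
      unfolding E' by (simp add: algebra_simps)
    then show ?thesis
      using x3 nz E'(1,2) by (simp add: pullback1_eq pt_eq_iff)
  qed
  then show "E \<in> push1 U" using u by (auto simp: push1_def pushf_def)
qed

lemma push_lin_add: "push_lin p (a + b) = push_lin p a + push_lin p b"
  by (simp add: pt_eq_iff add_divide_distrib algebra_simps)

lemma push_lin_scaleR: "push_lin p (c *\<^sub>R a) = c *\<^sub>R push_lin p a"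
  by (simp add: pt_eq_iff add_divide_distrib algebra_simps)

lemma pushf_add: "pushf (\<lambda>x. u x + v x) = pushf u + pushf v"
  by (auto simp: fun_eq_iff pushf_def push_lin_add)

lemma pushf_scaleR: "pushf (\<lambda>x. c *\<^sub>R u x) = c *\<^sub>R pushf u"
  by (auto simp: fun_eq_iff pushf_def push_lin_scaleR scaleR_fun_def)

lemma pushf_cong: "(\<And>x. x \<in> inf_pyramid \<Longrightarrow> u x = v x) \<Longrightarrow> pushf u = pushf v"
  using psi_mem by (auto simp: fun_eq_iff pushf_def)

lemma pushf_zero_iff: "pushf u = 0 \<longleftrightarrow> (\<forall>x\<in>inf_pyramid. u x = 0)"
proof
  assume 0: "pushf u = 0"
  show "\<forall>x\<in>inf_pyramid. u x = 0"
  proof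
    fix x assume x: "x \<in> inf_pyramid"
    then have x3: "x$3 \<ge> 0" by (auto simp: inf_pyramid_def)
    have ps: "psi (phi x) = x" using x3 by (intro psi_phi) auto
    have "1 - phi x $ 3 = 1 / (1 + x$3)" using x3 by (simp add: field_simps)
    then have t: "1 - phi x $ 3 \<noteq> 0" using x3 by simp
    have "push_lin (phi x) (u x) = 0"
      using fun_cong[OF 0, of "phi x"] phi_mem[OF x] by (simp add: pushf_def ps)
    then show "u x = 0"
      using t unfolding pt_eq_iff push_lin_nth by auto
  qed
next
  assume "\<forall>x\<in>inf_pyramid. u x = 0"
  then have "pushf u = pushf (\<lambda>_. 0)" by (intro pushf_cong) auto
  also have "\<dots> = 0" by (auto simp: fun_eq_iff pushf_def pt_eq_iff)
  finally show "pushf u = 0" .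
qed

section \<open>Differentiation and the change of variables\<close>

text \<open>The chain rule for \<open>psi\<close>: gradients transform by the same
  \<open>push_lin\<close> as 1-forms, so the gradient of a pushed 0-form is the push of its
  gradient.\<close>

lemma GDERIV_psi:
  assumes "GDERIV f (psi p) :> g" "p$3 < 1"
  shows "GDERIV (\<lambda>p. f (psi p)) p :> push_lin p g"
proof -
  have nth: "((\<lambda>p::pt. p$i) has_derivative (\<lambda>h. h$i)) (at p)" for i
    by (rule bounded_linear_imp_has_derivative[OF bounded_linear_vec_nth])
  have nz: "1 - p$3 \<noteq> 0" using assms by linarith
  have q: "((\<lambda>p::pt. p$i / (1 - p$3)) has_derivative (\<lambda>h. h$i / (1 - p$3) + p$i * h$3 / (1 - p$3)\<^sup>2)) (at p)" for i
    by (rule has_derivative_eq_rhs, rule has_derivative_divide'[OF nth has_derivative_diff[OF has_derivative_const nth] nz])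
      (use nz in \<open>simp add: fun_eq_iff add_divide_distrib power2_eq_square\<close>)
  have 3: "(\<lambda>h::pt. h$3 / (1 - p$3) + p$3 * h$3 / (1 - p$3)\<^sup>2) = (\<lambda>h. h$3 / (1 - p$3)\<^sup>2)"
    using quotient_derivative_aux[OF nz] by (simp add: fun_eq_iff)
  have "(psi has_derivative (\<lambda>h. vector [h$1 / (1 - p$3) + p$1 * h$3 / (1 - p$3)\<^sup>2,
      h$2 / (1 - p$3) + p$2 * h$3 / (1 - p$3)\<^sup>2, h$3 / (1 - p$3)\<^sup>2])) (at p)"
    unfolding psi_def by (rule has_derivative_vector3[OF q q q[of 3, unfolded 3] refl])
  from has_derivative_compose[OF this assms(1)[unfolded gderiv_def]]
  have "((\<lambda>p. f (psi p)) has_derivative (\<lambda>h. vector [h$1 / (1 - p$3) + p$1 * h$3 / (1 - p$3)\<^sup>2,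
      h$2 / (1 - p$3) + p$2 * h$3 / (1 - p$3)\<^sup>2, h$3 / (1 - p$3)\<^sup>2] \<bullet> g)) (at p)" .
  moreover have "(vector [h$1 / (1 - p$3) + p$1 * h$3 / (1 - p$3)\<^sup>2,
      h$2 / (1 - p$3) + p$2 * h$3 / (1 - p$3)\<^sup>2, h$3 / (1 - p$3)\<^sup>2] :: pt) \<bullet> g = h \<bullet> push_lin p g" for h :: pt
  proof -
    define t where "t = 1 - p$3"
    have "t \<noteq> 0" using nz by (simp add: t_def)
    then show ?thesis
      by (simp add: inner_pt t_def[symmetric]) (simp add: field_simps power2_eq_square)
  qed
  ultimately show ?thesis by (simp add: gderiv_def)
qed

lemma GDERIV_inverse_t:
  assumes "p$3 < 1"
  shows "GDERIV (\<lambda>p::pt. 1 / (1 - p$3)) p :> (1 / (1 - p$3)\<^sup>2) *\<^sub>R axis 3 1"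
proof -
  have "GDERIV (\<lambda>p::pt. inverse (1 - p$3)) p :> - (inverse (1 - p$3))\<^sup>2 *\<^sub>R (0 - axis 3 1)"
    using assms by (intro GDERIV_inverse GDERIV_diff GDERIV_const GDERIV_nth) auto
  then show ?thesis by (simp add: inverse_eq_divide power_divide)
qed

lemma gderiv_components:
  fixes E :: "pt \<Rightarrow> pt"
  assumes "\<And>i. GDERIV (\<lambda>p. E p $ i) p :> g i"
  shows "E differentiable (at p)"
    and "frechet_derivative E (at p) = (\<lambda>h. \<chi> i. h \<bullet> g i)"
    and "curl E p = vector [g 3 $ 2 - g 2 $ 3, g 1 $ 3 - g 3 $ 1, g 2 $ 1 - g 1 $ 2]"
proof -
  have D: "(E has_derivative (\<lambda>h. \<chi> i. h \<bullet> g i)) (at p)"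
    unfolding has_derivative_vec_nth_iff using assms by (simp add: gderiv_def)
  then show "E differentiable (at p)" by (auto simp: differentiable_def)
  show f: "frechet_derivative E (at p) = (\<lambda>h. \<chi> i. h \<bullet> g i)"
    using frechet_derivative_at[OF D] by simp
  show "curl E p = vector [g 3 $ 2 - g 2 $ 3, g 1 $ 3 - g 3 $ 1, g 2 $ 1 - g 1 $ 2]"
    unfolding curl_def f by (simp add: Let_def inner_axis')
qed

text \<open>Gradient of the component \<open>i\<close> of \<open>push_lin p (u (psi p))\<close>,
  when \<open>u\<close> has the value \<open>v\<close> and the component gradients \<open>G\<close>
  at \<open>psi p\<close>. The local \<open>e j\<close> is the gradient of
  \<open>u_j / (1 - p_3)\<close>; the terms in \<open>axis 3 1\<close> come from differentiating
  powers of \<open>1 / (1 - p_3)\<close>.\<close>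

definition push_grad :: "pt \<Rightarrow> pt \<Rightarrow> (3 \<Rightarrow> pt) \<Rightarrow> 3 \<Rightarrow> pt"
  where "push_grad p v G i =
    (let e = (\<lambda>j. (1 / (1 - p$3)) *\<^sub>R push_lin p (G j) + (v$j / (1 - p$3)\<^sup>2) *\<^sub>R axis 3 1)
     in if i = 3 then psi p $ 1 *\<^sub>R e 1 + (v$1 / (1 - p$3)) *\<^sub>R push_lin p (axis 1 1) +
       (psi p $ 2 *\<^sub>R e 2 + (v$2 / (1 - p$3)) *\<^sub>R push_lin p (axis 2 1)) +
       ((1 / (1 - p$3)\<^sup>2) *\<^sub>R push_lin p (G 3) + (2 * v$3 / (1 - p$3) ^ 3) *\<^sub>R axis 3 1)
     else e i)"

lemma GDERIV_push_lin:
  assumes G: "\<And>i. GDERIV (\<lambda>x. u x $ i) (psi p) :> G i" and p: "p$3 < 1"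
  shows "GDERIV (\<lambda>p. push_lin p (u (psi p)) $ i) p :> push_grad p (u (psi p)) G i"
proof -
  have nz: "1 - p$3 \<noteq> 0" using p by linarith
  have t2: "((1 / (1 - p$3))\<^sup>2) = 1 / (1 - p$3)\<^sup>2" by (simp add: power_divide)
  note T = GDERIV_inverse_t[OF p]
  have U: "GDERIV (\<lambda>p. u (psi p) $ j) p :> push_lin p (G j)" for j
    by (rule GDERIV_psi[OF G p])
  have X: "GDERIV (\<lambda>p. psi p $ j) p :> push_lin p (axis j 1)" for j
    by (rule GDERIV_psi[OF GDERIV_nth p])
  define e where "e = (\<lambda>j. (1 / (1 - p$3)) *\<^sub>R push_lin p (G j) + (u (psi p) $ j / (1 - p$3)\<^sup>2) *\<^sub>R (axis 3 1 :: pt))"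
  have E: "GDERIV (\<lambda>p. u (psi p) $ j * (1 / (1 - p$3))) p :> e j" for j
    by (rule GDERIV_subst, rule GDERIV_mult[OF U T]) (simp add: e_def)
  have E3: "GDERIV (\<lambda>p. u (psi p) $ 3 * ((1 / (1 - p$3)) * (1 / (1 - p$3)))) p :>
     (1 / (1 - p$3)\<^sup>2) *\<^sub>R push_lin p (G 3) + (2 * u (psi p) $ 3 / (1 - p$3) ^ 3) *\<^sub>R axis 3 1"
    by (rule GDERIV_subst, rule GDERIV_mult[OF U GDERIV_mult[OF T T]])
      (use nz in \<open>simp add: pt_eq_iff axis_def power2_eq_square power3_eq_cube mult_ac\<close>)
  have 3: "GDERIV (\<lambda>p. psi p $ 1 * (u (psi p) $ 1 * (1 / (1 - p$3))) + psi p $ 2 * (u (psi p) $ 2 * (1 / (1 - p$3)))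
     + u (psi p) $ 3 * ((1 / (1 - p$3)) * (1 / (1 - p$3)))) p :>
       psi p $ 1 *\<^sub>R e 1 + (u (psi p)$1 / (1 - p$3)) *\<^sub>R push_lin p (axis 1 1) +
       (psi p $ 2 *\<^sub>R e 2 + (u (psi p)$2 / (1 - p$3)) *\<^sub>R push_lin p (axis 2 1)) +
       ((1 / (1 - p$3)\<^sup>2) *\<^sub>R push_lin p (G 3) + (2 * u (psi p)$3 / (1 - p$3) ^ 3) *\<^sub>R axis 3 1)"
    by (rule GDERIV_subst, rule GDERIV_add[OF GDERIV_add[OF GDERIV_mult[OF X E] GDERIV_mult[OF X E]] E3]) simp
  have eq3: "(\<lambda>p. psi p $ 1 * (u (psi p) $ 1 * (1 / (1 - p$3))) + psi p $ 2 * (u (psi p) $ 2 * (1 / (1 - p$3)))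
     + u (psi p) $ 3 * ((1 / (1 - p$3)) * (1 / (1 - p$3)))) = (\<lambda>p. push_lin p (u (psi p)) $ 3)"
    by (simp add: fun_eq_iff add_divide_distrib power2_eq_square)
  have eq12: "(\<lambda>p. u (psi p) $ j * (1 / (1 - p$3))) = (\<lambda>p. push_lin p (u (psi p)) $ j)" if "j \<noteq> 3" for j
    using that exhaust_3[of j] by (auto simp: fun_eq_iff)
  show ?thesis
  proof (cases "i = 3")
    case True
    show ?thesis using 3[unfolded eq3] by (simp add: True push_grad_def e_def Let_def del: psi_nth push_lin_nth)
  next
    case False
    show ?thesis using E[of i, unfolded eq12[OF False]] False by (simp add: push_grad_def e_def Let_def del: psi_nth push_lin_nth)
  qed
qed

lemma pushf_interior:
  assumes G: "\<And>i. GDERIV (\<lambda>x. u x $ i) (psi p) :> G i" and p: "p \<in> interior pyramid"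
  shows "GDERIV (\<lambda>p. pushf u p $ i) p :> push_grad p (u (psi p)) G i"
proof -
  have p3: "p$3 < 1" using p by (auto simp: interior_pyramid)
  have "((\<lambda>p. push_lin p (u (psi p)) $ i) has_derivative (\<lambda>h. h \<bullet> push_grad p (u (psi p)) G i)) (at p)"
    using GDERIV_push_lin[OF G p3, of i] by (simp add: gderiv_def)
  then have "((\<lambda>p. pushf u p $ i) has_derivative (\<lambda>h. h \<bullet> push_grad p (u (psi p)) G i)) (at p)"
    by (rule has_derivative_transform_within_open[OF _ open_interior p])
      (use interior_pyramidD in \<open>auto simp: pushf_def\<close>)
  then show ?thesis by (simp add: gderiv_def)
qed

text \<open>The curl transforms as a 2-form.\<close>

lemma curl_pushf:
  assumes G: "\<And>i. GDERIV (\<lambda>x. u x $ i) (psi p) :> G i" and p: "p \<in> interior pyramid"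
    and c: "c1 = G 3 $ 2 - G 2 $ 3" "c2 = G 1 $ 3 - G 3 $ 1" "c3 = G 2 $ 1 - G 1 $ 2"
  shows "curl (pushf u) p = vector [c1 / (1 - p$3) ^ 3 - psi p $ 1 * c3 / (1 - p$3)\<^sup>2,
    c2 / (1 - p$3) ^ 3 - psi p $ 2 * c3 / (1 - p$3)\<^sup>2, c3 / (1 - p$3)\<^sup>2]"
proof -
  have p3: "p$3 < 1" using p by (auto simp: interior_pyramid)
  then have nz: "1 - p$3 \<noteq> 0" by linarith
  define t where "t = 1 - p$3"
  define x y where "x = psi p $ 1" and "y = psi p $ 2"
  have tn: "t \<noteq> 0" using nz by (simp add: t_def)
  have a: "axis 1 1 $ (2::3) = (0::real)" "axis 1 1 $ (3::3) = (0::real)" "axis 2 1 $ (1::3) = (0::real)"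
    "axis 2 1 $ (3::3) = (0::real)" "axis 3 1 $ (1::3) = (0::real)" "axis 3 1 $ (2::3) = (0::real)"
    by (auto simp: axis_def)
  have n: "(1::3) \<noteq> 3" "(2::3) \<noteq> (3::3)" by auto
  show ?thesis
    unfolding gderiv_components(3)[OF pushf_interior[OF G p]] c
    using tn n
    by (simp add: pt_eq_iff push_grad_def Let_def a t_def[symmetric] x_def[symmetric] y_def[symmetric] del: psi_nth)
      (simp add: field_simps power2_eq_square power3_eq_cube)
qed

lemma bounded_pt:
  fixes f :: "'a \<Rightarrow> pt"
  assumes "\<exists>C. \<forall>p\<in>S. \<bar>f p $ 1\<bar> \<le> C" "\<exists>C. \<forall>p\<in>S. \<bar>f p $ 2\<bar> \<le> C" "\<exists>C. \<forall>p\<in>S. \<bar>f p $ 3\<bar> \<le> C"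
  shows "bounded (f ` S)"
proof -
  obtain C1 C2 C3 where C: "\<forall>p\<in>S. \<bar>f p $ 1\<bar> \<le> C1" "\<forall>p\<in>S. \<bar>f p $ 2\<bar> \<le> C2" "\<forall>p\<in>S. \<bar>f p $ 3\<bar> \<le> C3"
    using assms by blast
  have "norm (f p) \<le> C1 + C2 + C3" if "p \<in> S" for p
    using norm_le_l1_cart[of "f p"] C that by (force simp: sum_3)
  then show ?thesis unfolding bounded_iff by blast
qed

lemma continuous_on_pt:
  fixes f :: "'a::topological_space \<Rightarrow> pt"
  assumes "\<And>i. continuous_on S (\<lambda>x. f x $ i)"
  shows "continuous_on S f"
  using continuous_on_vec_lambda[of S "\<lambda>i x. f x $ i"] assms by simp

lemma continuous_on_push_lin:
  assumes "S \<subseteq> {p. p$3 < 1}" "continuous_on S g"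
  shows "continuous_on S (\<lambda>p. push_lin p (g p))"
proof (rule continuous_on_pt)
  fix i :: 3
  have g: "continuous_on S (\<lambda>p. g p $ j)" for j using assms(2) by (intro continuous_intros)
  have "continuous_on S (\<lambda>p. push_lin p (g p) $ 1)" "continuous_on S (\<lambda>p. push_lin p (g p) $ 2)"
    "continuous_on S (\<lambda>p. push_lin p (g p) $ 3)"
    unfolding push_lin_nth psi_nth using assms(1) by (auto intro!: continuous_intros g)
  then show "continuous_on S (\<lambda>p. push_lin p (g p) $ i)"
    using exhaust_3[of i] by auto
qed

lemma continuous_on_psi: "S \<subseteq> {p. p$3 < 1} \<Longrightarrow> continuous_on S psi"
proof (rule continuous_on_pt)
  fix i :: 3
  assume S: "S \<subseteq> {p. p$3 < 1}"
  then have "continuous_on S (\<lambda>p. psi p $ 1)" "continuous_on S (\<lambda>p. psi p $ 2)" "continuous_on S (\<lambda>p. psi p $ 3)"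
    unfolding psi_nth by (auto intro!: continuous_intros)
  then show "continuous_on S (\<lambda>p. psi p $ i)" using exhaust_3[of i] by auto
qed

lemma continuous_on_push_grad:
  assumes S: "S \<subseteq> {p. p$3 < 1}" and v: "continuous_on S v" and G: "\<And>i. continuous_on S (G i)"
  shows "continuous_on S (\<lambda>p. push_grad p (v p) (\<lambda>i. G i p) i)"
proof -
  have p: "continuous_on S (\<lambda>p. push_lin p (g p))" if "continuous_on S g" for g
    using continuous_on_push_lin[OF S that] .
  have ps: "continuous_on S (\<lambda>p. psi p $ i)" for i using continuous_on_psi[OF S] by (intro continuous_intros)
  have e: "continuous_on S (\<lambda>p. (1 / (1 - p$3)) *\<^sub>R push_lin p (G j p) + (v p$j / (1 - p$3)\<^sup>2) *\<^sub>R axis 3 1)" for j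
    using S by (intro continuous_intros p G v) auto
  show ?thesis
    unfolding push_grad_def Let_def using S
    by (cases "i = 3") (auto intro!: continuous_intros p G v e ps simp del: psi_nth)
qed

section \<open>Regular fields\<close>

text \<open>What the integrals need and the apex allows: continuity away from it, and boundedness of
  the field and of its curl. Single derivatives are only asked to be continuous in the
  interior.\<close>

definition reg :: "(pt \<Rightarrow> pt) \<Rightarrow> bool"
  where "reg E \<longleftrightarrow> (\<forall>p. p \<notin> pyramid - {apex} \<longrightarrow> E p = 0) \<and> continuous_on (pyramid - {apex}) E \<and>
    bounded (range E) \<and> (\<forall>p\<in>interior pyramid. E differentiable (at p)) \<and>
    (\<forall>i j. continuous_on (interior pyramid) (\<lambda>p. frechet_derivative E (at p) (axis j 1) $ i)) \<and>
    bounded (curl E ` interior pyramid)"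

lemma psi_gt: "p \<in> pyramid - {apex} \<Longrightarrow> psi p $ 3 > -1"
  using psi_mem[of p] unfolding inf_pyramid_def by auto

text \<open>Pushing multiplies the horizontal components by \<open>1 + z\<close> and the vertical
  one by \<open>(1 + z)^2\<close>, and the curl, as a 2-form, by \<open>(1 + z)^3\<close> and
  \<open>(1 + z)^2\<close>. Decay of these orders on the infinite pyramid therefore means
  boundedness near the apex.\<close>

lemma reg_pushf:
  assumes G: "\<And>i x. x$3 > -1 \<Longrightarrow> GDERIV (\<lambda>x. u x $ i) x :> G i x"
    and cG: "\<And>i. continuous_on {x. x$3 > -1} (G i)"
    and u: "\<exists>C. \<forall>x\<in>inf_pyramid. \<bar>u x $ 1\<bar> * (1 + x$3) ^ 1 \<le> C" "\<exists>C. \<forall>x\<in>inf_pyramid. \<bar>u x $ 2\<bar> * (1 + x$3) ^ 1 \<le> C"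
      "\<exists>C. \<forall>x\<in>inf_pyramid. \<bar>u x $ 3\<bar> * (1 + x$3)\<^sup>2 \<le> C"
    and c: "\<exists>C. \<forall>x\<in>inf_pyramid. \<bar>G 3 x $ 2 - G 2 x $ 3\<bar> * (1 + x$3) ^ 3 \<le> C"
      "\<exists>C. \<forall>x\<in>inf_pyramid. \<bar>G 1 x $ 3 - G 3 x $ 1\<bar> * (1 + x$3) ^ 3 \<le> C"
      "\<exists>C. \<forall>x\<in>inf_pyramid. \<bar>G 2 x $ 1 - G 1 x $ 2\<bar> * (1 + x$3)\<^sup>2 \<le> C"
  shows "reg (pushf u)"
proof -
  have div: "\<bar>a\<bar> * (1 + psi p $ 3) ^ n = \<bar>a / (1 - p$3) ^ n\<bar>" if "p$3 < 1" for a n and p :: pt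
    using that one_plus_psi3[of p] by (simp add: power_divide abs_mult del: psi_nth)
  have le: "\<bar>psi p $ 1\<bar> \<le> 1 \<and> \<bar>psi p $ 2\<bar> \<le> 1 \<and> p$3 < 1 \<and> psi p \<in> inf_pyramid" if "p \<in> pyramid - {apex}" for p
    using psi_mem[OF that] that pyramid_no_apex[of p] unfolding inf_pyramid_def by (simp del: psi_nth)
  have pull: "\<exists>C. \<forall>p\<in>pyramid - {apex}. \<bar>f (psi p) / (1 - p$3) ^ n\<bar> \<le> C"
    if H: "\<exists>C. \<forall>x\<in>inf_pyramid. \<bar>f x\<bar> * (1 + x$3) ^ n \<le> C" for f n
  proof -
    obtain C where C: "\<forall>x\<in>inf_pyramid. \<bar>f x\<bar> * (1 + x$3) ^ n \<le> C" using H by blast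
    have "\<bar>f (psi p) / (1 - p$3) ^ n\<bar> \<le> C" if "p \<in> pyramid - {apex}" for p
    proof -
      have "psi p \<in> inf_pyramid" "p$3 < 1" using le[OF that] by blast+
      then show ?thesis using C div[of p "f (psi p)" n] by metis
    qed
    then show ?thesis by blast
  qed
  have psi1: "\<bar>psi p $ i * a\<bar> \<le> \<bar>a\<bar>" if "p \<in> pyramid - {apex}" "i = 1 \<or> i = 2" for p i a
    using le[OF that(1)] that(2) mult_mono[of "\<bar>psi p $ i\<bar>" 1 "\<bar>a\<bar>" "\<bar>a\<bar>"] by (auto simp: abs_mult simp del: psi_nth)
  have off: "\<forall>p. p \<notin> pyramid - {apex} \<longrightarrow> pushf u p = 0" by (auto simp: pushf_def)
  have sub: "pyramid - {apex} \<subseteq> {p. p$3 < 1}" "interior pyramid \<subseteq> {p. p$3 < 1}"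
    using pyramid_no_apex by (auto simp: interior_pyramid)
  have "continuous_on {x. x$3 > -1} u"
  proof (rule continuous_on_pt)
    fix i
    show "continuous_on {x. x$3 > -1} (\<lambda>x. u x $ i)"
      using G[of _ i] by (intro continuous_at_imp_continuous_on ballI)
        (auto simp: gderiv_def intro: has_derivative_continuous)
  qed
  have cc: "continuous_on (pyramid - {apex}) (\<lambda>p. f (psi p))" "continuous_on (interior pyramid) (\<lambda>p. f (psi p))"
    if "continuous_on {x. x$3 > -1} f" for f :: "pt \<Rightarrow> pt"
    using continuous_on_compose2[OF that continuous_on_psi[OF sub(1)]]
      continuous_on_compose2[OF that continuous_on_psi[OF sub(2)]] psi_gt interior_pyramidD by blast+
  have cont: "continuous_on (pyramid - {apex}) (pushf u)"
    using continuous_on_push_lin[OF sub(1) cc(1)[OF \<open>continuous_on {x. x$3 > -1} u\<close>]]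
    by (rule continuous_on_eq) (auto simp: pushf_def)
  have "bounded (pushf u ` (pyramid - {apex}))"
  proof (rule bounded_pt)
    obtain C1 where C1: "\<forall>p\<in>pyramid - {apex}. \<bar>u (psi p) $ 1 / (1 - p$3) ^ 1\<bar> \<le> C1"
      using pull[OF u(1)] by blast
    obtain C2 where C2: "\<forall>p\<in>pyramid - {apex}. \<bar>u (psi p) $ 2 / (1 - p$3) ^ 1\<bar> \<le> C2"
      using pull[OF u(2)] by blast
    obtain C3 where C3: "\<forall>p\<in>pyramid - {apex}. \<bar>u (psi p) $ 3 / (1 - p$3) ^ 2\<bar> \<le> C3"
      using pull[OF u(3)] by blast
    show "\<exists>C. \<forall>p\<in>pyramid - {apex}. \<bar>pushf u p $ 1\<bar> \<le> C"
      using C1 by (auto simp: pushf_def)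
    show "\<exists>C. \<forall>p\<in>pyramid - {apex}. \<bar>pushf u p $ 2\<bar> \<le> C"
      using C2 by (auto simp: pushf_def)
    have "\<bar>pushf u p $ 3\<bar> \<le> C1 + C2 + C3" if p: "p \<in> pyramid - {apex}" for p
    proof -
      have "pushf u p $ 3 = psi p $ 1 * (u (psi p) $ 1 / (1 - p$3) ^ 1) + psi p $ 2 * (u (psi p) $ 2 / (1 - p$3) ^ 1) +
          u (psi p) $ 3 / (1 - p$3) ^ 2"
        using p by (simp add: pushf_def add_divide_distrib)
      moreover have "\<bar>psi p $ 1 * (u (psi p) $ 1 / (1 - p$3) ^ 1)\<bar> \<le> C1"
        using psi1[OF p, of 1] C1 p order_trans by blast
      moreover have "\<bar>psi p $ 2 * (u (psi p) $ 2 / (1 - p$3) ^ 1)\<bar> \<le> C2"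
        using psi1[OF p, of 2] C2 p order_trans by blast
      moreover have "\<bar>u (psi p) $ 3 / (1 - p$3) ^ 2\<bar> \<le> C3" using C3 p by blast
      ultimately show ?thesis by linarith
    qed
    then show "\<exists>C. \<forall>p\<in>pyramid - {apex}. \<bar>pushf u p $ 3\<bar> \<le> C" by blast
  qed
  moreover have "range (pushf u) \<subseteq> insert 0 (pushf u ` (pyramid - {apex}))"
    using off by auto
  ultimately have bdd: "bounded (range (pushf u))"
    using bounded_subset bounded_insert by blast
  have GD: "GDERIV (\<lambda>p. pushf u p $ i) p :> push_grad p (u (psi p)) (\<lambda>i. G i (psi p)) i"
    if "p \<in> interior pyramid" for p i
    by (rule pushf_interior[OF G that]) (rule psi_gt[OF interior_pyramidD[OF that]])
  have diff: "\<forall>p\<in>interior pyramid. pushf u differentiable (at p)"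
    using gderiv_components(1)[OF GD] by blast
  have "frechet_derivative (pushf u) (at p) (axis j 1) $ i = push_grad p (u (psi p)) (\<lambda>i. G i (psi p)) i $ j"
    if "p \<in> interior pyramid" for p i j
    using gderiv_components(2)[OF GD[OF that]] by (simp add: inner_axis')
  moreover have "continuous_on (interior pyramid) (\<lambda>p. push_grad p (u (psi p)) (\<lambda>i. G i (psi p)) i $ j)" for i j
    by (intro continuous_intros continuous_on_push_grad sub(2) cc(2) cG \<open>continuous_on {x. x$3 > -1} u\<close>)
  ultimately have cder: "continuous_on (interior pyramid) (\<lambda>p. frechet_derivative (pushf u) (at p) (axis j 1) $ i)" for i j
    by (simp cong: continuous_on_cong)
  have "bounded (curl (pushf u) ` interior pyramid)"
  proof (rule bounded_pt)
    define c1 c2 c3 where "c1 = (\<lambda>x. G 3 x $ 2 - G 2 x $ 3)" and "c2 = (\<lambda>x. G 1 x $ 3 - G 3 x $ 1)"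
      and "c3 = (\<lambda>x. G 2 x $ 1 - G 1 x $ 2)"
    have cu: "curl (pushf u) p = vector [c1 (psi p) / (1 - p$3) ^ 3 - psi p $ 1 * (c3 (psi p) / (1 - p$3) ^ 2),
      c2 (psi p) / (1 - p$3) ^ 3 - psi p $ 2 * (c3 (psi p) / (1 - p$3) ^ 2), c3 (psi p) / (1 - p$3) ^ 2]"
      if p: "p \<in> interior pyramid" for p
      using curl_pushf[OF G[OF psi_gt[OF interior_pyramidD[OF p]]] p]
      by (simp add: c1_def c2_def c3_def del: psi_nth)
    obtain C1 where C1: "\<forall>p\<in>pyramid - {apex}. \<bar>c1 (psi p) / (1 - p$3) ^ 3\<bar> \<le> C1"
      using pull[OF c(1)] by (auto simp: c1_def)
    obtain C2 where C2: "\<forall>p\<in>pyramid - {apex}. \<bar>c2 (psi p) / (1 - p$3) ^ 3\<bar> \<le> C2"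
      using pull[OF c(2)] by (auto simp: c2_def)
    obtain C3 where C3: "\<forall>p\<in>pyramid - {apex}. \<bar>c3 (psi p) / (1 - p$3) ^ 2\<bar> \<le> C3"
      using pull[OF c(3)] by (auto simp: c3_def)
    have *: "\<bar>psi p $ i * (c3 (psi p) / (1 - p$3) ^ 2)\<bar> \<le> C3" if "p \<in> pyramid - {apex}" "i = 1 \<or> i = 2" for i p
      using psi1[OF that] C3 that(1) order_trans by blast
    have "\<bar>curl (pushf u) p $ 1\<bar> \<le> C1 + C3 \<and> \<bar>curl (pushf u) p $ 2\<bar> \<le> C2 + C3 \<and> \<bar>curl (pushf u) p $ 3\<bar> \<le> C3"
      if p: "p \<in> interior pyramid" for p
    proof -
      note p' = interior_pyramidD[OF p]
      have "\<bar>c1 (psi p) / (1 - p$3) ^ 3\<bar> \<le> C1" "\<bar>c2 (psi p) / (1 - p$3) ^ 3\<bar> \<le> C2"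
        "\<bar>c3 (psi p) / (1 - p$3) ^ 2\<bar> \<le> C3" using C1 C2 C3 p' by blast+
      moreover have "\<bar>psi p $ 1 * (c3 (psi p) / (1 - p$3) ^ 2)\<bar> \<le> C3" "\<bar>psi p $ 2 * (c3 (psi p) / (1 - p$3) ^ 2)\<bar> \<le> C3"
        using *[OF p'] by blast+
      ultimately show ?thesis unfolding cu[OF p] vector_3 by linarith
    qed
    then show "\<exists>C. \<forall>p\<in>interior pyramid. \<bar>curl (pushf u) p $ 1\<bar> \<le> C"
      "\<exists>C. \<forall>p\<in>interior pyramid. \<bar>curl (pushf u) p $ 2\<bar> \<le> C"
      "\<exists>C. \<forall>p\<in>interior pyramid. \<bar>curl (pushf u) p $ 3\<bar> \<le> C" by blast+
  qed
  then show ?thesis unfolding reg_def using off cont bdd diff cder by blast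
qed

section \<open>The approximation spaces in terms of numerators\<close>

definition rfield :: "nat \<Rightarrow> (pt \<Rightarrow> real) \<Rightarrow> (pt \<Rightarrow> real) \<Rightarrow> (pt \<Rightarrow> real) \<Rightarrow> pt \<Rightarrow> pt"
  where "rfield k N1 N2 N3 p =
    vector [N1 p / (1 + p$3) ^ (k + 1), N2 p / (1 + p$3) ^ (k + 1), N3 p / (1 + p$3) ^ (k + 1)]"

lemma rfield_nth [simp]: "rfield k N1 N2 N3 p $ 1 = N1 p / (1 + p$3) ^ (k + 1)"
  "rfield k N1 N2 N3 p $ 2 = N2 p / (1 + p$3) ^ (k + 1)"
  "rfield k N1 N2 N3 p $ 3 = N3 p / (1 + p$3) ^ (k + 1)"
  by (simp_all add: rfield_def)

text \<open>Numerators over \<open>(1 + z)^(k + 1)\<close>. The function \<open>r\<close> of the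
  definition becomes \<open>R\<close>, extended to space as a polynomial constant in
  \<open>z\<close>, so that \<open>D1\<close> and \<open>D2\<close> apply to it.\<close>

definition bar_num :: "nat \<Rightarrow> (pt \<Rightarrow> real) \<Rightarrow> (pt \<Rightarrow> real) \<Rightarrow> (pt \<Rightarrow> real) \<Rightarrow> bool"
  where "bar_num k N1 N2 N3 \<longleftrightarrow> (\<exists>Q1 Q2 Q3 R.
    Q1 \<in> Qpoly (int k - 1) (int k) (int k - 1) \<and> Q2 \<in> Qpoly (int k) (int k - 1) (int k - 1) \<and>
    Q3 \<in> Qpoly (int k) (int k) (int k - 2) \<and> R \<in> Qpoly (int k) (int k) 0 \<and>
    N1 = (\<lambda>p. Q1 p + p$3 ^ k * D1 R p) \<and> N2 = (\<lambda>p. Q2 p + p$3 ^ k * D2 R p) \<and>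
    N3 = (\<lambda>p. Q3 p - p$3 ^ (k - 1) * R p))"

text \<open>\<open>D1\<close> and \<open>D2\<close> differentiate along slices and so agree with the
  \<open>deriv\<close> terms of \<open>U1_bar_inf\<close>; \<open>z^(k - 1)\<close> times
  \<open>z\<close> merges to \<open>z^k\<close> because \<open>k \<ge> 1\<close>.\<close>

lemma U1_bar_iff:
  assumes "k \<ge> 1"
  shows "u \<in> U1_bar_inf k \<longleftrightarrow> (\<exists>N1 N2 N3. bar_num k N1 N2 N3 \<and> u = rfield k N1 N2 N3)"
proof
  assume "u \<in> U1_bar_inf k"
  then obtain q1 q2 q3 r where q: "q1 \<in> Qrat (k + 1) (int k - 1) (int k) (int k - 1)"
    "q2 \<in> Qrat (k + 1) (int k) (int k - 1) (int k - 1)" "q3 \<in> Qrat (k + 1) (int k) (int k) (int k - 2)"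
    and r: "r \<in> Qpoly2 (int k) (int k)"
    and u: "u = (\<lambda>p. vector [q1 p, q2 p, q3 p] + (p$3 ^ (k - 1) / (1 + p$3) ^ (k + 1)) *\<^sub>R
          vector [deriv (\<lambda>x. r x (p$2)) (p$1) * p$3, deriv (\<lambda>y. r (p$1) y) (p$2) * p$3, - r (p$1) (p$2)])"
    unfolding U1_bar_inf_def by blast
  obtain Q1 Q2 Q3 where Q: "Q1 \<in> Qpoly (int k - 1) (int k) (int k - 1)" "Q2 \<in> Qpoly (int k) (int k - 1) (int k - 1)"
    "Q3 \<in> Qpoly (int k) (int k) (int k - 2)"
    "q1 = (\<lambda>p. Q1 p / (1 + p$3) ^ (k + 1))" "q2 = (\<lambda>p. Q2 p / (1 + p$3) ^ (k + 1))" "q3 = (\<lambda>p. Q3 p / (1 + p$3) ^ (k + 1))"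
    using q unfolding Qrat_def by blast
  define R where "R = (\<lambda>p::pt. r (p$1) (p$2))"
  have D: "D1 R p = deriv (\<lambda>x. r x (p$2)) (p$1)" "D2 R p = deriv (\<lambda>y. r (p$1) y) (p$2)" for p
    by (simp_all add: R_def D1_def D2_def)
  obtain j where j: "k = Suc j" using assms by (cases k) auto
  have "u = rfield k (\<lambda>p. Q1 p + p$3 ^ k * D1 R p) (\<lambda>p. Q2 p + p$3 ^ k * D2 R p) (\<lambda>p. Q3 p - p$3 ^ (k - 1) * R p)"
    unfolding u Q rfield_def D
    by (simp add: fun_eq_iff pt_eq_iff j R_def add_divide_distrib diff_divide_distrib mult_ac)
  moreover have "bar_num k (\<lambda>p. Q1 p + p$3 ^ k * D1 R p) (\<lambda>p. Q2 p + p$3 ^ k * D2 R p) (\<lambda>p. Q3 p - p$3 ^ (k - 1) * R p)"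
    unfolding bar_num_def using Q(1-3) Qpoly2_Qpoly[OF r] unfolding R_def by blast
  ultimately show "\<exists>N1 N2 N3. bar_num k N1 N2 N3 \<and> u = rfield k N1 N2 N3" by blast
next
  assume "\<exists>N1 N2 N3. bar_num k N1 N2 N3 \<and> u = rfield k N1 N2 N3"
  then obtain Q1 Q2 Q3 R where Q: "Q1 \<in> Qpoly (int k - 1) (int k) (int k - 1)" "Q2 \<in> Qpoly (int k) (int k - 1) (int k - 1)"
    "Q3 \<in> Qpoly (int k) (int k) (int k - 2)" and R: "R \<in> Qpoly (int k) (int k) 0"
    and u: "u = rfield k (\<lambda>p. Q1 p + p$3 ^ k * D1 R p) (\<lambda>p. Q2 p + p$3 ^ k * D2 R p) (\<lambda>p. Q3 p - p$3 ^ (k - 1) * R p)"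
    unfolding bar_num_def by blast
  define r where "r = (\<lambda>x y. R (vector [x, y, 0]))"
  have Rr: "R p = r (p$1) (p$2)" for p unfolding r_def by (rule Qpoly_no_z[OF R])
  have D: "D1 R p = deriv (\<lambda>x. r x (p$2)) (p$1)" "D2 R p = deriv (\<lambda>y. r (p$1) y) (p$2)" for p
    unfolding D1_def D2_def by (subst Rr, simp)+
  obtain j where j: "k = Suc j" using assms by (cases k) auto
  have "u = (\<lambda>p. vector [Q1 p / (1 + p$3) ^ (k + 1), Q2 p / (1 + p$3) ^ (k + 1), Q3 p / (1 + p$3) ^ (k + 1)] +
     (p$3 ^ (k - 1) / (1 + p$3) ^ (k + 1)) *\<^sub>R
          vector [deriv (\<lambda>x. r x (p$2)) (p$1) * p$3, deriv (\<lambda>y. r (p$1) y) (p$2) * p$3, - r (p$1) (p$2)])"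
    unfolding u rfield_def D Rr
    by (simp add: fun_eq_iff pt_eq_iff j add_divide_distrib diff_divide_distrib mult_ac)
  moreover have "r \<in> Qpoly2 (int k) (int k)" unfolding r_def by (rule Qpoly_Qpoly2[OF R])
  moreover have "(\<lambda>p. Q1 p / (1 + p$3) ^ (k + 1)) \<in> Qrat (k + 1) (int k - 1) (int k) (int k - 1)"
    "(\<lambda>p. Q2 p / (1 + p$3) ^ (k + 1)) \<in> Qrat (k + 1) (int k) (int k - 1) (int k - 1)"
    "(\<lambda>p. Q3 p / (1 + p$3) ^ (k + 1)) \<in> Qrat (k + 1) (int k) (int k) (int k - 2)"
    unfolding Qrat_def using Q by blast+
  ultimately show "u \<in> U1_bar_inf k"
    unfolding U1_bar_inf_def
    by (intro CollectI exI[of _ "\<lambda>p. Q1 p / (1 + p$3) ^ (k + 1)"] exI[of _ "\<lambda>p. Q2 p / (1 + p$3) ^ (k + 1)"]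
        exI[of _ "\<lambda>p. Q3 p / (1 + p$3) ^ (k + 1)"] exI[of _ r] conjI)
qed

lemma bar_num_Qpoly:
  assumes "bar_num k N1 N2 N3" "k \<ge> 1"
  shows "N1 \<in> Qpoly (int k - 1) (int k) (int k)" "N2 \<in> Qpoly (int k) (int k - 1) (int k)"
    "N3 \<in> Qpoly (int k) (int k) (int k - 1)"
proof -
  obtain Q1 Q2 Q3 R where Q: "Q1 \<in> Qpoly (int k - 1) (int k) (int k - 1)" "Q2 \<in> Qpoly (int k) (int k - 1) (int k - 1)"
    "Q3 \<in> Qpoly (int k) (int k) (int k - 2)" and R: "R \<in> Qpoly (int k) (int k) 0"
    and N: "N1 = (\<lambda>p. Q1 p + p$3 ^ k * D1 R p)" "N2 = (\<lambda>p. Q2 p + p$3 ^ k * D2 R p)" "N3 = (\<lambda>p. Q3 p - p$3 ^ (k - 1) * R p)"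
    using assms(1) unfolding bar_num_def by blast
  show "N1 \<in> Qpoly (int k - 1) (int k) (int k)" unfolding N
    by (intro Qpoly_add Qpoly_mono[OF Q(1)] Qpoly_mult[OF Qpoly_zpow Qpoly_D1[OF R]]) auto
  show "N2 \<in> Qpoly (int k) (int k - 1) (int k)" unfolding N
    by (intro Qpoly_add Qpoly_mono[OF Q(2)] Qpoly_mult[OF Qpoly_zpow Qpoly_D2[OF R]]) auto
  have "(\<lambda>p. p$3 ^ (k - 1) * R p) \<in> Qpoly (int k) (int k) (int k - 1)"
    using assms(2) by (intro Qpoly_mult[OF Qpoly_zpow R]) auto
  then show "N3 \<in> Qpoly (int k) (int k) (int k - 1)" unfolding N
    by (intro Qpoly_diff Qpoly_mono[OF Q(3)]) auto
qed

definition rgrad :: "nat \<Rightarrow> (pt \<Rightarrow> real) \<Rightarrow> pt \<Rightarrow> pt"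
  where "rgrad m N p = vector [D1 N p / (1 + p$3) ^ m, D2 N p / (1 + p$3) ^ m,
    ((1 + p$3) * D3 N p - real m * N p) / (1 + p$3) ^ (m + 1)]"

lemma rgrad_nth [simp]: "rgrad m N p $ 1 = D1 N p / (1 + p$3) ^ m" "rgrad m N p $ 2 = D2 N p / (1 + p$3) ^ m"
  "rgrad m N p $ 3 = ((1 + p$3) * D3 N p - real m * N p) / (1 + p$3) ^ (m + 1)"
  by (simp_all add: rgrad_def)

lemma GDERIV_rat:
  assumes "N \<in> Qpoly l m n" "p$3 > -1"
  shows "GDERIV (\<lambda>p. N p / (1 + p$3) ^ j) p :> rgrad j N p"
proof -
  have nz: "1 + p$3 \<noteq> 0" using assms by linarith
  have 1: "GDERIV (\<lambda>p::pt. 1 + p$3) p :> axis 3 1"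
    by (rule GDERIV_subst, rule GDERIV_add[OF GDERIV_const GDERIV_nth]) simp
  have 2: "GDERIV (\<lambda>p::pt. inverse ((1 + p$3) ^ j)) p :> - (inverse ((1 + p$3) ^ j))\<^sup>2 *\<^sub>R ((real j * (1 + p$3) ^ (j - 1)) *\<^sub>R axis 3 1)"
    using nz by (intro GDERIV_inverse GDERIV_power 1) auto
  have 3: "GDERIV (\<lambda>p. N p * inverse ((1 + p$3) ^ j)) p :> rgrad j N p"
  proof (rule GDERIV_subst, rule GDERIV_mult[OF Qpoly_GDERIV[OF assms(1)] 2])
    define t where "t = 1 + p$3"
    have "t \<noteq> 0" using nz by (simp add: t_def)
    then show "N p *\<^sub>R (- (inverse ((1 + p$3) ^ j))\<^sup>2 *\<^sub>R ((real j * (1 + p$3) ^ (j - 1)) *\<^sub>R axis 3 1)) +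
        inverse ((1 + p$3) ^ j) *\<^sub>R vector [D1 N p, D2 N p, D3 N p] = rgrad j N p"
      unfolding t_def[symmetric]
      by (cases j; simp add: pt_eq_iff axis_def rgrad_def t_def[symmetric] field_simps power2_eq_square)
  qed
  then show ?thesis by (simp add: divide_inverse)
qed

lemma continuous_on_rgrad:
  assumes "N \<in> Qpoly l m n"
  shows "continuous_on {p. p$3 > -1} (rgrad j N)"
proof (rule continuous_on_pt)
  fix i :: 3
  note c = Qpoly_continuous[OF assms] Qpoly_continuous[OF Qpoly_D1[OF assms]]
    Qpoly_continuous[OF Qpoly_D2[OF assms]] Qpoly_continuous[OF Qpoly_D3[OF assms]]
  have "continuous_on {p. p$3 > -1} (\<lambda>p. rgrad j N p $ 1)" "continuous_on {p. p$3 > -1} (\<lambda>p. rgrad j N p $ 2)"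
    "continuous_on {p. p$3 > -1} (\<lambda>p. rgrad j N p $ 3)"
    unfolding rgrad_nth by (auto intro!: continuous_intros c)
  then show "continuous_on {p. p$3 > -1} (\<lambda>p. rgrad j N p $ i)" using exhaust_3[of i] by auto
qed

lemma rat_bound:
  assumes "f \<in> Qpoly l m n" "n + int i \<le> int j"
  shows "\<exists>C. \<forall>x\<in>inf_pyramid. \<bar>f x / (1 + x$3) ^ j\<bar> * (1 + x$3) ^ i \<le> C"
proof -
  obtain C where C: "\<forall>p\<in>inf_pyramid. \<bar>f p\<bar> * (1 + p$3) ^ i \<le> C * (1 + p$3) ^ j"
    using Qpoly_bound[OF assms] by blast
  have "\<bar>f x / (1 + x$3) ^ j\<bar> * (1 + x$3) ^ i \<le> C" if x: "x \<in> inf_pyramid" for x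
  proof -
    have "1 + x$3 > 0" using x by (auto simp: inf_pyramid_def)
    then have "(1 + x$3) ^ j > 0" by simp
    then show ?thesis using C[rule_format, OF x] by (simp add: field_simps abs_mult)
  qed
  then show ?thesis by blast
qed

text \<open>The horizontal numerators have degree \<open>k\<close> in \<open>z\<close>, so by
  counting degrees the curl would be one order too large. The top terms come from \<open>R\<close>
  alone, and they cancel: in the third component of the curl because mixed derivatives commute, in
  the other two because of how \<open>z^k\<close> and \<open>z^(k-1)\<close> are balanced in the
  field.\<close>

lemma reg_bar:
  assumes bn: "bar_num k N1 N2 N3" and k: "k \<ge> 1"
  shows "reg (pushf (rfield k N1 N2 N3))"
proof -
  obtain Q1 Q2 Q3 R where Q: "Q1 \<in> Qpoly (int k - 1) (int k) (int k - 1)" "Q2 \<in> Qpoly (int k) (int k - 1) (int k - 1)"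
    "Q3 \<in> Qpoly (int k) (int k) (int k - 2)" and R: "R \<in> Qpoly (int k) (int k) 0"
    and N: "N1 = (\<lambda>p. Q1 p + p$3 ^ k * D1 R p)" "N2 = (\<lambda>p. Q2 p + p$3 ^ k * D2 R p)" "N3 = (\<lambda>p. Q3 p - p$3 ^ (k - 1) * R p)"
    using bn unfolding bar_num_def by blast
  obtain j where j: "k = Suc j" using k by (cases k) auto
  note NQ = bar_num_Qpoly[OF bn k]
  define G where "G = (\<lambda>i::3. rgrad (k + 1) (if i = 1 then N1 else if i = 2 then N2 else N3))"
  have G: "GDERIV (\<lambda>x. rfield k N1 N2 N3 x $ i) x :> G i x" if "x$3 > -1" for i x
  proof -
    have "GDERIV (\<lambda>x. rfield k N1 N2 N3 x $ 1) x :> rgrad (k + 1) N1 x"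
      "GDERIV (\<lambda>x. rfield k N1 N2 N3 x $ 2) x :> rgrad (k + 1) N2 x"
      "GDERIV (\<lambda>x. rfield k N1 N2 N3 x $ 3) x :> rgrad (k + 1) N3 x"
      unfolding rfield_nth
      using GDERIV_rat[OF NQ(1) that] GDERIV_rat[OF NQ(2) that] GDERIV_rat[OF NQ(3) that] by blast+
    then show ?thesis using exhaust_3[of i] unfolding G_def by (elim disjE) simp_all
  qed
  have cG: "continuous_on {x. x$3 > -1} (G i)" for i
    using continuous_on_rgrad[OF NQ(1)] continuous_on_rgrad[OF NQ(2)] continuous_on_rgrad[OF NQ(3)]
    by (auto simp: G_def)
  have DD: "D2 (D1 R) = D1 (D2 R)" "D3 (D1 R) = (\<lambda>_. 0)" "D3 (D2 R) = (\<lambda>_. 0)"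
    using Qpoly_D_commute[OF R] Qpoly_neg[OF Qpoly_D3[OF Qpoly_D1[OF R]]] Qpoly_neg[OF Qpoly_D3[OF Qpoly_D2[OF R]]] by auto
  have Z: "GDERIV (\<lambda>p::pt. p$3 ^ n) p :> (real n * p$3 ^ (n - 1)) *\<^sub>R axis 3 1" for n p
    by (intro GDERIV_power GDERIV_nth)
  have D_N: "D2 N1 p = D2 Q1 p + p$3 ^ k * D1 (D2 R) p" "D3 N1 p = D3 Q1 p + real k * p$3 ^ (k - 1) * D1 R p"
    "D1 N2 p = D1 Q2 p + p$3 ^ k * D1 (D2 R) p" "D3 N2 p = D3 Q2 p + real k * p$3 ^ (k - 1) * D2 R p"
    "D1 N3 p = D1 Q3 p - p$3 ^ (k - 1) * D1 R p" "D2 N3 p = D2 Q3 p - p$3 ^ (k - 1) * D2 R p" for p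
    unfolding N
    using GDERIV_D[OF GDERIV_add[OF Qpoly_GDERIV[OF Q(1)] GDERIV_mult[OF Z[of k p] Qpoly_GDERIV[OF Qpoly_D1[OF R]]]]]
      GDERIV_D[OF GDERIV_add[OF Qpoly_GDERIV[OF Q(2)] GDERIV_mult[OF Z[of k p] Qpoly_GDERIV[OF Qpoly_D2[OF R]]]]]
      GDERIV_D[OF GDERIV_diff[OF Qpoly_GDERIV[OF Q(3)] GDERIV_mult[OF Z[of "k - 1" p] Qpoly_GDERIV[OF R]]]]
    by (simp_all add: DD axis_def mult_ac)
  have N': "N1 p = Q1 p + p$3 ^ k * D1 R p" "N2 p = Q2 p + p$3 ^ k * D2 R p" for p
    by (simp_all add: N)
  \<comment> \<open>In \<open>M1\<close> the contribution of \<open>R\<close> is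
    \<open>-(k+1) z^(k-1) (1+z) D2 R + (k+1) z^k D2 R\<close>, that is
    \<open>-(k+1) z^(k-1) D2 R\<close>; in \<open>M2\<close> it is
    \<open>(k+1) z^(k-1) D1 R\<close>. All three numerators thus have degree at most
    \<open>k - 1\<close> in \<open>z\<close>, which is just what the bounds demand.\<close>
  define M1 where "M1 = (\<lambda>p. (1 + p$3) * (D2 Q3 p - D3 Q2 p) + real (k + 1) * (Q2 p - p$3 ^ (k - 1) * D2 R p))"
  define M2 where "M2 = (\<lambda>p. (1 + p$3) * (D3 Q1 p - D1 Q3 p) + real (k + 1) * (p$3 ^ (k - 1) * D1 R p - Q1 p))"
  define M3 where "M3 = (\<lambda>p. D1 Q2 p - D2 Q1 p)"
  have M: "M1 \<in> Qpoly (int k) (int k) (int k - 1)" "M2 \<in> Qpoly (int k) (int k) (int k - 1)" "M3 \<in> Qpoly (int k) (int k) (int k - 1)"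
  proof -
    have a: "(\<lambda>p. p$3 ^ (k - 1) * D1 R p) \<in> Qpoly (int k) (int k) (int k - 1)" "(\<lambda>p. p$3 ^ (k - 1) * D2 R p) \<in> Qpoly (int k) (int k) (int k - 1)"
      using k by (intro Qpoly_mult[OF Qpoly_zpow Qpoly_D1[OF R]] Qpoly_mult[OF Qpoly_zpow Qpoly_D2[OF R]]; simp)+
    have b: "(\<lambda>p. D2 Q3 p - D3 Q2 p) \<in> Qpoly (int k) (int k) (int k - 2)" "(\<lambda>p. D3 Q1 p - D1 Q3 p) \<in> Qpoly (int k) (int k) (int k - 2)"
      by (intro Qpoly_diff Qpoly_mono[OF Qpoly_D2[OF Q(3)]] Qpoly_mono[OF Qpoly_D3[OF Q(2)]]
          Qpoly_mono[OF Qpoly_D1[OF Q(3)]] Qpoly_mono[OF Qpoly_D3[OF Q(1)]]; simp)+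
    show "M1 \<in> Qpoly (int k) (int k) (int k - 1)" "M2 \<in> Qpoly (int k) (int k) (int k - 1)"
      unfolding M1_def M2_def
      by (intro Qpoly_add Qpoly_cmult Qpoly_diff a Qpoly_mono[OF Q(1)] Qpoly_mono[OF Q(2)]
          Qpoly_mult[OF Qpoly_1z b(1)] Qpoly_mult[OF Qpoly_1z b(2)]; simp)+
    show "M3 \<in> Qpoly (int k) (int k) (int k - 1)"
      unfolding M3_def by (intro Qpoly_diff Qpoly_mono[OF Qpoly_D1[OF Q(2)]] Qpoly_mono[OF Qpoly_D2[OF Q(1)]]; simp)
  qed
  have c: "G 3 x $ 2 - G 2 x $ 3 = M1 x / (1 + x$3) ^ (k + 2)" "G 1 x $ 3 - G 3 x $ 1 = M2 x / (1 + x$3) ^ (k + 2)"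
    "G 2 x $ 1 - G 1 x $ 2 = M3 x / (1 + x$3) ^ (k + 1)" if "x \<in> inf_pyramid" for x
  proof -
    have nz: "1 + x$3 \<noteq> 0" using that by (auto simp: inf_pyramid_def)
    define t where "t = 1 + x$3"
    have x3: "x$3 = t - 1" by (simp add: t_def)
    have tn: "t \<noteq> 0" using nz by (simp add: t_def)
    have d: "a / t ^ (k + 1) = a * t / t ^ (k + 2)" for a using tn by simp
    have n: "(2::3) \<noteq> 1" "(3::3) \<noteq> 1" "(3::3) \<noteq> 2" by auto
    show "G 2 x $ 1 - G 1 x $ 2 = M3 x / (1 + x$3) ^ (k + 1)"
      using n by (simp add: G_def M3_def D_N diff_divide_distrib[symmetric])
    have "G 3 x $ 2 - G 2 x $ 3 = (D2 N3 x * t - (t * D3 N2 x - real (k + 1) * N2 x)) / t ^ (k + 2)"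
      using n by (simp add: G_def t_def[symmetric] d[unfolded add_2_eq_Suc' Suc_eq_plus1[symmetric]] diff_divide_distrib add_divide_distrib del: power_Suc)
    also have "D2 N3 x * t - (t * D3 N2 x - real (k + 1) * N2 x) = M1 x"
      unfolding D_N M1_def t_def N'(2) by (simp add: j algebra_simps)
    finally show "G 3 x $ 2 - G 2 x $ 3 = M1 x / (1 + x$3) ^ (k + 2)" by (simp add: t_def)
    have "G 1 x $ 3 - G 3 x $ 1 = (t * D3 N1 x - real (k + 1) * N1 x - D1 N3 x * t) / t ^ (k + 2)"
      using n by (simp add: G_def t_def[symmetric] d[unfolded add_2_eq_Suc' Suc_eq_plus1[symmetric]] diff_divide_distrib add_divide_distrib del: power_Suc)
    also have "t * D3 N1 x - real (k + 1) * N1 x - D1 N3 x * t = M2 x"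
      unfolding D_N M2_def t_def N'(1) by (simp add: j algebra_simps)
    finally show "G 1 x $ 3 - G 3 x $ 1 = M2 x / (1 + x$3) ^ (k + 2)" by (simp add: t_def)
  qed
  show ?thesis
  proof (rule reg_pushf[of "rfield k N1 N2 N3" G, OF G cG])
    show "\<exists>C. \<forall>x\<in>inf_pyramid. \<bar>rfield k N1 N2 N3 x $ 1\<bar> * (1 + x$3) ^ 1 \<le> C"
      unfolding rfield_nth by (rule rat_bound[OF NQ(1)]) simp
    show "\<exists>C. \<forall>x\<in>inf_pyramid. \<bar>rfield k N1 N2 N3 x $ 2\<bar> * (1 + x$3) ^ 1 \<le> C"
      unfolding rfield_nth by (rule rat_bound[OF NQ(2)]) simp
    show "\<exists>C. \<forall>x\<in>inf_pyramid. \<bar>rfield k N1 N2 N3 x $ 3\<bar> * (1 + x$3)\<^sup>2 \<le> C"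
      unfolding rfield_nth by (rule rat_bound[OF NQ(3)]) simp
    show "\<exists>C. \<forall>x\<in>inf_pyramid. \<bar>G 3 x $ 2 - G 2 x $ 3\<bar> * (1 + x$3) ^ 3 \<le> C"
      using rat_bound[OF M(1), of 3 "k + 2"] by (simp add: c cong: ball_cong)
    show "\<exists>C. \<forall>x\<in>inf_pyramid. \<bar>G 1 x $ 3 - G 3 x $ 1\<bar> * (1 + x$3) ^ 3 \<le> C"
      using rat_bound[OF M(2), of 3 "k + 2"] by (simp add: c cong: ball_cong)
    show "\<exists>C. \<forall>x\<in>inf_pyramid. \<bar>G 2 x $ 1 - G 1 x $ 2\<bar> * (1 + x$3)\<^sup>2 \<le> C"
      using rat_bound[OF M(3), of 2 "k + 1"] by (simp add: c cong: ball_cong)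
  qed auto
qed

lemma bar_num_lin:
  assumes "bar_num k N1 N2 N3" "bar_num k N1' N2' N3'"
  shows "bar_num k (\<lambda>p. c * N1 p + N1' p) (\<lambda>p. c * N2 p + N2' p) (\<lambda>p. c * N3 p + N3' p)"
proof -
  obtain Q1 Q2 Q3 R where Q: "Q1 \<in> Qpoly (int k - 1) (int k) (int k - 1)" "Q2 \<in> Qpoly (int k) (int k - 1) (int k - 1)"
    "Q3 \<in> Qpoly (int k) (int k) (int k - 2)" and R: "R \<in> Qpoly (int k) (int k) 0"
    and N: "N1 = (\<lambda>p. Q1 p + p$3 ^ k * D1 R p)" "N2 = (\<lambda>p. Q2 p + p$3 ^ k * D2 R p)" "N3 = (\<lambda>p. Q3 p - p$3 ^ (k - 1) * R p)"
    using assms(1) unfolding bar_num_def by blast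
  obtain Q1' Q2' Q3' R' where Q': "Q1' \<in> Qpoly (int k - 1) (int k) (int k - 1)" "Q2' \<in> Qpoly (int k) (int k - 1) (int k - 1)"
    "Q3' \<in> Qpoly (int k) (int k) (int k - 2)" and R': "R' \<in> Qpoly (int k) (int k) 0"
    and N': "N1' = (\<lambda>p. Q1' p + p$3 ^ k * D1 R' p)" "N2' = (\<lambda>p. Q2' p + p$3 ^ k * D2 R' p)" "N3' = (\<lambda>p. Q3' p - p$3 ^ (k - 1) * R' p)"
    using assms(2) unfolding bar_num_def by blast
  note L = D_linear[OF Qpoly_GDERIV[OF R] Qpoly_GDERIV[OF R'], of c]
  have e: "(\<lambda>p. c * N1 p + N1' p) = (\<lambda>p. (c * Q1 p + Q1' p) + p$3 ^ k * D1 (\<lambda>p. c * R p + R' p) p)"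
    "(\<lambda>p. c * N2 p + N2' p) = (\<lambda>p. (c * Q2 p + Q2' p) + p$3 ^ k * D2 (\<lambda>p. c * R p + R' p) p)"
    "(\<lambda>p. c * N3 p + N3' p) = (\<lambda>p. (c * Q3 p + Q3' p) - p$3 ^ (k - 1) * (c * R p + R' p))"
    unfolding L N N' by (simp_all add: fun_eq_iff algebra_simps)
  show ?thesis
    unfolding bar_num_def
    using e
    by (intro exI[of _ "\<lambda>p. c * Q1 p + Q1' p"] exI[of _ "\<lambda>p. c * Q2 p + Q2' p"]
        exI[of _ "\<lambda>p. c * Q3 p + Q3' p"] exI[of _ "\<lambda>p. c * R p + R' p"] conjI Qpoly_add Qpoly_cmult Q Q' R R')
qed

lemma bar_num_I:
  assumes "N1 \<in> Qpoly (int k - 1) (int k) (int k - 1)" "N2 \<in> Qpoly (int k) (int k - 1) (int k - 1)"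
    "N3 \<in> Qpoly (int k) (int k) (int k - 2)"
  shows "bar_num k N1 N2 N3"
proof -
  have "D1 (\<lambda>_. 0) = (\<lambda>_. 0)" "D2 (\<lambda>_. 0) = (\<lambda>_. 0)"
    by (auto simp: fun_eq_iff GDERIV_D[OF GDERIV_const])
  then show ?thesis
    unfolding bar_num_def using assms
    by (intro exI[of _ N1] exI[of _ N2] exI[of _ N3] exI[of _ "\<lambda>_. 0"]) (auto simp: Qpoly_zero)
qed

lemma bar_num_swap:
  assumes "bar_num k N1 N2 N3"
  shows "bar_num k (\<lambda>p. N2 (swap12 p)) (\<lambda>p. N1 (swap12 p)) (\<lambda>p. N3 (swap12 p))"
proof -
  obtain Q1 Q2 Q3 R where Q: "Q1 \<in> Qpoly (int k - 1) (int k) (int k - 1)" "Q2 \<in> Qpoly (int k) (int k - 1) (int k - 1)"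
    "Q3 \<in> Qpoly (int k) (int k) (int k - 2)" and R: "R \<in> Qpoly (int k) (int k) 0"
    and N: "N1 = (\<lambda>p. Q1 p + p$3 ^ k * D1 R p)" "N2 = (\<lambda>p. Q2 p + p$3 ^ k * D2 R p)" "N3 = (\<lambda>p. Q3 p - p$3 ^ (k - 1) * R p)"
    using assms(1) unfolding bar_num_def by blast
  have D: "D1 (\<lambda>p. R (swap12 p)) p = D2 R (swap12 p)" "D2 (\<lambda>p. R (swap12 p)) p = D1 R (swap12 p)" for p
    by (simp_all add: D1_def D2_def)
  show ?thesis
    unfolding bar_num_def
    by (rule exI[of _ "\<lambda>p. Q2 (swap12 p)"], rule exI[of _ "\<lambda>p. Q1 (swap12 p)"],
        rule exI[of _ "\<lambda>p. Q3 (swap12 p)"], rule exI[of _ "\<lambda>p. R (swap12 p)"])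
      (auto simp: D N intro!: Qpoly_swap12 Q R)
qed

text \<open>The vertical faces are \<open>y = s\<close> (\<open>b = True\<close>) and \<open>x = s\<close> (\<open>b = False\<close>), for \<open>s\<close> equal to
  \<open>0\<close> or \<open>1\<close>.\<close>

definition ix :: "bool \<Rightarrow> 3" where "ix b = (if b then 1 else 2)"

definition face_point :: "bool \<Rightarrow> real \<Rightarrow> real \<Rightarrow> real \<Rightarrow> pt"
  where "face_point b w s z = vector [if b then w else s, if b then s else w, z]"

lemma face_point_nth [simp]: "face_point b w s z $ 1 = (if b then w else s)" "face_point b w s z $ 2 = (if b then s else w)"
  "face_point b w s z $ 3 = z" "face_point b w s z $ ix b = w" "face_point b w s z $ ix (\<not> b) = s"
  by (auto simp: face_point_def ix_def)

section \<open>Tangential traces on the vertical faces in terms of numerators\<close>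

definition Hom :: "nat \<Rightarrow> (real \<Rightarrow> real \<Rightarrow> real) set"
  where "Hom k = span {\<lambda>w z. w ^ a * (1 + z) ^ (k - 1 - a) | a. a \<le> k - 1}"

text \<open>The admissible traces with the common factor \<open>(1 + z)^(k + 1)\<close> cleared.
  Equality is only asked for on the face itself, as in \<open>U1_inf\<close>.\<close>

definition trace_num :: "nat \<Rightarrow> (real \<Rightarrow> real \<Rightarrow> real) \<Rightarrow> (real \<Rightarrow> real \<Rightarrow> real) \<Rightarrow> bool"
  where "trace_num k f g \<longleftrightarrow> (\<exists>A \<in> Ppoly2 (int k - 1). \<exists>B \<in> Ppoly2 (int k - 1). \<exists>S \<in> Hom k.
    \<forall>w\<in>{0..1}. \<forall>z\<ge>0. f w z = A w z + S w z * (1 + z) \<and> g w z = B w z - S w z * w)"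

lemma Hom_lin: "S \<in> Hom k \<Longrightarrow> T \<in> Hom k \<Longrightarrow> (\<lambda>w z. c * S w z + T w z) \<in> Hom k"
  unfolding Hom_def using span_add[OF span_scale[of S _ c], of _ T] by (simp add: plus_fun_def scaleR_fun_def)

lemma Hom_zero: "(\<lambda>w z. 0) \<in> Hom k"
proof -
  have "0 \<in> Hom k" unfolding Hom_def by (rule span_zero)
  then show ?thesis by (simp add: zero_fun_def)
qed

lemma Hom_pow: "(\<lambda>w z. c * (1 + z) ^ (k - 1)) \<in> Hom k"
proof -
  have "(\<lambda>w z::real. w ^ 0 * (1 + z) ^ (k - 1 - 0)) \<in> Hom k"
    unfolding Hom_def by (rule span_base) (intro CollectI exI[of _ 0] conjI; simp)
  from Hom_lin[OF this Hom_zero] show ?thesis by simp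
qed

lemma trace_num_lin:
  assumes "trace_num k f g" "trace_num k f' g'"
  shows "trace_num k (\<lambda>w z. c * f w z + f' w z) (\<lambda>w z. c * g w z + g' w z)"
proof -
  obtain A B S where 1: "A \<in> Ppoly2 (int k - 1)" "B \<in> Ppoly2 (int k - 1)" "S \<in> Hom k"
    "\<forall>w\<in>{0..1}. \<forall>z\<ge>0. f w z = A w z + S w z * (1 + z) \<and> g w z = B w z - S w z * w"
    using assms(1) unfolding trace_num_def by blast
  obtain A' B' S' where 2: "A' \<in> Ppoly2 (int k - 1)" "B' \<in> Ppoly2 (int k - 1)" "S' \<in> Hom k"
    "\<forall>w\<in>{0..1}. \<forall>z\<ge>0. f' w z = A' w z + S' w z * (1 + z) \<and> g' w z = B' w z - S' w z * w"
    using assms(2) unfolding trace_num_def by blast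
  have *: "c * f w z + f' w z = c * A w z + A' w z + (c * S w z + S' w z) * (1 + z) \<and>
    c * g w z + g' w z = c * B w z + B' w z - (c * S w z + S' w z) * w" if "w \<in> {0..1}" "z \<ge> 0" for w z
  proof -
    have e: "f w z = A w z + S w z * (1 + z)" "g w z = B w z - S w z * w"
      "f' w z = A' w z + S' w z * (1 + z)" "g' w z = B' w z - S' w z * w"
      using 1(4) 2(4) that by blast+
    show ?thesis unfolding e by (simp add: algebra_simps)
  qed
  show ?thesis
    unfolding trace_num_def
    by (intro bexI[OF _ Ppoly2_add[OF Ppoly2_cmult[OF 1(1), of c] 2(1)]]
        bexI[OF _ Ppoly2_add[OF Ppoly2_cmult[OF 1(2), of c] 2(2)]] bexI[OF _ Hom_lin[OF 1(3) 2(3), of c]]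
        ballI allI impI) (rule *)
qed

lemma trace_num_poly:
  "A \<in> Ppoly2 (int k - 1) \<Longrightarrow> B \<in> Ppoly2 (int k - 1) \<Longrightarrow>
    (\<And>w z. w \<in> {0..1} \<Longrightarrow> z \<ge> 0 \<Longrightarrow> f w z = A w z \<and> g w z = B w z) \<Longrightarrow> trace_num k f g"
  unfolding trace_num_def by (intro bexI[of _ A] bexI[of _ B] bexI[OF _ Hom_zero]) auto

lemma trace_num_zero: "(\<And>w z. w \<in> {0..1} \<Longrightarrow> z \<ge> 0 \<Longrightarrow> f w z = 0 \<and> g w z = 0) \<Longrightarrow> trace_num k f g"
  using trace_num_poly[OF Ppoly2_zero Ppoly2_zero] by blast

lemma tangential_traces_iff:
  assumes "\<And>w z. w \<in> {0..1} \<Longrightarrow> z \<ge> 0 \<Longrightarrow> F w z = f w z / (1 + z) ^ (k + 1) \<and> G w z = g w z / (1 + z) ^ (k + 1)"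
  shows "(\<exists>(f, g) \<in> tangential_traces k. \<forall>w\<in>{0..1}. \<forall>z\<ge>0. F w z = f w z \<and> G w z = g w z) \<longleftrightarrow> trace_num k f g"
proof
  assume "\<exists>(f, g) \<in> tangential_traces k. \<forall>w\<in>{0..1}. \<forall>z\<ge>0. F w z = f w z \<and> G w z = g w z"
  then obtain A B S where 1: "A \<in> Ppoly2 (int k - 1)" "B \<in> Ppoly2 (int k - 1)" "S \<in> Hom k"
    and 2: "\<forall>w\<in>{0..1}. \<forall>z\<ge>0. F w z = A w z / (1 + z) ^ (k + 1) + S w z / (1 + z) ^ (k + 1) * (1 + z) \<and>
       G w z = B w z / (1 + z) ^ (k + 1) - S w z / (1 + z) ^ (k + 1) * w"
    unfolding tangential_traces_def Prat2_def Ptilde_def Hom_def by auto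
  have "f w z = A w z + S w z * (1 + z) \<and> g w z = B w z - S w z * w" if "w \<in> {0..1}" "z \<ge> 0" for w z
  proof -
    have p: "(1 + z) ^ (k + 1) > 0" using that by simp
    have "f w z / (1 + z) ^ (k + 1) = (A w z + S w z * (1 + z)) / (1 + z) ^ (k + 1)"
      "g w z / (1 + z) ^ (k + 1) = (B w z - S w z * w) / (1 + z) ^ (k + 1)"
      using 2[rule_format, OF that] assms[OF that] by (auto simp: add_divide_distrib diff_divide_distrib)
    with p show ?thesis by (auto simp del: power_Suc)
  qed
  then show "trace_num k f g" unfolding trace_num_def using 1 by blast
next
  assume "trace_num k f g"
  then obtain A B S where 1: "A \<in> Ppoly2 (int k - 1)" "B \<in> Ppoly2 (int k - 1)" "S \<in> Hom k"
    and 2: "\<forall>w\<in>{0..1}. \<forall>z\<ge>0. f w z = A w z + S w z * (1 + z) \<and> g w z = B w z - S w z * w"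
    unfolding trace_num_def by blast
  define a b s where "a = (\<lambda>w z. A w z / (1 + z) ^ (k + 1))" and "b = (\<lambda>w z. B w z / (1 + z) ^ (k + 1))"
    and "s = (\<lambda>w z. S w z / (1 + z) ^ (k + 1))"
  have "a \<in> Prat2 (k + 1) (int k - 1)" "b \<in> Prat2 (k + 1) (int k - 1)" "s \<in> Ptilde k"
    unfolding a_def b_def s_def Prat2_def Ptilde_def using 1 unfolding Hom_def by blast+
  then have "(\<lambda>w z. a w z + s w z * (1 + z), \<lambda>w z. b w z - s w z * w) \<in> tangential_traces k"
    unfolding tangential_traces_def by blast
  moreover have "F w z = a w z + s w z * (1 + z) \<and> G w z = b w z - s w z * w" if "w \<in> {0..1}" "z \<ge> 0" for w z
    using 2 assms[OF that] that by (auto simp: a_def b_def s_def add_divide_distrib diff_divide_distrib)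
  ultimately show "\<exists>(f, g) \<in> tangential_traces k. \<forall>w\<in>{0..1}. \<forall>z\<ge>0. F w z = f w z \<and> G w z = g w z"
    by (intro bexI) auto
qed

definition U_num :: "nat \<Rightarrow> (pt \<Rightarrow> real) \<Rightarrow> (pt \<Rightarrow> real) \<Rightarrow> (pt \<Rightarrow> real) \<Rightarrow> bool"
  where "U_num k N1 N2 N3 \<longleftrightarrow> bar_num k N1 N2 N3 \<and> (\<forall>b. \<forall>s\<in>{0,1}.
    trace_num k (\<lambda>w z. (if b then N1 else N2) (face_point b w s z)) (\<lambda>w z. N3 (face_point b w s z)))"

lemma U1_inf_iff:
  assumes "k \<ge> 1"
  shows "u \<in> U1_inf k \<longleftrightarrow> (\<exists>N1 N2 N3. U_num k N1 N2 N3 \<and> u = rfield k N1 N2 N3)"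
proof -
  have t1: "(\<exists>(f, g) \<in> tangential_traces k. \<forall>x\<in>{0..1}. \<forall>z\<ge>0.
      rfield k N1 N2 N3 (vector [x, s, z]) $ 1 = f x z \<and> rfield k N1 N2 N3 (vector [x, s, z]) $ 3 = g x z) \<longleftrightarrow>
     trace_num k (\<lambda>w z. N1 (face_point True w s z)) (\<lambda>w z. N3 (face_point True w s z))" for N1 N2 N3 s
    by (rule tangential_traces_iff) (simp add: face_point_def)
  have t2: "(\<exists>(f, g) \<in> tangential_traces k. \<forall>x\<in>{0..1}. \<forall>z\<ge>0.
      rfield k N1 N2 N3 (vector [s, x, z]) $ 2 = f x z \<and> rfield k N1 N2 N3 (vector [s, x, z]) $ 3 = g x z) \<longleftrightarrow>
     trace_num k (\<lambda>w z. N2 (face_point False w s z)) (\<lambda>w z. N3 (face_point False w s z))" for N1 N2 N3 s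
    by (rule tangential_traces_iff) (simp add: face_point_def)
  have M: "rfield k N1 N2 N3 \<in> U1_inf k \<longleftrightarrow> rfield k N1 N2 N3 \<in> U1_bar_inf k \<and>
    (\<forall>b. \<forall>s\<in>{0,1}. trace_num k (\<lambda>w z. (if b then N1 else N2) (face_point b w s z)) (\<lambda>w z. N3 (face_point b w s z)))" for N1 N2 N3
    unfolding U1_inf_def mem_Collect_eq t1 t2 all_bool_eq by auto
  show ?thesis
  proof
    assume u: "u \<in> U1_inf k"
    then have "u \<in> U1_bar_inf k" by (simp add: U1_inf_def)
    then obtain N1 N2 N3 where N: "bar_num k N1 N2 N3" "u = rfield k N1 N2 N3"
      using U1_bar_iff[OF assms] by blast
    have "U_num k N1 N2 N3" unfolding U_num_def using N(1) u[unfolded N(2) M] by blast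
    then show "\<exists>N1 N2 N3. U_num k N1 N2 N3 \<and> u = rfield k N1 N2 N3" using N(2) by blast
  next
    assume "\<exists>N1 N2 N3. U_num k N1 N2 N3 \<and> u = rfield k N1 N2 N3"
    then obtain N1 N2 N3 where N: "U_num k N1 N2 N3" and u: "u = rfield k N1 N2 N3" by blast
    have "rfield k N1 N2 N3 \<in> U1_bar_inf k"
      using N U1_bar_iff[OF assms] unfolding U_num_def by blast
    then show "u \<in> U1_inf k" unfolding u M using N unfolding U_num_def by blast
  qed
qed

lemma U1_iff:
  assumes "k \<ge> 1"
  shows "E \<in> U1 k \<longleftrightarrow> (\<exists>N1 N2 N3. U_num k N1 N2 N3 \<and> E = pushf (rfield k N1 N2 N3))"
  unfolding U1_def push1_iff Bex_def U1_inf_iff[OF assms] by blast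

lemma reg_U1: "E \<in> U1 k \<Longrightarrow> k \<ge> 1 \<Longrightarrow> reg E"
  by (auto simp: U1_iff U_num_def intro: reg_bar)

lemma U_num_lin:
  assumes "U_num k N1 N2 N3" "U_num k N1' N2' N3'"
  shows "U_num k (\<lambda>p. c * N1 p + N1' p) (\<lambda>p. c * N2 p + N2' p) (\<lambda>p. c * N3 p + N3' p)"
  unfolding U_num_def
proof (intro conjI allI ballI)
  fix b and s :: real assume s: "s \<in> {0,1}"
  have "trace_num k (\<lambda>w z. c * (if b then N1 else N2) (face_point b w s z) + (if b then N1' else N2') (face_point b w s z))
    (\<lambda>w z. c * N3 (face_point b w s z) + N3' (face_point b w s z))"
    using assms s unfolding U_num_def by (intro trace_num_lin) blast+
  then show "trace_num k (\<lambda>w z. (if b then \<lambda>p. c * N1 p + N1' p else (\<lambda>p. c * N2 p + N2' p)) (face_point b w s z))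
      (\<lambda>w z. c * N3 (face_point b w s z) + N3' (face_point b w s z))" by (cases b) auto
qed (use assms bar_num_lin in \<open>auto simp: U_num_def\<close>)

lemma U_num_swap:
  assumes "U_num k N1 N2 N3"
  shows "U_num k (\<lambda>p. N2 (swap12 p)) (\<lambda>p. N1 (swap12 p)) (\<lambda>p. N3 (swap12 p))"
proof -
  have sw: "swap12 (face_point b w s z) = face_point (\<not> b) w s z" for b w s z by (simp add: pt_eq_iff)
  have "trace_num k (\<lambda>w z. (if b then (\<lambda>p. N2 (swap12 p)) else (\<lambda>p. N1 (swap12 p))) (face_point b w s z)) (\<lambda>w z. N3 (swap12 (face_point b w s z)))"
    if "s \<in> {0,1}" for b s
  proof -
    have "trace_num k (\<lambda>w z. (if \<not> b then N1 else N2) (face_point (\<not> b) w s z)) (\<lambda>w z. N3 (face_point (\<not> b) w s z))"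
      using assms that unfolding U_num_def by blast
    then show ?thesis by (cases b) (simp_all add: sw)
  qed
  then show ?thesis using assms bar_num_swap unfolding U_num_def by blast
qed

lemma U_num_zero_trace:
  assumes "bar_num k N1 N2 N3"
    and "\<And>b s w z. s \<in> {0,1} \<Longrightarrow> w \<in> {0..1} \<Longrightarrow> z \<ge> 0 \<Longrightarrow> (if b then N1 else N2) (face_point b w s z) = 0 \<and> N3 (face_point b w s z) = 0"
  shows "U_num k N1 N2 N3"
  unfolding U_num_def
  by (intro conjI allI ballI assms(1); rule trace_num_zero; rule assms(2))

lemma rfield_lin: "rfield k (\<lambda>p. c * N1 p + N1' p) (\<lambda>p. c * N2 p + N2' p) (\<lambda>p. c * N3 p + N3' p) =
   (\<lambda>x. c *\<^sub>R rfield k N1 N2 N3 x + rfield k N1' N2' N3' x)"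
  by (simp add: fun_eq_iff pt_eq_iff add_divide_distrib)

lemma subspace_U1:
  assumes "k \<ge> 1"
  shows "subspace (U1 k)"
proof -
  have lin: "c *\<^sub>R E + E' \<in> U1 k" if E: "E \<in> U1 k" "E' \<in> U1 k" for c E E'
  proof -
    obtain N1 N2 N3 N1' N2' N3' where 1: "U_num k N1 N2 N3" "E = pushf (rfield k N1 N2 N3)"
      "U_num k N1' N2' N3'" "E' = pushf (rfield k N1' N2' N3')"
      using E U1_iff[OF assms] by blast
    have "c *\<^sub>R E + E' = pushf (rfield k (\<lambda>p. c * N1 p + N1' p) (\<lambda>p. c * N2 p + N2' p) (\<lambda>p. c * N3 p + N3' p))"
      unfolding rfield_lin pushf_add pushf_scaleR 1 ..
    then show ?thesis using U_num_lin[OF 1(1,3)] U1_iff[OF assms] by blast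
  qed
  have "U_num k (\<lambda>_. 0) (\<lambda>_. 0) (\<lambda>_. 0)"
    by (intro U_num_zero_trace bar_num_I Qpoly_zero) auto
  then have "pushf (rfield k (\<lambda>_. 0) (\<lambda>_. 0) (\<lambda>_. 0)) \<in> U1 k" using U1_iff[OF assms] by blast
  moreover have "pushf (rfield k (\<lambda>_. 0) (\<lambda>_. 0) (\<lambda>_. 0)) = 0"
    unfolding pushf_zero_iff by (simp add: pt_eq_iff)
  ultimately have "0 \<in> U1 k" by simp
  then show ?thesis
    unfolding subspace_def using lin[of _ _ 1] lin[of _ 0] by auto
qed

section \<open>Fields with prescribed traces\<close>

text \<open>A cut-off across a face or edge: for \<open>s\<close> in \<open>{0,1}\<close> it is
  \<open>1\<close> at \<open>s\<close> and \<open>0\<close> at the opposite end.\<close>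

definition lin :: "real \<Rightarrow> real \<Rightarrow> real" where "lin s y = (1 - s) + (2 * s - 1) * y"

lemma lin_01: "s \<in> {0,1} \<Longrightarrow> s' \<in> {0,1} \<Longrightarrow> lin s s' = (if s = s' then 1 else 0)"
  by (auto simp: lin_def)

lemma lin_Qpoly: "(\<lambda>p. lin s (p$1)) \<in> Qpoly 1 0 0" "(\<lambda>p. lin s (p$2)) \<in> Qpoly 0 1 0"
  unfolding lin_def
  by (intro Qpoly_add Qpoly_cmult Qpoly_coord Qpoly_mono[OF Qpoly_const]; simp)+

lemma swap12_ix [simp]: "swap12 p $ ix b = p $ ix (\<not> b)"
  by (auto simp: ix_def)

text \<open>The pair \<open>sel b f\<close>, \<open>sel (\<not> b) f\<close> puts \<open>f\<close>
  into the horizontal component \<open>ix b\<close> and \<open>0\<close> into the other, so that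
  both orientations share one statement.\<close>

definition sel :: "bool \<Rightarrow> ('a \<Rightarrow> real) \<Rightarrow> 'a \<Rightarrow> real" where "sel b f = (if b then f else (\<lambda>_. 0))"

lemma sel_simps [simp]: "sel True f = f" "sel False f = (\<lambda>_. 0)"
  by (simp_all add: sel_def)

definition edge_num :: "bool \<Rightarrow> real \<Rightarrow> (real \<Rightarrow> real) \<Rightarrow> pt \<Rightarrow> real"
  where "edge_num b s f p = lin s (p $ ix (\<not> b)) * f (p $ ix b)"

text \<open>The numerator is constant in \<open>z\<close> and cut off linearly across. Its trace on
  a vertical face is therefore a polynomial of degree \<open>k - 1\<close> in \<open>w\<close>
  alone, or \<open>0\<close>, and fits the trace space without a homogeneous part.\<close>

lemma base_edge_lift:
  assumes "f \<in> Poly1 (int k - 1)" "k \<ge> 1" "s \<in> {0,1}"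
  shows "U_num k (sel b (edge_num b s f)) (sel (\<not> b) (edge_num b s f)) (\<lambda>_. 0)"
proof -
  have 1: "U_num k (edge_num True s f) (\<lambda>_. 0) (\<lambda>_. 0)"
    unfolding U_num_def
  proof (intro conjI allI ballI)
    have "edge_num True s f \<in> Qpoly (int k - 1) (int k) (int k - 1)"
      unfolding edge_num_def[abs_def] ix_def using assms(2)
      by (simp, intro Qpoly_mult[OF lin_Qpoly(2) Poly1_Qpoly1[OF assms(1)]]) auto
    then show "bar_num k (edge_num True s f) (\<lambda>_. 0) (\<lambda>_. 0)"
      by (intro bar_num_I Qpoly_zero)
    fix b' and s' :: real
    have "(\<lambda>w z::real. lin s s' * f w) \<in> Ppoly2 (int k - 1)"
      by (rule Ppoly2_cmult[OF Poly1_Ppoly2(2)[OF assms(1)]])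
    then show "trace_num k (\<lambda>w z. (if b' then edge_num True s f else (\<lambda>_. 0)) (face_point b' w s' z)) (\<lambda>w z. 0)"
      by (cases b') (auto simp: edge_num_def ix_def intro: trace_num_zero trace_num_poly[OF _ Ppoly2_zero])
  qed
  show ?thesis
  proof (cases b)
    case True
    then show ?thesis using 1 by simp
  next
    case False
    have "(\<lambda>p. edge_num True s f (swap12 p)) = edge_num False s f"
      by (simp add: edge_num_def fun_eq_iff)
    then show ?thesis using U_num_swap[OF 1] False by simp
  qed
qed

text \<open>The exchange behind the lifts whose traces have excessive degree: \<open>z^j\<close> and
  \<open>(1 + z)^j\<close> agree up to lower degree, and only the latter belongs to a homogeneous
  polynomial in \<open>w\<close> and \<open>1 + z\<close>.\<close>

lemma pow_shift_diff: "(\<lambda>w z::real. z ^ j - (1 + z) ^ j) \<in> Ppoly2 (int j - 1)"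
proof (induction j)
  case 0
  then show ?case by (simp add: Ppoly2_zero)
next
  case (Suc j)
  have a: "(\<lambda>w z::real. 1 + 0 * w + 1 * z) \<in> Ppoly2 1" by (rule Ppoly2_affine)
  have "(\<lambda>w z::real. (z ^ j - (1 + z) ^ j) * (1 + 0 * w + 1 * z) - w ^ 0 * z ^ j) \<in> Ppoly2 (int (Suc j) - 1)"
    by (intro Ppoly2_diff Ppoly2_mult[OF Suc a] Ppoly2_monom) auto
  then show ?case by (simp add: algebra_simps)
qed

text \<open>Both \<open>z^k\<close> in the first component and \<open>w z^(k-1)\<close> in the
  second have total degree \<open>k\<close>. The single choice
  \<open>S = \<kappa> \<sigma> (1 + z)^(k-1)\<close> absorbs the two at once, because
  \<open>\<sigma>\<close>, the derivative of \<open>- c * lin s w\<close> in \<open>w\<close>, ties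
  their coefficients together.\<close>

lemma vertical_trace:
  assumes P0: "P0 \<in> Poly1 (int k - 2)" and k: "k \<ge> 1" and P: "\<And>z. P z = P0 z + c * z ^ (k - 1)"
  shows "trace_num k (\<lambda>w z. \<kappa> * (z ^ k * (- c * (2 * s - 1)))) (\<lambda>w z. \<kappa> * (lin s w * P z))"
proof -
  obtain j where j: "k = Suc j" using k by (cases k) auto
  define \<sigma> where "\<sigma> = - c * (2 * s - 1)"
  have PP: "(\<lambda>w z. P z) \<in> Ppoly2 (int k - 1)"
  proof -
    have "(\<lambda>w z::real. P0 z + c * (w ^ 0 * z ^ (k - 1))) \<in> Ppoly2 (int k - 1)"
      using k by (intro Ppoly2_add Ppoly2_mono[OF Poly1_Ppoly2(1)[OF P0]] Ppoly2_cmult Ppoly2_monom) auto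
    then show ?thesis by (simp add: P)
  qed
  have PC: "(\<lambda>w z::real. P0 z + c * (z ^ j - (1 + z) ^ j)) \<in> Ppoly2 (int k - 2)"
    using j pow_shift_diff[of j] by (intro Ppoly2_add Poly1_Ppoly2(1)[OF P0] Ppoly2_cmult) simp
  define A where "A = (\<lambda>(w::real) (z::real). \<kappa> * (\<sigma> * (z ^ k - (1 + z) ^ k)))"
  define B where "B = (\<lambda>(w::real) (z::real). \<kappa> * ((1 - s) * P z + (2 * s - 1) * (w * (P0 z + c * (z ^ j - (1 + z) ^ j)))))"
  have A: "A \<in> Ppoly2 (int k - 1)" unfolding A_def by (intro Ppoly2_cmult pow_shift_diff)
  have B: "B \<in> Ppoly2 (int k - 1)"
    unfolding B_def by (intro Ppoly2_cmult Ppoly2_add PP Ppoly2_mult[OF Ppoly2_coord(1) PC]) auto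
  show ?thesis
    unfolding trace_num_def
  proof (rule bexI[OF _ A], rule bexI[OF _ B], rule bexI[OF _ Hom_pow[of "\<kappa> * \<sigma>" k]], intro ballI allI impI conjI)
    fix w z :: real
    show "\<kappa> * (z ^ k * (- c * (2 * s - 1))) = A w z + \<kappa> * \<sigma> * (1 + z) ^ (k - 1) * (1 + z)"
      by (simp add: A_def \<sigma>_def j algebra_simps)
    show "\<kappa> * (lin s w * P z) = B w z - \<kappa> * \<sigma> * (1 + z) ^ (k - 1) * w"
      by (simp add: B_def \<sigma>_def P lin_def j algebra_simps)
  qed
qed

text \<open>The term in \<open>z^(k-1)\<close> of the third component is available only through
  \<open>R\<close>; hence \<open>R\<close> is the product of the cut-offs times \<open>- c\<close>,
  with \<open>c\<close> the top coefficient of \<open>P\<close>. Its derivatives then force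
  horizontal numerators with the factor \<open>z^k\<close>, which vanish on the base and leave the
  base edges untouched.\<close>

lemma vertical_edge_lift:
  assumes P: "P \<in> Poly1 (int k - 1)" and k: "k \<ge> 1" and s: "s1 \<in> {0,1}" "s2 \<in> {0,1}"
  shows "\<exists>N1 N2. U_num k N1 N2 (\<lambda>p. lin s1 (p$1) * lin s2 (p$2) * P (p$3)) \<and>
    (\<forall>p. p$3 = 0 \<longrightarrow> N1 p = 0 \<and> N2 p = 0)"
proof -
  have "int (k - 1) = int k - 1" using k by simp
  then obtain P0 c where P0: "P0 \<in> Poly1 (int k - 2)" and Pz: "\<forall>z. P z = P0 z + c * z ^ (k - 1)"
    using Poly1_top[of P "k - 1"] P by auto
  define R where "R = (\<lambda>p::pt. (- c) * (lin s1 (p$1) * lin s2 (p$2)))"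
  have R: "R \<in> Qpoly (int k) (int k) 0"
    unfolding R_def using k by (intro Qpoly_cmult Qpoly_mult[OF lin_Qpoly(1) lin_Qpoly(2)]) auto
  have g1: "GDERIV (\<lambda>p::pt. lin s (p$i)) p :> (2 * s - 1) *\<^sub>R axis i 1" for s i p
    unfolding lin_def
    by (rule GDERIV_subst, rule GDERIV_add[OF GDERIV_const GDERIV_mult[OF GDERIV_const GDERIV_nth]]) simp
  have "GDERIV R p :> (- c) *\<^sub>R (lin s1 (p$1) *\<^sub>R ((2 * s2 - 1) *\<^sub>R axis 2 1) + lin s2 (p$2) *\<^sub>R ((2 * s1 - 1) *\<^sub>R axis 1 1))" for p
    unfolding R_def
    by (rule GDERIV_subst, rule GDERIV_mult[OF GDERIV_const GDERIV_mult[OF g1 g1]]) simp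
  note D = GDERIV_D[OF this]
  have D1R: "D1 R p = lin s2 (p$2) * (- c * (2 * s1 - 1))" and D2R: "D2 R p = lin s1 (p$1) * (- c * (2 * s2 - 1))" for p
    using D[of p] by (auto simp: axis_def)
  define Q3 where "Q3 = (\<lambda>p::pt. lin s1 (p$1) * lin s2 (p$2) * P0 (p$3))"
  have Q3: "Q3 \<in> Qpoly (int k) (int k) (int k - 2)"
    unfolding Q3_def
    by (rule Qpoly_mult[OF Qpoly_mult[OF lin_Qpoly(1) lin_Qpoly(2)] Poly1_Qpoly3[OF P0], of 1 1 0]) (use k in auto)
  define N1 N2 where "N1 = (\<lambda>p::pt. p$3 ^ k * D1 R p)" and "N2 = (\<lambda>p::pt. p$3 ^ k * D2 R p)"
  have N3: "(\<lambda>p. lin s1 (p$1) * lin s2 (p$2) * P (p$3)) = (\<lambda>p::pt. Q3 p - p$3 ^ (k - 1) * R p)"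
    by (simp add: fun_eq_iff Q3_def R_def Pz algebra_simps)
  have "bar_num k N1 N2 (\<lambda>p. lin s1 (p$1) * lin s2 (p$2) * P (p$3))"
    unfolding N3 bar_num_def using Q3 R
    by (intro exI[of _ "\<lambda>_. 0"] exI[of _ Q3] exI[of _ R]) (auto simp: N1_def N2_def Qpoly_zero)
  moreover have "trace_num k (\<lambda>w z. (if b then N1 else N2) (face_point b w s z))
     (\<lambda>w z. lin s1 (face_point b w s z $ 1) * lin s2 (face_point b w s z $ 2) * P (face_point b w s z $ 3))" for b s
    using vertical_trace[OF P0 k Pz[rule_format], of "lin s2 s" s1] vertical_trace[OF P0 k Pz[rule_format], of "lin s1 s" s2]
    by (cases b) (simp_all add: N1_def N2_def D1R D2R mult_ac)
  ultimately have "U_num k N1 N2 (\<lambda>p. lin s1 (p$1) * lin s2 (p$2) * P (p$3))"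
    unfolding U_num_def by blast
  moreover have "\<forall>p. p$3 = 0 \<longrightarrow> N1 p = 0 \<and> N2 p = 0" using k by (simp add: N1_def N2_def)
  ultimately show ?thesis by blast
qed

text \<open>The converse of \<open>bubble_trace\<close>. A monomial of degree below
  \<open>k - 2\<close> in \<open>db\<close> gives a trace of degree at most \<open>k - 1\<close>.
  For degree exactly \<open>k - 2\<close> the terms of degree \<open>k\<close> are carried by
  \<open>S = w^(a+1) (1 + z)^e\<close>, an element of \<open>Hom k\<close> since
  \<open>e = k - 1 - (a + 1)\<close>.\<close>

lemma tri_trace:
  assumes da: "da \<in> Ppoly2 (int k - 2)" and db: "db \<in> Ppoly2 (int k - 2)"
  shows "trace_num k (\<lambda>w z. z * (da w z + w * db w z)) (\<lambda>w z. w * (1 - w) * db w z)"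
  using db
proof (induction rule: Ppoly2_induct)
  case zero
  have "(\<lambda>w z. z * da w z) \<in> Ppoly2 (int k - 1)"
    by (rule Ppoly2_mult[OF Ppoly2_coord(2) da]) simp
  then show ?case by (intro trace_num_poly[OF _ Ppoly2_zero]) auto
next
  case (step c a e g)
  have "trace_num k (\<lambda>w z. z * w * (w ^ a * z ^ e)) (\<lambda>w z. w * (1 - w) * (w ^ a * z ^ e))"
  proof (cases "int (a + e) = int k - 2")
    case True
    define A where "A = (\<lambda>w z::real. (w ^ Suc a * z ^ 0) * (z ^ Suc e - (1 + z) ^ Suc e))"
    define B where "B = (\<lambda>w z::real. w ^ Suc a * z ^ e - (w ^ Suc (Suc a) * z ^ 0) * (z ^ e - (1 + z) ^ e))"
    define S where "S = (\<lambda>w z::real. w ^ Suc a * (1 + z) ^ (k - 1 - Suc a))"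
    have ke: "k - Suc (Suc a) = e" using True by linarith
    have A: "A \<in> Ppoly2 (int k - 1)"
      unfolding A_def using True by (intro Ppoly2_mult[OF Ppoly2_monom[OF order_refl] pow_shift_diff]) auto
    have B: "B \<in> Ppoly2 (int k - 1)"
      unfolding B_def using True
      by (intro Ppoly2_diff Ppoly2_mult[OF Ppoly2_monom[OF order_refl] pow_shift_diff] Ppoly2_monom) auto
    have S: "S \<in> Hom k"
      unfolding S_def Hom_def by (rule span_base) (use True in \<open>intro CollectI exI[of _ "Suc a"]; auto\<close>)
    show ?thesis
      unfolding trace_num_def
      by (rule bexI[OF _ A], rule bexI[OF _ B], rule bexI[OF _ S])
        (simp add: A_def B_def S_def ke algebra_simps)
  next
    case False
    have "(\<lambda>w z::real. w ^ Suc a * z ^ Suc e) \<in> Ppoly2 (int k - 1)"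
      "(\<lambda>w z::real. w ^ Suc a * z ^ e - w ^ Suc (Suc a) * z ^ e) \<in> Ppoly2 (int k - 1)"
      using step False by (intro Ppoly2_monom Ppoly2_diff; auto)+
    then show ?thesis by (rule trace_num_poly) (simp add: algebra_simps)
  qed
  from trace_num_lin[OF this step.IH, of c] show ?case by (simp add: algebra_simps)
qed

definition tri_num1 :: "bool \<Rightarrow> real \<Rightarrow> (real \<Rightarrow> real \<Rightarrow> real) \<Rightarrow> (real \<Rightarrow> real \<Rightarrow> real) \<Rightarrow> pt \<Rightarrow> real"
  where "tri_num1 b s da db p = lin s (p $ ix (\<not> b)) * (p$3 * (da (p $ ix b) (p$3) + p $ ix b * db (p $ ix b) (p$3)))"

definition tri_num3 :: "bool \<Rightarrow> real \<Rightarrow> (real \<Rightarrow> real \<Rightarrow> real) \<Rightarrow> pt \<Rightarrow> real"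
  where "tri_num3 b s db p = lin s (p $ ix (\<not> b)) * (p $ ix b * (1 - p $ ix b) * db (p $ ix b) (p$3))"

text \<open>The bubble trace is extended by the cut-off across the face. On the opposite face the
  cut-off vanishes; on the adjacent faces the horizontal tangential component is \<open>0\<close> by
  construction and the factor \<open>w (1 - w)\<close> kills the vertical one.\<close>

lemma tri_lift:
  assumes d: "da \<in> Ppoly2 (int k - 2)" "db \<in> Ppoly2 (int k - 2)" and k: "k \<ge> 1" and s: "s \<in> {0,1}"
  shows "U_num k (sel b (tri_num1 b s da db)) (sel (\<not> b) (tri_num1 b s da db)) (tri_num3 b s db)"
proof -
  have 1: "U_num k (tri_num1 True s da db) (\<lambda>_. 0) (tri_num3 True s db)"
    unfolding U_num_def
  proof (intro conjI allI ballI)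
    have w: "(\<lambda>p::pt. 1 - p$1) \<in> Qpoly 1 0 0"
      by (intro Qpoly_diff Qpoly_coord Qpoly_mono[OF Qpoly_const]; simp)
    have "(\<lambda>p. da (p$1) (p$3) + p$1 * db (p$1) (p$3)) \<in> Qpoly (int k - 1) 0 (int k - 2)"
      by (intro Qpoly_add Qpoly_mono[OF Ppoly2_Qpoly[OF d(1)]] Qpoly_mult[OF Qpoly_coord(1) Ppoly2_Qpoly[OF d(2)]]) auto
    then have "(\<lambda>p. p$3 * (da (p$1) (p$3) + p$1 * db (p$1) (p$3))) \<in> Qpoly (int k - 1) 0 (int k - 1)"
      by (rule Qpoly_mult[OF Qpoly_coord(3)]) auto
    from Qpoly_mult[OF lin_Qpoly(2) this, of "int k - 1" "int k" "int k - 1" s]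
    have "tri_num1 True s da db \<in> Qpoly (int k - 1) (int k) (int k - 1)"
      unfolding tri_num1_def[abs_def] ix_def using k by simp
    moreover have "(\<lambda>p. p$1 * (1 - p$1) * db (p$1) (p$3)) \<in> Qpoly (int k) 0 (int k - 2)"
      by (rule Qpoly_mult[OF Qpoly_mult[OF Qpoly_coord(1) w, of 2 0 0] Ppoly2_Qpoly[OF d(2)]]) auto
    from Qpoly_mult[OF lin_Qpoly(2) this, of "int k" "int k" "int k - 2" s]
    have "tri_num3 True s db \<in> Qpoly (int k) (int k) (int k - 2)"
      unfolding tri_num3_def[abs_def] ix_def using k by simp
    ultimately show "bar_num k (tri_num1 True s da db) (\<lambda>_. 0) (tri_num3 True s db)"
      by (intro bar_num_I Qpoly_zero)
    fix b' and s' :: real assume s': "s' \<in> {0,1}"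
    have "trace_num k (\<lambda>w z. lin s s' * (z * (da w z + w * db w z)) + 0) (\<lambda>w z. lin s s' * (w * (1 - w) * db w z) + 0)"
      by (rule trace_num_lin[OF tri_trace[OF d] trace_num_zero]) auto
    moreover have "s' * (1 - s') = 0" using s' by auto
    ultimately show "trace_num k (\<lambda>w z. (if b' then tri_num1 True s da db else (\<lambda>_. 0)) (face_point b' w s' z)) (\<lambda>w z. tri_num3 True s db (face_point b' w s' z))"
      by (cases b') (auto simp: tri_num1_def tri_num3_def ix_def intro: trace_num_zero)
  qed
  show ?thesis
  proof (cases b)
    case True
    then show ?thesis using 1 by simp
  next
    case False
    have "(\<lambda>p. tri_num1 True s da db (swap12 p)) = tri_num1 False s da db" "(\<lambda>p. tri_num3 True s db (swap12 p)) = tri_num3 False s db"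
      by (simp_all add: tri_num1_def tri_num3_def fun_eq_iff)
    then show ?thesis using U_num_swap[OF 1] False by simp
  qed
qed

lemma x01: "(\<lambda>p::pt. p$1 * (1 - p$1)) \<in> Qpoly 2 0 0"
  by (intro Qpoly_mult[OF Qpoly_coord(1), of _ 1 0 0] Qpoly_diff Qpoly_coord Qpoly_mono[OF Qpoly_const]; simp)

lemma y01: "(\<lambda>p::pt. p$2 * (1 - p$2)) \<in> Qpoly 0 2 0"
  by (intro Qpoly_mult[OF Qpoly_coord(2), of _ 0 1 0] Qpoly_diff Qpoly_coord Qpoly_mono[OF Qpoly_const]; simp)

text \<open>The factors \<open>y (1 - y)\<close> and \<open>x (1 - x)\<close> make the tangential
  traces on all vertical faces vanish, so the face conditions hold for every choice of cofactors on
  the base.\<close>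

lemma base_lift:
  assumes "g1 \<in> Qpoly2 (int k - 1) (int k - 2)" "g2 \<in> Qpoly2 (int k - 2) (int k - 1)" "k \<ge> 1"
  shows "U_num k (\<lambda>p. p$2 * (1 - p$2) * g1 (p$1) (p$2)) (\<lambda>p. p$1 * (1 - p$1) * g2 (p$1) (p$2)) (\<lambda>_. 0)"
proof (rule U_num_zero_trace)
  show "bar_num k (\<lambda>p. p$2 * (1 - p$2) * g1 (p$1) (p$2)) (\<lambda>p. p$1 * (1 - p$1) * g2 (p$1) (p$2)) (\<lambda>_. 0)"
    using assms(3)
    by (intro bar_num_I Qpoly_zero Qpoly_mult[OF y01 Qpoly2_Qpoly[OF assms(1)]] Qpoly_mult[OF x01 Qpoly2_Qpoly[OF assms(2)]]) auto
qed auto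

section \<open>Fields with vanishing tangential trace\<close>

text \<open>The bound \<open>max l 0\<close> leaves room for a function constant in \<open>x\<close>
  even when \<open>l\<close> is negative.\<close>

lemma Qpoly_slice1: "f \<in> Qpoly l m n \<Longrightarrow> (\<lambda>p. f (vector [s, p$2, p$3])) \<in> Qpoly (max l 0) m n"
proof (induction rule: Qpoly_induct)
  case (step c a b e g)
  have "(\<lambda>p. (c * s ^ a) * (p$1 ^ 0 * p$2 ^ b * p$3 ^ e) + g (vector [s, p$2, p$3])) \<in> Qpoly (max l 0) m n"
    using step by (intro Qpoly_add[OF Qpoly_cmult[OF Qpoly_monom]]) auto
  then show ?case by (simp add: mult_ac)
qed (simp add: Qpoly_zero)

lemma Qpoly_slice3: "f \<in> Qpoly l m n \<Longrightarrow> (\<lambda>p. f (vector [p$1, p$2, s])) \<in> Qpoly l m (max n 0)"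
proof (induction rule: Qpoly_induct)
  case (step c a b e g)
  have "(\<lambda>p. (c * s ^ e) * (p$1 ^ a * p$2 ^ b * p$3 ^ 0) + g (vector [p$1, p$2, s])) \<in> Qpoly l m (max n 0)"
    using step by (intro Qpoly_add[OF Qpoly_cmult[OF Qpoly_monom]]) auto
  then show ?case by (simp add: mult_ac)
qed (simp add: Qpoly_zero)

lemma open_cube: "open {p::pt. 0 < p$1 \<and> p$1 < 1 \<and> 0 < p$2 \<and> p$2 < 1 \<and> 0 < p$3 \<and> p$3 < 1}"
  by (intro open_Collect_conj open_Collect_less continuous_intros)

lemma Qpoly_eq_zero_cube:
  assumes "f \<in> Qpoly l m n" "\<And>x y z. 0 < x \<Longrightarrow> x < 1 \<Longrightarrow> 0 < y \<Longrightarrow> y < 1 \<Longrightarrow> 0 < z \<Longrightarrow> z < 1 \<Longrightarrow> f (vector [x,y,z]) = 0"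
  shows "f p = 0"
proof (rule Qpoly_eq_zero[OF assms(1) open_cube, of "vector [1/2, 1/2, 1/2]"])
  fix q :: pt assume "q \<in> {p. 0 < p$1 \<and> p$1 < 1 \<and> 0 < p$2 \<and> p$2 < 1 \<and> 0 < p$3 \<and> p$3 < 1}"
  moreover have "q = vector [q$1, q$2, q$3]" by (simp add: pt_eq_iff)
  ultimately show "f q = 0" using assms(2)[of "q$1" "q$2" "q$3"] by auto
qed auto

text \<open>Traces are known only on the part of the plane that belongs to the pyramid; a polynomial
  that vanishes there vanishes on the whole plane.\<close>

lemma face_ext1:
  assumes "f \<in> Qpoly l m n" "\<And>y z. 0 < y \<Longrightarrow> y < 1 \<Longrightarrow> 0 < z \<Longrightarrow> z < 1 \<Longrightarrow> f (vector [s,y,z]) = 0"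
  shows "f (vector [s,y,z]) = 0"
  using Qpoly_eq_zero_cube[OF Qpoly_slice1[OF assms(1), of s], of "vector [s,y,z]"] assms(2) by simp

lemma face_ext3:
  assumes "f \<in> Qpoly l m n" "\<And>x y. 0 < x \<Longrightarrow> x < 1 \<Longrightarrow> 0 < y \<Longrightarrow> y < 1 \<Longrightarrow> f (vector [x,y,s]) = 0"
  shows "f (vector [x,y,s]) = 0"
  using Qpoly_eq_zero_cube[OF Qpoly_slice3[OF assms(1), of s], of "vector [x,y,s]"] assms(2) by simp

lemma factor1:
  assumes f: "f \<in> Qpoly l m n" and z: "\<And>s y z. s \<in> {0,1} \<Longrightarrow> 0 < y \<Longrightarrow> y < 1 \<Longrightarrow> 0 < z \<Longrightarrow> z < 1 \<Longrightarrow> f (vector [s,y,z]) = 0"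
  shows "\<exists>g \<in> Qpoly (l - 2) m n. \<forall>p. f p = p$1 * (1 - p$1) * g p"
proof -
  have f0: "f (vector [s,y,z]) = 0" if "s \<in> {0,1}" for s y z by (rule face_ext1[OF f z[OF that]])
  obtain g where g: "g \<in> Qpoly (l - 1) m n" "\<forall>p. f p = f (vector [0, p$2, p$3]) + (p$1 - 0) * g p"
    by (rule bexE[OF Qpoly_div1[OF f, of 0]])
  have fg: "f p = p$1 * g p" for p using g(2)[rule_format, of p] f0[of 0] by simp
  have g0: "g (vector [1,y,z]) = 0" for y z using fg[of "vector [1,y,z]"] f0[of 1] by simp
  obtain h where h: "h \<in> Qpoly (l - 1 - 1) m n" "\<forall>p. g p = g (vector [1, p$2, p$3]) + (p$1 - 1) * h p"
    by (rule bexE[OF Qpoly_div1[OF g(1), of 1]])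
  have gh: "g p = (p$1 - 1) * h p" for p using h(2)[rule_format, of p] g0 by simp
  have "l - 1 - 1 = l - 2" by simp
  then have "(\<lambda>p. (-1) * h p) \<in> Qpoly (l - 2) m n" using Qpoly_cmult[OF h(1), of "-1"] by simp
  moreover have "f p = p$1 * (1 - p$1) * ((-1) * h p)" for p unfolding fg gh by (simp add: algebra_simps)
  ultimately show ?thesis by (intro bexI[of _ "\<lambda>p. (-1) * h p"] allI) 
qed

lemma factor2:
  assumes f: "f \<in> Qpoly l m n" and z: "\<And>s x z. s \<in> {0,1} \<Longrightarrow> 0 < x \<Longrightarrow> x < 1 \<Longrightarrow> 0 < z \<Longrightarrow> z < 1 \<Longrightarrow> f (vector [x,s,z]) = 0"
  shows "\<exists>g \<in> Qpoly l (m - 2) n. \<forall>p. f p = p$2 * (1 - p$2) * g p"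
proof -
  obtain g where g: "g \<in> Qpoly (m - 2) l n" "\<forall>p. f (swap12 p) = p$1 * (1 - p$1) * g p"
    by (rule bexE[OF factor1[OF Qpoly_swap12[OF f]]]) (use z in auto)
  have *: "f p = p$2 * (1 - p$2) * g (swap12 p)" for p
    using g(2)[rule_format, of "swap12 p"] by simp
  show ?thesis by (intro bexI[OF _ Qpoly_swap12[OF g(1)]] allI) (rule *)
qed

lemma factor3:
  assumes f: "f \<in> Qpoly l m n" and z: "\<And>x y. 0 < x \<Longrightarrow> x < 1 \<Longrightarrow> 0 < y \<Longrightarrow> y < 1 \<Longrightarrow> f (vector [x,y,0]) = 0"
  shows "\<exists>g \<in> Qpoly l m (n - 1). \<forall>p. f p = p$3 * g p"
proof -
  obtain g where g: "g \<in> Qpoly l m (n - 1)" "\<forall>p. f p = f (vector [p$1, p$2, 0]) + p$3 * g p"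
    by (rule bexE[OF Qpoly_div3[OF f]])
  have "f (vector [x,y,0]) = 0" for x y by (rule face_ext3[OF f z])
  then have *: "f p = p$3 * g p" for p using g(2)[rule_format, of p] by simp
  show ?thesis by (intro bexI[OF _ g(1)] allI) (rule *)
qed

text \<open>Growth in \<open>z\<close>: for fixed \<open>(x, y)\<close> the term
  \<open>t^j h\<close> must be balanced by \<open>g\<close>, which is at most of order
  \<open>t^(j-1)\<close>.\<close>

lemma top_coefficient_zero:
  assumes g: "g \<in> Qpoly l m (int j - 1)" and h: "h \<in> Qpoly l' m' 0"
    and z: "\<And>p. p \<in> inf_pyramid \<Longrightarrow> g p + p$3 ^ j * h p = 0"
  shows "h p = 0"
proof (rule Qpoly_eq_zero_cube[OF h])
  fix x y z0 :: real assume xy: "0 < x" "x < 1" "0 < y" "y < 1" "0 < z0" "z0 < 1"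
  obtain C where C: "C \<ge> 0" "\<forall>p\<in>inf_pyramid. \<bar>g p\<bar> * (1 + p$3) ^ 1 \<le> C * (1 + p$3) ^ j"
    using Qpoly_bound[OF g, of 1 j] by auto
  define a where "a = \<bar>h (vector [x,y,0])\<bar>"
  have ha: "h (vector [x,y,t]) = h (vector [x,y,0])" for t
    using Qpoly_no_z[OF h, of "vector [x,y,t]"] by simp
  have "a * (1 + t) \<le> C * 2 ^ j" if t: "t \<ge> 1" for t
  proof -
    have p: "vector [x,y,t] \<in> inf_pyramid" using xy t by (auto simp: inf_pyramid_def)
    have "g (vector [x,y,t]) + t ^ j * h (vector [x,y,0]) = 0" using z[OF p] ha[of t] by simp
    then have "g (vector [x,y,t]) = - (t ^ j * h (vector [x,y,0]))" by linarith
    then have "\<bar>g (vector [x,y,t])\<bar> = t ^ j * a" using t by (simp add: a_def abs_mult)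
    then have "t ^ j * a * (1 + t) \<le> C * (1 + t) ^ j" using C(2)[rule_format, OF p] by simp
    also have "\<dots> \<le> C * (2 * t) ^ j" using t C(1) by (intro mult_left_mono power_mono) auto
    also have "\<dots> = t ^ j * (C * 2 ^ j)" by (simp add: power_mult_distrib)
    finally have "t ^ j * (a * (1 + t)) \<le> t ^ j * (C * 2 ^ j)" by (simp add: mult_ac)
    moreover have "t ^ j > 0" using t by simp
    ultimately show ?thesis by simp
  qed
  \<comment> \<open>At this height the inequality would read
    \<open>2 a + C 2^j \<le> C 2^j\<close>.\<close>
  from this[of "1 + C * 2 ^ j / a"] have "a = 0"
  proof (rule_tac ccontr)
    assume H: "1 \<le> 1 + C * 2 ^ j / a \<Longrightarrow> a * (1 + (1 + C * 2 ^ j / a)) \<le> C * 2 ^ j" and "a \<noteq> 0"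
    then have "a > 0" by (simp add: a_def)
    then have "a * (1 + (1 + C * 2 ^ j / a)) = 2 * a + C * 2 ^ j" "1 \<le> 1 + C * 2 ^ j / a"
      using C(1) by (auto simp: field_simps)
    with H \<open>a > 0\<close> show False by linarith
  qed
  then show "h (vector [x,y,z0]) = 0" using ha by (simp add: a_def)
qed

text \<open>Numerators of the 0-forms that vanish on the boundary, as \<open>U0_zero_iff\<close>
  shows.\<close>

definition bubble :: "(pt \<Rightarrow> real) \<Rightarrow> pt \<Rightarrow> real"
  where "bubble H p = p$1 * (1 - p$1) * (p$2 * (1 - p$2)) * (p$3 * H p)"

lemma bubble_Qpoly:
  assumes "H \<in> Qpoly (int k - 2) (int k - 2) (int k - 2)"
  shows "bubble H \<in> Qpoly (int k) (int k) (int k - 1)"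
  unfolding bubble_def[abs_def]
  by (rule Qpoly_mult[OF Qpoly_mult[OF x01 y01, of 2 2 0] Qpoly_mult[OF Qpoly_coord(3) assms, of "int k - 2" "int k - 2" "int k - 1"]]) auto

text \<open>The derivatives are taken along slices, and a slice that lies in a face on which
  \<open>bubble H\<close> vanishes is identically \<open>0\<close>.\<close>

lemma D_bubble_face:
  "p$2 \<in> {0,1} \<or> p$3 = 0 \<Longrightarrow> D1 (bubble H) p = 0" "p$1 \<in> {0,1} \<or> p$3 = 0 \<Longrightarrow> D2 (bubble H) p = 0"
  "p$1 \<in> {0,1} \<or> p$2 \<in> {0,1} \<Longrightarrow> D3 (bubble H) p = 0"
  by (auto simp: D1_def D2_def D3_def bubble_def)

lemma D3_bubble:
  assumes "H \<in> Qpoly l m n"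
  shows "D3 (bubble H) p = p$1 * (1 - p$1) * (p$2 * (1 - p$2)) * (H p + p$3 * D3 H p)"
proof -
  have "((\<lambda>s. p$1 * (1 - p$1) * (p$2 * (1 - p$2)) * (s * H (vector [p$1, p$2, s]))) has_real_derivative
     p$1 * (1 - p$1) * (p$2 * (1 - p$2)) * (1 * H (vector [p$1, p$2, p$3]) + D3 H p * p$3)) (at (p$3))"
    using GDERIV_partial(3)[OF Qpoly_GDERIV[OF assms, of p]]
    by (intro DERIV_cmult DERIV_mult DERIV_ident) simp
  moreover have "vector [p$1, p$2, p$3] = p" by (simp add: pt_eq_iff)
  ultimately show ?thesis
    unfolding D3_def[of "bubble H"] bubble_def by (intro DERIV_imp_deriv) (simp add: mult_ac)
qed

text \<open>The three \<open>gnum\<close> are the numerators of the gradient of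
  \<open>Q / (1 + z)^k\<close>, brought to the denominator \<open>(1 + z)^(k + 1)\<close>; hence the
  factor \<open>1 + z\<close> in the first two.\<close>

definition gnum1 :: "(pt \<Rightarrow> real) \<Rightarrow> pt \<Rightarrow> real" where "gnum1 Q p = (1 + p$3) * D1 Q p"
definition gnum2 :: "(pt \<Rightarrow> real) \<Rightarrow> pt \<Rightarrow> real" where "gnum2 Q p = (1 + p$3) * D2 Q p"
definition gnum3 :: "nat \<Rightarrow> (pt \<Rightarrow> real) \<Rightarrow> pt \<Rightarrow> real"
  where "gnum3 k Q p = (1 + p$3) * D3 Q p - real k * Q p"

text \<open>This accounts for the special terms of the 1-form space. If \<open>R\<close> is the
  coefficient of \<open>z^(k-1)\<close> in \<open>Q\<close>, the top order part of the gradient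
  numerators is \<open>z^k D1 R\<close>, \<open>z^k D2 R\<close> and, since
  \<open>(k - 1) - k = -1\<close>, \<open>- z^(k-1) R\<close>.\<close>

lemma bar_num_grad:
  assumes Q: "Q \<in> Qpoly (int k) (int k) (int k - 1)" and k: "k \<ge> 1"
  shows "bar_num k (gnum1 Q) (gnum2 Q) (gnum3 k Q)"
proof -
  obtain j where j: "k = Suc j" using k by (cases k) auto
  obtain Q0 R where Q0: "Q0 \<in> Qpoly (int k) (int k) (int k - 2)" and R: "R \<in> Qpoly (int k) (int k) 0"
    and QR: "\<And>p. Q p = Q0 p + p$3 ^ j * R p"
    using Qpoly_top[of Q "int k" "int k" j] Q j by auto
  have D3R: "D3 R = (\<lambda>_. 0)" using Qpoly_neg[OF Qpoly_D3[OF R]] by simp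
  have Qe: "Q = (\<lambda>p. Q0 p + p$3 ^ j * R p)" using QR by blast
  have Z: "GDERIV (\<lambda>p::pt. p$3 ^ j) p :> (real j * p$3 ^ (j - 1)) *\<^sub>R axis 3 1" for p
    by (intro GDERIV_power GDERIV_nth)
  have D: "D1 Q p = D1 Q0 p + p$3 ^ j * D1 R p" "D2 Q p = D2 Q0 p + p$3 ^ j * D2 R p"
    "D3 Q p = D3 Q0 p + real j * p$3 ^ (j - 1) * R p" for p
    unfolding Qe using GDERIV_D[OF GDERIV_add[OF Qpoly_GDERIV[OF Q0] GDERIV_mult[OF Z[of p] Qpoly_GDERIV[OF R]]]]
    by (simp_all add: D3R axis_def mult_ac)
  define q1 where "q1 = (\<lambda>p. (1 + p$3) * D1 Q0 p + p$3 ^ j * D1 R p)"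
  define q2 where "q2 = (\<lambda>p. (1 + p$3) * D2 Q0 p + p$3 ^ j * D2 R p)"
  define q3 where "q3 = (\<lambda>p. ((1 + p$3) * D3 Q0 p - real k * Q0 p) + real j * (p$3 ^ (j - 1) * R p))"
  have q1: "q1 \<in> Qpoly (int k - 1) (int k) (int k - 1)"
    unfolding q1_def using j by (intro Qpoly_add Qpoly_mult[OF Qpoly_1z Qpoly_D1[OF Q0]] Qpoly_mult[OF Qpoly_zpow Qpoly_D1[OF R]]) auto
  have q2: "q2 \<in> Qpoly (int k) (int k - 1) (int k - 1)"
    unfolding q2_def using j by (intro Qpoly_add Qpoly_mult[OF Qpoly_1z Qpoly_D2[OF Q0]] Qpoly_mult[OF Qpoly_zpow Qpoly_D2[OF R]]) auto
  \<comment> \<open>For \<open>j = 0\<close> the exponent \<open>j - 1\<close> is truncated, but the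
    factor \<open>real j\<close> is \<open>0\<close>.\<close>
  have zr: "(\<lambda>p. real j * (p$3 ^ (j - 1) * R p)) \<in> Qpoly (int k) (int k) (int k - 2)"
  proof (cases j)
    case 0
    then show ?thesis by (simp add: Qpoly_zero)
  next
    case (Suc i)
    then show ?thesis using j by (intro Qpoly_cmult Qpoly_mult[OF Qpoly_zpow R]) auto
  qed
  have q3: "q3 \<in> Qpoly (int k) (int k) (int k - 2)"
    unfolding q3_def by (intro Qpoly_add[OF _ zr] Qpoly_diff Qpoly_cmult Q0 Qpoly_mult[OF Qpoly_1z Qpoly_D3[OF Q0]]) auto
  have "gnum1 Q = (\<lambda>p. q1 p + p$3 ^ k * D1 R p)" "gnum2 Q = (\<lambda>p. q2 p + p$3 ^ k * D2 R p)"
    by (simp_all add: gnum1_def gnum2_def q1_def q2_def D j fun_eq_iff algebra_simps)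
  moreover have "gnum3 k Q p = q3 p - p$3 ^ (k - 1) * R p" for p
    unfolding gnum3_def q3_def D QR by (cases j) (simp_all add: j algebra_simps)
  then have "gnum3 k Q = (\<lambda>p. q3 p - p$3 ^ (k - 1) * R p)" by blast
  ultimately show ?thesis unfolding bar_num_def using q1 q2 q3 R by blast
qed

lemma U_num_grad:
  assumes H: "H \<in> Qpoly (int k - 2) (int k - 2) (int k - 2)" and k: "k \<ge> 1"
  shows "U_num k (gnum1 (bubble H)) (gnum2 (bubble H)) (gnum3 k (bubble H))"
proof (rule U_num_zero_trace[OF bar_num_grad[OF bubble_Qpoly[OF H] k]])
  fix b and s w z :: real assume "s \<in> {0,1}"
  then show "(if b then gnum1 (bubble H) else gnum2 (bubble H)) (face_point b w s z) = 0 \<and> gnum3 k (bubble H) (face_point b w s z) = 0"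
    by (cases b) (auto simp: gnum1_def gnum2_def gnum3_def D_bubble_face bubble_def)
qed

section \<open>Rotational bubbles and the splitting of fields with zero trace\<close>

definition vnum1 :: "(pt \<Rightarrow> real) \<Rightarrow> pt \<Rightarrow> real" where "vnum1 q p = p$2 * (1 - p$2) * p$3 * q p"
definition vnum2 :: "(pt \<Rightarrow> real) \<Rightarrow> pt \<Rightarrow> real" where "vnum2 q p = p$1 * (1 - p$1) * p$3 * q p"
definition vnum3 :: "(pt \<Rightarrow> real) \<Rightarrow> pt \<Rightarrow> real"
  where "vnum3 q p = p$1 * (1 - p$1) * p$2 * (1 - p$2) * q p"

definition v_spaces :: "nat \<Rightarrow> (pt \<Rightarrow> real) \<Rightarrow> (pt \<Rightarrow> real) \<Rightarrow> (pt \<Rightarrow> real) \<Rightarrow> bool"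
  where "v_spaces k q1 q2 \<rho> \<longleftrightarrow> q1 \<in> Qpoly (int k - 1) (int k - 2) (int k - 2) \<and>
    q2 \<in> Qpoly (int k - 2) (int k - 1) (int k - 2) \<and> \<rho> \<in> Qpoly (int k - 2) (int k - 2) 0"

text \<open>For \<open>k = 1\<close> the space of \<open>\<rho>\<close> is zero, and for larger
  \<open>k\<close> the degree \<open>0\<close> is at most \<open>k - 2\<close>. So
  \<open>vnum3 \<rho>\<close> fits the third component without a contribution of \<open>r\<close>;
  the last bound records that it is also constant in \<open>z\<close>.\<close>

lemma vnum_Qpoly:
  assumes "v_spaces k q1 q2 \<rho>" "k \<ge> 1"
  shows "vnum1 q1 \<in> Qpoly (int k - 1) (int k) (int k - 1)" "vnum2 q2 \<in> Qpoly (int k) (int k - 1) (int k - 1)"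
    "vnum3 \<rho> \<in> Qpoly (int k) (int k) (int k - 2)" "vnum3 \<rho> \<in> Qpoly (int k) (int k) 0"
proof -
  note q = assms(1)[unfolded v_spaces_def]
  show "vnum1 q1 \<in> Qpoly (int k - 1) (int k) (int k - 1)"
    unfolding vnum1_def[abs_def] using q by (intro Qpoly_mult[OF Qpoly_mult[OF y01 Qpoly_coord(3), of 0 2 1]]) auto
  show "vnum2 q2 \<in> Qpoly (int k) (int k - 1) (int k - 1)"
    unfolding vnum2_def[abs_def] using q by (intro Qpoly_mult[OF Qpoly_mult[OF x01 Qpoly_coord(3), of 2 0 1]]) auto
  have v: "vnum3 \<rho> = (\<lambda>p. (p$1 * (1 - p$1)) * (p$2 * (1 - p$2)) * \<rho> p)"
    by (simp add: vnum3_def fun_eq_iff mult_ac)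
  show v0: "vnum3 \<rho> \<in> Qpoly (int k) (int k) 0"
    unfolding v using q by (intro Qpoly_mult[OF Qpoly_mult[OF x01 y01, of 2 2 0]]) auto
  show "vnum3 \<rho> \<in> Qpoly (int k) (int k) (int k - 2)"
  proof (cases "k = 1")
    case True
    then have "\<rho> = (\<lambda>_. 0)" using q by (intro Qpoly_neg[of \<rho> "int k - 2" "int k - 2" 0]) auto
    then show ?thesis by (simp add: vnum3_def[abs_def] Qpoly_zero)
  next
    case False
    then show ?thesis using assms(2) by (intro Qpoly_mono[OF v0]) auto
  qed
qed

lemma U_num_v:
  assumes "v_spaces k q1 q2 \<rho>" "k \<ge> 1"
  shows "U_num k (vnum1 q1) (vnum2 q2) (vnum3 \<rho>)"
proof (rule U_num_zero_trace[OF bar_num_I])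
  fix b and s w z :: real assume "s \<in> {0,1}"
  then show "(if b then vnum1 q1 else vnum2 q2) (face_point b w s z) = 0 \<and> vnum3 \<rho> (face_point b w s z) = 0"
    by (cases b) (auto simp: vnum1_def vnum2_def vnum3_def)
qed (use vnum_Qpoly[OF assms] in auto)

text \<open>Up to a function independent of \<open>z\<close>, every polynomial of degree \<open>k - 1\<close> in \<open>z\<close> is the numerator of
  the \<open>z\<close>-derivative of some \<open>z H / (1 + z)^k\<close>.\<close>

lemma z_derivative_numerator:
  assumes "G \<in> Qpoly l m (int k - 1)"
  shows "\<exists>H \<in> Qpoly l m (int k - 2). \<exists>\<rho> \<in> Qpoly l m 0. \<forall>p.
    G p = \<rho> p + ((1 + p$3) * (H p + p$3 * D3 H p) - real k * (p$3 * H p))"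
  using assms
proof (induction rule: Qpoly_induct)
  case zero
  have "D3 (\<lambda>_. 0) = (\<lambda>_. 0)" by (auto simp: fun_eq_iff GDERIV_D[OF GDERIV_const])
  then show ?case by (intro bexI[of _ "\<lambda>_. 0"]) (auto simp: Qpoly_zero)
next
  case (step c a b e g)
  have mon: "\<exists>H \<in> Qpoly l m (int k - 2). \<exists>\<rho> \<in> Qpoly l m 0. \<forall>p.
    p$1 ^ a * p$2 ^ b * p$3 ^ e = \<rho> p + ((1 + p$3) * (H p + p$3 * D3 H p) - real k * (p$3 * H p))"
    if "int e \<le> int k - 1" for e
    using that
  proof (induction e)
    case 0
    have "D3 (\<lambda>_. 0) = (\<lambda>_. 0)" by (auto simp: fun_eq_iff GDERIV_D[OF GDERIV_const])
    then show ?case using step Qpoly_monom[of a l b m 0 0]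
      by (intro bexI[of _ "\<lambda>_. 0"] bexI[of _ "\<lambda>p. p$1 ^ a * p$2 ^ b * p$3 ^ 0"]) (auto simp: Qpoly_zero)
  next
    case (Suc e)
    then obtain H \<rho> where H: "H \<in> Qpoly l m (int k - 2)" and \<rho>: "\<rho> \<in> Qpoly l m 0"
      and eq: "\<forall>p. p$1 ^ a * p$2 ^ b * p$3 ^ e = \<rho> p + ((1 + p$3) * (H p + p$3 * D3 H p) - real k * (p$3 * H p))"
      by auto
    \<comment> \<open>Applied to \<open>M\<close>, the operator that sends \<open>H\<close> to
      \<open>(1 + z) (H + z D3 H) - k z H\<close> gives \<open>(e + 1) M + d z M\<close>. The
      coefficient \<open>d\<close> is nonzero because \<open>e + 1 \<le> k - 1\<close>.\<close>
    define d where "d = real (Suc e) - real k"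
    have d: "d \<noteq> 0" using Suc by (simp add: d_def)
    define M where "M = (\<lambda>p::pt. p$1 ^ a * p$2 ^ b * p$3 ^ e)"
    have M: "M \<in> Qpoly l m (int k - 2)" unfolding M_def using step Suc by (intro Qpoly_monom) auto
    have D3M: "D3 M p = real e * p$1 ^ a * p$2 ^ b * p$3 ^ (e - 1)" for p
      unfolding M_def using GDERIV_D(3)[OF GDERIV_monom] by simp
    have zD3M: "p$3 * D3 M p = real e * M p" for p 
    proof -
      have "M p = p$1 ^ a * p$2 ^ b * p$3 ^ e" by (simp add: M_def)
      then show ?thesis unfolding D3M by (cases e) auto
    qed
    \<comment> \<open>Solving that relation for \<open>z M\<close> expresses it through the operator
      at \<open>M\<close> and through \<open>M\<close> itself, to which the induction hypothesis
      applies.\<close>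
    define H' where "H' = (\<lambda>p. (- real (Suc e) / d) * H p + (1 / d) * M p)"
    have H': "H' \<in> Qpoly l m (int k - 2)" unfolding H'_def by (intro Qpoly_add Qpoly_cmult H M)
    have cM: "(\<lambda>p. (1 / d) * M p) \<in> Qpoly l m (int k - 2)" by (intro Qpoly_cmult M)
    have D3c: "D3 (\<lambda>p. (1 / d) * M p) p = (1 / d) * D3 M p" for p
      using D_linear(3)[OF Qpoly_GDERIV[OF M] GDERIV_const[of 0], of "1 / d"] GDERIV_D(3)[OF GDERIV_const[of 0]] by simp
    have D3H': "D3 H' p = (- real (Suc e) / d) * D3 H p + (1 / d) * D3 M p" for p
      unfolding H'_def using D_linear(3)[OF Qpoly_GDERIV[OF H] Qpoly_GDERIV[OF cM], of "- real (Suc e) / d"] D3c by simp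
    have "p$1 ^ a * p$2 ^ b * p$3 ^ Suc e =
      (- real (Suc e) / d) * \<rho> p + ((1 + p$3) * (H' p + p$3 * D3 H' p) - real k * (p$3 * H' p))" for p
    proof -
      have e1: "M p = \<rho> p + ((1 + p$3) * (H p + p$3 * D3 H p) - real k * (p$3 * H p))"
        using eq unfolding M_def by blast
      have "(1 + p$3) * (M p + p$3 * D3 M p) - real k * (p$3 * M p) = real (Suc e) * M p + d * (p$3 * M p)"
        unfolding zD3M by (simp add: d_def algebra_simps)
      then have e2: "p$3 * M p = (1 / d) * ((1 + p$3) * (M p + p$3 * D3 M p) - real k * (p$3 * M p)) - (real (Suc e) / d) * M p"
        using d by (simp add: field_simps)
      have "p$1 ^ a * p$2 ^ b * p$3 ^ Suc e = p$3 * M p" by (simp add: M_def mult_ac)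
      also have "\<dots> = (1 / d) * ((1 + p$3) * (M p + p$3 * D3 M p) - real k * (p$3 * M p)) -
        (real (Suc e) / d) * (\<rho> p + ((1 + p$3) * (H p + p$3 * D3 H p) - real k * (p$3 * H p)))"
        by (subst e2, subst e1) simp
      also have "\<dots> = (- real (Suc e) / d) * \<rho> p + ((1 + p$3) * (H' p + p$3 * D3 H' p) - real k * (p$3 * H' p))"
        unfolding D3H' unfolding H'_def using d by (simp add: field_simps)
      finally show ?thesis .
    qed
    then show ?case by (intro bexI[OF _ H'] bexI[OF _ Qpoly_cmult[OF \<rho>]] allI)
  qed
  obtain H1 \<rho>1 where 1: "H1 \<in> Qpoly l m (int k - 2)" "\<rho>1 \<in> Qpoly l m 0"
    "\<forall>p. p$1 ^ a * p$2 ^ b * p$3 ^ e = \<rho>1 p + ((1 + p$3) * (H1 p + p$3 * D3 H1 p) - real k * (p$3 * H1 p))"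
    using mon[of e] step by auto
  obtain H2 \<rho>2 where 2: "H2 \<in> Qpoly l m (int k - 2)" "\<rho>2 \<in> Qpoly l m 0"
    "\<forall>p. g p = \<rho>2 p + ((1 + p$3) * (H2 p + p$3 * D3 H2 p) - real k * (p$3 * H2 p))"
    using step by auto
  have D: "D3 (\<lambda>p. c * H1 p + H2 p) p = c * D3 H1 p + D3 H2 p" for p
    using D_linear(3)[OF Qpoly_GDERIV[OF 1(1)] Qpoly_GDERIV[OF 2(1)], of c] by simp
  have "c * (p$1 ^ a * p$2 ^ b * p$3 ^ e) + g p = (c * \<rho>1 p + \<rho>2 p) +
     ((1 + p$3) * ((c * H1 p + H2 p) + p$3 * D3 (\<lambda>p. c * H1 p + H2 p) p) - real k * (p$3 * (c * H1 p + H2 p)))" for p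
    unfolding D 1(3)[rule_format] 2(3)[rule_format] by (simp add: algebra_simps)
  then show ?case
    by (intro bexI[OF _ Qpoly_add[OF Qpoly_cmult[OF 1(1), of c] 2(1)]]
        bexI[OF _ Qpoly_add[OF Qpoly_cmult[OF 1(2), of c] 2(2)]] allI)
qed

lemma phi_frontier:
  assumes "x$1 \<in> {0,1} \<or> x$2 \<in> {0,1} \<or> x$3 = 0" "x \<in> inf_pyramid"
  shows "phi x \<in> frontier pyramid"
proof -
  have "1 + x$3 > 0" using assms(2) by (auto simp: inf_pyramid_def)
  then have "1 - x$3 / (1 + x$3) = 1 / (1 + x$3)" by (simp add: field_simps)
  then show ?thesis
    unfolding frontier_pyramid interior_pyramid using assms phi_mem[OF assms(2)] by auto
qed

text \<open>The third component is settled first: its zero trace gives the factor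
  \<open>x (1 - x) y (1 - y)\<close>, and the cofactor is a \<open>z\<close>-derivative up to a
  function \<open>\<rho>\<close> of \<open>x\<close> and \<open>y\<close>. The primitive defines the
  gradient part. Once that is subtracted, the third component has degree at most
  \<open>k - 2\<close> in \<open>z\<close>, so no term in \<open>r\<close> is left and the
  horizontal components can be factored separately.\<close>

lemma vol_decomp:
  assumes bn: "bar_num k N1 N2 N3" and k: "k \<ge> 1"
    and side: "\<And>b s w z. s \<in> {0,1} \<Longrightarrow> w \<in> {0..1} \<Longrightarrow> z \<ge> 0 \<Longrightarrow>
      (if b then N1 else N2) (face_point b w s z) = 0 \<and> N3 (face_point b w s z) = 0"
    and base: "\<And>x y. x \<in> {0..1} \<Longrightarrow> y \<in> {0..1} \<Longrightarrow> N1 (vector [x,y,0]) = 0 \<and> N2 (vector [x,y,0]) = 0"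
  shows "\<exists>H \<in> Qpoly (int k - 2) (int k - 2) (int k - 2). \<exists>q1 q2 \<rho>. v_spaces k q1 q2 \<rho> \<and>
    (\<forall>p. N1 p = gnum1 (bubble H) p + vnum1 q1 p \<and> N2 p = gnum2 (bubble H) p + vnum2 q2 p \<and>
      N3 p = gnum3 k (bubble H) p + vnum3 \<rho> p)"
proof -
  note NQ = bar_num_Qpoly[OF bn k]
  have N3x: "N3 (vector [s,y,z]) = 0" if "s \<in> {0,1}" "0 < y" "y < 1" "0 < z" "z < 1" for s y z
    using side[of s y z False] that by (auto simp: face_point_def)
  have N3y: "N3 (vector [x,s,z]) = 0" if "s \<in> {0,1}" "0 < x" "x < 1" "0 < z" "z < 1" for s x z
    using side[of s x z True] that by (auto simp: face_point_def)
  obtain g where g: "g \<in> Qpoly (int k - 2) (int k) (int k - 1)" "\<forall>p. N3 p = p$1 * (1 - p$1) * g p"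
    by (rule bexE[OF factor1[OF NQ(3) N3x]])
  have gy: "g (vector [x,s,z]) = 0" if "s \<in> {0,1}" "0 < x" "x < 1" "0 < z" "z < 1" for s x z
    using N3y[OF that] g(2)[rule_format, of "vector [x,s,z]"] that by auto
  obtain G where G: "G \<in> Qpoly (int k - 2) (int k - 2) (int k - 1)" "\<forall>p. g p = p$2 * (1 - p$2) * G p"
    by (rule bexE[OF factor2[OF g(1) gy]])
  obtain H \<rho> where H: "H \<in> Qpoly (int k - 2) (int k - 2) (int k - 2)" and \<rho>: "\<rho> \<in> Qpoly (int k - 2) (int k - 2) 0"
    and GH: "\<forall>p. G p = \<rho> p + ((1 + p$3) * (H p + p$3 * D3 H p) - real k * (p$3 * H p))"
    using z_derivative_numerator[OF G(1)] by blast
  have N3d: "N3 p = gnum3 k (bubble H) p + vnum3 \<rho> p" for p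
    unfolding g(2)[rule_format] G(2)[rule_format] GH[rule_format] gnum3_def D3_bubble[OF H] bubble_def vnum3_def
    by (simp add: algebra_simps)
  have bn': "bar_num k (\<lambda>p. (-1) * gnum1 (bubble H) p + N1 p) (\<lambda>p. (-1) * gnum2 (bubble H) p + N2 p) (\<lambda>p. (-1) * gnum3 k (bubble H) p + N3 p)"
    by (rule bar_num_lin[OF bar_num_grad[OF bubble_Qpoly[OF H] k] bn])
  then obtain Q1 Q2 Q3 R where Q: "Q1 \<in> Qpoly (int k - 1) (int k) (int k - 1)" "Q2 \<in> Qpoly (int k) (int k - 1) (int k - 1)"
    "Q3 \<in> Qpoly (int k) (int k) (int k - 2)" and R: "R \<in> Qpoly (int k) (int k) 0"
    and M1: "(\<lambda>p. (-1) * gnum1 (bubble H) p + N1 p) = (\<lambda>p. Q1 p + p$3 ^ k * D1 R p)"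
    and M2: "(\<lambda>p. (-1) * gnum2 (bubble H) p + N2 p) = (\<lambda>p. Q2 p + p$3 ^ k * D2 R p)"
    and M3: "(\<lambda>p. (-1) * gnum3 k (bubble H) p + N3 p) = (\<lambda>p. Q3 p - p$3 ^ (k - 1) * R p)"
    unfolding bar_num_def by blast
  have v3: "vnum3 \<rho> \<in> Qpoly (int k) (int k) (int k - 2)"
    using vnum_Qpoly(3)[of k "\<lambda>_. 0" "\<lambda>_. 0" \<rho>] \<rho> k by (simp add: v_spaces_def Qpoly_zero)
  \<comment> \<open>Both \<open>vnum3 \<rho>\<close> and \<open>Q3\<close> have degree at most
    \<open>k - 2\<close> in \<open>z\<close>, so neither can balance \<open>z^(k-1) R\<close> at
    infinity.\<close>
  have R0: "R p = 0" for p
  proof (rule top_coefficient_zero[OF _ R])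
    have "int (k - 1) - 1 = int k - 2" using k by simp
    then show "(\<lambda>p. vnum3 \<rho> p - Q3 p) \<in> Qpoly (int k) (int k) (int (k - 1) - 1)"
      using Qpoly_diff[OF v3 Q(3)] by simp
    show "(vnum3 \<rho> p - Q3 p) + p$3 ^ (k - 1) * R p = 0" for p
      using fun_cong[OF M3, of p] N3d[of p] by simp
  qed
  then have R0': "R = (\<lambda>_. 0)" by blast
  have D0: "D1 R p = 0" "D2 R p = 0" for p
    unfolding R0' by (auto simp: GDERIV_D[OF GDERIV_const])
  have N1Q: "N1 p = gnum1 (bubble H) p + Q1 p" and N2Q: "N2 p = gnum2 (bubble H) p + Q2 p" for p
    using fun_cong[OF M1, of p] fun_cong[OF M2, of p] by (simp_all add: D0)
  have Q1y: "Q1 (vector [x,s,z]) = 0" if "s \<in> {0,1}" "0 < x" "x < 1" "0 < z" "z < 1" for s x z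
    using side[of s x z True] that N1Q[of "vector [x,s,z]"] D_bubble_face(1)[of "vector [x,s,z]" H] by (auto simp: face_point_def gnum1_def)
  have Q2x: "Q2 (vector [s,y,z]) = 0" if "s \<in> {0,1}" "0 < y" "y < 1" "0 < z" "z < 1" for s y z
    using side[of s y z False] that N2Q[of "vector [s,y,z]"] D_bubble_face(2)[of "vector [s,y,z]" H] by (auto simp: face_point_def gnum2_def)
  have Qz: "Q1 (vector [x,y,0]) = 0" "Q2 (vector [x,y,0]) = 0" if "0 < x" "x < 1" "0 < y" "y < 1" for x y
    using base[of x y] that N1Q[of "vector [x,y,0]"] N2Q[of "vector [x,y,0]"] D_bubble_face(1)[of "vector [x,y,0]" H]
      D_bubble_face(2)[of "vector [x,y,0]" H] by (auto simp: gnum1_def gnum2_def)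
  obtain g1 where g1: "g1 \<in> Qpoly (int k - 1) (int k - 2) (int k - 1)" "\<forall>p. Q1 p = p$2 * (1 - p$2) * g1 p"
    by (rule bexE[OF factor2[OF Q(1) Q1y]])
  obtain g2 where g2: "g2 \<in> Qpoly (int k - 2) (int k - 1) (int k - 1)" "\<forall>p. Q2 p = p$1 * (1 - p$1) * g2 p"
    by (rule bexE[OF factor1[OF Q(2) Q2x]])
  have gz: "g1 (vector [x,y,0]) = 0" "g2 (vector [x,y,0]) = 0" if "0 < x" "x < 1" "0 < y" "y < 1" for x y
    using Qz[OF that] g1(2)[rule_format, of "vector [x,y,0]"] g2(2)[rule_format, of "vector [x,y,0]"] that by auto
  have kk: "int k - 1 - 1 = int k - 2" by simp
  obtain q1 where q1: "q1 \<in> Qpoly (int k - 1) (int k - 2) (int k - 2)" "\<forall>p. g1 p = p$3 * q1 p"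
    by (rule bexE[OF factor3[OF g1(1) gz(1), unfolded kk]])
  obtain q2 where q2: "q2 \<in> Qpoly (int k - 2) (int k - 1) (int k - 2)" "\<forall>p. g2 p = p$3 * q2 p"
    by (rule bexE[OF factor3[OF g2(1) gz(2), unfolded kk]])
  have "v_spaces k q1 q2 \<rho>" using q1(1) q2(1) \<rho> by (simp add: v_spaces_def)
  moreover have "N1 p = gnum1 (bubble H) p + vnum1 q1 p" "N2 p = gnum2 (bubble H) p + vnum2 q2 p" for p
    unfolding N1Q N2Q g1(2)[rule_format] g2(2)[rule_format] q1(2)[rule_format] q2(2)[rule_format] vnum1_def vnum2_def
    by (simp_all add: mult_ac)
  ultimately show ?thesis using N3d H by blast
qed

lemma inf_interior:
  assumes "0 < x" "x < 1" "0 < y" "y < 1" "0 < z"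
  shows "phi (vector [x,y,z]) \<in> interior pyramid" "psi (phi (vector [x,y,z])) = vector [x,y,z]"
proof -
  show "psi (phi (vector [x,y,z])) = vector [x,y,z]" using assms by (intro psi_phi) auto
  have "1 - z / (1 + z) = 1 / (1 + z)" using assms by (simp add: field_simps)
  then show "phi (vector [x,y,z]) \<in> interior pyramid"
    unfolding interior_pyramid using assms by (auto simp: divide_strict_right_mono)
qed

text \<open>Turns an identity in the interior of the finite pyramid into identities of polynomials,
  valid everywhere.\<close>

lemma rfield_zero_interior:
  assumes N: "N1 \<in> Qpoly l1 m1 n1" "N2 \<in> Qpoly l2 m2 n2" "N3 \<in> Qpoly l3 m3 n3"
    and z: "\<And>p. p \<in> interior pyramid \<Longrightarrow> pushf (rfield k N1 N2 N3) p = 0"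
  shows "N1 p = 0" "N2 p = 0" "N3 p = 0"
proof -
  have *: "N1 (vector [x,y,z]) = 0 \<and> N2 (vector [x,y,z]) = 0 \<and> N3 (vector [x,y,z]) = 0"
    if i: "0 < x" "x < 1" "0 < y" "y < 1" "0 < z" for x y z
  proof -
    define p where "p = phi (vector [x,y,z])"
    note ip = inf_interior[OF i, folded p_def]
    have p3: "p$3 < 1" using ip(1) by (auto simp: interior_pyramid)
    have "push_lin p (rfield k N1 N2 N3 (vector [x,y,z])) = 0"
      using z[OF ip(1)] interior_pyramidD[OF ip(1)] by (simp add: pushf_def ip(2))
    then have "rfield k N1 N2 N3 (vector [x,y,z]) = 0"
      using p3 unfolding pt_eq_iff push_lin_nth by auto
    then show ?thesis using i by (simp add: pt_eq_iff)
  qed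
  show "N1 p = 0" by (rule Qpoly_eq_zero_cube[OF N(1)]) (use * in auto)
  show "N2 p = 0" by (rule Qpoly_eq_zero_cube[OF N(2)]) (use * in auto)
  show "N3 p = 0" by (rule Qpoly_eq_zero_cube[OF N(3)]) (use * in auto)
qed

lemma pushf_rfield_zero: "(\<And>p. N1 p = 0) \<Longrightarrow> (\<And>p. N2 p = 0) \<Longrightarrow> (\<And>p. N3 p = 0) \<Longrightarrow> pushf (rfield k N1 N2 N3) = 0"
  unfolding pushf_zero_iff by (simp add: pt_eq_iff)

section \<open>Gradients\<close>

text \<open>The value \<open>0\<close> at the apex is the continuous extension, as required by
  \<open>push0\<close>.\<close>

definition bubble_form :: "nat \<Rightarrow> (pt \<Rightarrow> real) \<Rightarrow> pt \<Rightarrow> real"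
  where "bubble_form k H p = (if p \<in> pyramid - {apex} then bubble H (psi p) / (1 + psi p $ 3) ^ k else 0)"

definition bubble_grad :: "nat \<Rightarrow> (pt \<Rightarrow> real) \<Rightarrow> pt \<Rightarrow> pt"
  where "bubble_grad k H = pushf (rfield k (gnum1 (bubble H)) (gnum2 (bubble H)) (gnum3 k (bubble H)))"

lemma bubble_grad_rgrad: "x$3 > -1 \<Longrightarrow> rfield k (gnum1 Q) (gnum2 Q) (gnum3 k Q) x = rgrad k Q x"
  by (simp add: pt_eq_iff gnum1_def gnum2_def gnum3_def)

lemma bubble_form_has_derivative:
  assumes H: "H \<in> Qpoly (int k - 2) (int k - 2) (int k - 2)" and p: "p \<in> interior pyramid"
  shows "(bubble_form k H has_derivative (\<lambda>h. h \<bullet> bubble_grad k H p)) (at p)"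
proof -
  note p' = interior_pyramidD[OF p]
  have p3: "p$3 < 1" using p by (auto simp: interior_pyramid)
  have "GDERIV (\<lambda>p. bubble H (psi p) / (1 + psi p $ 3) ^ k) p :> push_lin p (rgrad k (bubble H) (psi p))"
    by (rule GDERIV_psi[OF GDERIV_rat[OF bubble_Qpoly[OF H] psi_gt[OF p']] p3])
  moreover have "push_lin p (rgrad k (bubble H) (psi p)) = bubble_grad k H p"
    unfolding bubble_grad_def pushf_def using p' bubble_grad_rgrad[OF psi_gt[OF p']] by simp
  ultimately have "((\<lambda>p. bubble H (psi p) / (1 + psi p $ 3) ^ k) has_derivative (\<lambda>h. h \<bullet> bubble_grad k H p)) (at p)"
    by (simp add: gderiv_def)
  then show ?thesis
    by (rule has_derivative_transform_within_open[OF _ open_interior p])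
      (use interior_pyramidD in \<open>auto simp: bubble_form_def\<close>)
qed

lemma grad_eq: "(q has_derivative (\<lambda>h. h \<bullet> g)) (at p) \<Longrightarrow> grad q p = g"
proof -
  assume "(q has_derivative (\<lambda>h. h \<bullet> g)) (at p)"
  then have "frechet_derivative q (at p) = (\<lambda>h. h \<bullet> g)"
    using frechet_derivative_at by metis
  then show "grad q p = g" by (simp add: grad_def vec_eq_iff inner_axis')
qed

lemma grad_bubble_form:
  assumes H: "H \<in> Qpoly (int k - 2) (int k - 2) (int k - 2)" and p: "p \<in> interior pyramid"
  shows "grad (bubble_form k H) p = bubble_grad k H p"
  by (rule grad_eq[OF bubble_form_has_derivative[OF assms]])

lemma bubble_grad_U1: "H \<in> Qpoly (int k - 2) (int k - 2) (int k - 2) \<Longrightarrow> k \<ge> 1 \<Longrightarrow> bubble_grad k H \<in> U1 k"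
  using U_num_grad U1_iff unfolding bubble_grad_def by blast

text \<open>On the infinite pyramid this is the commutation of \<open>D1\<close>, \<open>D2\<close>
  and \<open>D3\<close>; \<open>curl_pushf\<close> carries it over to the finite one.\<close>

lemma curl_bubble_grad:
  assumes H: "H \<in> Qpoly (int k - 2) (int k - 2) (int k - 2)" and k: "k \<ge> 1" and p: "p \<in> interior pyramid"
  shows "curl (bubble_grad k H) p = 0"
proof -
  define Q where "Q = bubble H"
  note Q = bubble_Qpoly[OF H, folded Q_def]
  define x where "x = psi p"
  have x3: "x$3 > -1" unfolding x_def by (rule psi_gt[OF interior_pyramidD[OF p]])
  define G where "G = (\<lambda>i::3. if i = 1 then rgrad k (D1 Q) x else if i = 2 then rgrad k (D2 Q) x
     else rgrad k (D3 Q) x - real k *\<^sub>R rgrad (k + 1) Q x)"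
  obtain j where j: "k = Suc j" using k by (cases k) auto
  have e: "(1 + y$3) * a / (1 + y$3) ^ (k + 1) = a / (1 + y$3) ^ k" for y :: pt and a
    by (cases "1 + y$3 = 0") (auto simp: j)
  \<comment> \<open>The factor \<open>1 + z\<close> is cancelled and the third component is split,
    so that each fraction is of the kind treated by \<open>GDERIV_rat\<close>.\<close>
  have f: "(\<lambda>y. rfield k (gnum1 Q) (gnum2 Q) (gnum3 k Q) y $ 1) = (\<lambda>y. D1 Q y / (1 + y$3) ^ k)"
    "(\<lambda>y. rfield k (gnum1 Q) (gnum2 Q) (gnum3 k Q) y $ 2) = (\<lambda>y. D2 Q y / (1 + y$3) ^ k)"
    "(\<lambda>y. rfield k (gnum1 Q) (gnum2 Q) (gnum3 k Q) y $ 3) = (\<lambda>y. D3 Q y / (1 + y$3) ^ k - real k * (Q y / (1 + y$3) ^ (k + 1)))"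
    unfolding rfield_nth gnum1_def gnum2_def gnum3_def diff_divide_distrib e by (simp_all del: power_Suc)
  have G3: "GDERIV (\<lambda>y. D3 Q y / (1 + y$3) ^ k - real k * (Q y / (1 + y$3) ^ (k + 1))) x :>
      rgrad k (D3 Q) x - real k *\<^sub>R rgrad (k + 1) Q x"
    by (rule GDERIV_subst, rule GDERIV_diff[OF GDERIV_rat[OF Qpoly_D3[OF Q] x3] GDERIV_mult[OF GDERIV_const GDERIV_rat[OF Q x3]]]) simp
  have n: "(2::3) \<noteq> 1" "(3::3) \<noteq> 1" "(3::3) \<noteq> 2" by auto
  have GD: "GDERIV (\<lambda>y. rfield k (gnum1 Q) (gnum2 Q) (gnum3 k Q) y $ i) (psi p) :> G i" for i
    using GDERIV_rat[OF Qpoly_D1[OF Q] x3, of k] GDERIV_rat[OF Qpoly_D2[OF Q] x3, of k] G3 exhaust_3[of i] n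
    unfolding x_def[symmetric] G_def by (elim disjE) (simp_all add: f del: rfield_nth)
  note c = Qpoly_D_commute[OF Q]
  have t: "1 + x$3 \<noteq> 0" using x3 by linarith
  have "G 3 $ 2 - G 2 $ 3 = 0" "G 1 $ 3 - G 3 $ 1 = 0" "G 2 $ 1 - G 1 $ 2 = 0"
    using n t c by (simp_all add: G_def diff_divide_distrib)
  then show ?thesis
    unfolding bubble_grad_def Q_def[symmetric] curl_pushf[OF GD p refl refl refl] by (simp add: pt_eq_iff)
qed

text \<open>With zero gradient the form is constant on each line parallel to the
  \<open>z\<close>-axis, and it vanishes at \<open>z = 0\<close>. The first conclusion serves
  injectivity, the second the nondegeneracy of the gradient pairing.\<close>

lemma bubble_grad_zero:
  assumes H: "H \<in> Qpoly (int k - 2) (int k - 2) (int k - 2)" and k: "k \<ge> 1"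
    and z: "\<And>p. p \<in> interior pyramid \<Longrightarrow> bubble_grad k H p = 0"
  shows "bubble_grad k H = 0" "bubble_form k H = 0"
proof -
  note bQ = bubble_Qpoly[OF H]
  have gz: "gnum1 (bubble H) p = 0" "gnum2 (bubble H) p = 0" "gnum3 k (bubble H) p = 0" for p
    using rfield_zero_interior[OF bar_num_Qpoly[OF bar_num_grad[OF bQ k] k] z[unfolded bubble_grad_def]] by blast+
  show "bubble_grad k H = 0" unfolding bubble_grad_def by (rule pushf_rfield_zero) (rule gz)+
  have "bubble H p / (1 + p$3) ^ k = 0" if p: "p \<in> inf_pyramid" for p
  proof (cases "p$3 = 0")
    case False
    define f where "f = (\<lambda>z. bubble H (vector [p$1, p$2, z]) / (1 + z) ^ k)"
    have z0: "p$3 > 0" using p False by (auto simp: inf_pyramid_def)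
    have D: "(f has_real_derivative 0) (at z)" if "z \<ge> 0" for z
      using GDERIV_partial(3)[OF GDERIV_rat[OF bQ, of "vector [p$1, p$2, z]" k]] that gz(3)[of "vector [p$1, p$2, z]"]
      by (simp add: f_def gnum3_def)
    have "f (p$3) = f 0"
      using z0 by (intro DERIV_isconst_end) (auto intro!: DERIV_continuous_on[OF DERIV_subset[OF D]] D)
    moreover have "vector [p$1, p$2, p$3] = p" by (simp add: pt_eq_iff)
    ultimately show ?thesis by (simp add: f_def bubble_def)
  qed (simp add: bubble_def)
  then have "bubble_form k H p = 0" for p
    using psi_mem[of p] by (simp add: bubble_form_def del: psi_nth)
  then show "bubble_form k H = 0" by auto
qed

text \<open>On the face \<open>x = 0\<close> the term \<open>c z^k\<close> exceeds the degree
  \<open>k - 1\<close> of the rest, so \<open>c = 0\<close>; the zeros on the five faces then split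
  off the bubble factor. Conversely a bubble form is of order \<open>1 / (1 + z) = 1 - p_3\<close>
  at infinity, hence continuous at the apex with value \<open>0\<close>.\<close>

lemma U0_zero_iff:
  assumes k: "k \<ge> 1"
  shows "q \<in> U0_zero k \<longleftrightarrow> (\<exists>H \<in> Qpoly (int k - 2) (int k - 2) (int k - 2). q = bubble_form k H)"
proof
  assume "q \<in> U0_zero k"
  then obtain u where off: "\<forall>p. p \<notin> pyramid \<longrightarrow> q p = 0" and u: "u \<in> U0_inf k" "\<forall>x\<in>inf_pyramid. q (phi x) = u x"
    and fr: "\<forall>p\<in>frontier pyramid. q p = 0"
    unfolding U0_zero_def U0_def push0_def by blast
  obtain q' c where q': "q' \<in> Qrat k (int k) (int k) (int k - 1)" "u = (\<lambda>p. q' p + c * (p$3 ^ k / (1 + p$3) ^ k))"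
    using u(1) unfolding U0_inf_def by blast
  obtain Q where Q: "Q \<in> Qpoly (int k) (int k) (int k - 1)" "q' = (\<lambda>p. Q p / (1 + p$3) ^ k)"
    using q'(1) unfolding Qrat_def by blast
  have uQ: "u p = (Q p + c * p$3 ^ k) / (1 + p$3) ^ k" for p
    unfolding q'(2) Q(2) by (simp add: add_divide_distrib)
  have z: "Q x + c * x$3 ^ k = 0" if "x$1 \<in> {0,1} \<or> x$2 \<in> {0,1} \<or> x$3 = 0" "x \<in> inf_pyramid" for x
  proof -
    have "u x = 0" using fr u(2) phi_frontier[OF that] that(2) by auto
    moreover have "1 + x$3 > 0" using that(2) by (auto simp: inf_pyramid_def)
    ultimately show ?thesis by (simp add: uQ)
  qed
  \<comment> \<open>Written as a constant function, so that \<open>top_coefficient_zero\<close>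
    applies with \<open>h = c\<close>.\<close>
  have c0: "(\<lambda>_. c) (0::pt) = 0"
  proof (rule top_coefficient_zero[OF Qpoly_slice1[OF Q(1), of 0] Qpoly_const])
    fix p :: pt assume "p \<in> inf_pyramid"
    then show "Q (vector [0, p$2, p$3]) + p$3 ^ k * c = 0"
      using z[of "vector [0, p$2, p$3]"] by (simp add: inf_pyramid_def mult.commute)
  qed
  have zQ: "Q x = 0" if "x$1 \<in> {0,1} \<or> x$2 \<in> {0,1} \<or> x$3 = 0" "x \<in> inf_pyramid" for x
    using z[OF that] c0 by simp
  obtain g where g: "g \<in> Qpoly (int k - 2) (int k) (int k - 1)" "\<forall>p. Q p = p$1 * (1 - p$1) * g p"
    by (rule bexE[OF factor1[OF Q(1)]]) (rule zQ, auto simp: inf_pyramid_def)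
  have gy: "g (vector [x,s,z]) = 0" if "s \<in> {0,1}" "0 < x" "x < 1" "0 < z" "z < 1" for s x z
    using zQ[of "vector [x,s,z]"] g(2)[rule_format, of "vector [x,s,z]"] that by (auto simp: inf_pyramid_def)
  obtain g' where g': "g' \<in> Qpoly (int k - 2) (int k - 2) (int k - 1)" "\<forall>p. g p = p$2 * (1 - p$2) * g' p"
    by (rule bexE[OF factor2[OF g(1) gy]])
  have gz: "g' (vector [x,y,0]) = 0" if "0 < x" "x < 1" "0 < y" "y < 1" for x y
    using zQ[of "vector [x,y,0]"] g(2)[rule_format, of "vector [x,y,0]"] g'(2)[rule_format, of "vector [x,y,0]"] that
    by (auto simp: inf_pyramid_def)
  have kk: "int k - 1 - 1 = int k - 2" by simp
  obtain H where H: "H \<in> Qpoly (int k - 2) (int k - 2) (int k - 2)" "\<forall>p. g' p = p$3 * H p"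
    by (rule bexE[OF factor3[OF g'(1) gz, unfolded kk]])
  have QH: "Q p = bubble H p" for p
    unfolding g(2)[rule_format] g'(2)[rule_format] H(2)[rule_format] bubble_def by (simp add: mult_ac)
  have "q p = bubble_form k H p" for p
  proof (cases "p \<in> pyramid - {apex}")
    case True
    then have "p$3 < 1" unfolding mem_pyramid_no_apex by blast
    then have "phi (psi p) = p" by (intro phi_psi) auto
    then have "q p = u (psi p)" using u(2) psi_mem[OF True] by metis
    then show ?thesis using True c0 by (simp add: uQ QH bubble_form_def)
  next
    case False
    have "apex \<in> frontier pyramid" unfolding frontier_pyramid interior_pyramid by (simp add: pyramid_def)
    then show ?thesis using False off fr by (auto simp: bubble_form_def)
  qed
  then show "\<exists>H \<in> Qpoly (int k - 2) (int k - 2) (int k - 2). q = bubble_form k H" using H(1) by blast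
next
  assume "\<exists>H \<in> Qpoly (int k - 2) (int k - 2) (int k - 2). q = bubble_form k H"
  then obtain H where H: "H \<in> Qpoly (int k - 2) (int k - 2) (int k - 2)" and q: "q = bubble_form k H" by blast
  note bQ = bubble_Qpoly[OF H]
  define u where "u = (\<lambda>p. bubble H p / (1 + p$3) ^ k)"
  have P0: "(\<lambda>w z. 0) \<in> Prat2 k (int k)"
    unfolding Prat2_def using Ppoly2_zero[of "int k"] by force
  have "u \<in> U0_inf k"
    unfolding U0_inf_def mem_Collect_eq
  proof (intro conjI ballI)
    have "(\<lambda>p. bubble H p / (1 + p$3) ^ k) \<in> Qrat k (int k) (int k) (int k - 1)"
      unfolding Qrat_def using bQ by blast
    then show "\<exists>q\<in>Qrat k (int k) (int k) (int k - 1). \<exists>c. u = (\<lambda>p. q p + c * (p$3 ^ k / (1 + p$3) ^ k))"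
      by (intro bexI[of _ "\<lambda>p. bubble H p / (1 + p$3) ^ k"] exI[of _ 0]) (auto simp: u_def)
    fix s :: real assume "s \<in> {0,1}"
    then show "\<exists>f\<in>Prat2 k (int k). \<forall>x\<in>{0..1}. \<forall>z\<ge>0. u (vector [x, s, z]) = f x z"
      "\<exists>f\<in>Prat2 k (int k). \<forall>y\<in>{0..1}. \<forall>z\<ge>0. u (vector [s, y, z]) = f y z"
      by (auto intro!: bexI[OF _ P0] simp: u_def bubble_def)
  qed
  moreover have "\<forall>x\<in>inf_pyramid. q (phi x) = u x"
  proof
    fix x assume x: "x \<in> inf_pyramid"
    then have "psi (phi x) = x" by (intro psi_phi) (auto simp: inf_pyramid_def)
    then show "q (phi x) = u x" using phi_mem[OF x] by (simp add: q bubble_form_def u_def)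
  qed
  moreover have "continuous (at apex within pyramid) q"
  proof -
    obtain C where C: "\<forall>x\<in>inf_pyramid. \<bar>bubble H x / (1 + x$3) ^ k\<bar> * (1 + x$3) ^ 1 \<le> C"
      using rat_bound[OF bQ, of 1 k] by auto
    have "norm (q p) \<le> C * (1 - p$3)" if "p \<in> pyramid" "p \<noteq> apex" for p
    proof -
      have p: "p \<in> pyramid - {apex}" using that by simp
      have p3: "p$3 < 1" using p unfolding mem_pyramid_no_apex by blast
      have "\<bar>bubble H (psi p) / (1 + psi p $ 3) ^ k\<bar> * (1 + psi p $ 3) ^ 1 \<le> C"
        using C psi_mem[OF p] by blast
      then have "\<bar>q p\<bar> * (1 / (1 - p$3)) \<le> C"
        unfolding q bubble_form_def using p one_plus_psi3[of p] p3 by (simp del: psi_nth)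
      then show ?thesis using p3 by (simp add: field_simps)
    qed
    then have vert_edge: "eventually (\<lambda>p. norm (q p) \<le> C * (1 - p$3)) (at apex within pyramid)"
      by (auto simp: eventually_at_filter)
    have "((\<lambda>p::pt. C * (1 - p$3)) \<longlongrightarrow> C * (1 - apex$3)) (at apex within pyramid)"
      by (intro tendsto_intros)
    then have "((\<lambda>p::pt. C * (1 - p$3)) \<longlongrightarrow> 0) (at apex within pyramid)" by simp
    then have "(q \<longlongrightarrow> 0) (at apex within pyramid)"
      by (rule Lim_null_comparison[OF vert_edge])
    moreover have "q apex = 0" by (simp add: q bubble_form_def)
    ultimately show ?thesis by (simp add: continuous_within)
  qed
  moreover have "q p = 0" if "p \<notin> pyramid" for p using that by (simp add: q bubble_form_def)
  ultimately have "q \<in> U0 k" unfolding U0_def push0_def by blast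
  moreover have "q p = 0" if "p \<in> frontier pyramid" for p
  proof (cases "p \<in> pyramid - {apex}")
    case True
    then have p3: "p$3 < 1" unfolding mem_pyramid_no_apex by blast
    have "p$1 = 0 \<or> p$2 = 0 \<or> p$3 = 0 \<or> p$1 = 1 - p$3 \<or> p$2 = 1 - p$3"
      using that True unfolding frontier_pyramid interior_pyramid by (auto simp: pyramid_def)
    then have "psi p $ 1 \<in> {0,1} \<or> psi p $ 2 \<in> {0,1} \<or> psi p $ 3 = 0" using p3 by auto
    then have "bubble H (psi p) = 0" unfolding bubble_def by (auto simp del: psi_nth)
    then show ?thesis by (simp add: q bubble_form_def)
  qed (auto simp: q bubble_form_def)
  ultimately show "q \<in> U0_zero k" unfolding U0_zero_def by blast
qed

section \<open>The rotational bubble fields\<close>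

lemma U1_zero_curl_iff:
  "E \<in> U1_zero_curl k \<longleftrightarrow> (\<exists>q1 q2 \<rho>. v_spaces k q1 q2 \<rho> \<and> E = pushf (rfield k (vnum1 q1) (vnum2 q2) (vnum3 \<rho>)))"
proof -
  have *: "u \<in> U1_zero_curl_inf k \<longleftrightarrow> (\<exists>q1 q2 \<rho>. v_spaces k q1 q2 \<rho> \<and> u = rfield k (vnum1 q1) (vnum2 q2) (vnum3 \<rho>))" for u
  proof -
    have e: "(\<lambda>p. vector [p$2 * (1 - p$2) * p$3 * (q1 p / (1 + p$3) ^ (k + 1)), p$1 * (1 - p$1) * p$3 * (q2 p / (1 + p$3) ^ (k + 1)),
                 p$1 * (1 - p$1) * p$2 * (1 - p$2) * (\<rho> p / (1 + p$3) ^ (k + 1))]) = rfield k (vnum1 q1) (vnum2 q2) (vnum3 \<rho>)" for q1 q2 \<rho>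
      by (simp add: rfield_def vnum1_def vnum2_def vnum3_def fun_eq_iff)
    show ?thesis
    proof
      assume "u \<in> U1_zero_curl_inf k"
      then obtain q1 q2 \<rho> where q: "q1 \<in> Qrat (k + 1) (int k - 1) (int k - 2) (int k - 2)"
        "q2 \<in> Qrat (k + 1) (int k - 2) (int k - 1) (int k - 2)" "\<rho> \<in> Qrat (k + 1) (int k - 2) (int k - 2) 0"
        and u: "u = (\<lambda>p. vector [p$2 * (1 - p$2) * p$3 * q1 p, p$1 * (1 - p$1) * p$3 * q2 p,
                 p$1 * (1 - p$1) * p$2 * (1 - p$2) * \<rho> p])"
        unfolding U1_zero_curl_inf_def by blast
      obtain r1 r2 r3 where r: "r1 \<in> Qpoly (int k - 1) (int k - 2) (int k - 2)" "r2 \<in> Qpoly (int k - 2) (int k - 1) (int k - 2)"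
        "r3 \<in> Qpoly (int k - 2) (int k - 2) 0"
        "q1 = (\<lambda>p. r1 p / (1 + p$3) ^ (k + 1))" "q2 = (\<lambda>p. r2 p / (1 + p$3) ^ (k + 1))" "\<rho> = (\<lambda>p. r3 p / (1 + p$3) ^ (k + 1))"
        using q unfolding Qrat_def by blast
      have "u = rfield k (vnum1 r1) (vnum2 r2) (vnum3 r3)" unfolding u r(4-6) e ..
      then show "\<exists>q1 q2 \<rho>. v_spaces k q1 q2 \<rho> \<and> u = rfield k (vnum1 q1) (vnum2 q2) (vnum3 \<rho>)"
        using r(1-3) unfolding v_spaces_def by blast
    next
      assume "\<exists>q1 q2 \<rho>. v_spaces k q1 q2 \<rho> \<and> u = rfield k (vnum1 q1) (vnum2 q2) (vnum3 \<rho>)"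
      then obtain r1 r2 r3 where r: "r1 \<in> Qpoly (int k - 1) (int k - 2) (int k - 2)" "r2 \<in> Qpoly (int k - 2) (int k - 1) (int k - 2)"
        "r3 \<in> Qpoly (int k - 2) (int k - 2) 0" and u: "u = rfield k (vnum1 r1) (vnum2 r2) (vnum3 r3)"
        unfolding v_spaces_def by blast
      have "(\<lambda>p. r1 p / (1 + p$3) ^ (k + 1)) \<in> Qrat (k + 1) (int k - 1) (int k - 2) (int k - 2)"
        "(\<lambda>p. r2 p / (1 + p$3) ^ (k + 1)) \<in> Qrat (k + 1) (int k - 2) (int k - 1) (int k - 2)"
        "(\<lambda>p. r3 p / (1 + p$3) ^ (k + 1)) \<in> Qrat (k + 1) (int k - 2) (int k - 2) 0"
        unfolding Qrat_def using r by blast+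
      then show "u \<in> U1_zero_curl_inf k"
        unfolding U1_zero_curl_inf_def u e[symmetric]
        by (intro CollectI exI[of _ "\<lambda>p. r1 p / (1 + p$3) ^ (k + 1)"] exI[of _ "\<lambda>p. r2 p / (1 + p$3) ^ (k + 1)"]
            exI[of _ "\<lambda>p. r3 p / (1 + p$3) ^ (k + 1)"] conjI refl)
    qed
  qed
  show ?thesis unfolding U1_zero_curl_def push1_iff Bex_def * by blast
qed

text \<open>The function \<open>f + (c / k) (1 + z)^(-k)\<close> is constant, and its value at
  \<open>0\<close> is \<open>c / k\<close>. Multiplied by \<open>1 + z\<close>, the bound on
  \<open>f\<close> shows that \<open>(1 + z) |c| / k\<close> stays bounded; so \<open>c = 0\<close>,
  and then \<open>f = 0\<close>.\<close>

lemma decaying_primitive: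
  fixes f :: "real \<Rightarrow> real"
  assumes k: "k \<ge> 1" and c: "continuous_on {0..} f" and f0: "f 0 = 0"
    and D: "\<And>z. z > 0 \<Longrightarrow> (f has_real_derivative c / (1 + z) ^ (k + 1)) (at z)"
    and b: "\<And>z. z \<ge> 0 \<Longrightarrow> \<bar>f z\<bar> * (1 + z) \<le> C"
  shows "c = 0 \<and> (\<forall>z\<ge>0. f z = 0)"
proof -
  define h where "h = (\<lambda>z. f z + c / real k * (1 / (1 + z) ^ k))"
  have "(h has_real_derivative 0) (at z)" if "z > 0" for z
  proof -
    have nz: "1 + z \<noteq> 0" using that by linarith
    obtain j where j: "k = Suc j" using k by (cases k) auto
    have "((\<lambda>z. 1 / (1 + z) ^ k) has_real_derivative - (real k / (1 + z) ^ (k + 1))) (at z)"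
    proof -
      define t where "t = 1 + z"
      have t: "t \<noteq> 0" using nz by (simp add: t_def)
      have "((\<lambda>z. (1 + z) ^ k) has_real_derivative real k * t ^ j) (at z)"
      proof -
        have "((\<lambda>z. 1 + z) has_real_derivative 1) (at z)"
          by (auto intro!: derivative_eq_intros)
        from DERIV_power[OF this, of k] show ?thesis by (simp add: j t_def)
      qed
      from DERIV_inverse'[OF this] have
        "((\<lambda>z. inverse ((1 + z) ^ k)) has_real_derivative - (inverse (t ^ k) * (real k * t ^ j) * inverse (t ^ k))) (at z)"
        using t by (simp add: t_def)
      moreover have "inverse (t ^ k) * (real k * t ^ j) * inverse (t ^ k) = real k / t ^ (k + 1)"
        using t by (simp add: j field_simps)
      ultimately show ?thesis by (simp add: t_def inverse_eq_divide)
    qed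
    then have "(h has_real_derivative c / (1 + z) ^ (k + 1) + c / real k * (- (real k / (1 + z) ^ (k + 1)))) (at z)"
      unfolding h_def by (intro DERIV_add D that DERIV_cmult)
    then show ?thesis using k by simp
  qed
  moreover have "continuous_on {0..z} h" if "z > 0" for z
    unfolding h_def by (intro continuous_intros continuous_on_subset[OF c]) (auto simp: add_nonneg_eq_0_iff)
  ultimately have h: "h z = h 0" if "z > 0" for z
    using that by (intro DERIV_isconst_end) auto
  have "\<bar>c / real k\<bar> * (1 + z) \<le> C + \<bar>c / real k\<bar>" if z: "z > 0" for z
  proof -
    have "f z + c / real k * (1 / (1 + z) ^ k) = c / real k" using h[OF z] f0 by (simp add: h_def)
    then have "\<bar>c / real k\<bar> \<le> \<bar>f z\<bar> + \<bar>c / real k\<bar> * (1 / (1 + z) ^ k)"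
      using abs_triangle_ineq[of "f z" "c / real k * (1 / (1 + z) ^ k)"] z by (simp add: abs_mult)
    then have "\<bar>c / real k\<bar> * (1 + z) \<le> (\<bar>f z\<bar> + \<bar>c / real k\<bar> * (1 / (1 + z) ^ k)) * (1 + z)"
      using z by (intro mult_right_mono) auto
    also have "\<dots> = \<bar>f z\<bar> * (1 + z) + \<bar>c / real k\<bar> * ((1 + z) / (1 + z) ^ k)"
      by (simp add: algebra_simps add_divide_distrib)
    also have "\<dots> \<le> C + \<bar>c / real k\<bar> * 1"
    proof (intro add_mono b mult_left_mono)
      have "(1 + z) ^ 1 \<le> (1 + z) ^ k" using k z by (intro power_increasing) auto
      then show "(1 + z) / (1 + z) ^ k \<le> 1" using z by simp
    qed (use z in auto)
    finally show ?thesis by simp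
  qed
  have "c = 0"
  proof (rule ccontr)
    define a where "a = \<bar>c / real k\<bar>"
    assume "c \<noteq> 0"
    then have a: "a > 0" using k by (simp add: a_def)
    have C: "C \<ge> 0" using b[of 0] by simp
    \<comment> \<open>The bound at \<open>z = 1 + C / a\<close>, where it would give
      \<open>2 a \<le> a\<close>.\<close>
    have "a * (1 + (1 + C / a)) \<le> C + a"
      using \<open>\<And>z. z > 0 \<Longrightarrow> \<bar>c / real k\<bar> * (1 + z) \<le> C + \<bar>c / real k\<bar>\<close>[of "1 + C / a"] a C
      by (simp add: a_def add_pos_nonneg)
    moreover have "a * (1 + (1 + C / a)) = 2 * a + C" using a by (simp add: field_simps)
    ultimately show False using a by linarith
  qed
  moreover have "f z = 0" if "z \<ge> 0" for z
    using h[of z] f0 that \<open>c = 0\<close> by (cases "z = 0") (auto simp: h_def)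
  ultimately show ?thesis by blast
qed

text \<open>The constant \<open>c\<close> is the \<open>x\<close>- or \<open>y\<close>-derivative of
  \<open>V3\<close>, which does not depend on \<open>z\<close>; this is the purpose of the degree
  \<open>0\<close> of \<open>\<rho>\<close> in \<open>z\<close>. Since \<open>c\<close> vanishes too
  and \<open>V3 = 0\<close> for \<open>x = 0\<close>, integration in \<open>x\<close> gives
  \<open>V3 = 0\<close> as well.\<close>

lemma v_curl_zero:
  assumes v: "v_spaces k q1 q2 \<rho>" and k: "k \<ge> 1"
    and z: "\<And>p. p \<in> interior pyramid \<Longrightarrow> curl (pushf (rfield k (vnum1 q1) (vnum2 q2) (vnum3 \<rho>))) p = 0"
  shows "pushf (rfield k (vnum1 q1) (vnum2 q2) (vnum3 \<rho>)) = 0"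
proof -
  define V1 V2 V3 where "V1 = vnum1 q1" and "V2 = vnum2 q2" and "V3 = vnum3 \<rho>"
  note V = vnum_Qpoly[OF v k, folded V1_def V2_def V3_def]
  define G where "G = (\<lambda>x. \<lambda>i::3. rgrad (k + 1) (if i = 1 then V1 else if i = 2 then V2 else V3) x)"
  have n: "(2::3) \<noteq> 1" "(3::3) \<noteq> 1" "(3::3) \<noteq> 2" by auto
  have GD: "GDERIV (\<lambda>y. rfield k V1 V2 V3 y $ i) x :> G x i" if "x$3 > -1" for x i
  proof -
    have "GDERIV (\<lambda>y. rfield k V1 V2 V3 y $ 1) x :> rgrad (k + 1) V1 x"
      "GDERIV (\<lambda>y. rfield k V1 V2 V3 y $ 2) x :> rgrad (k + 1) V2 x"
      "GDERIV (\<lambda>y. rfield k V1 V2 V3 y $ 3) x :> rgrad (k + 1) V3 x"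
      unfolding rfield_nth
      using GDERIV_rat[OF V(1) that] GDERIV_rat[OF V(2) that] GDERIV_rat[OF V(3) that] by blast+
    then show ?thesis using exhaust_3[of i] unfolding G_def by (elim disjE) simp_all
  qed
  have c: "rgrad (k + 1) V1 (vector [x,y,z]) $ 3 = D1 V3 (vector [x,y,0]) / (1 + z) ^ (k + 1)"
    "rgrad (k + 1) V2 (vector [x,y,z]) $ 3 = D2 V3 (vector [x,y,0]) / (1 + z) ^ (k + 1)"
    if i: "0 < x" "x < 1" "0 < y" "y < 1" "0 < z" for x y z
  proof -
    define p where "p = phi (vector [x,y,z])"
    note ip = inf_interior[OF i, folded p_def]
    have p3: "1 - p$3 \<noteq> 0" using ip(1) by (auto simp: interior_pyramid)
    define x' :: pt where "x' = vector [x,y,z]"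
    have GD': "GDERIV (\<lambda>y. rfield k V1 V2 V3 y $ i) (psi p) :> G x' i" for i
      unfolding ip(2) x'_def by (rule GD) (use i in simp)
    have "curl (pushf (rfield k V1 V2 V3)) p = 0" using z[OF ip(1)] by (simp add: V1_def V2_def V3_def)
    note cz = this[unfolded curl_pushf[OF GD' ip(1) refl refl refl] pt_eq_iff vector_3 zero_index]
    \<comment> \<open>The third component comes first, because in the transformed curl it also
      enters the other two.\<close>
    have 3: "G x' 2 $ 1 - G x' 1 $ 2 = 0" using cz p3 by auto
    have 1: "G x' 3 $ 2 - G x' 2 $ 3 = 0" "G x' 1 $ 3 - G x' 3 $ 1 = 0"
      using cz p3 unfolding 3 by auto
    have d: "D1 V3 x' = D1 V3 (vector [x,y,0])" "D2 V3 x' = D2 V3 (vector [x,y,0])"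
      using Qpoly_no_z[OF Qpoly_D1[OF V(4)], of x'] Qpoly_no_z[OF Qpoly_D2[OF V(4)], of x'] by (simp_all add: x'_def)
    show "rgrad (k + 1) V1 (vector [x,y,z]) $ 3 = D1 V3 (vector [x,y,0]) / (1 + z) ^ (k + 1)"
      using 1(2) n unfolding G_def rgrad_nth(1) x'_def[symmetric] d(1)[symmetric] by (simp add: x'_def)
    show "rgrad (k + 1) V2 (vector [x,y,z]) $ 3 = D2 V3 (vector [x,y,0]) / (1 + z) ^ (k + 1)"
      using 1(1) n unfolding G_def rgrad_nth(2) x'_def[symmetric] d(2)[symmetric] by (simp add: x'_def)
  qed
  have main: "d = 0 \<and> (\<forall>z\<ge>0. N (vector [x,y,z]) / (1 + z) ^ (k + 1) = 0)"
    if N: "N \<in> Qpoly l m (int k - 1)" and xy: "0 < x" "x < 1" "0 < y" "y < 1"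
      and d: "\<And>z. z > 0 \<Longrightarrow> rgrad (k + 1) N (vector [x,y,z]) $ 3 = d / (1 + z) ^ (k + 1)"
      and N0: "N (vector [x,y,0]) = 0" for N l m x y d
  proof -
    have D: "((\<lambda>z. N (vector [x,y,z]) / (1 + z) ^ (k + 1)) has_real_derivative rgrad (k + 1) N (vector [x,y,z]) $ 3) (at z)"
      if "z \<ge> 0" for z
      using GDERIV_partial(3)[OF GDERIV_rat[OF N, of "vector [x,y,z]" "k + 1"]] that by (simp del: rgrad_nth)
    obtain C where C: "\<forall>x\<in>inf_pyramid. \<bar>N x / (1 + x$3) ^ (k + 1)\<bar> * (1 + x$3) ^ 1 \<le> C"
      using rat_bound[OF N, of 1 "k + 1"] by auto
    show ?thesis
    proof (rule decaying_primitive[OF k, where C = C])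
      show "continuous_on {0..} (\<lambda>z. N (vector [x,y,z]) / (1 + z) ^ (k + 1))"
        by (rule DERIV_continuous_on[OF DERIV_subset[OF D]]) auto
      show "\<bar>N (vector [x,y,z]) / (1 + z) ^ (k + 1)\<bar> * (1 + z) \<le> C" if "z \<ge> 0" for z
        using C[rule_format, of "vector [x,y,z]"] xy that by (simp add: inf_pyramid_def del: power_Suc)
      show "((\<lambda>z. N (vector [x,y,z]) / (1 + z) ^ (k + 1)) has_real_derivative d / (1 + z) ^ (k + 1)) (at z)" if "z > 0" for z
        using D[of z] d[OF that] that by (simp del: rgrad_nth power_Suc)
    qed (simp add: N0)
  qed
  have V0: "V1 (vector [x,y,0]) = 0" "V2 (vector [x,y,0]) = 0" for x y
    by (simp_all add: V1_def V2_def vnum1_def vnum2_def)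
  have m1: "D1 V3 (vector [x,y,0]) = 0 \<and> (\<forall>z\<ge>0. V1 (vector [x,y,z]) / (1 + z) ^ (k + 1) = 0)"
    if "0 < x" "x < 1" "0 < y" "y < 1" for x y
    by (rule main[OF V(1) that c(1)[OF that] V0(1)])
  have m2: "\<forall>z\<ge>0. V2 (vector [x,y,z]) / (1 + z) ^ (k + 1) = 0" if "0 < x" "x < 1" "0 < y" "y < 1" for x y
    using main[OF V(2) that c(2)[OF that] V0(2)] by blast
  have V1z: "V1 p = 0" for p
    by (rule Qpoly_eq_zero_cube[OF V(1)]) (use m1 in force)
  have V2z: "V2 p = 0" for p
    by (rule Qpoly_eq_zero_cube[OF V(2)]) (use m2 in force)
  have V3z: "V3 p = 0" for p
  proof (rule Qpoly_eq_zero_cube[OF V(4)])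
    fix x y z :: real assume i: "0 < x" "x < 1" "0 < y" "y < 1" "0 < z" "z < 1"
    define f where "f = (\<lambda>x. V3 (vector [x,y,0]))"
    have D: "(f has_real_derivative D1 V3 (vector [s,y,0])) (at s)" for s
      using GDERIV_partial(1)[OF Qpoly_GDERIV[OF V(4), of "vector [s,y,0]"]] by (simp add: f_def)
    have "(f has_real_derivative 0) (at s)" if "0 < s" "s < x" for s
      using D[of s] m1[of s y] that i by auto
    moreover have "continuous_on {0..x} f" by (rule DERIV_continuous_on[OF DERIV_subset[OF D]]) auto
    ultimately have "f x = f 0"
      using i by (intro DERIV_isconst_end) auto
    moreover have "f 0 = 0" by (simp add: f_def V3_def vnum3_def)
    ultimately show "V3 (vector [x,y,z]) = 0"
      using Qpoly_no_z[OF V(4), of "vector [x,y,z]"] by (simp add: f_def)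
  qed
  show ?thesis
    unfolding V1_def[symmetric] V2_def[symmetric] V3_def[symmetric] by (rule pushf_rfield_zero[OF V1z V2z V3z])
qed

section \<open>Integrals over convex sets\<close>

text \<open>The boundary of a convex set is negligible, so continuity and boundedness inside
  determine the integral, whatever happens at the apex.\<close>

lemma set_int_interior:
  fixes f :: "'a::euclidean_space \<Rightarrow> 'b::euclidean_space"
  assumes T: "convex T" "bounded T" and f: "continuous_on (interior T) f" "bounded (f ` interior T)"
  shows "set_integrable lebesgue T f" "(LINT x:T|lebesgue. f x) = integral (interior T) f"
    "f absolutely_integrable_on interior T"
proof -
  have lm: "interior T \<in> lmeasurable"
    using T(2) by (simp add: bounded_subset[OF _ interior_subset] lmeasurable_open)
  obtain C where C: "\<And>x. x \<in> interior T \<Longrightarrow> norm (f x) \<le> C"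
    using f(2) by (auto simp: bounded_iff)
  have neg: "negligible (T - interior T)" "negligible (interior T - T)"
    using negligible_subset[OF negligible_convex_frontier[OF T(1)] Diff_mono[OF closure_subset order_refl, of T "interior T", folded frontier_def]]
      interior_subset[of T] by (auto simp: Diff_eq_empty_iff[THEN iffD2])
  show ai: "f absolutely_integrable_on interior T"
  proof (rule measurable_bounded_by_integrable_imp_absolutely_integrable)
    show "f \<in> borel_measurable (lebesgue_on (interior T))"
      using lm f(1) by (intro continuous_imp_measurable_on_sets_lebesgue) auto
    show "(\<lambda>x. C) integrable_on interior T"
      using lm by (rule integrable_on_const)
  qed (use lm C in auto)
  have ne: "negligible {x \<in> interior T - T. f x \<noteq> 0}" "negligible {x \<in> T - interior T. f x \<noteq> 0}"
    by (auto intro: negligible_subset[OF neg(1)] negligible_subset[OF neg(2)])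
  show si: "set_integrable lebesgue T f"
    using absolutely_integrable_spike_set[OF ai ne] .
  show "(LINT x:T|lebesgue. f x) = integral (interior T) f"
    using set_lebesgue_integral_eq_integral(2)[OF si] integral_spike_set[OF ne(2) ne(1)] by simp
qed

definition nice :: "'a::euclidean_space set \<Rightarrow> ('a \<Rightarrow> pt) \<Rightarrow> bool"
  where "nice T A \<longleftrightarrow> continuous_on (interior T) A \<and> bounded (A ` interior T)"

text \<open>The common form of all degrees of freedom up to constant factors; bilinearity and
  definiteness are then proved once for edges, faces and volume.\<close>

definition pair :: "'a::euclidean_space set \<Rightarrow> ('a \<Rightarrow> pt) \<Rightarrow> ('a \<Rightarrow> pt) \<Rightarrow> real"
  where "pair T A B = (LINT \<sigma>:T|lebesgue. A \<sigma> \<bullet> B \<sigma>)"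

lemma nice_inner:
  assumes "nice T A" "nice T B"
  shows "continuous_on (interior T) (\<lambda>\<sigma>. A \<sigma> \<bullet> B \<sigma>)" "bounded ((\<lambda>\<sigma>. A \<sigma> \<bullet> B \<sigma>) ` interior T)"
proof -
  show "continuous_on (interior T) (\<lambda>\<sigma>. A \<sigma> \<bullet> B \<sigma>)"
    using assms by (auto simp: nice_def intro!: continuous_intros)
  obtain C D where C: "\<And>x. x \<in> interior T \<Longrightarrow> norm (A x) \<le> C" and D: "\<And>x. x \<in> interior T \<Longrightarrow> norm (B x) \<le> D"
    using assms by (auto simp: nice_def bounded_iff)
  have "norm (A x \<bullet> B x) \<le> C * D" if "x \<in> interior T" for x
    using Cauchy_Schwarz_ineq2[of "A x" "B x"] mult_mono[OF C[OF that] D[OF that]]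
      order_trans[OF norm_ge_zero C[OF that]] by auto
  then show "bounded ((\<lambda>\<sigma>. A \<sigma> \<bullet> B \<sigma>) ` interior T)" by (auto simp: bounded_iff)
qed

lemma pair_integral:
  assumes "convex T" "bounded T" "nice T A" "nice T B"
  shows "pair T A B = integral (interior T) (\<lambda>\<sigma>. A \<sigma> \<bullet> B \<sigma>)"
    "(\<lambda>\<sigma>. A \<sigma> \<bullet> B \<sigma>) integrable_on interior T"
  using set_int_interior[OF assms(1,2) nice_inner[OF assms(3,4)]]
  by (auto simp: pair_def absolutely_integrable_on_def)

lemma nice_cong: "(\<And>\<sigma>. \<sigma> \<in> interior T \<Longrightarrow> A \<sigma> = A' \<sigma>) \<Longrightarrow> nice T A \<longleftrightarrow> nice T A'"
  unfolding nice_def by (simp cong: continuous_on_cong image_cong)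

lemma pair_commute: "pair T A B = pair T B A"
  by (simp add: pair_def inner_commute)

lemma pair_lin:
  assumes T: "convex T" "bounded T" and n: "nice T A" "nice T A'" "nice T B"
    and e: "\<And>\<sigma>. \<sigma> \<in> interior T \<Longrightarrow> A'' \<sigma> = c *\<^sub>R A \<sigma> + A' \<sigma>"
  shows "pair T A'' B = c * pair T A B + pair T A' B"
proof -
  have "nice T (\<lambda>\<sigma>. c *\<^sub>R A \<sigma> + A' \<sigma>)"
  proof -
    obtain C D where C: "\<And>x. x \<in> interior T \<Longrightarrow> norm (A x) \<le> C" and D: "\<And>x. x \<in> interior T \<Longrightarrow> norm (A' x) \<le> D"
      using n by (auto simp: nice_def bounded_iff)
    have "norm (c *\<^sub>R A x + A' x) \<le> \<bar>c\<bar> * C + D" if "x \<in> interior T" for x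
      using norm_triangle_ineq[of "c *\<^sub>R A x" "A' x"] C[OF that] D[OF that] mult_left_mono[OF C[OF that], of "\<bar>c\<bar>"] by force
    then have "bounded ((\<lambda>\<sigma>. c *\<^sub>R A \<sigma> + A' \<sigma>) ` interior T)" by (auto simp: bounded_iff)
    then show ?thesis using n by (auto simp: nice_def intro!: continuous_intros)
  qed
  then have n'': "nice T A''" using nice_cong[of T A'' "\<lambda>\<sigma>. c *\<^sub>R A \<sigma> + A' \<sigma>"] e by simp
  have "integral (interior T) (\<lambda>\<sigma>. A'' \<sigma> \<bullet> B \<sigma>) = integral (interior T) (\<lambda>\<sigma>. c *\<^sub>R (A \<sigma> \<bullet> B \<sigma>) + A' \<sigma> \<bullet> B \<sigma>)"
    by (rule integral_cong) (simp add: e inner_add_left)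
  also have "\<dots> = c * integral (interior T) (\<lambda>\<sigma>. A \<sigma> \<bullet> B \<sigma>) + integral (interior T) (\<lambda>\<sigma>. A' \<sigma> \<bullet> B \<sigma>)"
    using pair_integral(2)[OF T n(1) n(3)] pair_integral(2)[OF T n(2) n(3)]
      integrable_cmul[OF pair_integral(2)[OF T n(1) n(3)], of c]
    by (subst integral_add) simp_all
  finally show ?thesis using T n n'' by (simp add: pair_integral)
qed

text \<open>On a small box around \<open>x\<close> the integral is squeezed between \<open>0\<close>
  and \<open>0\<close>, and there a continuous nonnegative function with zero integral
  vanishes.\<close>

lemma nonneg_integral_zero:
  fixes f :: "'a::euclidean_space \<Rightarrow> real"
  assumes S: "open S" and f: "continuous_on S f" "f integrable_on S" "\<And>x. x \<in> S \<Longrightarrow> f x \<ge> 0"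
    and 0: "integral S f = 0" and x: "x \<in> S"
  shows "f x = 0"
proof -
  obtain a b where ab: "x \<in> box a b" "cbox a b \<subseteq> S"
    by (rule open_contains_cbox[OF S x]) auto
  have ne: "box a b \<noteq> {}" using ab by auto
  have c: "continuous_on (cbox a b) f" using f(1) ab(2) continuous_on_subset by blast
  have i: "f integrable_on cbox a b" using integrable_continuous[OF c] .
  have "integral (cbox a b) f \<le> integral S f"
    by (rule integral_subset_le[OF ab(2) i f(2)]) (use f(3) in blast)
  moreover have "integral (cbox a b) f \<ge> 0"
    by (rule integral_nonneg[OF i]) (use f(3) ab(2) in blast)
  ultimately have "(f has_integral 0) (cbox a b)" using 0 i by (metis antisym integrable_integral)
  then show ?thesis
    using has_integral_0_cbox_imp_0[OF c _ _ ne, of x] f(3) ab box_subset_cbox by blast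
qed

lemma pair_nonneg_zero:
  assumes T: "convex T" "bounded T" and n: "nice T A" "nice T B"
    and nn: "\<And>\<sigma>. \<sigma> \<in> interior T \<Longrightarrow> A \<sigma> \<bullet> B \<sigma> \<ge> 0" and 0: "pair T A B = 0" and \<sigma>: "\<sigma> \<in> interior T"
  shows "A \<sigma> \<bullet> B \<sigma> = 0"
  by (rule nonneg_integral_zero[OF open_interior nice_inner(1)[OF n] pair_integral(2)[OF T n] nn])
    (use 0 pair_integral(1)[OF T n] \<sigma> in auto)

section \<open>Linear functionals\<close>

text \<open>By induction on the basis: subtracting from a new basis vector its components along the
  previous ones gives a nonzero test function that cannot be orthogonal to \<open>W\<close>.\<close>

lemma dual_lift:
  fixes L :: "'q::real_vector \<Rightarrow> 'w::real_vector \<Rightarrow> real"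
  assumes B: "finite B" "independent B" "span B = T" and W: "subspace W"
    and lq: "\<And>c q q' w. q \<in> T \<Longrightarrow> q' \<in> T \<Longrightarrow> w \<in> W \<Longrightarrow> L (c *\<^sub>R q + q') w = c * L q w + L q' w"
    and lw: "\<And>c q w w'. q \<in> T \<Longrightarrow> w \<in> W \<Longrightarrow> w' \<in> W \<Longrightarrow> L q (c *\<^sub>R w + w') = c * L q w + L q w'"
    and nd: "\<And>q. q \<in> T \<Longrightarrow> (\<And>w. w \<in> W \<Longrightarrow> L q w = 0) \<Longrightarrow> q = 0"
  shows "\<exists>w\<in>W. \<forall>b\<in>B. L b w = c b"
proof -
  have T: "subspace T" using B(3) subspace_span by blast
  have q0: "L 0 w = 0" if "w \<in> W" for w
    using lq[of 0 0 w 1] subspace_0[OF T] that by simp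
  have w0: "L q 0 = 0" if "q \<in> T" for q
    using lw[of q 0 0 1] subspace_0[OF W] that by simp
  have sumq: "L (\<Sum>b\<in>I. a b *\<^sub>R b) w = (\<Sum>b\<in>I. a b * L b w)" if "finite I" "I \<subseteq> T" "w \<in> W" for I a w
    using that
  proof (induction I)
    case (insert x F)
    have "(\<Sum>b\<in>F. a b *\<^sub>R b) \<in> T" using insert by (intro subspace_sum[OF T] subspace_scale[OF T]) auto
    then show ?case using insert by (simp add: lq)
  qed (simp add: q0)
  have sumw: "L q (\<Sum>b\<in>I. a b *\<^sub>R d b) = (\<Sum>b\<in>I. a b * L q (d b))" if "finite I" "d ` I \<subseteq> W" "q \<in> T" for I a q and d :: "'q \<Rightarrow> 'w"
    using that
  proof (induction I)
    case (insert x F)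
    have "(\<Sum>b\<in>F. a b *\<^sub>R d b) \<in> W" using insert by (intro subspace_sum[OF W] subspace_scale[OF W]) auto
    then show ?case using insert by (simp add: lw)
  qed (simp add: w0)
  have "\<forall>c. \<exists>w\<in>W. \<forall>b\<in>F. L b w = c b" if "finite F" "F \<subseteq> B" for F
    using that
  proof (induction F)
    case empty
    then show ?case using subspace_0[OF W] by auto
  next
    case (insert x F)
    then have IH: "\<forall>c. \<exists>w\<in>W. \<forall>b\<in>F. L b w = c b" and FT: "F \<subseteq> T" and xT: "x \<in> T"
      using B(3) span_superset[of B] by auto
    have "\<forall>b. \<exists>w\<in>W. \<forall>b'\<in>F. L b' w = (if b' = b then 1 else 0)"
      by (rule allI) (rule IH[rule_format])
    then obtain d where d: "\<And>b. d b \<in> W" "\<And>b b'. b' \<in> F \<Longrightarrow> L b' (d b) = (if b' = b then 1 else 0)"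
      by metis
    \<comment> \<open>The components of \<open>x\<close> along \<open>F\<close> are measured by the
      dual system \<open>d\<close>. The result is nonzero because \<open>x\<close> does not lie in
      the span of \<open>F\<close>.\<close>
    define q where "q = (-1) *\<^sub>R (\<Sum>b\<in>F. L x (d b) *\<^sub>R b) + x"
    have sT: "(\<Sum>b\<in>F. L x (d b) *\<^sub>R b) \<in> T" using FT by (intro subspace_sum[OF T] subspace_scale[OF T]) auto
    have qT: "q \<in> T" unfolding q_def using sT xT T by (intro subspace_add subspace_scale)
    have "x \<notin> span F"
      using independent_mono[OF B(2) insert(4)] insert(2) by (simp add: independent_insert)
    moreover have "(\<Sum>b\<in>F. L x (d b) *\<^sub>R b) \<in> span F" by (intro span_sum span_scale span_base)
    ultimately have "q \<noteq> 0" unfolding q_def by auto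
    then obtain v where v: "v \<in> W" "L q v \<noteq> 0" using nd[OF qT] by blast
    \<comment> \<open>The mirror image of the correction in \<open>q\<close>: it makes
      \<open>w\<close> invisible to \<open>F\<close>, and the two corrections match, so that
      \<open>L x w = L q v\<close>.\<close>
    define w where "w = (-1) *\<^sub>R (\<Sum>b\<in>F. L b v *\<^sub>R d b) + v"
    have sW: "(\<Sum>b\<in>F. L b v *\<^sub>R d b) \<in> W" using d(1) by (intro subspace_sum[OF W] subspace_scale[OF W])
    have wW: "w \<in> W" unfolding w_def using sW v W by (intro subspace_add subspace_scale)
    have dW: "d ` F \<subseteq> W" using d(1) by blast
    have wF: "L b w = 0" if b: "b \<in> F" for b
    proof -
      have bT: "b \<in> T" using b FT by blast
      have "(\<Sum>b'\<in>F. L b' v * L b (d b')) = L b v"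
        using b insert(1) by (subst sum.remove[OF insert(1) b]) (simp add: d(2) sum.neutral)
      then show ?thesis
        unfolding w_def lw[OF bT sW v(1)] sumw[OF insert(1) dW bT] by simp
    qed
    have wx: "L x w = L q v"
    proof -
      have "L x w = - (\<Sum>b\<in>F. L b v * L x (d b)) + L x v"
        unfolding w_def lw[OF xT sW v(1)] sumw[OF insert(1) dW xT] by simp
      moreover have "L q v = - (\<Sum>b\<in>F. L x (d b) * L b v) + L x v"
        unfolding q_def lq[OF sT xT v(1)] sumq[OF insert(1) FT v(1)] by simp
      ultimately show ?thesis by (simp add: mult.commute)
    qed
    show ?case
    proof
      fix c
      obtain u where u: "u \<in> W" "\<forall>b\<in>F. L b u = c b" using IH by blast
      define r where "r = ((c x - L x u) / L x w) *\<^sub>R w + u"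
      have "r \<in> W" unfolding r_def using u wW W by (intro subspace_add subspace_scale)
      moreover have "L b r = c b" if "b \<in> insert x F" for b
      proof -
        have bT: "b \<in> T" using that FT xT by blast
        have "L x w \<noteq> 0" using v wx by simp
        then show ?thesis
          using that u(2) wF[of b] unfolding r_def lw[OF bT wW u(1)] by (cases "b = x") auto
      qed
      ultimately show "\<exists>w\<in>W. \<forall>b\<in>insert x F. L b w = c b" by blast
    qed
  qed
  then show ?thesis using B(1) by blast
qed

text \<open>The bases in a \<open>dof_choice\<close> are arbitrary sets; their finiteness, on which
  the induction in \<open>dual_lift\<close> rests, is derived from this.\<close>

definition finite_dim :: "'a::real_vector set \<Rightarrow> bool"
  where "finite_dim T \<longleftrightarrow> (\<exists>F. finite F \<and> T \<subseteq> span F)"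

lemma finite_dim_basis: "is_basis B T \<Longrightarrow> finite_dim T \<Longrightarrow> finite B"
  unfolding is_basis_def finite_dim_def using independent_span_bound span_superset by blast

lemma finite_dim_span: "finite F \<Longrightarrow> finite_dim (span F)"
  unfolding finite_dim_def by blast

lemma finite_dim_image:
  assumes "finite_dim T" "linear f"
  shows "finite_dim (f ` T)"
proof -
  obtain F where F: "finite F" "T \<subseteq> span F" using assms(1) unfolding finite_dim_def by blast
  have "f ` T \<subseteq> span (f ` F)" using F(2) linear_span_image[OF assms(2)] by blast
  then show ?thesis unfolding finite_dim_def using F(1) by blast
qed

lemma finite_dim_sum:
  assumes "finite_dim S" "finite_dim T"
  shows "finite_dim {a + b | a b. a \<in> S \<and> b \<in> T}"
proof -
  obtain F G where F: "finite F" "S \<subseteq> span F" "finite G" "T \<subseteq> span G" using assms unfolding finite_dim_def by blast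
  have "{a + b | a b. a \<in> S \<and> b \<in> T} \<subseteq> span (F \<union> G)"
    using F span_mono[of F "F \<union> G"] span_mono[of G "F \<union> G"] by (auto intro!: span_add)
  then show ?thesis unfolding finite_dim_def using F by blast
qed

lemma finite_dim_mono: "finite_dim T \<Longrightarrow> S \<subseteq> T \<Longrightarrow> finite_dim S"
  unfolding finite_dim_def by blast

section \<open>Conformity in the interior\<close>

text \<open>By translation invariance every difference quotient of \<open>f\<close> along
  \<open>e\<close> has integral \<open>0\<close>. The quotients converge to \<open>g\<close> and, by
  the mean value theorem, are dominated by a constant on a fixed ball.\<close>

lemma integral_partial_zero:
  fixes f g :: "'a::euclidean_space \<Rightarrow> real"
  assumes D: "\<And>p. ((\<lambda>s. f (p + s *\<^sub>R e)) has_real_derivative g p) (at 0)"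
    and cf: "continuous_on UNIV f" and cg: "continuous_on UNIV g"
    and supp: "\<And>p. norm p > R \<Longrightarrow> f p = 0"
  shows "integrable lborel g" "(LINT p|lborel. g p) = 0"
proof -
  have Ds: "((\<lambda>s. f (p + s *\<^sub>R e)) has_real_derivative g (p + t *\<^sub>R e)) (at t)" for p t
  proof -
    have "((\<lambda>s. f ((p + t *\<^sub>R e) + s *\<^sub>R e)) has_real_derivative g (p + t *\<^sub>R e)) (at 0)" by (rule D)
    then have "((\<lambda>s. f (p + (s + t) *\<^sub>R e)) has_real_derivative g (p + t *\<^sub>R e)) (at 0)"
      by (simp add: algebra_simps)
    then show ?thesis using DERIV_at_within_shift[of "\<lambda>s. f (p + s *\<^sub>R e)" "g (p + t *\<^sub>R e)" t 0 UNIV] by (simp add: add.commute)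
  qed
  define h where "h = (\<lambda>n p. real (Suc n) * (f (inverse (real (Suc n)) *\<^sub>R e + p) - f p))"
  have conv: "(\<lambda>n. h n p) \<longlonglongrightarrow> g p" for p
  proof -
    have "(\<lambda>s. (f (p + s *\<^sub>R e) - f p) / s) \<midarrow>0\<rightarrow> g p"
      using D[of p] by (simp add: DERIV_def)
    then have "(\<lambda>n. (f (p + inverse (real (Suc n)) *\<^sub>R e) - f p) / inverse (real (Suc n))) \<longlonglongrightarrow> g p"
      unfolding tendsto_at_iff_sequentially
      using LIMSEQ_inverse_real_of_nat by (auto simp: comp_def dest!: spec[of _ "\<lambda>n. inverse (real (Suc n))"])
    moreover have "(f (p + inverse (real (Suc n)) *\<^sub>R e) - f p) / inverse (real (Suc n)) = h n p" for n
      by (simp add: h_def divide_inverse mult.commute add.commute del: of_nat_Suc)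
    ultimately show ?thesis by simp
  qed
  \<comment> \<open>Outside this ball \<open>f\<close> and all its shifts by at most
    \<open>e\<close> vanish, hence all the quotients \<open>h n\<close> and their limit.\<close>
  define K where "K = cball (0::'a) (\<bar>R\<bar> + norm e)"
  have gz: "g p = 0" if "p \<notin> K" for p
  proof -
    have np: "norm p > \<bar>R\<bar> + norm e" using that by (simp add: K_def)
    have "h n p = 0" for n
    proof -
      have "norm (inverse (real (Suc n)) *\<^sub>R e) \<le> norm e"
        using mult_right_mono[of "inverse (real (Suc n))" 1 "norm e"] by (simp add: inverse_le_1_iff)
      then have "norm (inverse (real (Suc n)) *\<^sub>R e + p) > R"
        using np norm_triangle_ineq2[of p "- (inverse (real (Suc n)) *\<^sub>R e)"] by (simp add: add.commute)
      moreover have "norm p > R" using np norm_ge_zero[of e] by linarith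
      ultimately show ?thesis using supp by (simp add: h_def)
    qed
    then have "(\<lambda>n. 0) \<longlonglongrightarrow> g p" using conv[of p] by simp
    then show ?thesis using LIMSEQ_unique tendsto_const by blast
  qed
  have "compact (g ` K)" unfolding K_def using cg by (intro compact_continuous_image) (auto intro: continuous_on_subset)
  then obtain B where B: "\<And>p. p \<in> K \<Longrightarrow> \<bar>g p\<bar> \<le> B" using compact_imp_bounded bounded_real by (metis imageI)
  then have gB: "\<bar>g p\<bar> \<le> \<bar>B\<bar>" for p using gz[of p] by (cases "p \<in> K") force+
  have hB: "norm (h n p) \<le> \<bar>B\<bar> * indicator K p" for n p
  proof (cases "p \<in> K")
    case True
    define s where "s = inverse (real (Suc n))"
    have s: "s > 0" by (simp add: s_def)
    obtain z where z: "f (p + s *\<^sub>R e) - f (p + 0 *\<^sub>R e) = (s - 0) * g (p + z *\<^sub>R e)"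
      using MVT2[of 0 s "\<lambda>s. f (p + s *\<^sub>R e)" "\<lambda>t. g (p + t *\<^sub>R e)"] s Ds by blast
    have "h n p = g (p + z *\<^sub>R e)"
      using z by (simp add: h_def s_def add.commute field_simps)
    then show ?thesis using gB True by simp
  next
    case False
    have "norm p > \<bar>R\<bar> + norm e" using False by (simp add: K_def)
    moreover have "norm (inverse (real (Suc n)) *\<^sub>R e) \<le> norm e"
      using mult_right_mono[of "inverse (real (Suc n))" 1 "norm e"] by (simp add: inverse_le_1_iff)
    ultimately have "norm (inverse (real (Suc n)) *\<^sub>R e + p) > R"
      using norm_triangle_ineq2[of p "- (inverse (real (Suc n)) *\<^sub>R e)"] by (simp add: add.commute)
    moreover have "norm p > R" using \<open>norm p > \<bar>R\<bar> + norm e\<close> norm_ge_zero[of e] by linarith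
    ultimately show ?thesis using supp by (simp add: h_def)
  qed
  have bf: "f \<in> borel_measurable lborel" "g \<in> borel_measurable lborel"
    using cf cg by (auto intro: borel_measurable_continuous_onI)
  have iw: "integrable lborel (\<lambda>p. \<bar>B\<bar> * indicator K p)"
    using emeasure_lborel_cball_finite[of 0 "\<bar>R\<bar> + norm e"] unfolding K_def
    by (intro integrable_mult_right integrable_real_indicator) simp_all
  have bh: "h n \<in> borel_measurable lborel" for n
    unfolding h_def using bf(1) by measurable
  show "integrable lborel g"
    by (rule Bochner_Integration.integrable_bound[OF iw bf(2)]) (use gB gz in \<open>auto simp: indicator_def\<close>)
  have intf: "integrable lborel f"
  proof -
    have "integrable lborel (\<lambda>x. indicator (cball 0 \<bar>R\<bar>) x *\<^sub>R f x)"
      by (rule borel_integrable_compact) (auto intro: continuous_on_subset[OF cf])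
    moreover have "(\<lambda>x. indicator (cball 0 \<bar>R\<bar>) x *\<^sub>R f x) = f"
      using supp by (auto simp: fun_eq_iff indicator_def)
    ultimately show ?thesis by simp
  qed
  have shift: "integrable lborel (\<lambda>p. f (c + p))" "(LINT p|lborel. f (c + p)) = (LINT p|lborel. f p)" for c
  proof -
    have m: "(+) c \<in> measurable lborel borel" by measurable
    have fb: "f \<in> borel_measurable borel" using cf by (rule borel_measurable_continuous_onI)
    have "integrable (distr lborel borel ((+) c)) f" using intf by (simp add: lborel_distr_plus)
    then show "integrable lborel (\<lambda>p. f (c + p))"
      using integrable_distr_eq[OF m fb] by blast
    show "(LINT p|lborel. f (c + p)) = (LINT p|lborel. f p)"
      using integral_distr[OF m fb] by (simp add: lborel_distr_plus)
  qed
  have "(LINT p|lborel. h n p) = 0" for n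
    unfolding h_def using shift intf by simp
  moreover have "(\<lambda>n. LINT p|lborel. h n p) \<longlonglongrightarrow> (LINT p|lborel. g p)"
    by (rule integral_dominated_convergence[OF bf(2) bh iw]) (use conv hB in auto)
  ultimately show "(LINT p|lborel. g p) = 0" by (simp add: LIMSEQ_const_iff)
qed

lemma nice_square_integrable:
  assumes "nice pyramid A"
  shows "square_integrable pyramid A"
  unfolding square_integrable_def
proof
  have "set_integrable lebesgue pyramid A"
    using set_int_interior(1)[OF convex_pyramid bounded_pyramid] assms unfolding nice_def by blast
  then show "set_borel_measurable lebesgue pyramid A"
    unfolding set_integrable_def set_borel_measurable_def by (rule borel_measurable_integrable)
  have "set_integrable lebesgue pyramid (\<lambda>p. A p \<bullet> A p)"
    using set_int_interior(1)[OF convex_pyramid bounded_pyramid nice_inner[OF assms assms]] .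
  then show "set_integrable lebesgue pyramid (\<lambda>p. (norm (A p))\<^sup>2)"
    by (simp add: power2_norm_eq_inner)
qed

lemma line_derivative:
  fixes u :: "pt \<Rightarrow> pt"
  assumes "u differentiable (at p)"
  shows "((\<lambda>s. u (p + s *\<^sub>R axis l 1) $ i) has_real_derivative frechet_derivative u (at p) (axis l 1) $ i) (at 0)"
proof -
  have "(u has_derivative frechet_derivative u (at p)) (at (p + 0 *\<^sub>R axis l 1))"
    using iffD1[OF frechet_derivative_works assms] by simp
  then have "((\<lambda>s. u (p + s *\<^sub>R axis l 1)) has_derivative (\<lambda>h. frechet_derivative u (at p) (h *\<^sub>R axis l 1))) (at 0)"
    by (rule has_derivative_compose[rotated]) (auto intro!: derivative_eq_intros)
  moreover have "frechet_derivative u (at p) (h *\<^sub>R axis l 1) = h *\<^sub>R frechet_derivative u (at p) (axis l 1)" for h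
    using linear_scale[OF linear_frechet_derivative[OF assms]] .
  ultimately show ?thesis
    unfolding has_derivative_vec_nth_iff has_field_derivative_def by (simp add: mult_commute_abs)
qed

text \<open>\<open>E\<close> is differentiable in the interior only, but its products with
  \<open>v\<close> and with the derivatives of \<open>v\<close> vanish outside the compact set
  \<open>K\<close>. Continuity is checked on the open sets \<open>interior pyramid\<close> and
  \<open>- K\<close>, which cover the space.\<close>

lemma ibp:
  fixes l i j :: 3
  assumes E: "reg E" and v: "test_field pyramid v"
  defines "g \<equiv> \<lambda>p. if p \<in> interior pyramid then
      frechet_derivative E (at p) (axis l 1) $ i * v p $ j + E p $ i * frechet_derivative v (at p) (axis l 1) $ j else 0"
  shows "integrable lebesgue g" "(LINT p|lebesgue. g p) = 0"
proof -
  define K where "K = closure {p. v p \<noteq> 0}"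
  have K: "compact K" "K \<subseteq> interior pyramid" and vC: "\<And>n. C_n n v"
    using v unfolding test_field_def K_def by auto
  have vz: "v p = 0" if "p \<notin> K" for p using that closure_subset[of "{p. v p \<noteq> 0}"] by (auto simp: K_def)
  have vd: "v differentiable (at p)" for p using vC[of "Suc 0"] by simp
  have ax: "axis l (1::real) \<in> Basis" for l :: 3 by (auto simp: axis_in_Basis_iff)
  have vc1: "continuous_on UNIV v" using vC[of 0] by simp
  have vc2: "continuous_on UNIV (\<lambda>p. frechet_derivative v (at p) (axis l 1))" using vC[of "Suc 0"] ax by simp
  have dvz: "frechet_derivative v (at p) (axis l 1) = 0" if "p \<in> - K" for p
  proof -
    have "((\<lambda>_. 0) has_derivative (\<lambda>_. 0)) (at p)" by simp
    then have "(v has_derivative (\<lambda>_. 0)) (at p)"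
      by (rule has_derivative_transform_within_open[of _ _ _ _ "- K"]) (use that K(1) vz in \<open>auto simp: compact_imp_closed open_Compl\<close>)
    then have "frechet_derivative v (at p) = (\<lambda>_. 0)" using frechet_derivative_at by metis
    then show ?thesis by simp
  qed
  have Ec: "continuous_on (interior pyramid) E"
    using E continuous_on_subset interior_pyramidD unfolding reg_def by blast
  have cov: "UNIV = interior pyramid \<union> - K" using K by blast
  have oK: "open (- K)" using K(1) by (simp add: compact_imp_closed open_Compl)
  have gK: "g p = 0" if "p \<in> - K" for p using that vz dvz by (simp add: g_def)
  have cg: "continuous_on UNIV g"
    unfolding cov
  proof (rule continuous_on_open_Un[OF open_interior oK])
    have "continuous_on (interior pyramid) (\<lambda>p. frechet_derivative E (at p) (axis l 1) $ i * v p $ j + E p $ i * frechet_derivative v (at p) (axis l 1) $ j)"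
    proof (intro continuous_on_add continuous_on_mult)
      show "continuous_on (interior pyramid) (\<lambda>p. frechet_derivative E (at p) (axis l 1) $ i)"
        using E unfolding reg_def by blast
    qed (use Ec continuous_on_subset[OF vc1 subset_UNIV] continuous_on_subset[OF vc2 subset_UNIV] in \<open>auto intro!: continuous_intros\<close>)
    then show "continuous_on (interior pyramid) g"
      by (rule continuous_on_eq) (simp add: g_def)
    show "continuous_on (- K) g"
      by (rule continuous_on_eq[OF continuous_on_const[of _ 0]]) (simp add: gK)
  qed
  have cf: "continuous_on UNIV (\<lambda>p. E p $ i * v p $ j)"
    unfolding cov
  proof (rule continuous_on_open_Un[OF open_interior oK])
    show "continuous_on (interior pyramid) (\<lambda>p. E p $ i * v p $ j)"
      using Ec by (intro continuous_intros continuous_on_subset[OF vc1]) auto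
    show "continuous_on (- K) (\<lambda>p. E p $ i * v p $ j)"
      by (rule continuous_on_eq[OF continuous_on_const[of _ 0]]) (simp add: vz)
  qed
  obtain R where R: "\<And>p. p \<in> K \<Longrightarrow> norm p \<le> R" using compact_imp_bounded[OF K(1)] by (auto simp: bounded_iff)
  have D: "((\<lambda>s. E (p + s *\<^sub>R axis l 1) $ i * v (p + s *\<^sub>R axis l 1) $ j) has_real_derivative g p) (at 0)" for p
  proof (cases "p \<in> interior pyramid")
    case True
    then have "E differentiable (at p)" using E unfolding reg_def by blast
    from DERIV_mult[OF line_derivative[OF this, of l i] line_derivative[OF vd, of p l j]]
    show ?thesis using True by (simp add: g_def mult.commute add.commute)
  next
    case False
    then have pK: "p \<in> - K" using K by blast
    have "open ((\<lambda>s::real. p + s *\<^sub>R axis l 1) -` (- K))"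
      by (rule open_vimage[OF oK]) (intro continuous_intros)
    then have "((\<lambda>s. E (p + s *\<^sub>R axis l 1) $ i * v (p + s *\<^sub>R axis l 1) $ j) has_real_derivative 0) (at 0)"
      by (intro has_field_derivative_transform_within_open[OF DERIV_const[of 0]]) (use pK vz in auto)
    then show ?thesis using gK[OF pK] by simp
  qed
  note I = integral_partial_zero[OF D cf cg, of R]
  have s: "E p $ i * v p $ j = 0" if "norm p > R" for p using that R[of p] vz[of p] by force
  have bg: "g \<in> borel_measurable lborel" using cg by (simp add: borel_measurable_continuous_onI)
  show "integrable lebesgue g" using I(1)[OF s] bg by (simp add: integrable_completion)
  show "(LINT p|lebesgue. g p) = 0" using I(2)[OF s] bg by (simp add: integral_completion)
qed

lemma reg_nice: "reg E \<Longrightarrow> nice pyramid E"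
  unfolding reg_def nice_def using interior_pyramidD
  by (meson bounded_subset continuous_on_subset image_mono subsetI subset_UNIV)

lemma reg_curl_nice: "reg E \<Longrightarrow> nice pyramid (curl E)"
proof -
  assume E: "reg E"
  have "continuous_on (interior pyramid) (curl E)"
  proof (rule continuous_on_pt)
    fix i :: 3
    have "continuous_on (interior pyramid) (\<lambda>p. curl E p $ 1)" "continuous_on (interior pyramid) (\<lambda>p. curl E p $ 2)"
      "continuous_on (interior pyramid) (\<lambda>p. curl E p $ 3)"
      unfolding curl_def Let_def vector_3 using E unfolding reg_def by (auto intro: continuous_on_diff)
    then show "continuous_on (interior pyramid) (\<lambda>p. curl E p $ i)" using exhaust_3[of i] by auto
  qed
  then show ?thesis using E unfolding reg_def nice_def by blast
qed

text \<open>The pointwise curl serves as the distributional one. The behaviour at the apex does not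
  interfere, since the supports of test fields are compact subsets of the interior.\<close>

lemma reg_H_curl:
  assumes E: "reg E"
  shows "E \<in> H_curl pyramid"
proof -
  have sq: "square_integrable pyramid E" "square_integrable pyramid (curl E)"
    using nice_square_integrable reg_nice[OF E] reg_curl_nice[OF E] by blast+
  have "(LINT p:pyramid|lebesgue. E p \<bullet> curl v p) = (LINT p:pyramid|lebesgue. curl E p \<bullet> v p)"
    if v: "test_field pyramid v" for v
  proof -
    have vC: "C_n n v" for n using v unfolding test_field_def by blast
    have ax: "axis l (1::real) \<in> Basis" for l :: 3 by (auto simp: axis_in_Basis_iff)
    have vc2: "continuous_on UNIV (\<lambda>p. frechet_derivative v (at p) (axis l 1))" for l using vC[of "Suc 0"] ax by simp
    have "continuous_on UNIV (curl v)"
    proof (rule continuous_on_pt)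
      fix i :: 3
      have "continuous_on UNIV (\<lambda>p. curl v p $ 1)" "continuous_on UNIV (\<lambda>p. curl v p $ 2)" "continuous_on UNIV (\<lambda>p. curl v p $ 3)"
        unfolding curl_def Let_def vector_3 by (auto intro!: continuous_intros vc2)
      then show "continuous_on UNIV (\<lambda>p. curl v p $ i)" using exhaust_3[of i] by auto
    qed
    have "nice pyramid A" if "continuous_on UNIV A" for A
    proof -
      have "compact (A ` cbox 0 1)"
        by (intro compact_continuous_image continuous_on_subset[OF that]) auto
      moreover have "A ` interior pyramid \<subseteq> A ` cbox 0 1"
        using interior_subset[of pyramid] pyramid_subset_cbox by blast
      ultimately show ?thesis
        unfolding nice_def using continuous_on_subset[OF that] bounded_subset compact_imp_bounded by blast
    qed
    then have nv: "nice pyramid v" "nice pyramid (curl v)"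
      using vC[of 0] \<open>continuous_on UNIV (curl v)\<close> by auto
    define g where "g = (\<lambda>l i j p. if p \<in> interior pyramid then
      frechet_derivative E (at p) (axis l 1) $ i * v p $ j + E p $ i * frechet_derivative v (at p) (axis l 1) $ j else 0)"
    have I: "integrable lebesgue (g l i j)" "(LINT p|lebesgue. g l i j p) = 0" for l i j
      unfolding g_def by (rule ibp[OF E v])+
    \<comment> \<open>The divergence of the cross product of \<open>E\<close> and \<open>v\<close>,
      extended by \<open>0\<close>; in the interior it equals the difference of
      \<open>curl E \<bullet> v\<close> and \<open>E \<bullet> curl v\<close>.\<close>
    define G where "G = (\<lambda>p. g 2 3 1 p - g 3 2 1 p + (g 3 1 2 p - g 1 3 2 p) + (g 1 2 3 p - g 2 1 3 p))"
    have I0: "(LINT p|lebesgue. G p) = 0"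
      unfolding G_def using I by simp
    have Gint: "indicator (interior pyramid) p *\<^sub>R (curl E p \<bullet> v p - E p \<bullet> curl v p) = G p" for p
      by (cases "p \<in> interior pyramid") (simp_all add: G_def g_def curl_def Let_def inner_pt algebra_simps)
    have "pair pyramid (curl E) v - pair pyramid E (curl v) =
       integral (interior pyramid) (\<lambda>p. curl E p \<bullet> v p - E p \<bullet> curl v p)"
      using pair_integral[OF convex_pyramid bounded_pyramid reg_curl_nice[OF E] nv(1)]
        pair_integral[OF convex_pyramid bounded_pyramid reg_nice[OF E] nv(2)]
      by (simp add: integral_diff)
    also have "\<dots> = (LINT p:interior pyramid|lebesgue. curl E p \<bullet> v p - E p \<bullet> curl v p)"
    proof (rule set_lebesgue_integral_eq_integral(2)[symmetric])
      have "integrable lebesgue G" unfolding G_def using I(1) by simp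
      then show "set_integrable lebesgue (interior pyramid) (\<lambda>p. curl E p \<bullet> v p - E p \<bullet> curl v p)"
        unfolding set_integrable_def Gint .
    qed
    also have "\<dots> = 0" unfolding set_lebesgue_integral_def Gint by (rule I0)
    finally show ?thesis unfolding pair_def by simp
  qed
  then show ?thesis unfolding H_curl_def using sq by blast
qed

section \<open>Edges and faces\<close>

definition base_edge :: "bool \<Rightarrow> real \<Rightarrow> pt \<times> pt" where "base_edge b s = (face_point b 0 s 0, face_point b 1 s 0)"
definition vert_edge :: "real \<Rightarrow> real \<Rightarrow> pt \<times> pt" where "vert_edge s1 s2 = (vector [s1, s2, 0], apex)"
definition tri_face :: "bool \<Rightarrow> real \<Rightarrow> pt \<times> pt \<times> pt" where "tri_face b s = (face_point b 0 s 0, face_point b 1 s 0, apex)"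

lemma edges_iff: "e \<in> edges \<longleftrightarrow> (\<exists>b. \<exists>s\<in>{0,1}. e = base_edge b s) \<or> (\<exists>s1\<in>{0,1}. \<exists>s2\<in>{0,1}. e = vert_edge s1 s2)"
  unfolding edges_def by (auto simp: ex_bool_eq base_edge_def vert_edge_def face_point_def)

lemma tri_faces_iff: "T \<in> tri_faces \<longleftrightarrow> (\<exists>b. \<exists>s\<in>{0,1}. T = tri_face b s)"
  unfolding tri_faces_def by (auto simp: ex_bool_eq tri_face_def face_point_def)

definition edge_point :: "pt \<times> pt \<Rightarrow> real \<Rightarrow> pt" where "edge_point e s = fst e + s *\<^sub>R (snd e - fst e)"
text \<open>The edge vector is not normalised, which keeps the coefficients simple; a unit tangent
  differs from it by a nonzero factor.\<close>

definition edge_trace :: "(pt \<Rightarrow> pt) \<Rightarrow> pt \<times> pt \<Rightarrow> real \<Rightarrow> real"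
  where "edge_trace E e s = E (edge_point e s) \<bullet> (snd e - fst e)"

lemma edge_dof_pair:
  "edge_dof e t q E = norm (snd e - fst e) * pair {0..1} (\<lambda>s. E (edge_point e s)) (\<lambda>s. q (edge_point e s) *\<^sub>R t)"
  by (cases e) (simp add: edge_dof_def pair_def edge_point_def mult.commute)

lemma edge_point_base_edge: "edge_point (base_edge b s) \<sigma> = face_point b \<sigma> s 0"
  by (auto simp: edge_point_def base_edge_def pt_eq_iff)

lemma edge_point_vert_edge: "edge_point (vert_edge s1 s2) \<sigma> = vector [s1 * (1 - \<sigma>), s2 * (1 - \<sigma>), \<sigma>]"
  by (auto simp: edge_point_def vert_edge_def pt_eq_iff algebra_simps)

text \<open>Some coordinate serves as the parameter, so every polynomial in the parameter is the
  restriction of a polynomial in space of the same degree.\<close>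

lemma edge_coordinate: "e \<in> edges \<Longrightarrow> \<exists>i. \<forall>\<sigma>. edge_point e \<sigma> $ i = \<sigma>"
  unfolding edges_iff using edge_point_base_edge edge_point_vert_edge
  by (metis face_point_nth(4) vector_3(3))

lemma edge_point_mem: "e \<in> edges \<Longrightarrow> 0 \<le> \<sigma> \<Longrightarrow> \<sigma> < 1 \<Longrightarrow> edge_point e \<sigma> \<in> pyramid - {apex}"
  unfolding edges_iff mem_pyramid_no_apex
  by (auto simp: edge_point_base_edge edge_point_vert_edge pyramid_def)

lemma edge_nonzero: "e \<in> edges \<Longrightarrow> snd e - fst e \<noteq> 0"
proof
  assume e: "e \<in> edges" and 0: "snd e - fst e = 0"
  obtain i where "\<forall>\<sigma>. edge_point e \<sigma> $ i = \<sigma>" using edge_coordinate[OF e] by blast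
  from this[rule_format, of 0] this[rule_format, of 1] show False by (simp add: edge_point_def 0)
qed

lemma edge_set_edge_point: "edge_set e = edge_point e ` {0..1}"
proof (cases e)
  case (Pair a b)
  then show ?thesis
    by (simp add: closed_segment_image_interval edge_point_def[abs_def] algebra_simps)
qed

lemma pushf_at:
  assumes "p \<in> pyramid - {apex}"
  shows "pushf (rfield k N1 N2 N3) p = push_lin p (vector [N1 (psi p) * (1 - p$3) ^ (k + 1), N2 (psi p) * (1 - p$3) ^ (k + 1), N3 (psi p) * (1 - p$3) ^ (k + 1)])"
proof -
  have "p$3 \<noteq> 1" using assms unfolding mem_pyramid_no_apex by auto
  then show ?thesis
    using assms unfolding pushf_def rfield_def one_plus_psi3[OF \<open>p$3 \<noteq> 1\<close>]
    by (simp add: power_divide)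
qed

lemma edge_trace_base_edge:
  assumes "s \<in> {0,1}" "0 \<le> \<sigma>" "\<sigma> \<le> 1"
  shows "edge_trace (pushf (rfield k N1 N2 N3)) (base_edge b s) \<sigma> = (if b then N1 else N2) (face_point b \<sigma> s 0)"
proof -
  have m: "face_point b \<sigma> s 0 \<in> pyramid - {apex}"
    unfolding mem_pyramid_no_apex using assms by (auto simp: pyramid_def)
  have ps: "psi (face_point b \<sigma> s 0) = face_point b \<sigma> s 0" by (simp add: pt_eq_iff)
  show ?thesis
    unfolding edge_trace_def edge_point_base_edge pushf_at[OF m] ps by (auto simp: base_edge_def inner_pt)
qed

text \<open>The edge comes from the line over \<open>(s1, s2)\<close> parallel to the
  \<open>z\<close>-axis, so only the third component survives. The exponent is \<open>k + 1\<close>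
  from the denominator minus \<open>2\<close> from \<open>push_lin\<close>.\<close>

lemma edge_trace_vert_edge:
  assumes "s1 \<in> {0,1}" "s2 \<in> {0,1}" "0 \<le> \<sigma>" "\<sigma> < 1" "k \<ge> 1"
  shows "edge_trace (pushf (rfield k N1 N2 N3)) (vert_edge s1 s2) \<sigma> = (1 - \<sigma>) ^ (k - 1) * N3 (vector [s1, s2, \<sigma> / (1 - \<sigma>)])"
proof -
  have m: "vector [s1 * (1 - \<sigma>), s2 * (1 - \<sigma>), \<sigma>] \<in> pyramid - {apex}"
    unfolding mem_pyramid_no_apex using assms by (auto simp: pyramid_def)
  have ps: "psi (vector [s1 * (1 - \<sigma>), s2 * (1 - \<sigma>), \<sigma>]) = vector [s1, s2, \<sigma> / (1 - \<sigma>)]"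
    using assms by (simp add: pt_eq_iff)
  obtain j where j: "k = Suc j" using assms by (cases k) auto
  define t where "t = 1 - \<sigma>"
  have t: "t \<noteq> 0" using assms by (simp add: t_def)
  show ?thesis
    unfolding edge_trace_def edge_point_vert_edge pushf_at[OF m] ps push_lin_def inner_pt
    using t by (simp add: vert_edge_def t_def[symmetric] j power2_eq_square) (simp add: field_simps)
qed

section \<open>Parametrisation of the triangular faces and of the base\<close>

definition ref_triangle :: "(real \<times> real) set"
  where "ref_triangle = {\<sigma>. 0 \<le> fst \<sigma> \<and> 0 \<le> snd \<sigma> \<and> fst \<sigma> + snd \<sigma> \<le> 1}"

lemma ref_triangle_halfspaces: "ref_triangle = {\<sigma>. (1, 0) \<bullet> \<sigma> \<ge> 0} \<inter> {\<sigma>. (0, 1) \<bullet> \<sigma> \<ge> 0} \<inter> {\<sigma>. (1, 1) \<bullet> \<sigma> \<le> 1}"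
  by (auto simp: ref_triangle_def inner_prod_def)

lemma interior_ref_triangle: "interior ref_triangle = {\<sigma>. 0 < fst \<sigma> \<and> 0 < snd \<sigma> \<and> fst \<sigma> + snd \<sigma> < 1}"
proof -
  have nz: "(1, 0) \<noteq> (0 :: real \<times> real)" "(0, 1) \<noteq> (0 :: real \<times> real)" "(1, 1) \<noteq> (0 :: real \<times> real)"
    by (auto simp: zero_prod_def)
  show ?thesis
    unfolding ref_triangle_halfspaces interior_Int interior_halfspace_ge[OF nz(1)] interior_halfspace_ge[OF nz(2)]
      interior_halfspace_le[OF nz(3)] by (auto simp: inner_prod_def)
qed

lemma interior_ref_triangleD: "\<sigma> \<in> interior ref_triangle \<Longrightarrow> \<sigma> \<in> ref_triangle \<and> snd \<sigma> < 1"
  using interior_subset[of ref_triangle] by (auto simp: interior_ref_triangle)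

lemma convex_ref_triangle: "convex ref_triangle"
  unfolding ref_triangle_halfspaces by (intro convex_Int convex_halfspace_ge convex_halfspace_le)

lemma bounded_ref_triangle: "bounded ref_triangle"
proof -
  have "ref_triangle \<subseteq> cbox (0,0) (1,1)" by (auto simp: ref_triangle_def cbox_Pair_eq)
  then show ?thesis using bounded_cbox bounded_subset by blast
qed

definition tri_point :: "pt \<times> pt \<times> pt \<Rightarrow> real \<times> real \<Rightarrow> pt"
  where "tri_point T \<sigma> = fst T + fst \<sigma> *\<^sub>R (fst (snd T) - fst T) + snd \<sigma> *\<^sub>R (snd (snd T) - fst T)"

lemma tri_dof_pair:
  "tri_dof T q E = norm (cross3 (fst (snd T) - fst T) (snd (snd T) - fst T)) * pair ref_triangle (\<lambda>\<sigma>. E (tri_point T \<sigma>)) (\<lambda>\<sigma>. q (tri_point T \<sigma>))"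
  by (cases T) (simp add: tri_dof_def pair_def tri_point_def ref_triangle_def)

lemma tri_set_tri_point: "tri_set T = tri_point T ` ref_triangle"
proof (cases T)
  case (fields a b c)
  then show ?thesis
    unfolding tri_point_def ref_triangle_def tri_set.simps fields convex_hull_3_alt by (force simp: image_iff)
qed

lemma tri_face_sides: "fst (snd (tri_face b s)) - fst (tri_face b s) = axis (ix b) 1" "snd (snd (tri_face b s)) - fst (tri_face b s) = face_point b 0 (- s) 1"
  by (auto simp: tri_face_def pt_eq_iff axis_def ix_def)

lemma tri_point_tri_face: "tri_point (tri_face b s) \<sigma> = face_point b (fst \<sigma>) (s * (1 - snd \<sigma>)) (snd \<sigma>)"
  unfolding tri_point_def tri_face_sides by (auto simp: tri_face_def pt_eq_iff axis_def ix_def algebra_simps)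

lemma tri_point_mem:
  assumes "s \<in> {0,1}" "\<sigma> \<in> ref_triangle" "snd \<sigma> < 1"
  shows "tri_point (tri_face b s) \<sigma> \<in> pyramid - {apex}" "psi (tri_point (tri_face b s) \<sigma>) = face_point b (fst \<sigma> / (1 - snd \<sigma>)) s (snd \<sigma> / (1 - snd \<sigma>))"
proof -
  show "tri_point (tri_face b s) \<sigma> \<in> pyramid - {apex}"
    unfolding mem_pyramid_no_apex tri_point_tri_face using assms by (auto simp: pyramid_def ref_triangle_def)
  show "psi (tri_point (tri_face b s) \<sigma>) = face_point b (fst \<sigma> / (1 - snd \<sigma>)) s (snd \<sigma> / (1 - snd \<sigma>))"
    unfolding tri_point_tri_face using assms by (auto simp: pt_eq_iff)
qed

text \<open>The vector \<open>face_point b 0 (- s) 1\<close> leads from the first vertex of the face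
  to the apex. In the inner product with it the numerator transverse to the vertical face cancels,
  which leaves the two tangential ones.\<close>

lemma face_components:
  assumes s: "s \<in> {0,1}" and \<sigma>: "\<sigma> \<in> ref_triangle" "snd \<sigma> < 1" and k: "k \<ge> 1"
    and t_def: "t = 1 - snd \<sigma>" and F_def: "F = face_point b (fst \<sigma> / t) s (snd \<sigma> / t)"
  shows "pushf (rfield k N1 N2 N3) (tri_point (tri_face b s) \<sigma>) \<bullet> axis (ix b) 1 = (if b then N1 else N2) F * t ^ k"
    "pushf (rfield k N1 N2 N3) (tri_point (tri_face b s) \<sigma>) \<bullet> face_point b 0 (- s) 1 =
      fst \<sigma> / t * ((if b then N1 else N2) F * t ^ k) + N3 F * t ^ (k - 1)"
proof -
  have t: "t \<noteq> 0" using \<sigma> by (simp add: t_def)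
  obtain j where j: "k = Suc j" using k by (cases k) auto
  have 3: "1 - tri_point (tri_face b s) \<sigma> $ 3 = t" by (simp add: tri_point_tri_face t_def)
  have F: "psi (tri_point (tri_face b s) \<sigma>) = F" using tri_point_mem(2)[OF s \<sigma>] by (simp add: F_def t_def)
  have p: "pushf (rfield k N1 N2 N3) (tri_point (tri_face b s) \<sigma>) = vector [N1 F * t ^ k, N2 F * t ^ k,
    F$1 * (N1 F * t ^ k) + F$2 * (N2 F * t ^ k) + N3 F * t ^ (k - 1)]"
    unfolding pushf_at[OF tri_point_mem(1)[OF s \<sigma>]] push_lin_def F 3
    using t by (simp add: pt_eq_iff j power2_eq_square add_divide_distrib)
  show "pushf (rfield k N1 N2 N3) (tri_point (tri_face b s) \<sigma>) \<bullet> axis (ix b) 1 = (if b then N1 else N2) F * t ^ k"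
    unfolding p by (simp add: inner_axis ix_def)
  show "pushf (rfield k N1 N2 N3) (tri_point (tri_face b s) \<sigma>) \<bullet> face_point b 0 (- s) 1 =
      fst \<sigma> / t * ((if b then N1 else N2) F * t ^ k) + N3 F * t ^ (k - 1)"
    unfolding p by (simp add: inner_pt F_def)
qed

definition ref_square :: "(real \<times> real) set" where "ref_square = {0..1} \<times> {0..1}"

lemma ref_square_facts: "convex ref_square" "bounded ref_square" "interior ref_square = {0<..<1} \<times> {0<..<1}"
  by (auto simp: ref_square_def interior_Times convex_Times bounded_Times)

definition base_point :: "real \<times> real \<Rightarrow> pt" where "base_point \<sigma> = vector [fst \<sigma>, snd \<sigma>, 0]"

text \<open>Moves the fixed normal to the test field, so that the base functional pairs the field
  with a rotated test field.\<close>

lemma cross3_inner_swap: "cross3 u n \<bullet> q = u \<bullet> cross3 n q"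
  by (simp add: cross3_def inner_pt algebra_simps)

lemma base_dof_pair: "base_dof n q E = pair ref_square (\<lambda>\<sigma>. E (base_point \<sigma>)) (\<lambda>\<sigma>. cross3 n (q (base_point \<sigma>)))"
  by (simp add: base_dof_def base_integral_def pair_def base_point_def ref_square_def cross3_inner_swap)

lemma base_point_mem: "\<sigma> \<in> ref_square \<Longrightarrow> base_point \<sigma> \<in> pyramid - {apex}" "\<sigma> \<in> ref_square \<Longrightarrow> base_point \<sigma> \<in> base"
  unfolding mem_pyramid_no_apex base_def by (auto simp: base_point_def pyramid_def ref_square_def)

lemma base_components:
  assumes "\<sigma> \<in> ref_square"
  shows "pushf (rfield k N1 N2 N3) (base_point \<sigma>) $ 1 = N1 (base_point \<sigma>)" "pushf (rfield k N1 N2 N3) (base_point \<sigma>) $ 2 = N2 (base_point \<sigma>)"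
proof -
  have ps: "psi (base_point \<sigma>) = base_point \<sigma>" by (simp add: pt_eq_iff base_point_def)
  show "pushf (rfield k N1 N2 N3) (base_point \<sigma>) $ 1 = N1 (base_point \<sigma>)" "pushf (rfield k N1 N2 N3) (base_point \<sigma>) $ 2 = N2 (base_point \<sigma>)"
    unfolding pushf_at[OF base_point_mem(1)[OF assms]] ps by (simp_all add: base_point_def)
qed

section \<open>Bilinearity of the degrees of freedom\<close>

lemma nice_continuous:
  assumes "continuous_on UNIV h" "bounded T" "\<And>\<sigma>. \<sigma> \<in> interior T \<Longrightarrow> B \<sigma> = h \<sigma>"
  shows "nice T B"
proof -
  have "compact (h ` closure T)"
    using assms(2) by (intro compact_continuous_image continuous_on_subset[OF assms(1)]) (auto simp: compact_closure)
  moreover have "h ` interior T \<subseteq> h ` closure T"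
    using interior_subset[of T] closure_subset[of T] by blast
  ultimately have "nice T h"
    unfolding nice_def using continuous_on_subset[OF assms(1)] bounded_subset compact_imp_bounded by blast
  then show ?thesis using nice_cong[of T B h] assms(3) by blast
qed

lemma nice_compose:
  assumes E: "reg E" and par: "continuous_on UNIV par" "\<And>\<sigma>. \<sigma> \<in> interior T \<Longrightarrow> par \<sigma> \<in> pyramid - {apex}"
  shows "nice T (\<lambda>\<sigma>. E (par \<sigma>))"
  unfolding nice_def
proof
  show "continuous_on (interior T) (\<lambda>\<sigma>. E (par \<sigma>))"
  proof (rule continuous_on_compose2[OF _ continuous_on_subset[OF par(1) subset_UNIV]])
    show "continuous_on (pyramid - {apex}) E" using E unfolding reg_def by blast
    show "par ` interior T \<subseteq> pyramid - {apex}" by (rule image_subsetI) (rule par(2))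
  qed
  have "bounded (range E)" using E unfolding reg_def by blast
  then show "bounded ((\<lambda>\<sigma>. E (par \<sigma>)) ` interior T)" by (rule bounded_subset) auto
qed

lemma continuous_edge_point: "continuous_on UNIV (edge_point e)"
  unfolding edge_point_def by (intro continuous_intros)

lemma continuous_tri_point: "continuous_on UNIV (tri_point T)"
  unfolding tri_point_def by (intro continuous_intros)

lemma continuous_base_point: "continuous_on UNIV base_point"
proof (rule continuous_on_pt)
  fix i :: 3
  have "continuous_on UNIV (\<lambda>\<sigma>. base_point \<sigma> $ 1)" "continuous_on UNIV (\<lambda>\<sigma>. base_point \<sigma> $ 2)" "continuous_on UNIV (\<lambda>\<sigma>. base_point \<sigma> $ 3)"
    unfolding base_point_def vector_3 by (intro continuous_intros)+
  then show "continuous_on UNIV (\<lambda>\<sigma>. base_point \<sigma> $ i)" using exhaust_3[of i] by auto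
qed

lemma nice_edge: "reg E \<Longrightarrow> e \<in> edges \<Longrightarrow> nice {0..1} (\<lambda>s. E (edge_point e s))"
  by (rule nice_compose[OF _ continuous_edge_point], assumption, rule edge_point_mem) auto

lemma nice_face: "reg E \<Longrightarrow> s \<in> {0,1} \<Longrightarrow> nice ref_triangle (\<lambda>\<sigma>. E (tri_point (tri_face b s) \<sigma>))"
  by (rule nice_compose[OF _ continuous_tri_point], assumption, rule tri_point_mem(1)) (auto dest: interior_ref_triangleD)

lemma nice_base: "reg E \<Longrightarrow> nice ref_square (\<lambda>\<sigma>. E (base_point \<sigma>))"
  using interior_subset[of ref_square] by (intro nice_compose[OF _ continuous_base_point] base_point_mem(1)) auto

lemma edge_space_restr:
  "q \<in> edge_space k e \<longleftrightarrow> (\<exists>f \<in> Apoly (int k - 1). q = restr (edge_set e) f)"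
  unfolding edge_space_def Ppoly_on_Apoly by blast

lemma nice_edge_test:
  assumes "q \<in> edge_space k e"
  shows "nice {0..1} (\<lambda>s. q (edge_point e s) *\<^sub>R t)"
proof -
  obtain f where f: "f \<in> Apoly (int k - 1)" "q = restr (edge_set e) f" using assms edge_space_restr by blast
  show ?thesis
  proof (rule nice_continuous[of "\<lambda>s. f (edge_point e s) *\<^sub>R t"])
    show "continuous_on UNIV (\<lambda>s. f (edge_point e s) *\<^sub>R t)"
      by (intro continuous_on_scaleR continuous_on_compose2[OF Apoly_continuous[OF f(1), of UNIV] continuous_edge_point] continuous_on_const) auto
    show "q (edge_point e s) *\<^sub>R t = f (edge_point e s) *\<^sub>R t" if "s \<in> interior {0..1}" for s
      using that by (auto simp: f(2) restr_def edge_set_edge_point)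
  qed auto
qed

lemma tri_space_comp:
  assumes "q \<in> tri_space k \<nu> T"
  shows "\<exists>f \<in> Apoly (int k - 2). \<forall>\<sigma>\<in>ref_triangle. q (tri_point T \<sigma>) $ i = f (tri_point T \<sigma>)"
proof -
  have "(\<lambda>p. q p $ i) \<in> Ppoly_on (tri_set T) (int k - 2)" using assms unfolding tri_space_def by blast
  then obtain f where f: "f \<in> Apoly (int k - 2)" "(\<lambda>p. q p $ i) = restr (tri_set T) f"
    unfolding Ppoly_on_Apoly by blast
  have "q (tri_point T \<sigma>) $ i = f (tri_point T \<sigma>)" if "\<sigma> \<in> ref_triangle" for \<sigma>
    using fun_cong[OF f(2), of "tri_point T \<sigma>"] that by (simp add: restr_def tri_set_tri_point)
  then show ?thesis using f(1) by blast
qed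

lemma nice_tri_test:
  assumes "q \<in> tri_space k \<nu> T"
  shows "nice ref_triangle (\<lambda>\<sigma>. q (tri_point T \<sigma>))"
proof -
  obtain f1 where f1: "f1 \<in> Apoly (int k - 2)" "\<forall>\<sigma>\<in>ref_triangle. q (tri_point T \<sigma>) $ 1 = f1 (tri_point T \<sigma>)" using tri_space_comp[OF assms] by blast
  obtain f2 where f2: "f2 \<in> Apoly (int k - 2)" "\<forall>\<sigma>\<in>ref_triangle. q (tri_point T \<sigma>) $ 2 = f2 (tri_point T \<sigma>)" using tri_space_comp[OF assms] by blast
  obtain f3 where f3: "f3 \<in> Apoly (int k - 2)" "\<forall>\<sigma>\<in>ref_triangle. q (tri_point T \<sigma>) $ 3 = f3 (tri_point T \<sigma>)" using tri_space_comp[OF assms] by blast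
  have c: "continuous_on UNIV (\<lambda>\<sigma>. f (tri_point T \<sigma>))" if "f \<in> Apoly (int k - 2)" for f
    by (rule continuous_on_compose2[OF Apoly_continuous[OF that, of UNIV] continuous_tri_point]) auto
  show ?thesis
  proof (rule nice_continuous[of "\<lambda>\<sigma>. vector [f1 (tri_point T \<sigma>), f2 (tri_point T \<sigma>), f3 (tri_point T \<sigma>)]", OF _ bounded_ref_triangle])
    show "continuous_on UNIV (\<lambda>\<sigma>. vector [f1 (tri_point T \<sigma>), f2 (tri_point T \<sigma>), f3 (tri_point T \<sigma>)] :: pt)"
    proof (rule continuous_on_pt)
      fix i :: 3
      show "continuous_on UNIV (\<lambda>\<sigma>. (vector [f1 (tri_point T \<sigma>), f2 (tri_point T \<sigma>), f3 (tri_point T \<sigma>)] :: pt) $ i)"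
        using exhaust_3[of i] c[OF f1(1)] c[OF f2(1)] c[OF f3(1)] by auto
    qed
    show "q (tri_point T \<sigma>) = vector [f1 (tri_point T \<sigma>), f2 (tri_point T \<sigma>), f3 (tri_point T \<sigma>)]" if "\<sigma> \<in> interior ref_triangle" for \<sigma>
      using that interior_subset[of ref_triangle] f1(2) f2(2) f3(2) by (auto simp: pt_eq_iff)
  qed
qed

lemma Qpoly2_continuous: "f \<in> Qpoly2 l m \<Longrightarrow> continuous_on S (\<lambda>\<sigma>. f (fst \<sigma>) (snd \<sigma>))"
  by (induction rule: Qpoly2_induct) (auto intro!: continuous_intros)

lemma nice_base_test:
  assumes "q \<in> base_space k"
  shows "nice ref_square (\<lambda>\<sigma>. cross3 n (q (base_point \<sigma>)))"
proof -
  obtain q1 q2 where q: "q1 \<in> Qpoly2 (int k - 2) (int k - 1)" "q2 \<in> Qpoly2 (int k - 1) (int k - 2)"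
    "q = restr base (\<lambda>p. vector [q1 (p$1) (p$2), q2 (p$1) (p$2), 0])"
    using assms unfolding base_space_def by blast
  show ?thesis
  proof (rule nice_continuous[of "\<lambda>\<sigma>. cross3 n (vector [q1 (fst \<sigma>) (snd \<sigma>), q2 (fst \<sigma>) (snd \<sigma>), 0])", OF _ ref_square_facts(2)])
    have c: "continuous_on UNIV (\<lambda>\<sigma>. q1 (fst \<sigma>) (snd \<sigma>))" "continuous_on UNIV (\<lambda>\<sigma>. q2 (fst \<sigma>) (snd \<sigma>))"
      using Qpoly2_continuous q by blast+
    show "continuous_on UNIV (\<lambda>\<sigma>. cross3 n (vector [q1 (fst \<sigma>) (snd \<sigma>), q2 (fst \<sigma>) (snd \<sigma>), 0]))"
    proof (rule continuous_on_pt)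
      fix i :: 3
      let ?c = "\<lambda>\<sigma>. cross3 n (vector [q1 (fst \<sigma>) (snd \<sigma>), q2 (fst \<sigma>) (snd \<sigma>), 0])"
      have "continuous_on UNIV (\<lambda>\<sigma>. ?c \<sigma> $ 1)" "continuous_on UNIV (\<lambda>\<sigma>. ?c \<sigma> $ 2)" "continuous_on UNIV (\<lambda>\<sigma>. ?c \<sigma> $ 3)"
        unfolding cross3_def vector_3 by (intro continuous_on_add continuous_on_mult continuous_on_diff continuous_on_const c)+
      then show "continuous_on UNIV (\<lambda>\<sigma>. ?c \<sigma> $ i)"
        using exhaust_3[of i] by auto
    qed
    show "cross3 n (q (base_point \<sigma>)) = cross3 n (vector [q1 (fst \<sigma>) (snd \<sigma>), q2 (fst \<sigma>) (snd \<sigma>), 0])" if "\<sigma> \<in> interior ref_square" for \<sigma>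
    proof -
      have "base_point \<sigma> \<in> base" using that interior_subset[of ref_square] base_point_mem(2) by blast
      then show ?thesis by (simp add: q(3) restr_def) (simp add: base_point_def)
    qed
  qed
qed

lemma pair_lin2:
  assumes "convex T" "bounded T" "nice T A" "nice T B" "nice T B'"
    "\<And>\<sigma>. \<sigma> \<in> interior T \<Longrightarrow> B'' \<sigma> = c *\<^sub>R B \<sigma> + B' \<sigma>"
  shows "pair T A B'' = c * pair T A B + pair T A B'"
  using pair_lin[OF assms(1,2,4,5,3,6)] by (simp add: pair_commute)

lemma scaleR_fun_apply [simp]: "(c *\<^sub>R f) x = c *\<^sub>R f x" for f :: "'a \<Rightarrow> 'b::real_vector"
  by (simp add: scaleR_fun_def)

lemma edge_dof_lin:
  assumes "reg E" "e \<in> edges"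
  shows "reg E' \<Longrightarrow> q \<in> edge_space k e \<Longrightarrow> edge_dof e t q (c *\<^sub>R E + E') = c * edge_dof e t q E + edge_dof e t q E'"
    "q \<in> edge_space k e \<Longrightarrow> q' \<in> edge_space k e \<Longrightarrow> edge_dof e t (c *\<^sub>R q + q') E = c * edge_dof e t q E + edge_dof e t q' E"
proof -
  have T: "convex {0..1::real}" "bounded {0..1::real}" by auto
  show "edge_dof e t q (c *\<^sub>R E + E') = c * edge_dof e t q E + edge_dof e t q E'" if "reg E'" "q \<in> edge_space k e"
    using pair_lin[OF T nice_edge[OF assms] nice_edge[OF that(1) assms(2)] nice_edge_test[OF that(2)], of "\<lambda>s. (c *\<^sub>R E + E') (edge_point e s)" c t]
    by (simp add: edge_dof_pair algebra_simps)
  show "edge_dof e t (c *\<^sub>R q + q') E = c * edge_dof e t q E + edge_dof e t q' E" if "q \<in> edge_space k e" "q' \<in> edge_space k e"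
    using pair_lin2[OF T nice_edge[OF assms] nice_edge_test[OF that(1)] nice_edge_test[OF that(2)], of "\<lambda>s. (c *\<^sub>R q + q') (edge_point e s) *\<^sub>R t" c t t]
    by (simp add: edge_dof_pair algebra_simps)
qed

lemma tri_dof_lin:
  assumes "reg E" "s \<in> {0,1}"
  shows "reg E' \<Longrightarrow> q \<in> tri_space k \<nu> (tri_face b s) \<Longrightarrow> tri_dof (tri_face b s) q (c *\<^sub>R E + E') = c * tri_dof (tri_face b s) q E + tri_dof (tri_face b s) q E'"
    "q \<in> tri_space k \<nu> (tri_face b s) \<Longrightarrow> q' \<in> tri_space k \<nu> (tri_face b s) \<Longrightarrow> tri_dof (tri_face b s) (c *\<^sub>R q + q') E = c * tri_dof (tri_face b s) q E + tri_dof (tri_face b s) q' E"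
proof -
  show "tri_dof (tri_face b s) q (c *\<^sub>R E + E') = c * tri_dof (tri_face b s) q E + tri_dof (tri_face b s) q E'" if "reg E'" "q \<in> tri_space k \<nu> (tri_face b s)"
    using pair_lin[OF convex_ref_triangle bounded_ref_triangle nice_face[OF assms, of b] nice_face[OF that(1) assms(2), of b] nice_tri_test[OF that(2)], of "\<lambda>\<sigma>. (c *\<^sub>R E + E') (tri_point (tri_face b s) \<sigma>)" c]
    by (simp add: tri_dof_pair algebra_simps)
  show "tri_dof (tri_face b s) (c *\<^sub>R q + q') E = c * tri_dof (tri_face b s) q E + tri_dof (tri_face b s) q' E" if "q \<in> tri_space k \<nu> (tri_face b s)" "q' \<in> tri_space k \<nu> (tri_face b s)"
    using pair_lin2[OF convex_ref_triangle bounded_ref_triangle nice_face[OF assms, of b] nice_tri_test[OF that(1)] nice_tri_test[OF that(2)], of "\<lambda>\<sigma>. (c *\<^sub>R q + q') (tri_point (tri_face b s) \<sigma>)" c]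
    by (simp add: tri_dof_pair algebra_simps)
qed

lemma base_dof_lin:
  assumes "reg E"
  shows "reg E' \<Longrightarrow> q \<in> base_space k \<Longrightarrow> base_dof n q (c *\<^sub>R E + E') = c * base_dof n q E + base_dof n q E'"
    "q \<in> base_space k \<Longrightarrow> q' \<in> base_space k \<Longrightarrow> base_dof n (c *\<^sub>R q + q') E = c * base_dof n q E + base_dof n q' E"
proof -
  show "base_dof n q (c *\<^sub>R E + E') = c * base_dof n q E + base_dof n q E'" if "reg E'" "q \<in> base_space k"
    using pair_lin[OF ref_square_facts(1,2) nice_base[OF assms] nice_base[OF that(1)] nice_base_test[OF that(2)], of "\<lambda>\<sigma>. (c *\<^sub>R E + E') (base_point \<sigma>)" c]
    by (simp add: base_dof_pair)
  show "base_dof n (c *\<^sub>R q + q') E = c * base_dof n q E + base_dof n q' E" if "q \<in> base_space k" "q' \<in> base_space k"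
    using pair_lin2[OF ref_square_facts(1,2) nice_base[OF assms] nice_base_test[OF that(1)] nice_base_test[OF that(2)], of "\<lambda>\<sigma>. cross3 n ((c *\<^sub>R q + q') (base_point \<sigma>))" c n n]
    by (simp add: base_dof_pair cross_add_right cross_mult_right)
qed

lemma curl_lin:
  assumes "reg E" "reg E'" "p \<in> interior pyramid"
  shows "curl (c *\<^sub>R E + E') p = c *\<^sub>R curl E p + curl E' p"
proof -
  have D: "(E has_derivative frechet_derivative E (at p)) (at p)" "(E' has_derivative frechet_derivative E' (at p)) (at p)"
    using assms iffD1[OF frechet_derivative_works] unfolding reg_def by blast+
  have e: "(\<lambda>x. c *\<^sub>R E x + E' x) = c *\<^sub>R E + E'" by (simp add: fun_eq_iff)
  have "((\<lambda>x. c *\<^sub>R E x + E' x) has_derivative (\<lambda>h. c *\<^sub>R frechet_derivative E (at p) h + frechet_derivative E' (at p) h)) (at p)"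
    by (intro has_derivative_add has_derivative_scaleR_right D)
  from frechet_derivative_at[OF this[unfolded e]]
  have "frechet_derivative (c *\<^sub>R E + E') (at p) = (\<lambda>h. c *\<^sub>R frechet_derivative E (at p) h + frechet_derivative E' (at p) h)" ..
  then show ?thesis
    unfolding curl_def Let_def by (simp add: pt_eq_iff algebra_simps)
qed

lemma curl_dof_pair: "curl_dof v E = pair pyramid (curl E) (curl v)"
  by (simp add: curl_dof_def pair_def)

lemma curl_dof_lin:
  assumes "reg E" "reg v"
  shows "reg E' \<Longrightarrow> curl_dof v (c *\<^sub>R E + E') = c * curl_dof v E + curl_dof v E'"
    "reg v' \<Longrightarrow> curl_dof (c *\<^sub>R v + v') E = c * curl_dof v E + curl_dof v' E"
proof -
  show "curl_dof v (c *\<^sub>R E + E') = c * curl_dof v E + curl_dof v E'" if "reg E'"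
    unfolding curl_dof_pair using assms that
    by (intro pair_lin convex_pyramid bounded_pyramid reg_curl_nice curl_lin)
  show "curl_dof (c *\<^sub>R v + v') E = c * curl_dof v E + curl_dof v' E" if "reg v'"
    unfolding curl_dof_pair using assms that
    by (intro pair_lin2 convex_pyramid bounded_pyramid reg_curl_nice curl_lin)
qed

lemma grad_dof_pair: "grad_dof q E = pair pyramid E (grad q)"
  by (simp add: grad_dof_def pair_def)

lemma U0_zero_grad:
  assumes "q \<in> U0_zero k" "k \<ge> 1"
  shows "\<exists>H \<in> Qpoly (int k - 2) (int k - 2) (int k - 2). q = bubble_form k H \<and>
    (\<forall>p\<in>interior pyramid. (q has_derivative (\<lambda>h. h \<bullet> bubble_grad k H p)) (at p) \<and> grad q p = bubble_grad k H p)"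
proof -
  obtain H where H: "H \<in> Qpoly (int k - 2) (int k - 2) (int k - 2)" "q = bubble_form k H"
    using assms U0_zero_iff[OF assms(2), of q] by blast
  then show ?thesis using bubble_form_has_derivative[OF H(1)] grad_bubble_form[OF H(1)] by blast
qed

lemma nice_grad:
  assumes "q \<in> U0_zero k" "k \<ge> 1"
  shows "nice pyramid (grad q)"
proof -
  obtain H where H: "H \<in> Qpoly (int k - 2) (int k - 2) (int k - 2)" "\<forall>p\<in>interior pyramid. grad q p = bubble_grad k H p"
    using U0_zero_grad[OF assms] by blast
  show ?thesis
    using reg_nice[OF reg_U1[OF bubble_grad_U1[OF H(1) assms(2)] assms(2)]] nice_cong[of pyramid "grad q" "bubble_grad k H"] H(2) by blast
qed

text \<open>Linearity of \<open>grad\<close> in \<open>q\<close> rests on differentiability, which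
  elements of \<open>U0_zero\<close> have in the interior because of their bubble form.\<close>

lemma grad_dof_lin:
  assumes "reg E" "k \<ge> 1" "q \<in> U0_zero k"
  shows "reg E' \<Longrightarrow> grad_dof q (c *\<^sub>R E + E') = c * grad_dof q E + grad_dof q E'"
    "q' \<in> U0_zero k \<Longrightarrow> grad_dof (c *\<^sub>R q + q') E = c * grad_dof q E + grad_dof q' E"
proof -
  show "grad_dof q (c *\<^sub>R E + E') = c * grad_dof q E + grad_dof q E'" if "reg E'"
    unfolding grad_dof_pair
    by (rule pair_lin[OF convex_pyramid bounded_pyramid reg_nice[OF assms(1)] reg_nice[OF that] nice_grad[OF assms(3,2)]]) simp
  show "grad_dof (c *\<^sub>R q + q') E = c * grad_dof q E + grad_dof q' E" if q': "q' \<in> U0_zero k"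
    unfolding grad_dof_pair
  proof (rule pair_lin2[OF convex_pyramid bounded_pyramid reg_nice[OF assms(1)] nice_grad[OF assms(3,2)] nice_grad[OF q' assms(2)]])
    fix p assume p: "p \<in> interior pyramid"
    obtain H where H: "(q has_derivative (\<lambda>h. h \<bullet> bubble_grad k H p)) (at p)" "grad q p = bubble_grad k H p"
      using U0_zero_grad[OF assms(3,2)] p by blast
    obtain H' where H': "(q' has_derivative (\<lambda>h. h \<bullet> bubble_grad k H' p)) (at p)" "grad q' p = bubble_grad k H' p"
      using U0_zero_grad[OF q' assms(2)] p by blast
    have "((\<lambda>x. c *\<^sub>R q x + q' x) has_derivative (\<lambda>h. c *\<^sub>R (h \<bullet> bubble_grad k H p) + h \<bullet> bubble_grad k H' p)) (at p)"
      by (intro has_derivative_add has_derivative_scaleR_right H(1) H'(1))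
    then have "((c *\<^sub>R q + q') has_derivative (\<lambda>h. h \<bullet> (c *\<^sub>R bubble_grad k H p + bubble_grad k H' p))) (at p)"
      by (simp add: plus_fun_def scaleR_fun_def inner_add_right)
    then show "grad (c *\<^sub>R q + q') p = c *\<^sub>R grad q p + grad q' p"
      unfolding H(2) H'(2) by (rule grad_eq)
  qed
qed

lemma pair_zero:
  assumes "convex T" "bounded T" "nice T A" "nice T B" "\<And>\<sigma>. \<sigma> \<in> interior T \<Longrightarrow> A \<sigma> \<bullet> B \<sigma> = 0"
  shows "pair T A B = 0"
proof -
  have "integral (interior T) (\<lambda>\<sigma>. A \<sigma> \<bullet> B \<sigma>) = integral (interior T) (\<lambda>\<sigma>. 0)"
    by (rule integral_cong) (rule assms(5))
  then show ?thesis using pair_integral(1)[OF assms(1-4)] by simp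
qed

text \<open>This frees injectivity from the arbitrary basis: test functions may be taken from the
  whole space.\<close>

lemma basis_vanish:
  fixes f :: "'a::real_vector \<Rightarrow> real"
  assumes B: "is_basis B T" and lin: "\<And>c q q'. q \<in> T \<Longrightarrow> q' \<in> T \<Longrightarrow> f (c *\<^sub>R q + q') = c * f q + f q'"
    and z: "\<And>q. q \<in> B \<Longrightarrow> f q = 0" and q: "q \<in> T"
  shows "f q = 0"
proof -
  have sp: "span B = T" using B by (simp add: is_basis_def)
  then have "0 \<in> T" using span_zero by blast
  then have f0: "f 0 = 0" using lin[of 0 0 1] by simp
  have "q \<in> T \<and> f q = 0"
    using q unfolding sp[symmetric]
  proof (induction rule: span_induct_alt)
    case base
    then show ?case using f0 by (simp add: span_zero)
  next
    case (step c x y)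
    then have "x \<in> T" "y \<in> T" using sp span_superset by blast+
    then show ?case using step z lin[of x y c] by (simp add: span_add span_scale span_base)
  qed
  then show ?thesis ..
qed

lemma Poly1_eq_zero:
  assumes "p \<in> Poly1 n" "\<And>s. 0 < s \<Longrightarrow> s < 1 \<Longrightarrow> p s = 0"
  shows "p s = 0"
  using Ppoly2_eq_zero[OF Poly1_Ppoly2(2)[OF assms(1)], of "{0<..<1} \<times> UNIV" "1/2" 0 s] assms(2)
  by (auto simp: open_Times)

section \<open>Edge degrees of freedom\<close>

lemma unit_tangentD: "unit_tangent e t \<Longrightarrow> \<exists>c. c \<noteq> 0 \<and> t = c *\<^sub>R (snd e - fst e)"
  unfolding unit_tangent_def by (metis norm_zero scale_zero_left zero_neq_one)

text \<open>At \<open>z = 0\<close> the two parts of an admissible trace combine to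
  \<open>A + S\<close>, where both summands have degree at most \<open>k - 1\<close>.\<close>

lemma base_edge_poly:
  assumes "U_num k N1 N2 N3" "k \<ge> 1" "s \<in> {0,1}"
  shows "\<exists>p \<in> Poly1 (int k - 1). \<forall>w\<in>{0..1}. (if b then N1 else N2) (face_point b w s 0) = p w"
proof -
  obtain A B S where A: "A \<in> Ppoly2 (int k - 1)" "S \<in> Hom k"
    "\<forall>w\<in>{0..1}. \<forall>z\<ge>0. (if b then N1 else N2) (face_point b w s z) = A w z + S w z * (1 + z) \<and> N3 (face_point b w s z) = B w z - S w z * w"
    using assms unfolding U_num_def trace_num_def by blast
  have S: "S \<in> Ppoly2 (int k - 1)" using A(2) Ptilde_num assms(2) unfolding Hom_def by blast
  have "\<forall>w\<in>{0..1}. (if b then N1 else N2) (face_point b w s 0) = A w 0 + S w 0"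
    using A(3)[rule_format, of _ 0] by simp
  then show ?thesis by (intro bexI[OF _ Ppoly2_Poly1[OF Ppoly2_add[OF A(1) S], of 0]])
qed

lemma edge_poly:
  assumes U: "U_num k N1 N2 N3" and k: "k \<ge> 1" and e: "e \<in> edges"
  shows "\<exists>p \<in> Poly1 (int k - 1). \<forall>\<sigma>. 0 \<le> \<sigma> \<longrightarrow> \<sigma> < 1 \<longrightarrow> edge_trace (pushf (rfield k N1 N2 N3)) e \<sigma> = p \<sigma>"
proof -
  consider (base) b s where "s \<in> {0,1}" "e = base_edge b s" | (vert) s1 s2 where "s1 \<in> {0,1}" "s2 \<in> {0,1}" "e = vert_edge s1 s2"
    using e unfolding edges_iff by blast
  then show ?thesis
  proof cases
    case base
    obtain p where p: "p \<in> Poly1 (int k - 1)" "\<forall>w\<in>{0..1}. (if b then N1 else N2) (face_point b w s 0) = p w"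
      using base_edge_poly[OF U k base(1)] by blast
    then show ?thesis using edge_trace_base_edge[OF base(1), of _ k N1 N2 N3 b] unfolding base(2)
      by (intro bexI[OF _ p(1)]) auto
  next
    case vert
    have "N3 \<in> Qpoly (int k) (int k) (int k - 1)" using U bar_num_Qpoly(3) k unfolding U_num_def by blast
    from Qpoly_vertical[OF this, of s1 s2] obtain p where p: "p \<in> Poly1 (int k - 1)"
      "\<forall>s. s \<noteq> 1 \<longrightarrow> (1 - s) ^ (k - 1) * N3 (vector [s1, s2, s / (1 - s)]) = p s" by blast
    then show ?thesis using edge_trace_vert_edge[OF vert(1,2) _ _ k, of _ N1 N2 N3] unfolding vert(3)
      by (intro bexI[OF _ p(1)]) auto
  qed
qed

lemma edge_test_exists:
  assumes "e \<in> edges" "p \<in> Poly1 (int k - 1)"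
  shows "\<exists>q \<in> edge_space k e. \<forall>\<sigma>\<in>{0..1}. q (edge_point e \<sigma>) = p \<sigma>"
proof -
  obtain i where i: "\<forall>\<sigma>. edge_point e \<sigma> $ i = \<sigma>" using edge_coordinate[OF assms(1)] by blast
  have "restr (edge_set e) (\<lambda>x. p (x$i)) \<in> edge_space k e"
    unfolding edge_space_restr using Poly1_Apoly[OF assms(2)] by blast
  moreover have "restr (edge_set e) (\<lambda>x. p (x$i)) (edge_point e \<sigma>) = p \<sigma>" if "\<sigma> \<in> {0..1}" for \<sigma>
    using that i by (simp add: restr_def edge_set_edge_point)
  ultimately show ?thesis by blast
qed

lemma edge_test_poly:
  assumes "q \<in> edge_space k e"
  shows "\<exists>p \<in> Poly1 (int k - 1). \<forall>\<sigma>\<in>{0..1}. q (edge_point e \<sigma>) = p \<sigma>"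
proof -
  obtain f where f: "f \<in> Apoly (int k - 1)" "q = restr (edge_set e) f" using assms edge_space_restr by blast
  show ?thesis
    using Apoly_Poly1[OF f(1), of "fst e" "snd e - fst e"]
    by (intro bexI[of _ "\<lambda>s. f (fst e + s *\<^sub>R (snd e - fst e))"]) (auto simp: f(2) restr_def edge_set_edge_point edge_point_def)
qed

lemma edge_space_eq_zero:
  assumes "q \<in> edge_space k e" "\<And>\<sigma>. \<sigma> \<in> {0..1} \<Longrightarrow> q (edge_point e \<sigma>) = 0"
  shows "q = 0"
proof -
  obtain f where f: "f \<in> Apoly (int k - 1)" "q = restr (edge_set e) f" using assms edge_space_restr by blast
  have "q x = 0" for x
  proof (cases "x \<in> edge_set e")
    case True
    then show ?thesis using assms(2) unfolding edge_set_edge_point by blast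
  qed (simp add: f(2) restr_def)
  then show ?thesis by (simp add: fun_eq_iff)
qed

lemma edge_dof_zero:
  assumes E: "reg E" "e \<in> edges" and t: "unit_tangent e t" and q: "q \<in> edge_space k e"
    and z: "\<And>\<sigma>. 0 < \<sigma> \<Longrightarrow> \<sigma> < 1 \<Longrightarrow> edge_trace E e \<sigma> = 0"
  shows "edge_dof e t q E = 0"
proof -
  obtain c where c: "t = c *\<^sub>R (snd e - fst e)" using unit_tangentD[OF t] by blast
  have "pair {0..1} (\<lambda>s. E (edge_point e s)) (\<lambda>s. q (edge_point e s) *\<^sub>R t) = 0"
  proof (rule pair_zero[OF _ _ nice_edge[OF E] nice_edge_test[OF q]])
    fix \<sigma> :: real assume "\<sigma> \<in> interior {0..1}"
    then show "E (edge_point e \<sigma>) \<bullet> q (edge_point e \<sigma>) *\<^sub>R t = 0" using z[of \<sigma>] by (simp add: c edge_trace_def)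
  qed auto
  then show ?thesis by (simp add: edge_dof_pair)
qed

text \<open>Serves twice: for injectivity the trace is \<open>p\<close> and the test function
  \<open>p / c\<close>, for nondegeneracy the other way round. The factor \<open>c\<close> between
  unit tangent and edge vector cancels, and the integrand becomes \<open>p^2\<close>.\<close>

lemma edge_dof_definite:
  assumes E: "reg E" "e \<in> edges" and t: "t = c *\<^sub>R (snd e - fst e)" "c \<noteq> 0" and q: "q \<in> edge_space k e"
    and p: "p \<in> Poly1 n"
    and e: "\<And>\<sigma>. 0 < \<sigma> \<Longrightarrow> \<sigma> < 1 \<Longrightarrow> edge_trace E e \<sigma> * q (edge_point e \<sigma>) = p \<sigma> * p \<sigma> / c"
    and 0: "edge_dof e t q E = 0"
  shows "p \<sigma> = 0"
proof (rule Poly1_eq_zero[OF p])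
  fix s :: real assume s: "0 < s" "s < 1"
  have i: "E (edge_point e \<sigma>) \<bullet> q (edge_point e \<sigma>) *\<^sub>R t = p \<sigma> * p \<sigma>" if "\<sigma> \<in> interior {0..1}" for \<sigma>
    using e[of \<sigma>] that t(2) unfolding t(1) inner_scaleR_right edge_trace_def[symmetric] by (simp add: field_simps)
  have "norm (snd e - fst e) \<noteq> 0" using edge_nonzero[OF E(2)] by simp
  then have p0: "pair {0..1} (\<lambda>s. E (edge_point e s)) (\<lambda>s. q (edge_point e s) *\<^sub>R t) = 0"
    using 0 by (simp add: edge_dof_pair)
  have si: "s \<in> interior {0..1}" using s by simp
  have nn: "0 \<le> E (edge_point e \<sigma>) \<bullet> q (edge_point e \<sigma>) *\<^sub>R t" if "\<sigma> \<in> interior {0..1}" for \<sigma>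
    unfolding i[OF that] by simp
  have "E (edge_point e s) \<bullet> q (edge_point e s) *\<^sub>R t = 0"
    by (rule pair_nonneg_zero[OF _ _ nice_edge[OF E] nice_edge_test[OF q] nn p0 si]) auto
  then have "p s * p s = 0" unfolding i[OF si] .
  then show "p s = 0" by simp
qed

lemma edge_inj:
  assumes U: "U_num k N1 N2 N3" and k: "k \<ge> 1" and e: "e \<in> edges" and t: "unit_tangent e t"
    and z: "\<And>q. q \<in> edge_space k e \<Longrightarrow> edge_dof e t q (pushf (rfield k N1 N2 N3)) = 0"
    and \<sigma>: "0 \<le> \<sigma>" "\<sigma> < 1"
  shows "edge_trace (pushf (rfield k N1 N2 N3)) e \<sigma> = 0"
proof -
  have E: "reg (pushf (rfield k N1 N2 N3))" using U k reg_bar unfolding U_num_def by blast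
  obtain c where c: "t = c *\<^sub>R (snd e - fst e)" "c \<noteq> 0" using unit_tangentD[OF t] by blast
  obtain p where p: "p \<in> Poly1 (int k - 1)" "\<forall>\<sigma>. 0 \<le> \<sigma> \<longrightarrow> \<sigma> < 1 \<longrightarrow> edge_trace (pushf (rfield k N1 N2 N3)) e \<sigma> = p \<sigma>"
    using edge_poly[OF U k e] by blast
  obtain q where q: "q \<in> edge_space k e" "\<forall>\<sigma>\<in>{0..1}. q (edge_point e \<sigma>) = (1 / c) * p \<sigma>"
    using edge_test_exists[OF e Poly1_cmult[OF p(1), of "1 / c"]] by blast
  have "p \<sigma> = 0"
    by (rule edge_dof_definite[OF E e c q(1) p(1) _ z[OF q(1)]]) (use p(2) q(2) in auto)
  then show ?thesis using p(2) \<sigma> by simp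
qed

text \<open>Cut-offs confine the trace to the given edge. A lift from a base edge has no third
  component, and a lift from a vertical edge has horizontal numerators that vanish at
  \<open>z = 0\<close>; so neither kind of edge disturbs the other.\<close>

lemma edge_lift:
  assumes e: "e \<in> edges" and p: "p \<in> Poly1 (int k - 1)" and k: "k \<ge> 1"
  shows "\<exists>E\<in>U1 k. (\<forall>\<sigma>. 0 \<le> \<sigma> \<longrightarrow> \<sigma> < 1 \<longrightarrow> edge_trace E e \<sigma> = p \<sigma>) \<and>
    (\<forall>e'\<in>edges - {e}. \<forall>\<sigma>. 0 \<le> \<sigma> \<longrightarrow> \<sigma> < 1 \<longrightarrow> edge_trace E e' \<sigma> = 0)"
proof -
  consider (base) b s where "s \<in> {0,1}" "e = base_edge b s" | (vert) s1 s2 where "s1 \<in> {0,1}" "s2 \<in> {0,1}" "e = vert_edge s1 s2"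
    using e unfolding edges_iff by blast
  then show ?thesis
  proof cases
    case base
    define \<alpha> where "\<alpha> = edge_num b s p"
    define E where "E = pushf (rfield k (sel b \<alpha>) (sel (\<not> b) \<alpha>) (\<lambda>_. 0))"
    have "E \<in> U1 k" using base_edge_lift[OF p k base(1), of b] U1_iff[OF k] unfolding E_def \<alpha>_def by blast
    moreover have base_edge: "edge_trace E (base_edge b' s') \<sigma> = (if b' = b \<and> s' = s then p \<sigma> else 0)"
      if "s' \<in> {0,1}" "0 \<le> \<sigma>" "\<sigma> < 1" for b' s' \<sigma>
      using edge_trace_base_edge[OF that(1,2), of k "sel b \<alpha>" "sel (\<not> b) \<alpha>" "\<lambda>_. 0" b'] that lin_01[OF base(1) that(1)]
      unfolding E_def[symmetric] by (cases b; cases b') (auto simp: \<alpha>_def edge_num_def ix_def)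
    moreover have vert_edge: "edge_trace E (vert_edge s1 s2) \<sigma> = 0" if "s1 \<in> {0,1}" "s2 \<in> {0,1}" "0 \<le> \<sigma>" "\<sigma> < 1" for s1 s2 \<sigma>
      using edge_trace_vert_edge[OF that k] unfolding E_def by simp
    moreover have "edge_trace E e' \<sigma> = 0" if e': "e' \<in> edges" "e' \<noteq> e" and \<sigma>: "0 \<le> \<sigma>" "\<sigma> < 1" for e' \<sigma>
    proof -
      consider b' s' where "s' \<in> {0,1}" "e' = base_edge b' s'" | s1 s2 where "s1 \<in> {0,1}" "s2 \<in> {0,1}" "e' = vert_edge s1 s2"
        using e'(1) unfolding edges_iff by blast
      then show ?thesis using base_edge[OF _ \<sigma>] vert_edge[OF _ _ \<sigma>] e'(2) base(2) by cases auto
    qed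
    ultimately show ?thesis
      using base by (intro bexI[of _ E]) (simp_all add: base(2))
  next
    case vert
    obtain P where P: "P \<in> Poly1 (int k - 1)" "\<forall>s. s \<noteq> 1 \<longrightarrow> (1 - s) ^ (k - 1) * P (s / (1 - s)) = p s"
      using Poly1_vertical[OF p] by blast
    obtain N1 N2 where U: "U_num k N1 N2 (\<lambda>p. lin s1 (p$1) * lin s2 (p$2) * P (p$3))"
      and N: "\<forall>p. p$3 = 0 \<longrightarrow> N1 p = 0 \<and> N2 p = 0"
      using vertical_edge_lift[OF P(1) k vert(1,2)] by blast
    define E where "E = pushf (rfield k N1 N2 (\<lambda>p. lin s1 (p$1) * lin s2 (p$2) * P (p$3)))"
    have "E \<in> U1 k" using U U1_iff[OF k] unfolding E_def by blast
    moreover have base_edge: "edge_trace E (base_edge b' s') \<sigma> = 0" if "s' \<in> {0,1}" "0 \<le> \<sigma>" "\<sigma> < 1" for b' s' \<sigma>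
      using edge_trace_base_edge[OF that(1,2)] that N unfolding E_def by (cases b') auto
    moreover have vert_edge: "edge_trace E (vert_edge s1' s2') \<sigma> = (if s1' = s1 \<and> s2' = s2 then p \<sigma> else 0)"
      if "s1' \<in> {0,1}" "s2' \<in> {0,1}" "0 \<le> \<sigma>" "\<sigma> < 1" for s1' s2' \<sigma>
    proof -
      have "edge_trace E (vert_edge s1' s2') \<sigma> = lin s1 s1' * lin s2 s2' * ((1 - \<sigma>) ^ (k - 1) * P (\<sigma> / (1 - \<sigma>)))"
        using edge_trace_vert_edge[OF that k] unfolding E_def by (simp add: mult_ac)
      then show ?thesis using P(2) that lin_01[OF vert(1) that(1)] lin_01[OF vert(2) that(2)] by auto
    qed
    moreover have "edge_trace E e' \<sigma> = 0" if e': "e' \<in> edges" "e' \<noteq> e" and \<sigma>: "0 \<le> \<sigma>" "\<sigma> < 1" for e' \<sigma>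
    proof -
      consider b' s' where "s' \<in> {0,1}" "e' = base_edge b' s'" | s1' s2' where "s1' \<in> {0,1}" "s2' \<in> {0,1}" "e' = vert_edge s1' s2'"
        using e'(1) unfolding edges_iff by blast
      then show ?thesis using base_edge[OF _ \<sigma>] vert_edge[OF _ _ \<sigma>] e'(2) vert(3) by cases auto
    qed
    ultimately show ?thesis
      using vert(1,2) by (intro bexI[of _ E]) (simp_all add: vert(3))
  qed
qed

section \<open>Degrees of freedom of the triangular faces\<close>

text \<open>Tested against two sides of the triangle, hence independent of a choice of normal;
  \<open>snd \<sigma> < 1\<close> leaves out the apex.\<close>

definition tri_trace_zero :: "(pt \<Rightarrow> pt) \<Rightarrow> pt \<times> pt \<times> pt \<Rightarrow> bool"
  where "tri_trace_zero E T \<longleftrightarrow> (\<forall>\<sigma>\<in>ref_triangle. snd \<sigma> < 1 \<longrightarrow> E (tri_point T \<sigma>) \<bullet> (fst (snd T) - fst T) = 0 \<and>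
    E (tri_point T \<sigma>) \<bullet> (snd (snd T) - fst T) = 0)"

lemma unit_normal_tri:
  assumes "unit_normal (tri_set (tri_face b s)) \<nu>"
  shows "\<nu> \<bullet> axis (ix b) 1 = 0" "\<nu> \<bullet> face_point b 0 (- s) 1 = 0" "norm \<nu> = 1"
proof -
  have "fst (tri_face b s) \<in> tri_set (tri_face b s)" "fst (snd (tri_face b s)) \<in> tri_set (tri_face b s)" "snd (snd (tri_face b s)) \<in> tri_set (tri_face b s)"
    by (auto simp: tri_face_def intro!: hull_inc)
  then have "\<nu> \<bullet> (fst (snd (tri_face b s)) - fst (tri_face b s)) = 0" "\<nu> \<bullet> (snd (snd (tri_face b s)) - fst (tri_face b s)) = 0"
    using assms unfolding unit_normal_def by blast+
  then show "\<nu> \<bullet> axis (ix b) 1 = 0" "\<nu> \<bullet> face_point b 0 (- s) 1 = 0" "norm \<nu> = 1"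
    using assms unfolding unit_normal_def tri_face_sides by blast+
qed

text \<open>In the places \<open>ix b\<close> and \<open>3\<close> the two sides have the
  coordinates \<open>(1, 0)\<close> and \<open>(0, 1)\<close>, so the coefficients of a tangent
  vector can be read off there. The third coordinate of the difference vanishes because that of the
  normal does not.\<close>

lemma tangent_decomp:
  assumes \<nu>: "\<nu> \<bullet> axis (ix b) 1 = 0" "\<nu> \<bullet> face_point b 0 (- s) 1 = 0" "norm \<nu> = 1" and v: "v \<bullet> \<nu> = 0"
  shows "v = (v $ ix b) *\<^sub>R axis (ix b) 1 + (v$3) *\<^sub>R face_point b 0 (- s) 1"
proof -
  define w where "w = v - ((v $ ix b) *\<^sub>R axis (ix b) 1 + (v$3) *\<^sub>R face_point b 0 (- s) 1)"
  have w: "w $ ix b = 0" "w $ 3 = 0"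
    by (simp_all add: w_def axis_def ix_def)
  have w\<nu>: "w \<bullet> \<nu> = 0"
    using \<nu> v by (simp add: w_def inner_commute[of _ \<nu>] inner_diff_right inner_add_right)
  have "\<nu> $ ix b = 0" using \<nu>(1) by (simp add: inner_axis)
  have n3: "\<nu> $ 3 = s * \<nu> $ ix (\<not> b)" using \<nu>(2) \<open>\<nu> $ ix b = 0\<close> by (cases b) (simp_all add: inner_pt ix_def)
  have "\<nu> $ ix (\<not> b) \<noteq> 0"
  proof
    assume "\<nu> $ ix (\<not> b) = 0"
    then have "\<nu> = 0" using n3 \<open>\<nu> $ ix b = 0\<close> by (cases b) (simp_all add: pt_eq_iff ix_def)
    then show False using \<nu>(3) by simp
  qed
  moreover have "w $ ix (\<not> b) * \<nu> $ ix (\<not> b) = 0"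
    using w\<nu> w by (cases b) (simp_all add: inner_pt ix_def)
  ultimately have "w $ ix (\<not> b) = 0" by simp
  then have "w = 0" using w by (cases b) (simp_all add: pt_eq_iff ix_def)
  then show ?thesis by (simp add: w_def)
qed

lemma tri_test_decomp:
  assumes q: "q \<in> tri_space k \<nu> (tri_face b s)" and n: "unit_normal (tri_set (tri_face b s)) (\<nu> (tri_set (tri_face b s)))"
  shows "\<exists>\<alpha> \<in> Ppoly2 (int k - 2). \<exists>\<beta> \<in> Ppoly2 (int k - 2). \<forall>\<sigma>\<in>ref_triangle. q (tri_point (tri_face b s) \<sigma>) =
    \<alpha> (fst \<sigma>) (snd \<sigma>) *\<^sub>R axis (ix b) 1 + \<beta> (fst \<sigma>) (snd \<sigma>) *\<^sub>R face_point b 0 (- s) 1"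
proof -
  obtain f where f: "f \<in> Apoly (int k - 2)" "\<forall>\<sigma>\<in>ref_triangle. q (tri_point (tri_face b s) \<sigma>) $ ix b = f (tri_point (tri_face b s) \<sigma>)"
    using tri_space_comp[OF q] by blast
  obtain g where g: "g \<in> Apoly (int k - 2)" "\<forall>\<sigma>\<in>ref_triangle. q (tri_point (tri_face b s) \<sigma>) $ 3 = g (tri_point (tri_face b s) \<sigma>)"
    using tri_space_comp[OF q] by blast
  define \<alpha> \<beta> where "\<alpha> = (\<lambda>x y. f (tri_point (tri_face b s) (x, y)))" and "\<beta> = (\<lambda>x y. g (tri_point (tri_face b s) (x, y)))"
  have "\<alpha> \<in> Ppoly2 (int k - 2)" "\<beta> \<in> Ppoly2 (int k - 2)"
    unfolding \<alpha>_def \<beta>_def tri_point_def using Apoly_Ppoly2[OF f(1)] Apoly_Ppoly2[OF g(1)] by simp_all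
  moreover have "q (tri_point (tri_face b s) \<sigma>) = \<alpha> (fst \<sigma>) (snd \<sigma>) *\<^sub>R axis (ix b) 1 + \<beta> (fst \<sigma>) (snd \<sigma>) *\<^sub>R face_point b 0 (- s) 1"
    if "\<sigma> \<in> ref_triangle" for \<sigma>
  proof -
    have "q (tri_point (tri_face b s) \<sigma>) \<bullet> \<nu> (tri_set (tri_face b s)) = 0" using q unfolding tri_space_def by blast
    from tangent_decomp[OF unit_normal_tri[OF n] this] show ?thesis
      using f(2) g(2) that by (simp add: \<alpha>_def \<beta>_def)
  qed
  ultimately show ?thesis by blast
qed

text \<open>The face parameters are the ambient coordinates \<open>ix b\<close> and
  \<open>3\<close>, so \<open>\<alpha>\<close> and \<open>\<beta>\<close> extend to polynomials in
  space of the same degree.\<close>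

lemma tri_test_exists:
  assumes \<alpha>: "\<alpha> \<in> Ppoly2 (int k - 2)" and \<beta>: "\<beta> \<in> Ppoly2 (int k - 2)"
    and n: "unit_normal (tri_set (tri_face b s)) (\<nu> (tri_set (tri_face b s)))"
  shows "\<exists>q \<in> tri_space k \<nu> (tri_face b s). \<forall>\<sigma>\<in>ref_triangle. q (tri_point (tri_face b s) \<sigma>) =
    \<alpha> (fst \<sigma>) (snd \<sigma>) *\<^sub>R axis (ix b) 1 + \<beta> (fst \<sigma>) (snd \<sigma>) *\<^sub>R face_point b 0 (- s) 1"
proof -
  define h where "h = (\<lambda>x::pt. \<alpha> (x $ ix b) (x$3) *\<^sub>R axis (ix b) 1 + \<beta> (x $ ix b) (x$3) *\<^sub>R face_point b 0 (- s) 1)"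
  have i: "ix b = 1 \<or> ix b = 2" by (simp add: ix_def)
  have "(\<lambda>p. restr (tri_set (tri_face b s)) h p $ i) \<in> Ppoly_on (tri_set (tri_face b s)) (int k - 2)" for i
  proof -
    have "(\<lambda>x. h x $ i) \<in> Apoly (int k - 2)"
      using Apoly_add[OF Apoly_cmult[OF Ppoly2_Apoly[OF \<alpha> i], of "axis (ix b) 1 $ i"] Apoly_cmult[OF Ppoly2_Apoly[OF \<beta> i], of "face_point b 0 (- s) 1 $ i"]]
      by (simp add: h_def mult.commute)
    moreover have "(\<lambda>p. restr (tri_set (tri_face b s)) h p $ i) = restr (tri_set (tri_face b s)) (\<lambda>x. h x $ i)"
      by (auto simp: restr_def)
    ultimately show ?thesis unfolding Ppoly_on_Apoly by blast
  qed
  moreover have "restr (tri_set (tri_face b s)) h p \<bullet> \<nu> (tri_set (tri_face b s)) = 0" for p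
    using unit_normal_tri(1,2)[OF n] by (simp add: restr_def h_def inner_commute[of _ "\<nu> (tri_set (tri_face b s))"] inner_add_right)
  ultimately have "restr (tri_set (tri_face b s)) h \<in> tri_space k \<nu> (tri_face b s)" unfolding tri_space_def by blast
  moreover have "restr (tri_set (tri_face b s)) h (tri_point (tri_face b s) \<sigma>) = \<alpha> (fst \<sigma>) (snd \<sigma>) *\<^sub>R axis (ix b) 1 + \<beta> (fst \<sigma>) (snd \<sigma>) *\<^sub>R face_point b 0 (- s) 1"
    if "\<sigma> \<in> ref_triangle" for \<sigma>
  proof -
    have "tri_point (tri_face b s) \<sigma> $ ix b = fst \<sigma>" "tri_point (tri_face b s) \<sigma> $ 3 = snd \<sigma>" by (simp_all add: tri_point_tri_face)
    then show ?thesis using that by (simp add: restr_def tri_set_tri_point h_def)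
  qed
  ultimately show ?thesis by blast
qed

lemma tri_dof_zero:
  assumes E: "reg E" and s: "s \<in> {0,1}" and q: "q \<in> tri_space k \<nu> (tri_face b s)"
    and n: "unit_normal (tri_set (tri_face b s)) (\<nu> (tri_set (tri_face b s)))" and z: "tri_trace_zero E (tri_face b s)"
  shows "tri_dof (tri_face b s) q E = 0"
proof -
  obtain \<alpha> \<beta> where ab: "\<forall>\<sigma>\<in>ref_triangle. q (tri_point (tri_face b s) \<sigma>) = \<alpha> (fst \<sigma>) (snd \<sigma>) *\<^sub>R axis (ix b) 1 + \<beta> (fst \<sigma>) (snd \<sigma>) *\<^sub>R face_point b 0 (- s) 1"
    using tri_test_decomp[OF q n] by blast
  have "pair ref_triangle (\<lambda>\<sigma>. E (tri_point (tri_face b s) \<sigma>)) (\<lambda>\<sigma>. q (tri_point (tri_face b s) \<sigma>)) = 0"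
  proof (rule pair_zero[OF convex_ref_triangle bounded_ref_triangle nice_face[OF E s] nice_tri_test[OF q]])
    fix \<sigma> assume "\<sigma> \<in> interior ref_triangle"
    then show "E (tri_point (tri_face b s) \<sigma>) \<bullet> q (tri_point (tri_face b s) \<sigma>) = 0"
      using interior_ref_triangleD[of \<sigma>] ab z unfolding tri_trace_zero_def tri_face_sides by (simp add: inner_add_right)
  qed
  then show ?thesis by (simp add: tri_dof_pair)
qed

text \<open>In the coordinates of the face, a trace with vanishing edge traces is the field
  \<open>(y ((1 - y) a + x b), x (y a + (1 - x) b))\<close>.  Tested against \<open>(a, b)\<close> it gives
  \<open>y (1 - x - y) a^2 + x (1 - x - y) b^2 + x y (a + b)^2\<close>.\<close>

lemma bubble_components:
  assumes s: "s \<in> {0,1}" and k: "k \<ge> 1"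
    and a: "a \<in> Ppoly2 (int k - 2)" and b: "b \<in> Ppoly2 (int k - 2)"
    and da: "\<forall>w z. z \<noteq> -1 \<longrightarrow> da w z = (1 + z) ^ (k - 2) * a (w / (1 + z)) (z / (1 + z))"
    and db: "\<forall>w z. z \<noteq> -1 \<longrightarrow> db w z = (1 + z) ^ (k - 2) * b (w / (1 + z)) (z / (1 + z))"
    and N: "\<And>w z. w \<in> {0..1} \<Longrightarrow> z \<ge> 0 \<Longrightarrow> (if f then N1 else N2) (face_point f w s z) = z * (da w z + w * db w z) \<and>
      N3 (face_point f w s z) = w * (1 - w) * db w z"
    and \<sigma>: "\<sigma> \<in> ref_triangle" "snd \<sigma> < 1"
  defines "x \<equiv> fst \<sigma>" and "y \<equiv> snd \<sigma>"
  shows "pushf (rfield k N1 N2 N3) (tri_point (tri_face f s) \<sigma>) \<bullet> axis (ix f) 1 = y * ((1 - y) * a x y + x * b x y)"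
    "pushf (rfield k N1 N2 N3) (tri_point (tri_face f s) \<sigma>) \<bullet> face_point f 0 (- s) 1 = x * (y * a x y + (1 - x) * b x y)"
proof -
  define t where "t = 1 - y"
  have xy: "0 \<le> x" "0 \<le> y" "x + y \<le> 1" "t > 0" using \<sigma> by (auto simp: x_def y_def t_def ref_triangle_def)
  have t: "t \<noteq> 0" using xy by simp
  have w: "x / t \<in> {0..1}" "y / t \<ge> 0" using xy by (auto simp: t_def)
  have z1: "1 + y / t = 1 / t" using t by (simp add: t_def field_simps)
  have zn: "y / t \<noteq> -1" using w xy by linarith
  have d: "da (x / t) (y / t) = (1 / t) ^ (k - 2) * a x y" "db (x / t) (y / t) = (1 / t) ^ (k - 2) * b x y"
    using da[rule_format, OF zn, of "x / t"] db[rule_format, OF zn, of "x / t"] t by (simp_all add: z1)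
  have F: "face_point f (x / t) s (y / t) = face_point f (fst \<sigma> / (1 - snd \<sigma>)) s (snd \<sigma> / (1 - snd \<sigma>))"
    by (simp add: x_def y_def t_def)
  note FC = face_components[OF s \<sigma> k _ F, folded y_def x_def, folded t_def, OF refl, of N1 N2 N3]
  have Nw: "(if f then N1 else N2) (face_point f (x / t) s (y / t)) = y / t * (da (x / t) (y / t) + x / t * db (x / t) (y / t))"
    "N3 (face_point f (x / t) s (y / t)) = x / t * (1 - x / t) * db (x / t) (y / t)"
    using N[OF w] by auto
  have e1: "(if f then N1 else N2) (face_point f (x / t) s (y / t)) * t ^ k = y * (t * a x y + x * b x y)"
  \<comment> \<open>For \<open>k = 1\<close> the exponent \<open>k - 2\<close> is truncated, but
    then \<open>a\<close> and \<open>b\<close> are \<open>0\<close>.\<close>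
  proof (cases "k = 1")
    case True
    then have "a = (\<lambda>_ _. 0)" "b = (\<lambda>_ _. 0)" using Ppoly2_neg[OF a] Ppoly2_neg[OF b] by auto
    then show ?thesis by (simp add: Nw d)
  next
    case False
    then obtain j where j: "k = j + 2" using k by (metis add.commute le_add_diff_inverse le_neq_implies_less Suc_1 Suc_leI One_nat_def)
    show ?thesis unfolding Nw d using t by (simp add: j power_add power_divide power2_eq_square field_simps)
  qed
  have e2: "N3 (face_point f (x / t) s (y / t)) * t ^ (k - 1) = x * (1 - x / t) * b x y"
  proof (cases "k = 1")
    case True
    then have "a = (\<lambda>_ _. 0)" "b = (\<lambda>_ _. 0)" using Ppoly2_neg[OF a] Ppoly2_neg[OF b] by auto
    then show ?thesis by (simp add: Nw d)
  next
    case False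
    then obtain j where j: "k = j + 2" using k by (metis add.commute le_add_diff_inverse le_neq_implies_less Suc_1 Suc_leI One_nat_def)
    show ?thesis unfolding Nw d using t by (simp add: j power_add power_divide power2_eq_square field_simps)
  qed
  show "pushf (rfield k N1 N2 N3) (tri_point (tri_face f s) \<sigma>) \<bullet> axis (ix f) 1 = y * ((1 - y) * a x y + x * b x y)"
    using FC(1) e1 by (simp add: t_def)
  have "pushf (rfield k N1 N2 N3) (tri_point (tri_face f s) \<sigma>) \<bullet> face_point f 0 (- s) 1 = x / t * (y * (t * a x y + x * b x y)) + x * (1 - x / t) * b x y"
    using FC(2) e1 e2 by simp
  also have "\<dots> = x * (y * a x y + (1 - x) * b x y)"
    using t by (simp add: field_simps) (simp add: t_def algebra_simps)
  finally show "pushf (rfield k N1 N2 N3) (tri_point (tri_face f s) \<sigma>) \<bullet> face_point f 0 (- s) 1 = x * (y * a x y + (1 - x) * b x y)" .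
qed

lemma bubble_quadratic:
  fixes x y a b :: real
  shows "y * ((1 - y) * a + x * b) * a + x * (y * a + (1 - x) * b) * b =
    y * (1 - x - y) * a\<^sup>2 + x * (1 - x - y) * b\<^sup>2 + x * y * (a + b)\<^sup>2"
  by (simp add: power2_eq_square algebra_simps)

text \<open>Used, like its counterpart for edges, for injectivity and for nondegeneracy. The three
  weights in \<open>bubble_quadratic\<close> are positive inside the triangle, so each summand of
  the integrand vanishes separately.\<close>

lemma tri_dof_definite:
  assumes s: "s \<in> {0,1}" and E: "reg E" and q: "q \<in> tri_space k \<nu> (tri_face f s)"
    and a: "a \<in> Ppoly2 n" and b: "b \<in> Ppoly2 n"
    and e: "\<And>\<sigma>. \<sigma> \<in> interior ref_triangle \<Longrightarrow> E (tri_point (tri_face f s) \<sigma>) \<bullet> axis (ix f) 1 = snd \<sigma> * ((1 - snd \<sigma>) * a (fst \<sigma>) (snd \<sigma>) + fst \<sigma> * b (fst \<sigma>) (snd \<sigma>))"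
      "\<And>\<sigma>. \<sigma> \<in> interior ref_triangle \<Longrightarrow> E (tri_point (tri_face f s) \<sigma>) \<bullet> face_point f 0 (- s) 1 = fst \<sigma> * (snd \<sigma> * a (fst \<sigma>) (snd \<sigma>) + (1 - fst \<sigma>) * b (fst \<sigma>) (snd \<sigma>))"
    and qab: "\<And>\<sigma>. \<sigma> \<in> interior ref_triangle \<Longrightarrow> q (tri_point (tri_face f s) \<sigma>) = a (fst \<sigma>) (snd \<sigma>) *\<^sub>R axis (ix f) 1 + b (fst \<sigma>) (snd \<sigma>) *\<^sub>R face_point f 0 (- s) 1"
    and 0: "tri_dof (tri_face f s) q E = 0"
  shows "a x y = 0" "b x y = 0"
proof -
  have "cross3 (axis (ix f) 1) (face_point f 0 (- s) 1) \<noteq> 0"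
    by (cases f) (simp_all add: cross3_def pt_eq_iff axis_def ix_def)
  then have p0: "pair ref_triangle (\<lambda>\<sigma>. E (tri_point (tri_face f s) \<sigma>)) (\<lambda>\<sigma>. q (tri_point (tri_face f s) \<sigma>)) = 0"
    using 0 unfolding tri_dof_pair tri_face_sides by simp
  have form: "E (tri_point (tri_face f s) \<sigma>) \<bullet> q (tri_point (tri_face f s) \<sigma>) = snd \<sigma> * (1 - fst \<sigma> - snd \<sigma>) * (a (fst \<sigma>) (snd \<sigma>))\<^sup>2 +
     fst \<sigma> * (1 - fst \<sigma> - snd \<sigma>) * (b (fst \<sigma>) (snd \<sigma>))\<^sup>2 + fst \<sigma> * snd \<sigma> * (a (fst \<sigma>) (snd \<sigma>) + b (fst \<sigma>) (snd \<sigma>))\<^sup>2"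
    if "\<sigma> \<in> interior ref_triangle" for \<sigma>
    unfolding qab[OF that] inner_add_right inner_scaleR_right e(1)[OF that] e(2)[OF that]
    using bubble_quadratic[of "snd \<sigma>" "a (fst \<sigma>) (snd \<sigma>)" "fst \<sigma>" "b (fst \<sigma>) (snd \<sigma>)"] by (simp add: mult_ac)
  have nn: "0 \<le> snd \<sigma> * (1 - fst \<sigma> - snd \<sigma>) * (a (fst \<sigma>) (snd \<sigma>))\<^sup>2" "0 \<le> fst \<sigma> * (1 - fst \<sigma> - snd \<sigma>) * (b (fst \<sigma>) (snd \<sigma>))\<^sup>2"
    "0 \<le> fst \<sigma> * snd \<sigma> * (a (fst \<sigma>) (snd \<sigma>) + b (fst \<sigma>) (snd \<sigma>))\<^sup>2" if "\<sigma> \<in> interior ref_triangle" for \<sigma>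
    using that by (auto simp: interior_ref_triangle)
  have z: "a u v = 0 \<and> b u v = 0" if uv: "(u, v) \<in> interior ref_triangle" for u v
  proof -
    have "E (tri_point (tri_face f s) (u, v)) \<bullet> q (tri_point (tri_face f s) (u, v)) = 0"
      by (rule pair_nonneg_zero[OF convex_ref_triangle bounded_ref_triangle nice_face[OF E s] nice_tri_test[OF q] _ p0 uv])
        (use form nn in force)
    then have "v * (1 - u - v) * (a u v)\<^sup>2 = 0" "u * (1 - u - v) * (b u v)\<^sup>2 = 0"
      using form[OF uv] nn[OF uv] unfolding fst_conv snd_conv by linarith+
    then show ?thesis using uv by (auto simp: interior_ref_triangle)
  qed
  have "(1/3, 1/3) \<in> interior ref_triangle" by (auto simp: interior_ref_triangle)
  from Ppoly2_eq_zero[OF a open_interior this] Ppoly2_eq_zero[OF b open_interior this] z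
  show "a x y = 0" "b x y = 0" by blast+
qed

text \<open>Vanishing edge traces give the bubble shape through \<open>bubble_trace\<close>, and
  \<open>Ppoly2_hom\<close> turns the cofactors into polynomials on the finite triangle. Their
  degree \<open>k - 2\<close> is that of the test space, so they form an admissible test field
  themselves.\<close>

lemma tri_inj:
  assumes U: "U_num k N1 N2 N3" and k: "k \<ge> 1" and s: "s \<in> {0,1}"
    and n: "unit_normal (tri_set (tri_face f s)) (\<nu> (tri_set (tri_face f s)))"
    and base: "\<And>w. w \<in> {0..1} \<Longrightarrow> (if f then N1 else N2) (face_point f w s 0) = 0"
    and vert: "\<And>w z. w \<in> {0,1} \<Longrightarrow> z \<ge> 0 \<Longrightarrow> N3 (face_point f w s z) = 0"
    and 0: "\<And>q. q \<in> tri_space k \<nu> (tri_face f s) \<Longrightarrow> tri_dof (tri_face f s) q (pushf (rfield k N1 N2 N3)) = 0"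
    and wz: "w \<in> {0..1}" "z \<ge> 0"
  shows "(if f then N1 else N2) (face_point f w s z) = 0 \<and> N3 (face_point f w s z) = 0"
proof -
  have E: "reg (pushf (rfield k N1 N2 N3))" using U k reg_bar unfolding U_num_def by blast
  obtain A B S where A: "A \<in> Ppoly2 (int k - 1)" and B: "B \<in> Ppoly2 (int k - 1)" and SH: "S \<in> Hom k" and
    ABS: "\<forall>w\<in>{0..1}. \<forall>z\<ge>0. (if f then N1 else N2) (face_point f w s z) = A w z + S w z * (1 + z) \<and> N3 (face_point f w s z) = B w z - S w z * w"
    using U s unfolding U_num_def trace_num_def by blast
  have S: "S \<in> Ppoly2 (int k - 1)" using SH Ptilde_num k unfolding Hom_def by blast
  have "A w 0 + S w 0 = 0" if "w \<in> {0..1}" for w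
    using ABS[rule_format, of w 0] base[OF that] that by simp
  moreover have "B 0 z = 0" "B 1 z - S 1 z = 0" if "z \<ge> 0" for z
    using ABS[rule_format, of 0 z] ABS[rule_format, of 1 z] vert[of 0 z] vert[of 1 z] that by simp_all
  ultimately have "\<exists>da \<in> Ppoly2 (int k - 2). \<exists>db \<in> Ppoly2 (int k - 2). \<forall>w\<in>{0..1}. \<forall>z\<ge>0.
      A w z + S w z * (1 + z) = z * (da w z + w * db w z) \<and> B w z - S w z * w = w * (1 - w) * db w z"
    by (rule bubble_trace[OF A B S])
  then obtain da db where da: "da \<in> Ppoly2 (int k - 2)" and db: "db \<in> Ppoly2 (int k - 2)" and
    dab: "\<forall>w\<in>{0..1}. \<forall>z\<ge>0. A w z + S w z * (1 + z) = z * (da w z + w * db w z) \<and> B w z - S w z * w = w * (1 - w) * db w z"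
    by blast
  have N: "(if f then N1 else N2) (face_point f w s z) = z * (da w z + w * db w z) \<and> N3 (face_point f w s z) = w * (1 - w) * db w z"
    if "w \<in> {0..1}" "z \<ge> 0" for w z
    using ABS[rule_format, OF that] dab[rule_format, OF that] by simp
  obtain a where a: "a \<in> Ppoly2 (int k - 2)" "\<forall>w z. z \<noteq> -1 \<longrightarrow> da w z = (1 + z) ^ (k - 2) * a (w / (1 + z)) (z / (1 + z))"
    using Ppoly2_hom[OF da] by blast
  obtain b where b: "b \<in> Ppoly2 (int k - 2)" "\<forall>w z. z \<noteq> -1 \<longrightarrow> db w z = (1 + z) ^ (k - 2) * b (w / (1 + z)) (z / (1 + z))"
    using Ppoly2_hom[OF db] by blast
  obtain q where q: "q \<in> tri_space k \<nu> (tri_face f s)" "\<forall>\<sigma>\<in>ref_triangle. q (tri_point (tri_face f s) \<sigma>) =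
    a (fst \<sigma>) (snd \<sigma>) *\<^sub>R axis (ix f) 1 + b (fst \<sigma>) (snd \<sigma>) *\<^sub>R face_point f 0 (- s) 1"
    using tri_test_exists[where \<nu> = \<nu> and b = f and s = s, OF a(1) b(1) n] by blast
  note bc = bubble_components[OF s k a(1) b(1) a(2) b(2) N]
  have "a x y = 0 \<and> b x y = 0" for x y
    using tri_dof_definite[OF s E q(1) a(1) b(1) _ _ _ 0[OF q(1)], of x y] bc q(2) interior_ref_triangleD by blast
  then have "da w z = 0" "db w z = 0" using a(2) b(2) wz by auto
  then show ?thesis using N[OF wz] by simp
qed

text \<open>By \<open>Ppoly2_dehom\<close> any pair of cofactors on the finite triangle comes from
  numerators, to which \<open>tri_lift\<close> applies.\<close>

lemma tri_lift_exists:
  assumes a: "a \<in> Ppoly2 (int k - 2)" and b: "b \<in> Ppoly2 (int k - 2)" and k: "k \<ge> 1" and s: "s \<in> {0,1}"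
  shows "\<exists>E\<in>U1 k. (\<forall>e\<in>edges. \<forall>\<sigma>. 0 \<le> \<sigma> \<longrightarrow> \<sigma> < 1 \<longrightarrow> edge_trace E e \<sigma> = 0) \<and>
    (\<forall>T\<in>tri_faces - {tri_face f s}. tri_trace_zero E T) \<and>
    (\<forall>\<sigma>\<in>ref_triangle. snd \<sigma> < 1 \<longrightarrow>
      E (tri_point (tri_face f s) \<sigma>) \<bullet> axis (ix f) 1 = snd \<sigma> * ((1 - snd \<sigma>) * a (fst \<sigma>) (snd \<sigma>) + fst \<sigma> * b (fst \<sigma>) (snd \<sigma>)) \<and>
      E (tri_point (tri_face f s) \<sigma>) \<bullet> face_point f 0 (- s) 1 = fst \<sigma> * (snd \<sigma> * a (fst \<sigma>) (snd \<sigma>) + (1 - fst \<sigma>) * b (fst \<sigma>) (snd \<sigma>)))"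
proof -
  obtain da where da: "da \<in> Ppoly2 (int k - 2)" "\<forall>w z. z \<noteq> -1 \<longrightarrow> da w z = (1 + z) ^ (k - 2) * a (w / (1 + z)) (z / (1 + z))"
    using Ppoly2_dehom[OF a] by blast
  obtain db where db: "db \<in> Ppoly2 (int k - 2)" "\<forall>w z. z \<noteq> -1 \<longrightarrow> db w z = (1 + z) ^ (k - 2) * b (w / (1 + z)) (z / (1 + z))"
    using Ppoly2_dehom[OF b] by blast
  define N1 N2 N3 where "N1 = sel f (tri_num1 f s da db)" and "N2 = sel (\<not> f) (tri_num1 f s da db)" and "N3 = tri_num3 f s db"
  have U: "U_num k N1 N2 N3" unfolding N1_def N2_def N3_def by (rule tri_lift[OF da(1) db(1) k s])
  define E where "E = pushf (rfield k N1 N2 N3)"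
  have EU: "E \<in> U1 k" using U U1_iff[OF k] unfolding E_def by blast
  have Nf: "(if f' then N1 else N2) (face_point f' w s' z) = (if f' = f then lin s s' * (z * (da w z + w * db w z)) else 0)"
    "N3 (face_point f' w s' z) = (if f' = f then lin s s' * (w * (1 - w) * db w z) else 0)"
    if "s' \<in> {0,1}" for f' w s' z
    using that by (cases f; cases f'; auto simp: N1_def N2_def N3_def tri_num1_def tri_num3_def ix_def)+
  have e1: "edge_trace E (base_edge f' s') \<sigma> = 0" if "s' \<in> {0,1}" "0 \<le> \<sigma>" "\<sigma> < 1" for f' s' \<sigma>
    using edge_trace_base_edge[OF that(1,2), of k N1 N2 N3 f'] that Nf(1)[OF that(1), of f' \<sigma> 0] unfolding E_def by simp
  have e2: "edge_trace E (vert_edge s1 s2) \<sigma> = 0" if "s1 \<in> {0,1}" "s2 \<in> {0,1}" "0 \<le> \<sigma>" "\<sigma> < 1" for s1 s2 \<sigma>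
  proof -
    have "vector [s1, s2, z] = face_point f (if f then s1 else s2) (if f then s2 else s1) z" for z by (simp add: face_point_def)
    then have "N3 (vector [s1, s2, z]) = 0" for z
      using Nf(2)[of "if f then s2 else s1" f "if f then s1 else s2" z] that by (auto split: if_splits)
    then show ?thesis using edge_trace_vert_edge[OF that k] unfolding E_def by simp
  qed
  have f0: "tri_trace_zero E (tri_face f' s')" if "s' \<in> {0,1}" "f' \<noteq> f \<or> s' \<noteq> s" for f' s'
  proof -
    have "lin s s' = 0 \<or> f' \<noteq> f" using that lin_01[OF s that(1)] by auto
    then have "(if f' then N1 else N2) (face_point f' w s' z) = 0" "N3 (face_point f' w s' z) = 0" for w z
      using Nf[OF that(1), of f' w z] by auto
    then show ?thesis
      unfolding tri_trace_zero_def tri_face_sides E_def using face_components[OF that(1) _ _ k refl refl, of _ N1 N2 N3 f'] by simp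
  qed
  have bubble: "E (tri_point (tri_face f s) \<sigma>) \<bullet> axis (ix f) 1 = snd \<sigma> * ((1 - snd \<sigma>) * a (fst \<sigma>) (snd \<sigma>) + fst \<sigma> * b (fst \<sigma>) (snd \<sigma>)) \<and>
      E (tri_point (tri_face f s) \<sigma>) \<bullet> face_point f 0 (- s) 1 = fst \<sigma> * (snd \<sigma> * a (fst \<sigma>) (snd \<sigma>) + (1 - fst \<sigma>) * b (fst \<sigma>) (snd \<sigma>))"
    if "\<sigma> \<in> ref_triangle" "snd \<sigma> < 1" for \<sigma>
    unfolding E_def
    by (intro conjI bubble_components[OF s k a b da(2) db(2) _ that])
      (use Nf[OF s, of f] lin_01[OF s s] in auto)
  show ?thesis
  proof (intro bexI[OF _ EU] conjI ballI allI impI)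
    show "edge_trace E e \<sigma> = 0" if "e \<in> edges" "0 \<le> \<sigma>" "\<sigma> < 1" for e \<sigma>
      using that e1 e2 unfolding edges_iff by blast
    show "tri_trace_zero E T" if T: "T \<in> tri_faces - {tri_face f s}" for T
    proof -
      obtain f' s' where T': "s' \<in> {0,1}" "T = tri_face f' s'" using T unfolding Diff_iff tri_faces_iff by blast
      then have "f' \<noteq> f \<or> s' \<noteq> s" using T by blast
      then show ?thesis using f0[OF T'(1)] T'(2) by blast
    qed
  qed (use bubble in auto)
qed

section \<open>Degrees of freedom of the base\<close>

definition base_trace_zero :: "(pt \<Rightarrow> pt) \<Rightarrow> bool"
  where "base_trace_zero E \<longleftrightarrow> (\<forall>\<sigma>\<in>ref_square. E (base_point \<sigma>) $ 1 = 0 \<and> E (base_point \<sigma>) $ 2 = 0)"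

lemma unit_normal_base:
  assumes "unit_normal base n"
  shows "n$1 = 0" "n$2 = 0" "n$3 * n$3 = 1"
proof -
  have "base_point (0,0) \<in> base" "base_point (1,0) \<in> base" "base_point (0,1) \<in> base"
    by (auto intro!: base_point_mem(2) simp: ref_square_def)
  then have "n \<bullet> (base_point (1,0) - base_point (0,0)) = 0" "n \<bullet> (base_point (0,1) - base_point (0,0)) = 0"
    using assms unfolding unit_normal_def by blast+
  then show n: "n$1 = 0" "n$2 = 0" by (simp_all add: base_point_def inner_pt)
  have "n \<bullet> n = 1" using assms unfolding unit_normal_def by (simp add: norm_eq_1)
  then show "n$3 * n$3 = 1" by (simp add: inner_pt n)
qed

lemma base_dof_zero:
  assumes E: "reg E" and q: "q \<in> base_space k" and n: "unit_normal base n" and z: "base_trace_zero E"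
  shows "base_dof n q E = 0"
  unfolding base_dof_pair
proof (rule pair_zero[OF ref_square_facts(1,2) nice_base[OF E] nice_base_test[OF q]])
  fix \<sigma> assume "\<sigma> \<in> interior ref_square"
  then have "\<sigma> \<in> ref_square" using interior_subset by blast
  moreover have "cross3 n (q (base_point \<sigma>)) $ 3 = 0" by (simp add: cross3_def unit_normal_base[OF n])
  ultimately show "E (base_point \<sigma>) \<bullet> cross3 n (q (base_point \<sigma>)) = 0" using z by (simp add: base_trace_zero_def inner_pt)
qed

lemma Qpoly2_eq_zero:
  assumes "g \<in> Qpoly2 l m" "\<And>x y. 0 < x \<Longrightarrow> x < 1 \<Longrightarrow> 0 < y \<Longrightarrow> y < 1 \<Longrightarrow> g x y = 0"
  shows "g x y = 0"
  using Qpoly_eq_zero_cube[OF Qpoly2_Qpoly[OF assms(1)], of "vector [x,y,0]"] assms(2) by simp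

text \<open>The integrand is \<open>y (1 - y) g1^2 + x (1 - x) g2^2\<close>, with positive weights
  inside the square.\<close>

lemma base_dof_definite:
  assumes E: "reg E" and q: "q \<in> base_space k" and g: "g1 \<in> Qpoly2 l1 m1" "g2 \<in> Qpoly2 l2 m2"
    and e: "\<And>x y. 0 < x \<Longrightarrow> x < 1 \<Longrightarrow> 0 < y \<Longrightarrow> y < 1 \<Longrightarrow> E (base_point (x,y)) $ 1 = y * (1 - y) * g1 x y \<and>
      E (base_point (x,y)) $ 2 = x * (1 - x) * g2 x y \<and> cross3 n (q (base_point (x,y))) = vector [g1 x y, g2 x y, 0]"
    and 0: "base_dof n q E = 0"
  shows "g1 x y = 0" "g2 x y = 0"
proof -
  have z: "g1 u v = 0 \<and> g2 u v = 0" if uv: "0 < u" "u < 1" "0 < v" "v < 1" for u v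
  proof -
    have f: "E (base_point \<sigma>) \<bullet> cross3 n (q (base_point \<sigma>)) = snd \<sigma> * (1 - snd \<sigma>) * (g1 (fst \<sigma>) (snd \<sigma>))\<^sup>2 + fst \<sigma> * (1 - fst \<sigma>) * (g2 (fst \<sigma>) (snd \<sigma>))\<^sup>2"
      if "\<sigma> \<in> interior ref_square" for \<sigma>
      using that e[of "fst \<sigma>" "snd \<sigma>"] by (auto simp: ref_square_facts inner_pt power2_eq_square)
    have nn: "0 \<le> snd \<sigma> * (1 - snd \<sigma>) * (g1 (fst \<sigma>) (snd \<sigma>))\<^sup>2" "0 \<le> fst \<sigma> * (1 - fst \<sigma>) * (g2 (fst \<sigma>) (snd \<sigma>))\<^sup>2"
      if "\<sigma> \<in> interior ref_square" for \<sigma> using that by (auto simp: ref_square_facts)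
    have i: "(u, v) \<in> interior ref_square" using uv by (auto simp: ref_square_facts)
    have "E (base_point (u, v)) \<bullet> cross3 n (q (base_point (u, v))) = 0"
    proof (rule pair_nonneg_zero[OF ref_square_facts(1,2) nice_base[OF E] nice_base_test[OF q] _ 0[unfolded base_dof_pair] i])
      show "0 \<le> E (base_point \<sigma>) \<bullet> cross3 n (q (base_point \<sigma>))" if "\<sigma> \<in> interior ref_square" for \<sigma>
        unfolding f[OF that] using nn[OF that] by linarith
    qed
    then have "v * (1 - v) * (g1 u v)\<^sup>2 = 0" "u * (1 - u) * (g2 u v)\<^sup>2 = 0"
      using f[OF i] nn[OF i] unfolding fst_conv snd_conv by linarith+
    then show ?thesis using uv by auto
  qed
  show "g1 x y = 0" "g2 x y = 0" using Qpoly2_eq_zero[OF g(1)] Qpoly2_eq_zero[OF g(2)] z by blast+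
qed

lemma base_test_exists:
  assumes "g1 \<in> Qpoly2 (int k - 1) (int k - 2)" "g2 \<in> Qpoly2 (int k - 2) (int k - 1)" and n: "unit_normal base n"
  shows "\<exists>q \<in> base_space k. \<forall>\<sigma>\<in>ref_square. cross3 n (q (base_point \<sigma>)) = vector [g1 (fst \<sigma>) (snd \<sigma>), g2 (fst \<sigma>) (snd \<sigma>), 0]"
proof -
  \<comment> \<open>Inverts the rotation \<open>cross3 n\<close> by a right angle, as
    \<open>n = (0, 0, n3)\<close> with \<open>n3^2 = 1\<close>. The rotation also exchanges the two
    degree bounds, which is why cofactors match \<open>base_space\<close>.\<close>
  define q :: "pt \<Rightarrow> pt" where "q = restr base (\<lambda>p. vector [n$3 * g2 (p$1) (p$2), (- n$3) * g1 (p$1) (p$2), 0])"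
  have "q \<in> base_space k"
    unfolding base_space_def q_def
    by (intro CollectI exI[of _ "\<lambda>x y. n$3 * g2 x y"] exI[of _ "\<lambda>x y. (- n$3) * g1 x y"] conjI
      Qpoly2_cmult[OF assms(2)] Qpoly2_cmult[OF assms(1)] refl)
  moreover have "cross3 n (q (base_point \<sigma>)) = vector [g1 (fst \<sigma>) (snd \<sigma>), g2 (fst \<sigma>) (snd \<sigma>), 0]" if "\<sigma> \<in> ref_square" for \<sigma>
  proof -
    have c: "n$3 * (n$3 * c) = c" for c using unit_normal_base(3)[OF n] by (simp add: mult.assoc[symmetric])
    have "q (base_point \<sigma>) = vector [n$3 * g2 (fst \<sigma>) (snd \<sigma>), (- n$3) * g1 (fst \<sigma>) (snd \<sigma>), 0]"
      using base_point_mem(2)[OF that] by (simp add: q_def restr_def) (simp add: base_point_def)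
    then show ?thesis using unit_normal_base[OF n] by (simp add: cross3_def c)
  qed
  ultimately show ?thesis by blast
qed

text \<open>Zero traces on the four base edges split off \<open>y (1 - y)\<close> and
  \<open>x (1 - x)\<close>; after rotation the cofactors are an admissible test field.\<close>

lemma base_inj:
  assumes U: "U_num k N1 N2 N3" and k: "k \<ge> 1" and n: "unit_normal base n"
    and side: "\<And>b s w. s \<in> {0,1} \<Longrightarrow> w \<in> {0..1} \<Longrightarrow> (if b then N1 else N2) (face_point b w s 0) = 0"
    and 0: "\<And>q. q \<in> base_space k \<Longrightarrow> base_dof n q (pushf (rfield k N1 N2 N3)) = 0"
    and xy: "x \<in> {0..1}" "y \<in> {0..1}"
  shows "N1 (vector [x,y,0]) = 0 \<and> N2 (vector [x,y,0]) = 0"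
proof -
  have E: "reg (pushf (rfield k N1 N2 N3))" using U k reg_bar unfolding U_num_def by blast
  have NQ: "N1 \<in> Qpoly (int k - 1) (int k) (int k)" "N2 \<in> Qpoly (int k) (int k - 1) (int k)"
    using U bar_num_Qpoly k unfolding U_num_def by blast+
  have s1: "N1 (vector [x,s,0]) = 0" if "s \<in> {0,1}" "0 < x" "x < 1" for x s
    using side[OF that(1), of x True] that by (simp add: face_point_def)
  have s2: "N2 (vector [s,y,0]) = 0" if "s \<in> {0,1}" "0 < y" "y < 1" for y s
    using side[OF that(1), of y False] that by (simp add: face_point_def)
  obtain h1 where h1: "h1 \<in> Qpoly (int k - 1) (int k - 2) (max (int k) 0)" "\<forall>p. N1 (vector [p$1, p$2, 0]) = p$2 * (1 - p$2) * h1 p"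
    by (rule bexE[OF factor2[OF Qpoly_slice3[OF NQ(1), of 0]]]) (use s1 in auto)
  obtain h2 where h2: "h2 \<in> Qpoly (int k - 2) (int k - 1) (max (int k) 0)" "\<forall>p. N2 (vector [p$1, p$2, 0]) = p$1 * (1 - p$1) * h2 p"
    by (rule bexE[OF factor1[OF Qpoly_slice3[OF NQ(2), of 0]]]) (use s2 in auto)
  define g1 g2 where "g1 = (\<lambda>x y. h1 (vector [x,y,0]))" and "g2 = (\<lambda>x y. h2 (vector [x,y,0]))"
  have g: "g1 \<in> Qpoly2 (int k - 1) (int k - 2)" "g2 \<in> Qpoly2 (int k - 2) (int k - 1)"
    unfolding g1_def g2_def using Qpoly_Qpoly2 h1(1) h2(1) by blast+
  have N: "N1 (vector [x,y,0]) = y * (1 - y) * g1 x y" "N2 (vector [x,y,0]) = x * (1 - x) * g2 x y" for x y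
    using h1(2)[rule_format, of "vector [x,y,0]"] h2(2)[rule_format, of "vector [x,y,0]"] by (simp_all add: g1_def g2_def)
  obtain q where q: "q \<in> base_space k" "\<forall>\<sigma>\<in>ref_square. cross3 n (q (base_point \<sigma>)) = vector [g1 (fst \<sigma>) (snd \<sigma>), g2 (fst \<sigma>) (snd \<sigma>), 0]"
    using base_test_exists[OF g n] by blast
  have e: "pushf (rfield k N1 N2 N3) (base_point (x,y)) $ 1 = y * (1 - y) * g1 x y \<and>
      pushf (rfield k N1 N2 N3) (base_point (x,y)) $ 2 = x * (1 - x) * g2 x y \<and> cross3 n (q (base_point (x,y))) = vector [g1 x y, g2 x y, 0]"
    if "0 < x" "x < 1" "0 < y" "y < 1" for x y
  proof -
    have xy: "(x, y) \<in> ref_square" using that by (auto simp: ref_square_def)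
    have c: "cross3 n (q (base_point (x,y))) = vector [g1 x y, g2 x y, 0]" using bspec[OF q(2) xy] by simp
    have b: "base_point (x, y) = vector [x, y, 0]" by (simp add: base_point_def)
    show ?thesis
      using base_components[OF xy, of k N1 N2 N3] N[of x y] c unfolding b by simp
  qed
  show ?thesis
    unfolding N using base_dof_definite[OF E q(1) g e 0[OF q(1)]] by simp
qed

lemma base_lift_exists:
  assumes g: "g1 \<in> Qpoly2 (int k - 1) (int k - 2)" "g2 \<in> Qpoly2 (int k - 2) (int k - 1)" and k: "k \<ge> 1"
  shows "\<exists>E\<in>U1 k. (\<forall>e\<in>edges. \<forall>\<sigma>. 0 \<le> \<sigma> \<longrightarrow> \<sigma> < 1 \<longrightarrow> edge_trace E e \<sigma> = 0) \<and> (\<forall>T\<in>tri_faces. tri_trace_zero E T) \<and>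
    (\<forall>\<sigma>\<in>ref_square. E (base_point \<sigma>) $ 1 = snd \<sigma> * (1 - snd \<sigma>) * g1 (fst \<sigma>) (snd \<sigma>) \<and> E (base_point \<sigma>) $ 2 = fst \<sigma> * (1 - fst \<sigma>) * g2 (fst \<sigma>) (snd \<sigma>))"
proof -
  define N1 N2 :: "pt \<Rightarrow> real" where "N1 = (\<lambda>p. p$2 * (1 - p$2) * g1 (p$1) (p$2))" and "N2 = (\<lambda>p. p$1 * (1 - p$1) * g2 (p$1) (p$2))"
  define E where "E = pushf (rfield k N1 N2 (\<lambda>_. 0))"
  have EU: "E \<in> U1 k" using base_lift[OF g k] U1_iff[OF k] unfolding E_def N1_def N2_def by blast
  have N: "(if b then N1 else N2) (face_point b w s z) = 0" if "s \<in> {0,1}" for b w s z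
    using that by (cases b) (auto simp: N1_def N2_def)
  have e: "edge_trace E e \<sigma> = 0" if e: "e \<in> edges" and \<sigma>: "0 \<le> \<sigma>" "\<sigma> < 1" for e \<sigma>
  proof -
    consider b s where "s \<in> {0,1}" "e = base_edge b s" | s1 s2 where "s1 \<in> {0,1}" "s2 \<in> {0,1}" "e = vert_edge s1 s2"
      using e unfolding edges_iff by blast
    then show ?thesis
    proof cases
      case 1
      show ?thesis unfolding 1(2) E_def edge_trace_base_edge[OF 1(1) \<sigma>(1) less_imp_le[OF \<sigma>(2)]] by (rule N[OF 1(1)])
    next
      case 2
      show ?thesis unfolding 2(3) E_def edge_trace_vert_edge[OF 2(1,2) \<sigma> k] by simp
    qed
  qed
  have f: "tri_trace_zero E T" if Tf: "T \<in> tri_faces" for T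
  proof -
    obtain b s where T: "s \<in> {0,1}" "T = tri_face b s" using Tf unfolding tri_faces_iff by blast
    show ?thesis
      unfolding T(2) tri_trace_zero_def tri_face_sides E_def using face_components[OF T(1) _ _ k refl refl, of _ N1 N2 "\<lambda>_. 0" b] N[OF T(1)] by simp
  qed
  show ?thesis
  proof (intro bexI[OF _ EU] conjI ballI allI impI)
    fix \<sigma> assume "\<sigma> \<in> ref_square"
    then show "E (base_point \<sigma>) $ 1 = snd \<sigma> * (1 - snd \<sigma>) * g1 (fst \<sigma>) (snd \<sigma>)" "E (base_point \<sigma>) $ 2 = fst \<sigma> * (1 - fst \<sigma>) * g2 (fst \<sigma>) (snd \<sigma>)"
      using base_components[of \<sigma> k N1 N2 "\<lambda>_. 0"] by (simp_all add: E_def N1_def N2_def base_point_def)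
  qed (use e f in auto)
qed

section \<open>Finite dimension\<close>

lemma linear_combI:
  assumes "\<And>c x y. f (c *\<^sub>R x + y) = c *\<^sub>R f x + f y"
  shows "linear f"
proof (rule linearI)
  show "f (x + y) = f x + f y" for x y using assms[of 1 x y] by simp
  have "f 0 = 0" using assms[of 1 0 0] by simp
  then show "f (c *\<^sub>R x) = c *\<^sub>R f x" for c x using assms[of c x 0] by simp
qed

lemma finite_dim_Qpoly: "finite_dim (Qpoly l m n)"
proof -
  define g where "g = (\<lambda>(a, b, c) (p::pt). p$1 ^ a * p$2 ^ b * p$3 ^ c :: real)"
  have fin: "finite {a. int a \<le> l}" for l by (rule finite_subset[of _ "{..nat l}"]) auto
  have "{\<lambda>p::pt. p$1 ^ a * p$2 ^ b * p$3 ^ c | a b c. int a \<le> l \<and> int b \<le> m \<and> int c \<le> n} \<subseteq>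
    g ` ({a. int a \<le> l} \<times> {b. int b \<le> m} \<times> {c. int c \<le> n})"
  proof
    fix f assume "f \<in> {\<lambda>p::pt. p$1 ^ a * p$2 ^ b * p$3 ^ c | a b c. int a \<le> l \<and> int b \<le> m \<and> int c \<le> n}"
    then obtain a b c where abc: "f = (\<lambda>p. p$1 ^ a * p$2 ^ b * p$3 ^ c)" "int a \<le> l" "int b \<le> m" "int c \<le> n" by blast
    show "f \<in> g ` ({a. int a \<le> l} \<times> {b. int b \<le> m} \<times> {c. int c \<le> n})"
      by (rule image_eqI[of _ _ "(a, b, c)"]) (simp_all add: abc g_def)
  qed
  then have "finite {\<lambda>p::pt. p$1 ^ a * p$2 ^ b * p$3 ^ c | a b c. int a \<le> l \<and> int b \<le> m \<and> int c \<le> n}"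
    by (rule finite_subset) (intro finite_imageI finite_cartesian_product fin)
  then show ?thesis unfolding Qpoly_def by (rule finite_dim_span)
qed

lemma finite_dim_Qpoly2: "finite_dim (Qpoly2 l m)"
proof -
  define f where "f = (\<lambda>(R :: pt \<Rightarrow> real) x y. R (vector [x,y,0]))"
  have "Qpoly2 l m \<subseteq> f ` Qpoly l m 0"
  proof
    fix r assume "r \<in> Qpoly2 l m"
    then show "r \<in> f ` Qpoly l m 0"
      by (intro image_eqI[of _ f "\<lambda>p. r (p$1) (p$2)"] Qpoly2_Qpoly) (simp_all add: f_def)
  qed
  moreover have "linear f"
    by (rule linear_combI) (simp add: fun_eq_iff f_def)
  ultimately show ?thesis using finite_dim_mono finite_dim_image finite_dim_Qpoly by blast
qed

lemma finite_dim_Ppoly_on: "finite_dim (Ppoly_on S n)"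
proof -
  have "Apoly n \<subseteq> Qpoly n n n" unfolding Apoly_def Qpoly_def by (rule span_mono) force
  moreover have "linear (restr S :: (pt \<Rightarrow> real) \<Rightarrow> pt \<Rightarrow> real)"
    by (rule linear_combI) (simp add: fun_eq_iff restr_def)
  ultimately show ?thesis unfolding Ppoly_on_Apoly using finite_dim_mono finite_dim_image finite_dim_Qpoly by blast
qed

lemma finite_dim_tri_space: "finite_dim (tri_space k \<nu> T)"
proof -
  define P where "P = Ppoly_on (tri_set T) (int k - 2)"
  define f where "f = (\<lambda>(i::3) (g :: pt \<Rightarrow> real) p. g p *\<^sub>R axis i (1::real))"
  have lin: "linear (f i)" for i
    by (rule linear_combI) (simp add: fun_eq_iff f_def algebra_simps)
  have "tri_space k \<nu> T \<subseteq> {a + b | a b. a \<in> f 1 ` P \<and> b \<in> {a + b | a b. a \<in> f 2 ` P \<and> b \<in> f 3 ` P}}"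
  proof
    fix q assume q: "q \<in> tri_space k \<nu> T"
    have c: "(\<lambda>p. q p $ i) \<in> P" for i using q unfolding tri_space_def P_def by blast
    have "q = f 1 (\<lambda>p. q p $ 1) + (f 2 (\<lambda>p. q p $ 2) + f 3 (\<lambda>p. q p $ 3))"
      by (simp add: fun_eq_iff pt_eq_iff axis_def f_def)
    then show "q \<in> {a + b | a b. a \<in> f 1 ` P \<and> b \<in> {a + b | a b. a \<in> f 2 ` P \<and> b \<in> f 3 ` P}}"
      using imageI[OF c[of 1], of "f 1"] imageI[OF c[of 2], of "f 2"] imageI[OF c[of 3], of "f 3"] by blast
  qed
  moreover have "finite_dim {a + b | a b. a \<in> f 1 ` P \<and> b \<in> {a + b | a b. a \<in> f 2 ` P \<and> b \<in> f 3 ` P}}"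
    unfolding P_def by (intro finite_dim_sum finite_dim_image finite_dim_Ppoly_on lin)
  ultimately show ?thesis by (rule finite_dim_mono[rotated])
qed

lemma finite_dim_base_space: "finite_dim (base_space k)"
proof -
  define f where "f = (\<lambda>(r :: real \<Rightarrow> real \<Rightarrow> real). restr base (\<lambda>p. vector [r (p$1) (p$2), 0, 0] :: pt))"
  define g where "g = (\<lambda>(r :: real \<Rightarrow> real \<Rightarrow> real). restr base (\<lambda>p. vector [0, r (p$1) (p$2), 0] :: pt))"
  have lin: "linear f" "linear g"
    by (rule linear_combI; simp add: fun_eq_iff restr_def pt_eq_iff f_def g_def)+
  have e: "restr base (\<lambda>p. vector [q1 (p$1) (p$2), q2 (p$1) (p$2), 0]) = f q1 + g q2" for q1 q2
    by (simp add: fun_eq_iff restr_def pt_eq_iff f_def g_def)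
  have "base_space k \<subseteq> {a + b | a b. a \<in> f ` Qpoly2 (int k - 2) (int k - 1) \<and> b \<in> g ` Qpoly2 (int k - 1) (int k - 2)}"
    unfolding base_space_def e by blast
  moreover have "finite_dim {a + b | a b. a \<in> f ` Qpoly2 (int k - 2) (int k - 1) \<and> b \<in> g ` Qpoly2 (int k - 1) (int k - 2)}"
    by (intro finite_dim_sum finite_dim_image finite_dim_Qpoly2 lin)
  ultimately show ?thesis by (rule finite_dim_mono[rotated])
qed

lemma finite_dim_U0_zero:
  assumes k: "k \<ge> 1"
  shows "finite_dim (U0_zero k)"
proof -
  have b: "bubble (c *\<^sub>R H + H') p = c * bubble H p + bubble H' p" for c H H' p
    by (simp add: bubble_def algebra_simps)
  have "linear (bubble_form k)"
    by (rule linear_combI) (simp add: fun_eq_iff bubble_form_def b add_divide_distrib del: psi_nth)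
  moreover have "U0_zero k \<subseteq> bubble_form k ` Qpoly (int k - 2) (int k - 2) (int k - 2)"
    using U0_zero_iff[OF k] by blast
  ultimately show ?thesis using finite_dim_mono finite_dim_image finite_dim_Qpoly by blast
qed

lemma linear_pushf_rfield:
  assumes "\<And>c q q' p. a (c *\<^sub>R q + q') p = c * a q p + a q' p" "\<And>c q q' p. b (c *\<^sub>R q + q') p = c * b q p + b q' p"
    "\<And>c q q' p. d (c *\<^sub>R q + q') p = c * d q p + d q' p"
  shows "linear (\<lambda>q. pushf (rfield k (a q) (b q) (d q)))"
proof (rule linear_combI)
  fix c q q'
  have "a (c *\<^sub>R q + q') = (\<lambda>p. c * a q p + a q' p)" "b (c *\<^sub>R q + q') = (\<lambda>p. c * b q p + b q' p)"
    "d (c *\<^sub>R q + q') = (\<lambda>p. c * d q p + d q' p)"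
    by (intro ext assms)+
  then show "pushf (rfield k (a (c *\<^sub>R q + q')) (b (c *\<^sub>R q + q')) (d (c *\<^sub>R q + q'))) =
      c *\<^sub>R pushf (rfield k (a q) (b q) (d q)) + pushf (rfield k (a q') (b q') (d q'))"
    by (simp only: rfield_lin pushf_add pushf_scaleR)
qed

lemma finite_dim_U1_zero_curl: "finite_dim (U1_zero_curl k)"
proof -
  define f1 where "f1 = (\<lambda>q. pushf (rfield k (vnum1 q) (\<lambda>_. 0) (\<lambda>_. 0)))"
  define f2 where "f2 = (\<lambda>q. pushf (rfield k (\<lambda>_. 0) (vnum2 q) (\<lambda>_. 0)))"
  define f3 where "f3 = (\<lambda>q. pushf (rfield k (\<lambda>_. 0) (\<lambda>_. 0) (vnum3 q)))"
  have lin: "linear f1" "linear f2" "linear f3"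
    unfolding f1_def f2_def f3_def
    by (rule linear_pushf_rfield; simp add: vnum1_def vnum2_def vnum3_def algebra_simps)+
  have e: "pushf (rfield k (vnum1 q1) (vnum2 q2) (vnum3 \<rho>)) = f1 q1 + (f2 q2 + f3 \<rho>)" for q1 q2 \<rho>
    unfolding pushf_add[symmetric] f1_def f2_def f3_def by (rule pushf_cong) (simp add: pt_eq_iff)
  have "U1_zero_curl k \<subseteq> {a + b | a b. a \<in> f1 ` Qpoly (int k - 1) (int k - 2) (int k - 2) \<and>
     b \<in> {a + b | a b. a \<in> f2 ` Qpoly (int k - 2) (int k - 1) (int k - 2) \<and> b \<in> f3 ` Qpoly (int k - 2) (int k - 2) 0}}"
  proof
    fix v assume "v \<in> U1_zero_curl k"
    then obtain q1 q2 \<rho> where v: "v_spaces k q1 q2 \<rho>" "v = f1 q1 + (f2 q2 + f3 \<rho>)"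
      unfolding U1_zero_curl_iff e by blast
    then show "v \<in> {a + b | a b. a \<in> f1 ` Qpoly (int k - 1) (int k - 2) (int k - 2) \<and>
     b \<in> {a + b | a b. a \<in> f2 ` Qpoly (int k - 2) (int k - 1) (int k - 2) \<and> b \<in> f3 ` Qpoly (int k - 2) (int k - 2) 0}}"
      unfolding v_spaces_def by blast
  qed
  moreover have "finite_dim {a + b | a b. a \<in> f1 ` Qpoly (int k - 1) (int k - 2) (int k - 2) \<and>
     b \<in> {a + b | a b. a \<in> f2 ` Qpoly (int k - 2) (int k - 1) (int k - 2) \<and> b \<in> f3 ` Qpoly (int k - 2) (int k - 2) 0}}"
    by (intro finite_dim_sum finite_dim_image finite_dim_Qpoly lin)
  ultimately show ?thesis by (rule finite_dim_mono[rotated])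
qed

section \<open>Vanishing traces\<close>

definition edge_traces_zero :: "(pt \<Rightarrow> pt) \<Rightarrow> bool"
  where "edge_traces_zero E \<longleftrightarrow> (\<forall>e\<in>edges. \<forall>\<sigma>. 0 \<le> \<sigma> \<longrightarrow> \<sigma> < 1 \<longrightarrow> edge_trace E e \<sigma> = 0)"

lemma subspace_combI:
  assumes "0 \<in> W" "\<And>c x y. x \<in> W \<Longrightarrow> y \<in> W \<Longrightarrow> c *\<^sub>R x + y \<in> W"
  shows "subspace W"
  unfolding subspace_def
proof (intro conjI ballI allI)
  show "x + y \<in> W" if "x \<in> W" "y \<in> W" for x y using assms(2)[OF that, of 1] by simp
  show "c *\<^sub>R x \<in> W" if "x \<in> W" for c x using assms(2)[OF that assms(1), of c] by simp
qed (rule assms)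

lemma U1_comb: "k \<ge> 1 \<Longrightarrow> E \<in> U1 k \<Longrightarrow> E' \<in> U1 k \<Longrightarrow> c *\<^sub>R E + E' \<in> U1 k"
  using subspace_U1 subspace_add subspace_scale by blast

lemma U1_0: "k \<ge> 1 \<Longrightarrow> 0 \<in> U1 k"
  using subspace_U1 subspace_0 by blast

lemma edge_trace_comb: "edge_trace (c *\<^sub>R E + E') e \<sigma> = c * edge_trace E e \<sigma> + edge_trace E' e \<sigma>"
  by (simp add: edge_trace_def inner_add_left)

lemma edge_trace_0: "edge_trace 0 e \<sigma> = 0"
  by (simp add: edge_trace_def)

lemma tri_trace_zero_comb: "tri_trace_zero E T \<Longrightarrow> tri_trace_zero E' T \<Longrightarrow> tri_trace_zero (c *\<^sub>R E + E') T"
  unfolding tri_trace_zero_def by (simp add: inner_add_left)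

lemma tri_trace_zero_0: "tri_trace_zero 0 T"
  by (simp add: tri_trace_zero_def)

lemma base_trace_zero_comb: "base_trace_zero E \<Longrightarrow> base_trace_zero E' \<Longrightarrow> base_trace_zero (c *\<^sub>R E + E')"
  unfolding base_trace_zero_def by simp

lemma base_trace_zero_0: "base_trace_zero 0"
  by (simp add: base_trace_zero_def)

lemma edge_traces_zero_comb: "edge_traces_zero E \<Longrightarrow> edge_traces_zero E' \<Longrightarrow> edge_traces_zero (c *\<^sub>R E + E')"
  unfolding edge_traces_zero_def edge_trace_comb by simp

lemma edge_traces_zero_0: "edge_traces_zero 0"
  by (simp add: edge_traces_zero_def edge_trace_0)

lemma zero_traces:
  assumes k: "k \<ge> 1"
    and side: "\<And>b s w z. s \<in> {0,1} \<Longrightarrow> (if b then N1 else N2) (face_point b w s z) = 0 \<and> N3 (face_point b w s z) = 0"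
    and base: "\<And>x y. N1 (vector [x,y,0]) = 0 \<and> N2 (vector [x,y,0]) = 0"
  shows "edge_traces_zero (pushf (rfield k N1 N2 N3))" "T \<in> tri_faces \<Longrightarrow> tri_trace_zero (pushf (rfield k N1 N2 N3)) T" "base_trace_zero (pushf (rfield k N1 N2 N3))"
proof -
  let ?E = "pushf (rfield k N1 N2 N3)"
  have e1: "edge_trace ?E (base_edge b s) \<sigma> = 0" if s: "s \<in> {0,1}" and \<sigma>: "0 \<le> \<sigma>" "\<sigma> < 1" for b s \<sigma>
    unfolding edge_trace_base_edge[OF s \<sigma>(1) less_imp_le[OF \<sigma>(2)]] by (rule conjunct1[OF side[OF s]])
  have e2: "edge_trace ?E (vert_edge s1 s2) \<sigma> = 0" if s: "s1 \<in> {0,1}" "s2 \<in> {0,1}" and \<sigma>: "0 \<le> \<sigma>" "\<sigma> < 1" for s1 s2 \<sigma>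
  proof -
    have "N3 (face_point True s1 s2 z) = 0" for z by (rule conjunct2[OF side[OF s(2)]])
    then show ?thesis unfolding edge_trace_vert_edge[OF s \<sigma> k] by (simp add: face_point_def)
  qed
  show "edge_traces_zero ?E"
    unfolding edge_traces_zero_def
  proof (intro ballI allI impI)
    fix e and \<sigma> :: real assume e: "e \<in> edges" and \<sigma>: "0 \<le> \<sigma>" "\<sigma> < 1"
    consider b s where "s \<in> {0,1}" "e = base_edge b s" | s1 s2 where "s1 \<in> {0,1}" "s2 \<in> {0,1}" "e = vert_edge s1 s2"
      using e unfolding edges_iff by blast
    then show "edge_trace ?E e \<sigma> = 0"
    proof cases
      case 1
      show ?thesis unfolding 1(2) by (rule e1[OF 1(1) \<sigma>])
    next
      case 2
      show ?thesis unfolding 2(3) by (rule e2[OF 2(1,2) \<sigma>])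
    qed
  qed
  show "tri_trace_zero ?E T" if T: "T \<in> tri_faces"
  proof -
    obtain b s where T': "s \<in> {0,1}" "T = tri_face b s" using T unfolding tri_faces_iff by blast
    show ?thesis
      unfolding T'(2) tri_trace_zero_def tri_face_sides using face_components[OF T'(1) _ _ k refl refl, of _ N1 N2 N3 b] side[OF T'(1), of b] by simp
  qed
  show "base_trace_zero ?E"
    unfolding base_trace_zero_def
  proof (intro ballI)
    fix \<sigma> assume s: "\<sigma> \<in> ref_square"
    show "?E (base_point \<sigma>) $ 1 = 0 \<and> ?E (base_point \<sigma>) $ 2 = 0"
      unfolding base_components[OF s] unfolding base_point_def by (rule base)
  qed
qed

lemma bubble_grad_traces:
  assumes k: "k \<ge> 1"
  shows "edge_traces_zero (bubble_grad k H)" "T \<in> tri_faces \<Longrightarrow> tri_trace_zero (bubble_grad k H) T" "base_trace_zero (bubble_grad k H)"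
proof -
  have s: "(if b then gnum1 (bubble H) else gnum2 (bubble H)) (face_point b w s z) = 0 \<and> gnum3 k (bubble H) (face_point b w s z) = 0"
    if "s \<in> {0,1}" for b s w z
    using that by (cases b) (auto simp: gnum1_def gnum2_def gnum3_def D_bubble_face bubble_def)
  have b: "gnum1 (bubble H) (vector [x,y,0]) = 0 \<and> gnum2 (bubble H) (vector [x,y,0]) = 0" for x y
    by (simp add: gnum1_def gnum2_def D_bubble_face)
  show "edge_traces_zero (bubble_grad k H)" "T \<in> tri_faces \<Longrightarrow> tri_trace_zero (bubble_grad k H) T" "base_trace_zero (bubble_grad k H)"
    unfolding bubble_grad_def by (rule zero_traces[OF k s b]; assumption)+
qed

lemma U1_zero_curl_traces:
  assumes k: "k \<ge> 1" and v: "v \<in> U1_zero_curl k"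
  shows "v \<in> U1 k" "edge_traces_zero v" "T \<in> tri_faces \<Longrightarrow> tri_trace_zero v T" "base_trace_zero v"
proof -
  obtain q1 q2 \<rho> where q: "v_spaces k q1 q2 \<rho>" "v = pushf (rfield k (vnum1 q1) (vnum2 q2) (vnum3 \<rho>))"
    using v unfolding U1_zero_curl_iff by blast
  have s: "(if b then vnum1 q1 else vnum2 q2) (face_point b w s z) = 0 \<and> vnum3 \<rho> (face_point b w s z) = 0"
    if "s \<in> {0,1}" for b s w z
    using that by (cases b) (auto simp: vnum1_def vnum2_def vnum3_def)
  have b: "vnum1 q1 (vector [x,y,0]) = 0 \<and> vnum2 q2 (vector [x,y,0]) = 0" for x y
    by (simp add: vnum1_def vnum2_def)
  show "v \<in> U1 k" using U_num_v[OF q(1) k] U1_iff[OF k] q(2) by blast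
  show "edge_traces_zero v" "T \<in> tri_faces \<Longrightarrow> tri_trace_zero v T" "base_trace_zero v"
    unfolding q(2) by (rule zero_traces[OF k s b]; assumption)+
qed

section \<open>Surjectivity of the degrees of freedom\<close>

lemma basis_span: "is_basis B T \<Longrightarrow> independent B \<and> span B = T"
  by (simp add: is_basis_def)

lemma basis_mem: "is_basis B T \<Longrightarrow> q \<in> B \<Longrightarrow> q \<in> T"
  using basis_span span_base by blast

text \<open>The pairing is restricted to fields with zero trace on all other edges, so that
  solutions for different edges add without interference. Nondegeneracy comes from lifting the test
  function itself.\<close>

lemma edge_group:
  assumes k: "k \<ge> 1" and e: "e \<in> edges" and t: "unit_tangent e t" and B: "is_basis B (edge_space k e)"
  shows "\<exists>w\<in>{E \<in> U1 k. \<forall>e'\<in>edges - {e}. \<forall>\<sigma>. 0 \<le> \<sigma> \<longrightarrow> \<sigma> < 1 \<longrightarrow> edge_trace E e' \<sigma> = 0}. \<forall>q\<in>B. edge_dof e t q w = c q"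
    (is "\<exists>w\<in>?W. _")
proof (rule dual_lift[where T = "edge_space k e"])
  show "finite B" using finite_dim_basis[OF B] finite_dim_Ppoly_on unfolding edge_space_def by blast
  show "independent B" "span B = edge_space k e" using basis_span[OF B] by blast+
  show "subspace ?W"
    by (rule subspace_combI) (use k U1_0 U1_comb in \<open>auto simp: edge_trace_comb edge_trace_0\<close>)
  fix q assume q: "q \<in> edge_space k e"
  show "edge_dof e t (d *\<^sub>R q + q') w = d * edge_dof e t q w + edge_dof e t q' w" if "q' \<in> edge_space k e" "w \<in> ?W" for d q' w
    using edge_dof_lin(2)[OF reg_U1 e q] that k by blast
  show "edge_dof e t q (d *\<^sub>R w + w') = d * edge_dof e t q w + edge_dof e t q w'" if "w \<in> ?W" "w' \<in> ?W" for d w w'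
    using edge_dof_lin(1)[OF reg_U1 e reg_U1 q] that k by blast
  assume 0: "\<And>w. w \<in> ?W \<Longrightarrow> edge_dof e t q w = 0"
  obtain d where d: "t = d *\<^sub>R (snd e - fst e)" "d \<noteq> 0" using unit_tangentD[OF t] by blast
  obtain p where p: "p \<in> Poly1 (int k - 1)" "\<forall>\<sigma>\<in>{0..1}. q (edge_point e \<sigma>) = p \<sigma>"
    using edge_test_poly[OF q] by blast
  obtain E where E: "E \<in> U1 k" "\<forall>\<sigma>. 0 \<le> \<sigma> \<longrightarrow> \<sigma> < 1 \<longrightarrow> edge_trace E e \<sigma> = 1 / d * p \<sigma>"
    "\<forall>e'\<in>edges - {e}. \<forall>\<sigma>. 0 \<le> \<sigma> \<longrightarrow> \<sigma> < 1 \<longrightarrow> edge_trace E e' \<sigma> = 0"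
    using edge_lift[OF e Poly1_cmult[OF p(1), of "1 / d"] k] by blast
  have E0: "edge_dof e t q E = 0" by (rule 0) (use E in blast)
  have "p \<sigma> = 0" for \<sigma>
    by (rule edge_dof_definite[OF reg_U1[OF E(1) k] e d q p(1) _ E0]) (use E(2) p(2) in simp)
  then show "q = 0" by (intro edge_space_eq_zero[OF q]) (use p(2) in simp)
qed

lemma tri_space_off: "q \<in> tri_space k \<nu> T \<Longrightarrow> p \<notin> tri_set T \<Longrightarrow> q p = 0"
proof -
  assume q: "q \<in> tri_space k \<nu> T" and p: "p \<notin> tri_set T"
  have "q p $ i = 0" for i
  proof -
    have "(\<lambda>p. q p $ i) \<in> Ppoly_on (tri_set T) (int k - 2)" using q unfolding tri_space_def by blast
    then obtain f where "(\<lambda>p. q p $ i) = restr (tri_set T) f" unfolding Ppoly_on_def by blast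
    from fun_cong[OF this, of p] show ?thesis using p by (simp add: restr_def)
  qed
  then show "q p = 0" by (simp add: pt_eq_iff)
qed

text \<open>For nondegeneracy the components of a test field are taken as bubble cofactors; the
  lifted field pairs with the test field to a definite integral.\<close>

lemma tri_group:
  assumes k: "k \<ge> 1" and s: "s \<in> {0,1}" and n: "unit_normal (tri_set (tri_face b s)) (\<nu> (tri_set (tri_face b s)))"
    and B: "is_basis B (tri_space k \<nu> (tri_face b s))"
  shows "\<exists>w\<in>{E \<in> U1 k. edge_traces_zero E \<and> (\<forall>T\<in>tri_faces - {tri_face b s}. tri_trace_zero E T)}. \<forall>q\<in>B. tri_dof (tri_face b s) q w = c q"
    (is "\<exists>w\<in>?W. _")
proof (rule dual_lift[where T = "tri_space k \<nu> (tri_face b s)"])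
  show "finite B" using finite_dim_basis[OF B finite_dim_tri_space] .
  show "independent B" "span B = tri_space k \<nu> (tri_face b s)" using basis_span[OF B] by blast+
  show "subspace ?W"
    by (rule subspace_combI) (use k U1_0 U1_comb in \<open>auto simp: edge_traces_zero_comb edge_traces_zero_0 tri_trace_zero_comb tri_trace_zero_0\<close>)
  fix q assume q: "q \<in> tri_space k \<nu> (tri_face b s)"
  show "tri_dof (tri_face b s) (d *\<^sub>R q + q') w = d * tri_dof (tri_face b s) q w + tri_dof (tri_face b s) q' w"
    if "q' \<in> tri_space k \<nu> (tri_face b s)" "w \<in> ?W" for d q' w
    using tri_dof_lin(2)[OF reg_U1 s q that(1)] that k by blast
  show "tri_dof (tri_face b s) q (d *\<^sub>R w + w') = d * tri_dof (tri_face b s) q w + tri_dof (tri_face b s) q w'" if "w \<in> ?W" "w' \<in> ?W" for d w w'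
    using tri_dof_lin(1)[OF reg_U1 s reg_U1 q] that k by blast
  assume 0: "\<And>w. w \<in> ?W \<Longrightarrow> tri_dof (tri_face b s) q w = 0"
  obtain \<alpha> \<beta> where ab: "\<alpha> \<in> Ppoly2 (int k - 2)" "\<beta> \<in> Ppoly2 (int k - 2)"
    "\<forall>\<sigma>\<in>ref_triangle. q (tri_point (tri_face b s) \<sigma>) = \<alpha> (fst \<sigma>) (snd \<sigma>) *\<^sub>R axis (ix b) 1 + \<beta> (fst \<sigma>) (snd \<sigma>) *\<^sub>R face_point b 0 (- s) 1"
    using tri_test_decomp[OF q n] by blast
  obtain E where E: "E \<in> U1 k" "\<forall>e\<in>edges. \<forall>\<sigma>. 0 \<le> \<sigma> \<longrightarrow> \<sigma> < 1 \<longrightarrow> edge_trace E e \<sigma> = 0" "\<forall>T\<in>tri_faces - {tri_face b s}. tri_trace_zero E T"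
    and EF: "\<forall>\<sigma>\<in>ref_triangle. snd \<sigma> < 1 \<longrightarrow>
      E (tri_point (tri_face b s) \<sigma>) \<bullet> axis (ix b) 1 = snd \<sigma> * ((1 - snd \<sigma>) * \<alpha> (fst \<sigma>) (snd \<sigma>) + fst \<sigma> * \<beta> (fst \<sigma>) (snd \<sigma>)) \<and>
      E (tri_point (tri_face b s) \<sigma>) \<bullet> face_point b 0 (- s) 1 = fst \<sigma> * (snd \<sigma> * \<alpha> (fst \<sigma>) (snd \<sigma>) + (1 - fst \<sigma>) * \<beta> (fst \<sigma>) (snd \<sigma>))"
    using tri_lift_exists[OF ab(1,2) k s, of b] by blast
  have E0: "tri_dof (tri_face b s) q E = 0" by (rule 0) (use E edge_traces_zero_def in blast)
  have z: "\<alpha> x y = 0 \<and> \<beta> x y = 0" for x y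
    using tri_dof_definite[OF s reg_U1[OF E(1) k] q ab(1,2) _ _ _ E0, of x y] EF ab(3) interior_ref_triangleD by blast
  have "q p = 0" for p
  proof (cases "p \<in> tri_set (tri_face b s)")
    case True
    then obtain \<sigma> where "\<sigma> \<in> ref_triangle" "p = tri_point (tri_face b s) \<sigma>" unfolding tri_set_tri_point by blast
    then show ?thesis using ab(3) z by simp
  qed (rule tri_space_off[OF q])
  then show "q = 0" by (simp add: fun_eq_iff)
qed

lemma base_group:
  assumes k: "k \<ge> 1" and n: "unit_normal base n" and B: "is_basis B (base_space k)"
  shows "\<exists>w\<in>{E \<in> U1 k. edge_traces_zero E \<and> (\<forall>T\<in>tri_faces. tri_trace_zero E T)}. \<forall>q\<in>B. base_dof n q w = c q"
    (is "\<exists>w\<in>?W. _")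
proof (rule dual_lift[where T = "base_space k"])
  show "finite B" using finite_dim_basis[OF B finite_dim_base_space] .
  show "independent B" "span B = base_space k" using basis_span[OF B] by blast+
  show "subspace ?W"
    by (rule subspace_combI) (use k U1_0 U1_comb in \<open>auto simp: edge_traces_zero_comb edge_traces_zero_0 tri_trace_zero_comb tri_trace_zero_0\<close>)
  fix q assume q: "q \<in> base_space k"
  show "base_dof n (d *\<^sub>R q + q') w = d * base_dof n q w + base_dof n q' w" if "q' \<in> base_space k" "w \<in> ?W" for d q' w
    using base_dof_lin(2)[OF reg_U1 q that(1)] that k by blast
  show "base_dof n q (d *\<^sub>R w + w') = d * base_dof n q w + base_dof n q w'" if "w \<in> ?W" "w' \<in> ?W" for d w w'
    using base_dof_lin(1)[OF reg_U1 reg_U1 q] that k by blast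
  assume 0: "\<And>w. w \<in> ?W \<Longrightarrow> base_dof n q w = 0"
  obtain q1 q2 where qq: "q1 \<in> Qpoly2 (int k - 2) (int k - 1)" "q2 \<in> Qpoly2 (int k - 1) (int k - 2)"
    "q = restr base (\<lambda>p. vector [q1 (p$1) (p$2), q2 (p$1) (p$2), 0])"
    using q unfolding base_space_def by blast
  \<comment> \<open>The components of \<open>cross3 n q\<close>, with which the base functional
    pairs the field.\<close>
  define g1 g2 where "g1 = (\<lambda>x y. (- n$3) * q2 x y)" and "g2 = (\<lambda>x y. n$3 * q1 x y)"
  have g: "g1 \<in> Qpoly2 (int k - 1) (int k - 2)" "g2 \<in> Qpoly2 (int k - 2) (int k - 1)"
    unfolding g1_def g2_def by (rule Qpoly2_cmult[OF qq(2)] Qpoly2_cmult[OF qq(1)])+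
  obtain E where E: "E \<in> U1 k" "\<forall>e\<in>edges. \<forall>\<sigma>. 0 \<le> \<sigma> \<longrightarrow> \<sigma> < 1 \<longrightarrow> edge_trace E e \<sigma> = 0" "\<forall>T\<in>tri_faces. tri_trace_zero E T"
    and EF: "\<forall>\<sigma>\<in>ref_square. E (base_point \<sigma>) $ 1 = snd \<sigma> * (1 - snd \<sigma>) * g1 (fst \<sigma>) (snd \<sigma>) \<and> E (base_point \<sigma>) $ 2 = fst \<sigma> * (1 - fst \<sigma>) * g2 (fst \<sigma>) (snd \<sigma>)"
    using base_lift_exists[OF g k] by blast
  have E0: "base_dof n q E = 0" by (rule 0) (use E edge_traces_zero_def in blast)
  have e: "E (base_point (x,y)) $ 1 = y * (1 - y) * g1 x y \<and> E (base_point (x,y)) $ 2 = x * (1 - x) * g2 x y \<and>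
      cross3 n (q (base_point (x,y))) = vector [g1 x y, g2 x y, 0]"
    if "0 < x" "x < 1" "0 < y" "y < 1" for x y
  proof -
    have xy: "(x, y) \<in> ref_square" using that by (auto simp: ref_square_def)
    have "q (base_point (x,y)) = vector [q1 x y, q2 x y, 0]"
      using base_point_mem(2)[OF xy] by (simp add: qq(3) restr_def) (simp add: base_point_def)
    then have "cross3 n (q (base_point (x,y))) = vector [g1 x y, g2 x y, 0]"
      by (simp add: cross3_def unit_normal_base[OF n] g1_def g2_def)
    then show ?thesis using bspec[OF EF xy] by simp
  qed
  have "g1 x y = 0 \<and> g2 x y = 0" for x y
    using base_dof_definite[OF reg_U1[OF E(1) k] q g e E0] by blast
  moreover have "n$3 \<noteq> 0" using unit_normal_base(3)[OF n] by auto
  ultimately have "q1 x y = 0" "q2 x y = 0" for x y by (simp_all add: g1_def g2_def)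
  then show "q = 0" by (simp add: fun_eq_iff qq(3) restr_def pt_eq_iff)
qed

lemma curl_0:
  assumes "p \<in> interior pyramid"
  shows "curl 0 p = 0"
proof -
  have "reg 0" using reg_U1[OF U1_0, of 1] by simp
  from curl_lin[OF this this assms, of 1] show ?thesis by simp
qed

text \<open>Test space and trial space coincide. If \<open>v\<close> is annihilated, so is
  \<open>v\<close> paired with itself; hence \<open>curl v\<close> is \<open>0\<close>, and
  \<open>v_curl_zero\<close> applies.\<close>

lemma curl_group:
  assumes k: "k \<ge> 1" and B: "is_basis B (U1_zero_curl k)"
  shows "\<exists>w\<in>U1_zero_curl k. \<forall>v\<in>B. curl_dof v w = c v"
proof (rule dual_lift[where T = "U1_zero_curl k"])
  have r: "reg v" if "v \<in> U1_zero_curl k" for v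
    using reg_U1[OF U1_zero_curl_traces(1)[OF k that] k] .
  show "finite B" using finite_dim_basis[OF B finite_dim_U1_zero_curl] .
  show "independent B" "span B = U1_zero_curl k" using basis_span[OF B] by blast+
  then show "subspace (U1_zero_curl k)" using subspace_span by metis
  fix v assume v: "v \<in> U1_zero_curl k"
  show "curl_dof (d *\<^sub>R v + v') w = d * curl_dof v w + curl_dof v' w" if "v' \<in> U1_zero_curl k" "w \<in> U1_zero_curl k" for d v' w
    by (rule curl_dof_lin(2)[OF r[OF that(2)] r[OF v] r[OF that(1)]])
  show "curl_dof v (d *\<^sub>R w + w') = d * curl_dof v w + curl_dof v w'" if "w \<in> U1_zero_curl k" "w' \<in> U1_zero_curl k" for d w w'
    by (rule curl_dof_lin(1)[OF r[OF that(1)] r[OF v] r[OF that(2)]])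
  assume "\<And>w. w \<in> U1_zero_curl k \<Longrightarrow> curl_dof v w = 0"
  then have "curl_dof v v = 0" using v by blast
  then have "curl v p \<bullet> curl v p = 0" if "p \<in> interior pyramid" for p
    using pair_nonneg_zero[OF convex_pyramid bounded_pyramid reg_curl_nice[OF r[OF v]] reg_curl_nice[OF r[OF v]] _ _ that]
    by (simp add: curl_dof_pair)
  then have z: "curl v p = 0" if "p \<in> interior pyramid" for p using that by simp
  obtain q1 q2 \<rho> where q: "v_spaces k q1 q2 \<rho>" "v = pushf (rfield k (vnum1 q1) (vnum2 q2) (vnum3 \<rho>))"
    using v unfolding U1_zero_curl_iff by blast
  show "v = 0" unfolding q(2) by (rule v_curl_zero[OF q(1) k z[unfolded q(2)]])
qed

text \<open>A bubble form is paired with its own gradient. The fields are also required to be free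
  of curl, so that this group can be solved after the curl group.\<close>

lemma grad_group:
  assumes k: "k \<ge> 1" and B: "is_basis B (U0_zero k)"
  shows "\<exists>w\<in>{E \<in> U1 k. edge_traces_zero E \<and> (\<forall>T\<in>tri_faces. tri_trace_zero E T) \<and> base_trace_zero E \<and> (\<forall>p\<in>interior pyramid. curl E p = 0)}. \<forall>q\<in>B. grad_dof q w = c q"
    (is "\<exists>w\<in>?W. _")
proof (rule dual_lift[where T = "U0_zero k"])
  show "finite B" using finite_dim_basis[OF B finite_dim_U0_zero[OF k]] .
  show "independent B" "span B = U0_zero k" using basis_span[OF B] by blast+
  show "subspace ?W"
  proof (rule subspace_combI)
    show "0 \<in> ?W" using k by (simp add: U1_0 edge_traces_zero_0 tri_trace_zero_0 base_trace_zero_0 curl_0)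
    fix d x y assume xy: "x \<in> ?W" "y \<in> ?W"
    then have "curl (d *\<^sub>R x + y) p = 0" if "p \<in> interior pyramid" for p
      using curl_lin[of x y p d] reg_U1[of x k] reg_U1[of y k] that k by simp
    then show "d *\<^sub>R x + y \<in> ?W"
      using k xy by (simp add: U1_comb edge_traces_zero_comb tri_trace_zero_comb base_trace_zero_comb)
  qed
  fix q assume q: "q \<in> U0_zero k"
  show "grad_dof (d *\<^sub>R q + q') w = d * grad_dof q w + grad_dof q' w" if "q' \<in> U0_zero k" "w \<in> ?W" for d q' w
    using grad_dof_lin(2)[OF reg_U1 k q that(1)] that k by blast
  show "grad_dof q (d *\<^sub>R w + w') = d * grad_dof q w + grad_dof q w'" if "w \<in> ?W" "w' \<in> ?W" for d w w'
    using grad_dof_lin(1)[OF reg_U1 k q reg_U1] that k by blast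
  assume 0: "\<And>w. w \<in> ?W \<Longrightarrow> grad_dof q w = 0"
  obtain H where H: "H \<in> Qpoly (int k - 2) (int k - 2) (int k - 2)" "q = bubble_form k H" "\<forall>p\<in>interior pyramid. grad q p = bubble_grad k H p"
    using U0_zero_grad[OF q k] by blast
  have "bubble_grad k H \<in> ?W"
    using bubble_grad_U1[OF H(1) k] bubble_grad_traces[OF k] curl_bubble_grad[OF H(1) k] by blast
  from 0[OF this] have "grad_dof q (bubble_grad k H) = 0" .
  then have "bubble_grad k H p \<bullet> grad q p = 0" if "p \<in> interior pyramid" for p
    using pair_nonneg_zero[OF convex_pyramid bounded_pyramid reg_nice[OF reg_U1[OF bubble_grad_U1[OF H(1) k] k]] nice_grad[OF q k] _ _ that] H(3)
    by (simp add: grad_dof_pair)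
  then have "bubble_grad k H p = 0" if "p \<in> interior pyramid" for p using that H(3) by simp
  then show "q = 0" unfolding H(2) by (rule bubble_grad_zero(2)[OF H(1) k])
qed

section \<open>Solving the groups of functionals one after the other\<close>

lemma valid_choiceD:
  assumes "valid_choice k C"
  shows "e \<in> edges \<Longrightarrow> unit_tangent e (tangent C e)" "F \<in> faces \<Longrightarrow> unit_normal F (normal C F)"
    "e \<in> edges \<Longrightarrow> is_basis (edge_basis C e) (edge_space k e)"
    "T \<in> tri_faces \<Longrightarrow> is_basis (tri_basis C T) (tri_space k (normal C) T)"
    "is_basis (base_basis C) (base_space k)" "is_basis (grad_basis C) (U0_zero k)" "is_basis (curl_basis C) (U1_zero_curl k)"
  using assms unfolding valid_choice_def by blast+

lemma tri_normal:
  assumes "valid_choice k C" "T \<in> tri_faces"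
  shows "unit_normal (tri_set T) (normal C (tri_set T))"
  by (rule valid_choiceD(2)[OF assms(1)]) (use assms(2) in \<open>simp add: faces_def\<close>)

lemma base_normal: "valid_choice k C \<Longrightarrow> unit_normal base (normal C base)"
  by (rule valid_choiceD(2)) (simp_all add: faces_def)

lemma tri_face_mem: "s \<in> {0,1} \<Longrightarrow> tri_face b s \<in> tri_faces"
  unfolding tri_faces_iff by blast

lemma dof_comb:
  assumes k: "k \<ge> 1" and C: "valid_choice k C" and m: "m \<in> dofs C" and E: "E \<in> U1 k" "E' \<in> U1 k"
  shows "m (c *\<^sub>R E + E') = c * m E + m E'"
proof -
  note r = reg_U1[OF E(1) k] reg_U1[OF E(2) k]
  consider (edge) e q where "m = edge_dof e (tangent C e) q" "e \<in> edges" "q \<in> edge_basis C e"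
    | (tri) T q where "m = tri_dof T q" "T \<in> tri_faces" "q \<in> tri_basis C T"
    | (base) q where "m = base_dof (normal C base) q" "q \<in> base_basis C"
    | (grad) q where "m = grad_dof q" "q \<in> grad_basis C"
    | (curl) v where "m = curl_dof v" "v \<in> curl_basis C"
    using m unfolding dofs_def by blast
  then show ?thesis
  proof cases
    case edge
    show ?thesis unfolding edge(1)
      by (rule edge_dof_lin(1)[OF r(1) edge(2) r(2) basis_mem[OF valid_choiceD(3)[OF C edge(2)] edge(3)]])
  next
    case tri
    obtain b s where T: "s \<in> {0,1}" "T = tri_face b s" using tri(2) unfolding tri_faces_iff by blast
    note q = basis_mem[OF valid_choiceD(4)[OF C tri(2)] tri(3)]
    show ?thesis unfolding tri(1) T(2)
      by (rule tri_dof_lin(1)[OF r(1) T(1) r(2) q[unfolded T(2)]])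
  next
    case base
    show ?thesis unfolding base(1)
      by (rule base_dof_lin(1)[OF r(1) r(2) basis_mem[OF valid_choiceD(5)[OF C] base(2)]])
  next
    case grad
    show ?thesis unfolding grad(1)
      by (rule grad_dof_lin(1)[OF r(1) k basis_mem[OF valid_choiceD(6)[OF C] grad(2)] r(2)])
  next
    case curl
    have "reg v" using reg_U1[OF U1_zero_curl_traces(1)[OF k basis_mem[OF valid_choiceD(7)[OF C] curl(2)]] k] .
    then show ?thesis unfolding curl(1) by (rule curl_dof_lin(1)[OF r(1) _ r(2)])
  qed
qed

text \<open>Values are prescribed on the functionals, as in the theorem, and not on the test
  functions they come from.\<close>

definition solvable :: "('w::real_vector) set \<Rightarrow> ('w \<Rightarrow> real) set \<Rightarrow> bool"
  where "solvable U M \<longleftrightarrow> (\<forall>c. \<exists>w\<in>U. \<forall>m\<in>M. m w = c m)"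

text \<open>One step of a block triangular system: the correction \<open>w'\<close> repairs the
  values on \<open>M'\<close> and is invisible to \<open>M\<close>.\<close>

lemma solvable_extend:
  assumes U: "subspace U" and M: "solvable U M"
    and add: "\<And>m w w'. m \<in> M \<union> M' \<Longrightarrow> w \<in> U \<Longrightarrow> w' \<in> U \<Longrightarrow> m (w + w') = m w + m w'"
    and M': "\<And>c. \<exists>w\<in>U. (\<forall>m\<in>M'. m w = c m) \<and> (\<forall>m\<in>M. m w = 0)"
  shows "solvable U (M \<union> M')"
  unfolding solvable_def
proof
  fix c
  obtain w where w: "w \<in> U" "\<forall>m\<in>M. m w = c m" using M unfolding solvable_def by blast
  obtain w' where w': "w' \<in> U" "\<forall>m\<in>M'. m w' = c m - m w" "\<forall>m\<in>M. m w' = 0"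
    using M'[of "\<lambda>m. c m - m w"] by blast
  have "m (w + w') = c m" if "m \<in> M \<union> M'" for m
    using add[OF that w(1) w'(1)] that w(2) w'(2,3) by auto
  then show "\<exists>w\<in>U. \<forall>m\<in>M \<union> M'. m w = c m" using subspace_add[OF U w(1) w'(1)] by blast
qed

text \<open>For the edges, and then for the triangular faces: the groups of a family do not see each
  other's solutions, so they can be added in any order.\<close>

lemma solvable_family:
  assumes "finite I" and U: "subspace U" and M: "solvable U M"
    and "\<And>m w w'. m \<in> M \<union> (\<Union>i\<in>I. G i) \<Longrightarrow> w \<in> U \<Longrightarrow> w' \<in> U \<Longrightarrow> m (w + w') = m w + m w'"
    and "\<And>i c. i \<in> I \<Longrightarrow> \<exists>w\<in>U. (\<forall>m\<in>G i. m w = c m) \<and> (\<forall>m\<in>M. m w = 0) \<and> (\<forall>j\<in>I - {i}. \<forall>m\<in>G j. m w = 0)"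
  shows "solvable U (M \<union> (\<Union>i\<in>I. G i))"
  using assms(1,4,5)
proof (induction I)
  case empty
  then show ?case using M by simp
next
  case (insert i I)
  have "solvable U (M \<union> (\<Union>i\<in>I. G i))"
  proof (rule insert.IH)
    show "m (w + w') = m w + m w'" if "m \<in> M \<union> (\<Union>i\<in>I. G i)" "w \<in> U" "w' \<in> U" for m w w'
      by (rule insert.prems(1)) (use that in auto)
    show "\<exists>w\<in>U. (\<forall>m\<in>G j. m w = c m) \<and> (\<forall>m\<in>M. m w = 0) \<and> (\<forall>j\<in>I - {j}. \<forall>m\<in>G j. m w = 0)" if "j \<in> I" for j c
      using insert.prems(2)[of j c] that by blast
  qed
  then have "solvable U ((M \<union> (\<Union>i\<in>I. G i)) \<union> G i)"
  proof (rule solvable_extend[OF U])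
    show "m (w + w') = m w + m w'" if "m \<in> M \<union> (\<Union>i\<in>I. G i) \<union> G i" "w \<in> U" "w' \<in> U" for m w w'
      by (rule insert.prems(1)) (use that in auto)
    show "\<exists>w\<in>U. (\<forall>m\<in>G i. m w = c m) \<and> (\<forall>m\<in>M \<union> (\<Union>i\<in>I. G i). m w = 0)" for c
    proof -
      obtain w where w: "w \<in> U" "\<forall>m\<in>G i. m w = c m" "\<forall>m\<in>M. m w = 0" "\<forall>j\<in>insert i I - {i}. \<forall>m\<in>G j. m w = 0"
        using insert.prems(2)[of i c] by blast
      moreover have "m w = 0" if "j \<in> I" "m \<in> G j" for j m
        using w(4) that insert.hyps(2) by blast
      ultimately show ?thesis by (intro bexI[OF _ w(1)]) blast
    qed
  qed
  then show ?case by (simp add: Un_ac)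
qed

text \<open>Each group is solved by fields on which all earlier groups vanish. The curl group
  precedes the gradient group because the corrections in the latter are free of curl; the gradient
  moments of the rotational bubbles are corrected last.\<close>

lemma dofs_solvable:
  assumes k: "k \<ge> 1" and C: "valid_choice k C"
  shows "solvable (U1 k) (dofs C)"
proof -
  define ME where "ME e = edge_dof e (tangent C e) ` edge_basis C e" for e
  define MT where "MT T = tri_dof T ` tri_basis C T" for T
  define MB where "MB = base_dof (normal C base) ` base_basis C"
  define MG where "MG = grad_dof ` grad_basis C"
  define MC where "MC = curl_dof ` curl_basis C"
  \<comment> \<open>The empty set fits the shape of \<open>solvable_family\<close>, started from no
    functionals.\<close>
  let ?E = "{} \<union> (\<Union>e\<in>edges. ME e)"
  let ?T = "?E \<union> (\<Union>T\<in>tri_faces. MT T)"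
  have dofs: "dofs C = ?T \<union> MB \<union> MC \<union> MG"
    unfolding dofs_def ME_def MT_def MB_def MG_def MC_def by blast
  have add: "m (w + w') = m w + m w'" if "m \<in> ?T \<union> MB \<union> MC \<union> MG" "w \<in> U1 k" "w' \<in> U1 k" for m w w'
    using dof_comb[OF k C that(1)[folded dofs] that(2,3), of 1] by simp
  note U = subspace_U1[OF k]
  have e0: "m w = 0" if w: "w \<in> U1 k" and e: "e \<in> edges" and z: "\<And>\<sigma>. 0 \<le> \<sigma> \<Longrightarrow> \<sigma> < 1 \<Longrightarrow> edge_trace w e \<sigma> = 0"
    and m: "m \<in> ME e" for m w e
  proof -
    obtain q where q: "q \<in> edge_basis C e" "m = edge_dof e (tangent C e) q" using m unfolding ME_def by blast
    show ?thesis unfolding q(2)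
      by (rule edge_dof_zero[OF reg_U1[OF w k] e valid_choiceD(1)[OF C e] basis_mem[OF valid_choiceD(3)[OF C e] q(1)] z]) auto
  qed
  have E0: "\<forall>m\<in>?E. m w = 0" if w: "w \<in> U1 k" "edge_traces_zero w" for w
  proof
    fix m assume "m \<in> ?E"
    then obtain e where e: "e \<in> edges" "m \<in> ME e" by blast
    show "m w = 0" by (rule e0[OF w(1) e(1) _ e(2)]) (use w(2) e(1) in \<open>simp add: edge_traces_zero_def\<close>)
  qed
  have t0: "m w = 0" if w: "w \<in> U1 k" and T: "T \<in> tri_faces" and z: "tri_trace_zero w T" and m: "m \<in> MT T" for m w T
  proof -
    obtain q where q: "q \<in> tri_basis C T" "m = tri_dof T q" using m unfolding MT_def by blast
    obtain b s where T': "s \<in> {0,1}" "T = tri_face b s" using T unfolding tri_faces_iff by blast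
    note qT = basis_mem[OF valid_choiceD(4)[OF C T] q(1)]
    show ?thesis unfolding q(2) T'(2)
      by (rule tri_dof_zero[OF reg_U1[OF w k] T'(1) qT[unfolded T'(2)] tri_normal[OF C T, unfolded T'(2)] z[unfolded T'(2)]])
  qed
  have T0: "\<forall>m\<in>?T. m w = 0" if w: "w \<in> U1 k" "edge_traces_zero w" "\<forall>T\<in>tri_faces. tri_trace_zero w T" for w
    using E0[OF w(1,2)] t0[OF w(1)] w(3) by blast
  have B0: "\<forall>m\<in>MB. m w = 0" if w: "w \<in> U1 k" "base_trace_zero w" for w
    using base_dof_zero[OF reg_U1[OF w(1) k] basis_mem[OF valid_choiceD(5)[OF C]] base_normal[OF C] w(2)]
    unfolding MB_def by blast
  have C0: "\<forall>m\<in>MC. m w = 0" if w: "w \<in> U1 k" "\<forall>p\<in>interior pyramid. curl w p = 0" for w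
  proof
    fix m assume "m \<in> MC"
    then obtain v where v: "v \<in> curl_basis C" "m = curl_dof v" unfolding MC_def by blast
    have r: "reg v" using reg_U1[OF U1_zero_curl_traces(1)[OF k basis_mem[OF valid_choiceD(7)[OF C] v(1)]] k] .
    show "m w = 0" unfolding v(2) curl_dof_pair
      by (rule pair_zero[OF convex_pyramid bounded_pyramid reg_curl_nice[OF reg_U1[OF w(1) k]] reg_curl_nice[OF r]]) (use w(2) in simp)
  qed
  have sE: "solvable (U1 k) ?E"
  proof (rule solvable_family[OF _ U])
    show "finite edges" by (simp add: edges_def)
    show "solvable (U1 k) {}" unfolding solvable_def using U1_0[OF k] by blast
    show "m (w + w') = m w + m w'" if "m \<in> ?E" "w \<in> U1 k" "w' \<in> U1 k" for m w w'
      by (rule add[OF _ that(2,3)]) (use that(1) in blast)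
    fix e c assume e: "e \<in> edges"
    obtain w where w: "w \<in> U1 k" "\<forall>e'\<in>edges - {e}. \<forall>\<sigma>. 0 \<le> \<sigma> \<longrightarrow> \<sigma> < 1 \<longrightarrow> edge_trace w e' \<sigma> = 0"
      "\<forall>q\<in>edge_basis C e. edge_dof e (tangent C e) q w = c (edge_dof e (tangent C e) q)"
      using edge_group[OF k e valid_choiceD(1)[OF C e] valid_choiceD(3)[OF C e], of "\<lambda>q. c (edge_dof e (tangent C e) q)"] by blast
    show "\<exists>w\<in>U1 k. (\<forall>m\<in>ME e. m w = c m) \<and> (\<forall>m\<in>{}. m w = 0) \<and> (\<forall>j\<in>edges - {e}. \<forall>m\<in>ME j. m w = 0)"
    proof (intro bexI[OF _ w(1)] conjI ballI)
      show "m w = c m" if "m \<in> ME e" for m using w(3) that unfolding ME_def by blast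
      show "m w = 0" if e': "e' \<in> edges - {e}" and m: "m \<in> ME e'" for e' m
        by (rule e0[OF w(1) _ _ m]) (use w(2) e' in auto)
    qed simp
  qed
  have sT: "solvable (U1 k) ?T"
  proof (rule solvable_family[OF _ U sE])
    show "finite tri_faces" by (simp add: tri_faces_def)
    show "m (w + w') = m w + m w'" if "m \<in> ?T" "w \<in> U1 k" "w' \<in> U1 k" for m w w'
      by (rule add[OF _ that(2,3)]) (use that(1) in blast)
    fix T c assume T: "T \<in> tri_faces"
    obtain b s where T': "s \<in> {0,1}" "T = tri_face b s" using T unfolding tri_faces_iff by blast
    obtain w where w: "w \<in> U1 k" "edge_traces_zero w" "\<forall>T'\<in>tri_faces - {T}. tri_trace_zero w T'"
      "\<forall>q\<in>tri_basis C T. tri_dof T q w = c (tri_dof T q)"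
      using tri_group[OF k T'(1) tri_normal[OF C T, unfolded T'(2)] valid_choiceD(4)[OF C T, unfolded T'(2)], of "\<lambda>q. c (tri_dof (tri_face b s) q)"]
      unfolding T'(2) by blast
    show "\<exists>w\<in>U1 k. (\<forall>m\<in>MT T. m w = c m) \<and> (\<forall>m\<in>?E. m w = 0) \<and> (\<forall>j\<in>tri_faces - {T}. \<forall>m\<in>MT j. m w = 0)"
    proof (intro bexI[OF _ w(1)] conjI)
      show "\<forall>m\<in>MT T. m w = c m" using w(4) unfolding MT_def by blast
      show "\<forall>m\<in>?E. m w = 0" by (rule E0[OF w(1,2)])
      show "\<forall>j\<in>tri_faces - {T}. \<forall>m\<in>MT j. m w = 0" using t0[OF w(1)] w(3) by blast
    qed
  qed
  have sB: "solvable (U1 k) (?T \<union> MB)"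
  proof (rule solvable_extend[OF U sT])
    show "m (w + w') = m w + m w'" if "m \<in> ?T \<union> MB" "w \<in> U1 k" "w' \<in> U1 k" for m w w'
      by (rule add[OF _ that(2,3)]) (use that(1) in blast)
    fix c
    obtain w where w: "w \<in> U1 k" "edge_traces_zero w" "\<forall>T\<in>tri_faces. tri_trace_zero w T"
      "\<forall>q\<in>base_basis C. base_dof (normal C base) q w = c (base_dof (normal C base) q)"
      using base_group[OF k base_normal[OF C] valid_choiceD(5)[OF C], of "\<lambda>q. c (base_dof (normal C base) q)"] by blast
    show "\<exists>w\<in>U1 k. (\<forall>m\<in>MB. m w = c m) \<and> (\<forall>m\<in>?T. m w = 0)"
    proof (intro bexI[OF _ w(1)] conjI)
      show "\<forall>m\<in>MB. m w = c m" using w(4) unfolding MB_def by blast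
      show "\<forall>m\<in>?T. m w = 0" by (rule T0[OF w(1-3)])
    qed
  qed
  have sC: "solvable (U1 k) (?T \<union> MB \<union> MC)"
  proof (rule solvable_extend[OF U sB])
    show "m (w + w') = m w + m w'" if "m \<in> ?T \<union> MB \<union> MC" "w \<in> U1 k" "w' \<in> U1 k" for m w w'
      by (rule add[OF _ that(2,3)]) (use that(1) in blast)
    fix c
    obtain w where w: "w \<in> U1_zero_curl k" "\<forall>v\<in>curl_basis C. curl_dof v w = c (curl_dof v)"
      using curl_group[OF k valid_choiceD(7)[OF C], of "\<lambda>v. c (curl_dof v)"] by blast
    note t = U1_zero_curl_traces[OF k w(1)]
    show "\<exists>w\<in>U1 k. (\<forall>m\<in>MC. m w = c m) \<and> (\<forall>m\<in>?T \<union> MB. m w = 0)"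
    proof (intro bexI[OF _ t(1)] conjI)
      show "\<forall>m\<in>MC. m w = c m" using w(2) unfolding MC_def by blast
      show "\<forall>m\<in>?T \<union> MB. m w = 0" using T0[OF t(1,2)] t(3) B0[OF t(1,4)] by blast
    qed
  qed
  show ?thesis
    unfolding dofs
  proof (rule solvable_extend[OF U sC])
    show "m (w + w') = m w + m w'" if "m \<in> ?T \<union> MB \<union> MC \<union> MG" "w \<in> U1 k" "w' \<in> U1 k" for m w w'
      by (rule add[OF that])
    fix c
    obtain w where w: "w \<in> U1 k" "edge_traces_zero w" "\<forall>T\<in>tri_faces. tri_trace_zero w T" "base_trace_zero w" "\<forall>p\<in>interior pyramid. curl w p = 0"
      "\<forall>q\<in>grad_basis C. grad_dof q w = c (grad_dof q)"
      using grad_group[OF k valid_choiceD(6)[OF C], of "\<lambda>v. c (grad_dof v)"] by blast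
    show "\<exists>w\<in>U1 k. (\<forall>m\<in>MG. m w = c m) \<and> (\<forall>m\<in>?T \<union> MB \<union> MC. m w = 0)"
    proof (intro bexI[OF _ w(1)] conjI)
      show "\<forall>m\<in>MG. m w = c m" using w(6) unfolding MG_def by blast
      show "\<forall>m\<in>?T \<union> MB \<union> MC. m w = 0" using T0[OF w(1-3)] B0[OF w(1,4)] C0[OF w(1,5)] by blast
    qed
  qed
qed

section \<open>Traces determined by the degrees of freedom\<close>

lemma edge_zero:
  assumes k: "k \<ge> 1" and C: "valid_choice k C" and U: "U_num k N1 N2 N3" and e: "e \<in> edges"
    and 0: "\<And>q. q \<in> edge_basis C e \<Longrightarrow> edge_dof e (tangent C e) q (pushf (rfield k N1 N2 N3)) = 0"
    and \<sigma>: "0 \<le> \<sigma>" "\<sigma> < 1"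
  shows "edge_trace (pushf (rfield k N1 N2 N3)) e \<sigma> = 0"
proof (rule edge_inj[OF U k e valid_choiceD(1)[OF C e] _ \<sigma>])
  have r: "reg (pushf (rfield k N1 N2 N3))" using U k reg_bar unfolding U_num_def by blast
  fix q assume q: "q \<in> edge_space k e"
  show "edge_dof e (tangent C e) q (pushf (rfield k N1 N2 N3)) = 0"
    by (rule basis_vanish[where f = "\<lambda>q. edge_dof e (tangent C e) q (pushf (rfield k N1 N2 N3))", OF valid_choiceD(3)[OF C e]],
      erule (1) edge_dof_lin(2)[OF r e], erule 0, rule q)
qed

text \<open>Edge traces are known for \<open>\<sigma> < 1\<close> only, a bound meant for the apex.
  At the end \<open>w = 1\<close> of a base edge the value follows because it is given by a
  polynomial.\<close>

lemma base_edge_zero: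
  assumes k: "k \<ge> 1" and U: "U_num k N1 N2 N3" and s: "s \<in> {0,1}"
    and 0: "\<And>\<sigma>. 0 \<le> \<sigma> \<Longrightarrow> \<sigma> < 1 \<Longrightarrow> edge_trace (pushf (rfield k N1 N2 N3)) (base_edge b s) \<sigma> = 0" and w: "w \<in> {0..1}"
  shows "(if b then N1 else N2) (face_point b w s 0) = 0"
proof -
  obtain p where p: "p \<in> Poly1 (int k - 1)" "\<forall>w\<in>{0..1}. (if b then N1 else N2) (face_point b w s 0) = p w"
    using base_edge_poly[OF U k s] by blast
  have "p w = 0"
  proof (rule Poly1_eq_zero[OF p(1)])
    fix \<sigma> :: real assume \<sigma>: "0 < \<sigma>" "\<sigma> < 1"
    have "edge_trace (pushf (rfield k N1 N2 N3)) (base_edge b s) \<sigma> = p \<sigma>"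
      unfolding edge_trace_base_edge[OF s less_imp_le[OF \<sigma>(1)] less_imp_le[OF \<sigma>(2)]] by (rule bspec[OF p(2)]) (use \<sigma> in simp)
    moreover have "edge_trace (pushf (rfield k N1 N2 N3)) (base_edge b s) \<sigma> = 0" by (rule 0) (use \<sigma> in simp_all)
    ultimately show "p \<sigma> = 0" by simp
  qed
  then show ?thesis using bspec[OF p(2) w] by simp
qed

lemma vertical_edge_zero:
  assumes k: "k \<ge> 1" and s: "s1 \<in> {0,1}" "s2 \<in> {0,1}"
    and 0: "\<And>\<sigma>. 0 \<le> \<sigma> \<Longrightarrow> \<sigma> < 1 \<Longrightarrow> edge_trace (pushf (rfield k N1 N2 N3)) (vert_edge s1 s2) \<sigma> = 0" and z: "z \<ge> 0"
  shows "N3 (vector [s1, s2, z]) = 0"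
proof -
  \<comment> \<open>The height, in the finite pyramid, of the point over \<open>(s1, s2)\<close> at
    level \<open>z\<close>.\<close>
  define \<sigma> where "\<sigma> = z / (1 + z)"
  have \<sigma>: "0 \<le> \<sigma>" "\<sigma> < 1" using z by (simp_all add: \<sigma>_def field_simps)
  have "1 - \<sigma> = 1 / (1 + z)" using z by (simp add: \<sigma>_def field_simps)
  then have "\<sigma> / (1 - \<sigma>) = z" using z by (simp add: \<sigma>_def)
  then show ?thesis using 0[OF \<sigma>] \<sigma> unfolding edge_trace_vert_edge[OF s \<sigma> k] by simp
qed

text \<open>Uses the functionals of one face and of the edges in it, as the conformity claim
  demands; unisolvence applies it to every face.\<close>

lemma face_zero:
  assumes k: "k \<ge> 1" and C: "valid_choice k C" and U: "U_num k N1 N2 N3" and s: "s \<in> {0,1}"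
    and e: "\<And>e \<sigma>. e \<in> edges \<Longrightarrow> edge_set e \<subseteq> tri_set (tri_face b s) \<Longrightarrow> 0 \<le> \<sigma> \<Longrightarrow> \<sigma> < 1 \<Longrightarrow> edge_trace (pushf (rfield k N1 N2 N3)) e \<sigma> = 0"
    and 0: "\<And>q. q \<in> tri_basis C (tri_face b s) \<Longrightarrow> tri_dof (tri_face b s) q (pushf (rfield k N1 N2 N3)) = 0"
    and wz: "w \<in> {0..1}" "z \<ge> 0"
  shows "(if b then N1 else N2) (face_point b w s z) = 0 \<and> N3 (face_point b w s z) = 0"
proof -
  have r: "reg (pushf (rfield k N1 N2 N3))" using U k reg_bar unfolding U_num_def by blast
  have sub: "edge_set (x, y) \<subseteq> tri_set (tri_face b s)" if "x \<in> {face_point b 0 s 0, face_point b 1 s 0, apex}" "y \<in> {face_point b 0 s 0, face_point b 1 s 0, apex}" for x y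
    unfolding tri_face_def tri_set.simps edge_set.simps
    by (intro closed_segment_subset convex_convex_hull hull_inc that)
  show ?thesis
  proof (rule tri_inj[where \<nu> = "normal C" and f = b, OF U k s tri_normal[OF C tri_face_mem[OF s]] _ _ _ wz])
    show "(if b then N1 else N2) (face_point b w s 0) = 0" if w: "w \<in> {0..1}" for w
    proof (rule base_edge_zero[OF k U s e w])
      show "base_edge b s \<in> edges" unfolding edges_iff using s by blast
      show "edge_set (base_edge b s) \<subseteq> tri_set (tri_face b s)" unfolding base_edge_def by (rule sub) simp_all
    qed
    show "N3 (face_point b w s z) = 0" if w: "w \<in> {0,1}" and z: "z \<ge> 0" for w z
      unfolding face_point_def
    proof (rule vertical_edge_zero[OF k _ _ e z])
      let ?e = "vert_edge (if b then w else s) (if b then s else w)"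
      show v: "(if b then w else s) \<in> {0,1}" "(if b then s else w) \<in> {0,1}" using w s by auto
      show "?e \<in> edges" unfolding edges_iff using v by blast
      have "?e = (face_point b w s 0, apex)" by (simp add: vert_edge_def face_point_def)
      then show "edge_set ?e \<subseteq> tri_set (tri_face b s)" using sub[of "face_point b w s 0" apex] w by auto
    qed
    show "tri_dof (tri_face b s) q (pushf (rfield k N1 N2 N3)) = 0" if "q \<in> tri_space k (normal C) (tri_face b s)" for q
      by (rule basis_vanish[where f = "\<lambda>q. tri_dof (tri_face b s) q (pushf (rfield k N1 N2 N3))", OF valid_choiceD(4)[OF C tri_face_mem[OF s]]],
        erule (1) tri_dof_lin(2)[OF r s], erule 0, rule that)
  qed
qed

lemma base_zero:
  assumes k: "k \<ge> 1" and C: "valid_choice k C" and U: "U_num k N1 N2 N3"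
    and e: "\<And>e \<sigma>. e \<in> edges \<Longrightarrow> edge_set e \<subseteq> base \<Longrightarrow> 0 \<le> \<sigma> \<Longrightarrow> \<sigma> < 1 \<Longrightarrow> edge_trace (pushf (rfield k N1 N2 N3)) e \<sigma> = 0"
    and 0: "\<And>q. q \<in> base_basis C \<Longrightarrow> base_dof (normal C base) q (pushf (rfield k N1 N2 N3)) = 0"
    and xy: "x \<in> {0..1}" "y \<in> {0..1}"
  shows "N1 (vector [x,y,0]) = 0 \<and> N2 (vector [x,y,0]) = 0"
proof (rule base_inj[OF U k base_normal[OF C] _ _ xy])
  have r: "reg (pushf (rfield k N1 N2 N3))" using U k reg_bar unfolding U_num_def by blast
  show "(if b then N1 else N2) (face_point b w s 0) = 0" if s: "s \<in> {0,1}" and w: "w \<in> {0..1}" for b s w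
  proof (rule base_edge_zero[OF k U s e w])
    show "base_edge b s \<in> edges" unfolding edges_iff using s by blast
    show "edge_set (base_edge b s) \<subseteq> base"
      unfolding edge_set_edge_point using s by (auto simp: edge_point_base_edge base_def pyramid_def)
  qed
  show "base_dof (normal C base) q (pushf (rfield k N1 N2 N3)) = 0" if "q \<in> base_space k" for q
    by (rule basis_vanish[where f = "\<lambda>q. base_dof (normal C base) q (pushf (rfield k N1 N2 N3))", OF valid_choiceD(5)[OF C]],
      erule (1) base_dof_lin(2)[OF r], erule 0, rule that)
qed

section \<open>Unisolvence and conformity\<close>

lemma dofs_injective:
  assumes k: "k \<ge> 1" and C: "valid_choice k C" and E: "E \<in> U1 k" and 0: "\<forall>m\<in>dofs C. m E = 0"
  shows "E = 0"
proof -
  obtain N1 N2 N3 where N: "U_num k N1 N2 N3" "E = pushf (rfield k N1 N2 N3)" using E U1_iff[OF k] by blast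
  note r = reg_U1[OF E k]
  have e: "edge_trace (pushf (rfield k N1 N2 N3)) e \<sigma> = 0" if e: "e \<in> edges" and \<sigma>: "0 \<le> \<sigma>" "\<sigma> < 1" for e \<sigma>
  proof (rule edge_zero[OF k C N(1) e _ \<sigma>])
    fix q assume "q \<in> edge_basis C e"
    then have "edge_dof e (tangent C e) q \<in> dofs C" unfolding dofs_def using e by blast
    then show "edge_dof e (tangent C e) q (pushf (rfield k N1 N2 N3)) = 0" using 0 unfolding N(2) by blast
  qed
  have side: "(if b then N1 else N2) (face_point b w s z) = 0 \<and> N3 (face_point b w s z) = 0"
    if s: "s \<in> {0,1}" and wz: "w \<in> {0..1}" "z \<ge> 0" for b s w z
  proof (rule face_zero[OF k C N(1) s e _ wz])
    fix q assume "q \<in> tri_basis C (tri_face b s)"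
    then have "tri_dof (tri_face b s) q \<in> dofs C" unfolding dofs_def using tri_face_mem[OF s, of b] by blast
    then show "tri_dof (tri_face b s) q (pushf (rfield k N1 N2 N3)) = 0" using 0 unfolding N(2) by blast
  qed
  have base: "N1 (vector [x,y,0]) = 0 \<and> N2 (vector [x,y,0]) = 0" if xy: "x \<in> {0..1}" "y \<in> {0..1}" for x y
  proof (rule base_zero[OF k C N(1) e _ xy])
    fix q assume "q \<in> base_basis C"
    then have "base_dof (normal C base) q \<in> dofs C" unfolding dofs_def by blast
    then show "base_dof (normal C base) q (pushf (rfield k N1 N2 N3)) = 0" using 0 unfolding N(2) by blast
  qed
  have bn: "bar_num k N1 N2 N3" using N(1) unfolding U_num_def by blast
  obtain H q1 q2 \<rho> where H: "H \<in> Qpoly (int k - 2) (int k - 2) (int k - 2)" and q: "v_spaces k q1 q2 \<rho>"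
    and dec: "\<forall>p. N1 p = gnum1 (bubble H) p + vnum1 q1 p \<and> N2 p = gnum2 (bubble H) p + vnum2 q2 p \<and>
      N3 p = gnum3 k (bubble H) p + vnum3 \<rho> p"
    using vol_decomp[OF bn k side base] by blast
  define v where "v = pushf (rfield k (vnum1 q1) (vnum2 q2) (vnum3 \<rho>))"
  have vU: "v \<in> U1_zero_curl k" unfolding v_def U1_zero_curl_iff using q by blast
  note rv = reg_U1[OF U1_zero_curl_traces(1)[OF k vU] k] and rg = reg_U1[OF bubble_grad_U1[OF H k] k]
  have Ed: "E = bubble_grad k H + v"
    unfolding N(2) bubble_grad_def v_def pushf_add[symmetric]
    by (rule pushf_cong) (simp only: pt_eq_iff rfield_nth vector_add_component dec add_divide_distrib simp_thms)
  \<comment> \<open>The gradient part is invisible to the curl, so testing \<open>E\<close> against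
    \<open>v\<close> gives the integral of the square of \<open>curl v\<close>.\<close>
  have cE: "curl E p = curl v p" if "p \<in> interior pyramid" for p
    using curl_lin[OF rg rv that, of 1] curl_bubble_grad[OF H k that] unfolding Ed by simp
  have cd: "curl_dof w E = 0" if "w \<in> U1_zero_curl k" for w
  proof (rule basis_vanish[where f = "\<lambda>w. curl_dof w E", OF valid_choiceD(7)[OF C] _ _ that])
    fix c w w' assume w: "w \<in> U1_zero_curl k" "w' \<in> U1_zero_curl k"
    show "curl_dof (c *\<^sub>R w + w') E = c * curl_dof w E + curl_dof w' E"
      by (rule curl_dof_lin(2)[OF r reg_U1[OF U1_zero_curl_traces(1)[OF k w(1)] k] reg_U1[OF U1_zero_curl_traces(1)[OF k w(2)] k]])
  next
    fix w assume "w \<in> curl_basis C"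
    then have "curl_dof w \<in> dofs C" unfolding dofs_def by blast
    then show "curl_dof w E = 0" using 0 by blast
  qed
  have "curl E p \<bullet> curl v p = 0" if p: "p \<in> interior pyramid" for p
    by (rule pair_nonneg_zero[OF convex_pyramid bounded_pyramid reg_curl_nice[OF r] reg_curl_nice[OF rv] _ cd[OF vU, unfolded curl_dof_pair] p])
      (simp add: cE)
  then have "curl v p = 0" if "p \<in> interior pyramid" for p using that cE by simp
  then have v0: "v = 0" unfolding v_def by (rule v_curl_zero[OF q k])
  \<comment> \<open>What remains is a gradient, to be tested against its own bubble form.\<close>
  have EG: "E = bubble_grad k H" using Ed v0 by simp
  have ZU: "bubble_form k H \<in> U0_zero k" using U0_zero_iff[OF k] H by blast
  have "grad_dof (bubble_form k H) E = 0"
  proof (rule basis_vanish[where f = "\<lambda>w. grad_dof w E", OF valid_choiceD(6)[OF C] _ _ ZU])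
    fix c w w' assume w: "w \<in> U0_zero k" "w' \<in> U0_zero k"
    show "grad_dof (c *\<^sub>R w + w') E = c * grad_dof w E + grad_dof w' E"
      by (rule grad_dof_lin(2)[OF r k w])
  next
    fix w assume "w \<in> grad_basis C"
    then have "grad_dof w \<in> dofs C" unfolding dofs_def by blast
    then show "grad_dof w E = 0" using 0 by blast
  qed
  then have gz: "E p \<bullet> grad (bubble_form k H) p = 0" if "p \<in> interior pyramid" for p
    using pair_nonneg_zero[OF convex_pyramid bounded_pyramid reg_nice[OF r] nice_grad[OF ZU k] _ _ that] grad_bubble_form[OF H]
    by (simp add: grad_dof_pair EG)
  have "bubble_grad k H p = 0" if "p \<in> interior pyramid" for p using gz[OF that] grad_bubble_form[OF H that] EG by simp
  then show "E = 0" unfolding EG by (rule bubble_grad_zero(1)[OF H k])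
qed

section \<open>Tangential components and traces\<close>

lemma tangential_zeroD: "tangential_component n v = 0 \<Longrightarrow> v = (v \<bullet> n) *\<^sub>R n"
  by (simp add: tangential_component_def)

text \<open>The two sides span the plane orthogonal to \<open>n\<close>. If \<open>v\<close> is
  orthogonal to both, its tangential part \<open>d\<close> lies in their span and is orthogonal to
  it, hence to itself.\<close>

lemma tangential_zero_tri:
  assumes n: "n \<bullet> axis (ix b) 1 = 0" "n \<bullet> face_point b 0 (- s) 1 = 0" "norm n = 1"
  shows "tangential_component n v = 0 \<longleftrightarrow> v \<bullet> axis (ix b) 1 = 0 \<and> v \<bullet> face_point b 0 (- s) 1 = 0"
proof
  assume "tangential_component n v = 0"
  from tangential_zeroD[OF this] show "v \<bullet> axis (ix b) 1 = 0 \<and> v \<bullet> face_point b 0 (- s) 1 = 0"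
    using n by (metis inner_scaleR_left mult_zero_right)
next
  assume v: "v \<bullet> axis (ix b) 1 = 0 \<and> v \<bullet> face_point b 0 (- s) 1 = 0"
  define d where "d = tangential_component n v"
  have nn: "n \<bullet> n = 1" using n(3) by (simp add: norm_eq_1)
  have d: "d \<bullet> n = 0" "d \<bullet> axis (ix b) 1 = 0" "d \<bullet> face_point b 0 (- s) 1 = 0"
    using v n nn by (simp_all add: d_def tangential_component_def inner_diff_left)
  have "d \<bullet> d = 0"
    using arg_cong[OF tangent_decomp[OF n d(1)], of "\<lambda>u. d \<bullet> u"] d(2,3) by (simp add: inner_add_right)
  then show "tangential_component n v = 0" by (simp add: d_def)
qed

lemma tri_tangential:
  assumes s: "s \<in> {0,1}" and n: "unit_normal (tri_set (tri_face b s)) n"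
  shows "(\<forall>p\<in>tri_set (tri_face b s) - {apex}. tangential_component n (E p) = 0) \<longleftrightarrow> tri_trace_zero E (tri_face b s)"
proof -
  have "(\<forall>p\<in>tri_set (tri_face b s) - {apex}. tangential_component n (E p) = 0) \<longleftrightarrow>
    (\<forall>\<sigma>\<in>ref_triangle. snd \<sigma> < 1 \<longrightarrow> tangential_component n (E (tri_point (tri_face b s) \<sigma>)) = 0)"
  proof (intro iffI ballI impI)
    fix \<sigma> assume "\<forall>p\<in>tri_set (tri_face b s) - {apex}. tangential_component n (E p) = 0" "\<sigma> \<in> ref_triangle" "snd \<sigma> < 1"
    then show "tangential_component n (E (tri_point (tri_face b s) \<sigma>)) = 0"
      using tri_point_mem(1)[OF s, of \<sigma> b] unfolding tri_set_tri_point by blast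
  next
    fix p assume z: "\<forall>\<sigma>\<in>ref_triangle. snd \<sigma> < 1 \<longrightarrow> tangential_component n (E (tri_point (tri_face b s) \<sigma>)) = 0" and p: "p \<in> tri_set (tri_face b s) - {apex}"
    obtain \<sigma> where \<sigma>: "\<sigma> \<in> ref_triangle" "p = tri_point (tri_face b s) \<sigma>" using p unfolding tri_set_tri_point by blast
    have "snd \<sigma> \<noteq> 1"
    proof
      assume "snd \<sigma> = 1"
      then have "fst \<sigma> = 0" using \<sigma>(1) by (simp add: ref_triangle_def)
      then have "p = apex" using \<open>snd \<sigma> = 1\<close> by (simp add: \<sigma>(2) tri_point_tri_face apex_def pt_eq_iff)
      then show False using p by simp
    qed
    then have "snd \<sigma> < 1" using \<sigma>(1) by (simp add: ref_triangle_def)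
    then show "tangential_component n (E p) = 0" using z \<sigma> by blast
  qed
  then show ?thesis unfolding tri_trace_zero_def tri_face_sides tangential_zero_tri[OF unit_normal_tri[OF n]] .
qed

lemma base_base_point: "base = base_point ` ref_square"
proof -
  have "p \<in> base_point ` ref_square" if "p \<in> base" for p
    by (rule image_eqI[of _ _ "(p$1, p$2)"]) (use that in \<open>auto simp: base_def pyramid_def base_point_def ref_square_def pt_eq_iff\<close>)
  then show ?thesis using base_point_mem(2) by blast
qed

lemma base_tangential:
  assumes n: "unit_normal base n"
  shows "(\<forall>p\<in>base - {apex}. tangential_component n (E p) = 0) \<longleftrightarrow> base_trace_zero E"
proof -
  have "apex \<notin> base" by (simp add: base_def)
  then have "base - {apex} = base_point ` ref_square" using base_base_point by auto
  moreover have "tangential_component n v = 0 \<longleftrightarrow> v$1 = 0 \<and> v$2 = 0" for v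
    using unit_normal_base[OF n] by (simp add: tangential_component_def pt_eq_iff inner_pt mult.assoc)
  ultimately show ?thesis by (simp add: base_trace_zero_def)
qed

text \<open>Where the field is parallel to the normal it is orthogonal to the direction of every
  edge in the face.\<close>

lemma edge_tangential:
  assumes e: "e \<in> edges" "edge_set e \<subseteq> F" and n: "unit_normal F n"
    and z: "\<forall>p\<in>F - {apex}. tangential_component n (E p) = 0" and \<sigma>: "0 \<le> \<sigma>" "\<sigma> < 1"
  shows "edge_trace E e \<sigma> = 0"
proof -
  have m: "edge_point e \<sigma> \<in> F" if "\<sigma> \<in> {0..1}" for \<sigma> using e(2) that unfolding edge_set_edge_point by blast
  have "edge_point e \<sigma> \<in> F - {apex}" using m[of \<sigma>] edge_point_mem[OF e(1) \<sigma>] \<sigma> by simp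
  then have "E (edge_point e \<sigma>) = (E (edge_point e \<sigma>) \<bullet> n) *\<^sub>R n" using z tangential_zeroD by blast
  moreover have "n \<bullet> (snd e - fst e) = 0"
  proof -
    have "n \<bullet> (edge_point e 1 - edge_point e 0) = 0" using n m[of 1] m[of 0] unfolding unit_normal_def by simp
    then show ?thesis by (simp add: edge_point_def)
  qed
  ultimately show ?thesis unfolding edge_trace_def by (metis inner_scaleR_left mult_zero_right)
qed

lemma conforming_face:
  assumes k: "k \<ge> 1" and C: "valid_choice k C" and F: "F \<in> faces" and E: "E \<in> U1 k"
  shows "(\<forall>m\<in>dofs_on C F. m E = 0) \<longleftrightarrow> (\<forall>p \<in> F - {apex}. tangential_component (normal C F) (E p) = 0)"
proof
  note r = reg_U1[OF E k] and n = valid_choiceD(2)[OF C F]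
  assume z: "\<forall>p \<in> F - {apex}. tangential_component (normal C F) (E p) = 0"
  show "\<forall>m\<in>dofs_on C F. m E = 0"
  proof
    fix m assume "m \<in> dofs_on C F"
    then consider (edge) e q where "m = edge_dof e (tangent C e) q" "e \<in> edges" "edge_set e \<subseteq> F" "q \<in> edge_basis C e"
      | (tri) T q where "m = tri_dof T q" "T \<in> tri_faces" "tri_set T = F" "q \<in> tri_basis C T"
      | (base) q where "m = base_dof (normal C base) q" "F = base" "q \<in> base_basis C"
      unfolding dofs_on_def by blast
    then show "m E = 0"
    proof cases
      case edge
      show ?thesis unfolding edge(1)
        by (rule edge_dof_zero[OF r edge(2) valid_choiceD(1)[OF C edge(2)] basis_mem[OF valid_choiceD(3)[OF C edge(2)] edge(4)]
          edge_tangential[OF edge(2,3) n z]]) auto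
    next
      case tri
      obtain b s where T: "s \<in> {0,1}" "T = tri_face b s" using tri(2) unfolding tri_faces_iff by blast
      have F': "F = tri_set (tri_face b s)" using tri(3) T(2) by simp
      have "tri_trace_zero E (tri_face b s)" using tri_tangential[OF T(1) n[unfolded F']] z unfolding F' by blast
      moreover have "q \<in> tri_space k (normal C) (tri_face b s)"
        using basis_mem[OF valid_choiceD(4)[OF C tri(2)] tri(4)] unfolding T(2) .
      ultimately show ?thesis unfolding tri(1) T(2) using tri_dof_zero[where \<nu> = "normal C", OF r T(1) _ n[unfolded F']] by blast
    next
      case base
      have "base_trace_zero E" using base_tangential[OF base_normal[OF C]] z unfolding base(2) by blast
      then show ?thesis unfolding base(1)
        by (rule base_dof_zero[OF r basis_mem[OF valid_choiceD(5)[OF C] base(3)] base_normal[OF C]])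
    qed
  qed
next
  assume 0: "\<forall>m\<in>dofs_on C F. m E = 0"
  obtain N1 N2 N3 where N: "U_num k N1 N2 N3" "E = pushf (rfield k N1 N2 N3)" using E U1_iff[OF k] by blast
  have e: "edge_trace (pushf (rfield k N1 N2 N3)) e \<sigma> = 0" if e: "e \<in> edges" "edge_set e \<subseteq> F" and \<sigma>: "0 \<le> \<sigma>" "\<sigma> < 1" for e \<sigma>
  proof (rule edge_zero[OF k C N(1) e(1) _ \<sigma>])
    fix q assume "q \<in> edge_basis C e"
    then have "edge_dof e (tangent C e) q \<in> dofs_on C F" unfolding dofs_on_def using e by blast
    then show "edge_dof e (tangent C e) q (pushf (rfield k N1 N2 N3)) = 0" using 0 unfolding N(2) by blast
  qed
  consider "F = base" | T where "T \<in> tri_faces" "F = tri_set T"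
    using F unfolding faces_def by blast
  then consider "F = base" | b s where "s \<in> {0,1}" "F = tri_set (tri_face b s)"
    unfolding tri_faces_iff by cases blast+
  then show "\<forall>p \<in> F - {apex}. tangential_component (normal C F) (E p) = 0"
  proof cases
    case 1
    have b: "N1 (vector [x,y,0]) = 0 \<and> N2 (vector [x,y,0]) = 0" if xy: "x \<in> {0..1}" "y \<in> {0..1}" for x y
    proof (rule base_zero[OF k C N(1) e[unfolded 1] _ xy])
      fix q assume "q \<in> base_basis C"
      then have "base_dof (normal C base) q \<in> dofs_on C F" unfolding dofs_on_def using 1 by blast
      then show "base_dof (normal C base) q (pushf (rfield k N1 N2 N3)) = 0" using 0 unfolding N(2) by blast
    qed
    have "base_trace_zero E"
      unfolding base_trace_zero_def N(2)
    proof
      fix \<sigma> assume \<sigma>: "\<sigma> \<in> ref_square"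
      show "pushf (rfield k N1 N2 N3) (base_point \<sigma>) $ 1 = 0 \<and> pushf (rfield k N1 N2 N3) (base_point \<sigma>) $ 2 = 0"
        unfolding base_components[OF \<sigma>] unfolding base_point_def by (rule b) (use \<sigma> in \<open>auto simp: ref_square_def\<close>)
    qed
    then show ?thesis unfolding 1 base_tangential[OF base_normal[OF C]] .
  next
    case 2
    have f: "(if b then N1 else N2) (face_point b w s z) = 0 \<and> N3 (face_point b w s z) = 0" if wz: "w \<in> {0..1}" "z \<ge> 0" for w z
    proof (rule face_zero[OF k C N(1) 2(1) e[unfolded 2(2)] _ wz])
      fix q assume "q \<in> tri_basis C (tri_face b s)"
      then have "tri_dof (tri_face b s) q \<in> dofs_on C F" unfolding dofs_on_def using tri_face_mem[OF 2(1), of b] 2(2) by blast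
      then show "tri_dof (tri_face b s) q (pushf (rfield k N1 N2 N3)) = 0" using 0 unfolding N(2) by blast
    qed
    have "tri_trace_zero E (tri_face b s)"
      unfolding tri_trace_zero_def tri_face_sides N(2)
    proof (intro ballI impI)
      fix \<sigma> assume \<sigma>: "\<sigma> \<in> ref_triangle" "snd \<sigma> < 1"
      have "fst \<sigma> / (1 - snd \<sigma>) \<in> {0..1}" "snd \<sigma> / (1 - snd \<sigma>) \<ge> 0" using \<sigma> by (auto simp: ref_triangle_def)
      from f[OF this] show "pushf (rfield k N1 N2 N3) (tri_point (tri_face b s) \<sigma>) \<bullet> axis (ix b) 1 = 0 \<and>
          pushf (rfield k N1 N2 N3) (tri_point (tri_face b s) \<sigma>) \<bullet> face_point b 0 (- s) 1 = 0"
        using face_components[OF 2(1) \<sigma> k refl refl, of N1 N2 N3 b] by simp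
    qed
    then show ?thesis unfolding 2(2) tri_tangential[OF 2(1) tri_normal[OF C tri_face_mem[OF 2(1)]]] .
  qed
qed

theorem theorem6p2:
  fixes k :: nat and C :: dof_choice
  assumes "k \<ge> 1"
    and "valid_choice k C"
  shows "(U1 k \<subseteq> H_curl pyramid \<and>
          (\<forall>F\<in>faces. \<forall>u\<in>U1 k.
             (\<forall>m\<in>dofs_on C F. m u = 0) \<longleftrightarrow>
             (\<forall>p \<in> F - {apex}. tangential_component (normal C F) (u p) = 0))) \<and>
         (\<forall>c :: functional \<Rightarrow> real. \<exists>!u. u \<in> U1 k \<and> (\<forall>m\<in>dofs C. m u = c m))"
proof (intro conjI ballI allI)
  show "U1 k \<subseteq> H_curl pyramid" using reg_H_curl reg_U1 assms(1) by blast
  show "(\<forall>m\<in>dofs_on C F. m u = 0) \<longleftrightarrow> (\<forall>p \<in> F - {apex}. tangential_component (normal C F) (u p) = 0)"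
    if "F \<in> faces" "u \<in> U1 k" for F u
    by (rule conforming_face[OF assms that])
  fix c :: "functional \<Rightarrow> real"
  obtain w where w: "w \<in> U1 k" "\<forall>m\<in>dofs C. m w = c m"
    using dofs_solvable[OF assms] unfolding solvable_def by blast
  show "\<exists>!u. u \<in> U1 k \<and> (\<forall>m\<in>dofs C. m u = c m)"
  proof (rule ex1I)
    show "w \<in> U1 k \<and> (\<forall>m\<in>dofs C. m w = c m)" using w by blast
    fix u assume u: "u \<in> U1 k \<and> (\<forall>m\<in>dofs C. m u = c m)"
    have "(-1) *\<^sub>R w + u = 0"
    proof (rule dofs_injective[OF assms U1_comb[OF assms(1) w(1)]])
      show "u \<in> U1 k" using u by blast
      show "\<forall>m\<in>dofs C. m ((-1) *\<^sub>R w + u) = 0"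
      proof
        fix m assume m: "m \<in> dofs C"
        show "m ((-1) *\<^sub>R w + u) = 0"
          using dof_comb[OF assms m w(1), of u "-1"] u w(2) m by auto
      qed
    qed
    then show "u = w" by simp
  qed
qed

end
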